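(* Let $r\ge0$, $q=r+1$, $p\ge1$, $\rho_h>0$, $d_h\ge0$ ($1\le h\le r$), $\widehat a_*\in\mathbb R$, and $\xi_1,\dots,\xi_p\in\mathbb R$ pairwise distinct with $\xi_i+\rho_h>0$. Let $\boldsymbol\lambda=(n_1,\dots,n_r,\eta)\in\mathbb N_0^{r+1}$ have entries pairwise differing by at most one, $N=|\boldsymbol\lambda|\ge1$, and let $\boldsymbol m\in\mathbb N_0^p$ with $|\boldsymbol m|=N-1$. Assume the connection determinant $\Delta_{\mathrm H}=\det C$ is nonzero. With the notation of the context, the individual components are $$B^{(h),\mathrm H}_{\boldsymbol\lambda,\boldsymbol m}(t)=\mathcal P_h(t)+\frac1{\rho_h}\Bigl[\zeta_{h,0}+c_h(t)\mathcal T_h(t)+\frac{\mathcal W_h(t)}2+\sum_{J\ne h}\{\mathcal U_{h,J}(t)-\mathcal U_{J,h}(t)\}\Bigr],\qquad1\le h\le r,$$ $$D^{(1),\mathrm H}_{\boldsymbol\lambda,\boldsymbol m}(t)=\mathcal Q_1(t)+\frac12\sum_{J:\,n_J>0}\mathcal T_J(t).$$ They have the prescribed degree bounds ($\deg B^{(h),\mathrm H}<n_h$, $\deg D^{(1),\mathrm H}<\eta$), with zero components for zero indices, and give the Rodrigues decomposition $$\mathcal B^{\mathrm H}_{\boldsymbol\lambda,\boldsymbol m}(t)=\sum_{h=1}^rB^{(h),\mathrm H}_{\boldsymbol\lambda,\boldsymbol m}(t)K_{\rho_h,1}F(t)+D^{(1),\mathrm H}_{\boldsymbol\lambda,\boldsymbol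 m}(t)F(t).$$ For $r\ge1$, each $B^{(h),\mathrm H}$ contains at most $2r+2$ terminating (Srivastava–Daoust) functions, and $D^{(1),\mathrm H}$ at most $r+1$, with at most $p+2r+3$ arguments. The $B$-problem is weakly normal. Strong normality holds if and only if $$\det C[(j,\lambda_j-1)\leftarrow\mathbf p]\ne0\quad\text{for every }j\text{ with }\lambda_j>0.$$
   Context: Basic objects. $(a)_k=a(a+1)\cdots(a+k-1)$. $\phi_a(t)=\pi^{-1/2}\mathrm e^{-(t-a)^2}$; $(K_{\rho,d}f)(t)=\int_0^\infty\frac{\rho^d}{\Gamma(d)}u^{d-1}\mathrm e^{-\rho u}f(t+u)\,\mathrm du$, $K_{\rho,0}=I$; $F=K_{\rho_1,d_1}\cdots K_{\rho_r,d_r}\phi_{\widehat a_*}$; $U_h^{\mathrm H}=K_{\rho_h,1}F$ ($h\le r$), $U_q^{\mathrm H}=F$; $\lambda_h=n_h$, $\lambda_q=\eta$. Rodrigues function $\mathcal B^{\mathrm H}_{\boldsymbol\lambda,\boldsymbol m}=\prod_i(\xi_i+\partial_t)^{m_i}\prod_h\rho_h^{-n_h}K_{\rho_h,n_h}F$. $B$-problem: $(B_j)_{j=1}^q$, $\deg B_j<\lambda_j$, $\int_{\mathbb R}t^k\mathrm e^{\xi_it}\sum_jB_jU_j^{\mathrm H}\mathrm dt=0$ for $0\le k<m_i$; weakly normal = one-dimensional solution space; strongly normal = in addition all components with positive index attain degree $\lambda_j-1$. Connection matrix. $L_F(z)=\mathrm e^{\widehat a_*z+z^2/4}\prod_h(\rho_h/(\rho_h+z))^{d_h}$,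 $\Lambda_h=\frac{\rho_h}{\rho_h+z}L_F$, $\Lambda_q=L_F$, $D_{\boldsymbol n}=\prod_h(\rho_h+z)^{n_h}$, $\mathrm e^{uz-z^2/4}=\sum_\ell H_\ell(u)z^\ell/\ell!$, $\Phi_{j,k}=\frac{D_{\boldsymbol n}}{L_F}H_k(\partial_z)\Lambda_j$ ($1\le j\le q$, $0\le k<\lambda_j$; polynomials of degree $\le N-1$); $C_{\nu,(j,k)}=[z^\nu]\Phi_{j,k}$ ($0\le\nu<N$, lexicographic columns); $p_\nu=[z^\nu]\prod_i(\xi_i-z)^{m_i}$; $C[(j,k)\leftarrow\mathbf p]$ replaces column $(j,k)$ by $\mathbf p$. Constants. $L=|\boldsymbol n|$, $R=\eta$, $M=|\boldsymbol m|=L+R-1$, $\mathcal I=\{h:n_h>0\}$, $d_*=\sum_hd_h$, $c(t)=\widehat a_*-t$, $c_J(t)=\widehat a_*-\rho_J/2-t$, $x_h^{(J)}=-\frac1{\rho_h-\rho_J}$ (for $\rho_h\ne\rho_J$), and for $J\in\mathcal I$ $$\kappa_J=\frac{\prod_i(\xi_i+\rho_J)^{m_i}}{\prod_{h\in\mathcal I\setminus\{J\}}(\rho_h-\rho_J)^{n_h}},\qquad\zeta_{J,0}=\kappa_J\,\mathfrak C_{n_J-1}\Bigl(\bigl((-m_i)_i,(n_h)_{h\in\mathcal I\setminus\{J\}}\bigr),\bigl((\xi_i+\rho_J)^{-1}_i,(x_h^{(J)})_{h\in\mathcal I\setminus\{J\}}\bigr);0\Bigr),$$ with $\zeta_{J,0}=0$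 if $n_J=0$, where $\mathfrak C_m(\boldsymbol b,\boldsymbol x;0)=\sum_{|\boldsymbol\alpha|=m}\prod_h\frac{(b_h)_{\alpha_h}x_h^{\alpha_h}}{\alpha_h!}$. Finite-pole functions (needed only for $n_J\ge2$, when all $n_h\ge1$ and all rates are distinct). Let $d_Z=p+2r+2$ and order indices $\boldsymbol k=(\boldsymbol\alpha,\boldsymbol\beta,l,j,\mu,\nu)\in\mathbb N_0^{d_Z}$, $\boldsymbol\alpha$ of length $p+r-1$ (columns, then rows $h\ne J$), $\boldsymbol\beta$ of length $r-1$ (rows $h\ne J$). Put $\boldsymbol e_Z=(\mathbf 1_{p+2r},2,2)$, $\boldsymbol v_Z=(\mathbf 0_{p+r-1},\mathbf 1_{r-1},1,1,0,2)$, $\boldsymbol a_Z=((-m_i)_i,(n_h+d_h)_{h\ne J},(-d_h)_{h\ne J},1)$ (length $d_Z-3$), and $$\boldsymbol z_J(\upsilon;t)=\Bigl(\bigl(-\tfrac1{(\xi_i+\rho_J)c_J(t)}\bigr)_i,\bigl(-\tfrac{x_h^{(J)}}{c_J(t)}\bigr)_{h\ne J},\bigl(-\tfrac{x_h^{(J)}}{c_J(t)}\bigr)_{h\ne J},-\tfrac\upsilon{c_J(t)},1,\tfrac1{4c_J(t)^2},-\tfrac1{4c_J(t)^2}\Bigr).$$ For $b>0$, $N'\in\mathbb N_0$, $$\mathcal Z_{J,N'}(b,\upsilon;t)=\frac{c_J(t)^{N'}}{N'!}\sum_{\boldsymbol k}\frac{(-N')_{\boldsymbol e_Z\cdot\boldsymbol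 k}(b)_{\boldsymbol v_Z\cdot\boldsymbol k}}{(b+1)_{\boldsymbol v_Z\cdot\boldsymbol k}}\prod_{i=1}^{d_Z-3}(a_{Z,i})_{k_i}\prod_{i=1}^{d_Z}\frac{z_{J,i}(\upsilon;t)^{k_i}}{k_i!},$$ a finite sum, polynomial in $t$ after combining powers of $c_J(t)$ (this defines it also where $c_J(t)=0$); $\mathcal Z_{J,N'}=0$ for $N'<0$. Set $$\mathcal T_J=\frac{\kappa_J}{d_J+1}\mathcal Z_{J,n_J-2}(d_J+1,0;t),\quad\mathcal W_J=\frac{\kappa_J}{d_J+2}\mathcal Z_{J,n_J-3}(d_J+2,0;t),\quad\mathcal U_{h,J}=-\frac{\kappa_Jd_hx_h^{(J)}}{d_J+1}\mathcal Z_{J,n_J-2}(d_J+1,x_h^{(J)};t)\ (h\ne J),$$ all zero when $n_J<2$. Empty groups are omitted. Polynomial-part functions. Let $d_Y=p+2r+3$, indices $\boldsymbol k=(\boldsymbol\alpha,\boldsymbol\beta,l,k,v)$, $\boldsymbol\alpha$ of length $p+r$ (columns, then rows), $\boldsymbol\beta$ of length $r$. Put $\boldsymbol e_Y=(\mathbf 1_{p+2r+1},2,2)$, $\boldsymbol f_Y=(\mathbf 1_{p+2r+1},1,0)$, $\boldsymbol u_Y=(\mathbf 1_{p+r},\mathbf 0_r,0,1,0)$, $\boldsymbol v_Y=(\mathbf 1_{p+r},\mathbf 0_r,0,0,0)$, $\boldsymbol a_Y=((-m_i)_i,(n_h+d_h)_h,(-d_h)_h,1)$ (length $d_Y-2$),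 $$\boldsymbol y(\upsilon;t)=\Bigl(\bigl(-\tfrac{\xi_i}{2c(t)}\bigr)_i,\bigl(\tfrac{\rho_h}{2c(t)}\bigr)_h,\bigl(\tfrac{\rho_h}{2c(t)}\bigr)_h,-\tfrac\upsilon{2c(t)},-\tfrac1{2c(t)^2},\tfrac1{4c(t)^2}\Bigr).$$ For $N'\in\mathbb N_0$, $b\in\mathbb C$, $$\mathcal Y_{N'}(b,\upsilon;t)=(-2c(t))^{N'}\sum_{\boldsymbol e_Y\cdot\boldsymbol k\le N'}\frac{(-N')_{\boldsymbol e_Y\cdot\boldsymbol k}(b)_{\boldsymbol u_Y\cdot\boldsymbol k}}{(-N')_{\boldsymbol f_Y\cdot\boldsymbol k}(b)_{\boldsymbol v_Y\cdot\boldsymbol k}}\prod_{i=1}^{d_Y-2}(a_{Y,i})_{k_i}\prod_{i=1}^{d_Y}\frac{y_i(\upsilon;t)^{k_i}}{k_i!},$$ where the ratio $(b)_{|\boldsymbol\alpha|+k}/(b)_{|\boldsymbol\alpha|}$ is always read as $(b+|\boldsymbol\alpha|)_k$, and powers of $c(t)$ are combined so that the result is a polynomial in $t$; $\mathcal Y_{N'}=0$ for $N'<0$. Set $$\mathcal P_h(t)=\frac{2(-1)^Md_h}{\rho_h}\mathcal Y_{R-2}(d_*-R+1,-\rho_h;t),\qquad\mathcal Q_1(t)=(-1)^M\mathcal Y_{R-1}(d_*-R+1,0;t).$$ *)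

theory Defs
  imports
    "HOL-Analysis.Set_Integral"
    "HOL-Analysis.Gamma_Function"
    "HOL-Library.Poly_Mapping"
    "HOL-Library.Function_Algebras"
    "Jordan_Normal_Form.Determinant"
begin

section \<open>Terminating Srivastava--Daoust functions\<close>

definition dotn :: "nat list \<Rightarrow> nat list \<Rightarrow> nat" where
  "dotn u k = (\<Sum>i<length k. u ! i * k ! i)"

text \<open>
  The factor \<open>(b)\<^sub>s / (c)\<^sub>t\<close>. For \<open>b = c\<close> and \<open>t \<le> s\<close> it is read as \<open>(b + t)\<^bsub>s - t\<^esub>\<close>, which also
  gives it a meaning when \<open>(b)\<^sub>t = 0\<close>; by the lemma below, the reading matters only in that case.
\<close>

definition poch_quot :: "real \<Rightarrow> nat \<Rightarrow> real \<Rightarrow> nat \<Rightarrow> real" where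
  "poch_quot b s c t =
     (if b = c \<and> t \<le> s then pochhammer (b + real t) (s - t) else pochhammer b s / pochhammer c t)"

lemma poch_quot_eq_divide:
  assumes "pochhammer c t \<noteq> 0"
  shows "poch_quot b s c t = pochhammer b s / pochhammer c t"
  using assms by (auto simp: poch_quot_def pochhammer_product[of t s])

text \<open>
  \<open>quots\<close> is a list of entries \<open>(b, u, c, v)\<close> standing for the factors \<open>(b)\<^bsub>u\<cdot>k\<^esub> / (c)\<^bsub>v\<cdot>k\<^esub>\<close>;
  \<open>pars\<close> lists one numerator parameter for each of the first \<open>length pars\<close> variables.
\<close>

definition sd_coeff ::
    "(real \<times> nat list \<times> real \<times> nat list) list \<Rightarrow> real list \<Rightarrow> nat list \<Rightarrow> real" where
  "sd_coeff quots pars k =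
     (\<Prod>(b, u, c, v)\<leftarrow>quots. poch_quot b (dotn u k) c (dotn v k)) *
     (\<Prod>i<length pars. pochhammer (pars ! i) (k ! i)) / (\<Prod>i<length k. fact (k ! i))"

text \<open>
  The range of summation is part of the definition. It is automatic when \<open>(- N)\<^bsub>e\<cdot>k\<^esub>\<close> is among the
  numerator factors and not cancelled by a denominator.
\<close>

definition sd_indices :: "nat \<Rightarrow> nat list \<Rightarrow> nat list set" where
  "sd_indices N e = {k. length k = length e \<and> dotn e k \<le> N}"

definition sd_series ::
    "nat \<Rightarrow> nat list \<Rightarrow> (real \<times> nat list \<times> real \<times> nat list) list \<Rightarrow> real list \<Rightarrow> real list \<Rightarrow> real" where
  "sd_series N e quots pars z =
     (\<Sum>k\<in>sd_indices N e. sd_coeff quots pars k * (\<Prod>i<length e. z ! i ^ (k ! i)))"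

text \<open>
  The symbols for terminating functions that may occur in a component.

  \<open>Homogeneous k b x\<close> stands for the function \<open>\<CC>\<^sub>k(b, x; 0)\<close>.

  \<open>SD c N e quots pars args\<close> stands for \<open>c(t)\<^sup>N\<close> times the terminating series with the arguments
  \<open>x\<^sub>i / c(t)\<^bsup>w\<^sub>i\<^esup>\<close>, where \<open>args ! i = (x\<^sub>i, w\<^sub>i)\<close>, after combining the powers of the polynomial \<open>c\<close>
  (lemma \<open>poly_sd_poly\<close> below).
\<close>

datatype sd_fun =
    Homogeneous nat "real list" "real list"
  | SD "real poly" nat "nat list" "(real \<times> nat list \<times> real \<times> nat list) list"
      "real list" "(real \<times> nat) list"

fun sd_arity :: "sd_fun \<Rightarrow> nat" where
  "sd_arity (Homogeneous k b x) = length x"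
| "sd_arity (SD c N e quots pars args) = length args"

definition homogeneous_sum :: "nat \<Rightarrow> real list \<Rightarrow> real list \<Rightarrow> real" where
  "homogeneous_sum k b x =
     (\<Sum>\<alpha> | length \<alpha> = length x \<and> sum_list \<alpha> = k.
        \<Prod>i<length x. pochhammer (b ! i) (\<alpha> ! i) * x ! i ^ (\<alpha> ! i) / fact (\<alpha> ! i))"

fun sd_poly :: "sd_fun \<Rightarrow> real poly" where
  "sd_poly (Homogeneous k b x) = [:homogeneous_sum k b x:]"
| "sd_poly (SD c N e quots pars args) =
     (\<Sum>k\<in>sd_indices N e.
        smult (sd_coeff quots pars k * (\<Prod>i<length e. fst (args ! i) ^ (k ! i)))
          (c ^ (N - dotn (map snd args) k)))"

lemma poly_sd_poly:
  assumes len: "length args = length e"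
    and le: "\<And>i. i < length e \<Longrightarrow> snd (args ! i) \<le> e ! i"
    and nz: "poly c t \<noteq> 0"
  shows "poly (sd_poly (SD c N e quots pars args)) t =
    poly c t ^ N * sd_series N e quots pars (map (\<lambda>(x, w). x / poly c t ^ w) args)"
proof -
  have "(\<Prod>i<length e. fst (args ! i) ^ (k ! i)) * poly c t ^ (N - dotn (map snd args) k) =
        poly c t ^ N * (\<Prod>i<length e. map (\<lambda>(x, w). x / poly c t ^ w) args ! i ^ (k ! i))"
    if k: "k \<in> sd_indices N e" for k
  proof -
    have lk: "length k = length e" and dk: "dotn e k \<le> N"
      using k by (auto simp: sd_indices_def)
    have "dotn (map snd args) k \<le> dotn e k"
      unfolding dotn_def using len lk le by (intro sum_mono) auto
    hence d: "dotn (map snd args) k \<le> N"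
      using dk by simp
    have "(\<Prod>i<length e. map (\<lambda>(x, w). x / poly c t ^ w) args ! i ^ (k ! i)) =
          (\<Prod>i<length e. fst (args ! i) ^ (k ! i) / poly c t ^ (snd (args ! i) * k ! i))"
      using len by (intro prod.cong) (auto simp: case_prod_beta power_divide power_mult)
    also have "\<dots> = (\<Prod>i<length e. fst (args ! i) ^ (k ! i)) / poly c t ^ dotn (map snd args) k"
      using len lk by (simp add: prod_dividef dotn_def power_sum)
    finally show ?thesis
      using d nz by (simp add: power_diff)
  qed
  thus ?thesis
    by (auto simp: poly_sum poly_power sd_series_def sum_distrib_left mult.assoc
        intro!: sum.cong)
qed

text \<open>
  Formal linear combinations of terminating functions with polynomial coefficients: the functions
  contained in \<open>X\<close> are the elements of \<open>Poly_Mapping.keys X\<close>.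
\<close>

type_synonym sd_comb = "sd_fun \<Rightarrow>\<^sub>0 real poly"

definition sd_scale :: "real poly \<Rightarrow> sd_comb \<Rightarrow> sd_comb" where
  "sd_scale q = Poly_Mapping.map (\<lambda>c. q * c)"

definition sd_value :: "sd_comb \<Rightarrow> real poly" where
  "sd_value X = (\<Sum>f\<in>Poly_Mapping.keys X. Poly_Mapping.lookup X f * sd_poly f)"


section \<open>The weights\<close>

definition gauss :: "real \<Rightarrow> real \<Rightarrow> real" where
  "gauss a t = exp (- (t - a)\<^sup>2) / sqrt pi"

definition gamma_avg :: "real \<Rightarrow> real \<Rightarrow> (real \<Rightarrow> real) \<Rightarrow> real \<Rightarrow> real" where
  "gamma_avg \<rho> d f t =
     (if d = 0 then f t
      else LBINT u:{0<..}. \<rho> powr d / Gamma d * u powr (d - 1) * exp (- \<rho> * u) * f (t + u))"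

definition hermite_H :: "nat \<Rightarrow> real poly" where
  "hermite_H l =
     (\<Sum>i | i \<le> l \<and> even (l - i).
        monom (fact l / (fact i * fact ((l - i) div 2)) * (- 1 / 4) ^ ((l - i) div 2)) i)"

lemma hermite_H_sums:
  "(\<lambda>l. poly (hermite_H l) u * z ^ l / fact l) sums exp (u * z - z\<^sup>2 / 4)"
proof -
  define f where "f = (\<lambda>n. (u * z) ^ n / fact n)"
  define g where "g = (\<lambda>n. if even n then (- (z\<^sup>2 / 4)) ^ (n div 2) / fact (n div 2) else (0::real))"
  have f: "f sums exp (u * z)"
    using exp_converges[of "u * z"] by (simp add: f_def scaleR_conv_of_real field_simps)
  have f': "summable (\<lambda>n. norm (f n))"
    using summable_norm_exp[of "u * z"] by (simp add: f_def scaleR_conv_of_real field_simps)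
  have sm: "strict_mono (\<lambda>n::nat. 2 * n)"
    by (simp add: strict_mono_def)
  have range: "n \<in> range (\<lambda>n::nat. 2 * n) \<longleftrightarrow> even n" for n :: nat
    by (auto simp: image_iff dvd_def)
  have g: "g sums exp (- (z\<^sup>2 / 4))"
  proof -
    have "(\<lambda>n. g (2 * n)) sums exp (- (z\<^sup>2 / 4))"
      using exp_converges[of "- (z\<^sup>2 / 4)"] by (simp add: g_def scaleR_conv_of_real field_simps)
    thus ?thesis
      by (subst (asm) sums_mono_reindex[OF sm]) (auto simp: range g_def)
  qed
  have g': "summable (\<lambda>n. norm (g n))"
  proof -
    have "summable (\<lambda>n. norm (g (2 * n)))"
      using summable_norm_exp[of "- (z\<^sup>2 / 4)"] by (simp add: g_def scaleR_conv_of_real field_simps)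
    thus ?thesis
      by (subst (asm) summable_mono_reindex[OF sm, of "\<lambda>n. norm (g n)"]) (auto simp: range g_def)
  qed
  have "(\<lambda>l. \<Sum>i\<le>l. f i * g (l - i)) sums (exp (u * z) * exp (- (z\<^sup>2 / 4)))"
    using Cauchy_product_sums[OF f' g'] f g by (simp add: sums_iff)
  moreover have "(\<Sum>i\<le>l. f i * g (l - i)) = poly (hermite_H l) u * z ^ l / fact l" for l
  proof -
    have "(\<Sum>i\<le>l. f i * g (l - i)) = (\<Sum>i | i \<le> l \<and> even (l - i). f i * g (l - i))"
      by (rule sum.mono_neutral_right) (auto simp: g_def)
    also have "\<dots> = (\<Sum>i | i \<le> l \<and> even (l - i).
        poly (monom (fact l / (fact i * fact ((l - i) div 2)) * (- 1 / 4) ^ ((l - i) div 2)) i) u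
          * z ^ l / fact l)"
    proof (rule sum.cong, goal_cases)
      case (2 i)
      hence "even (l - i)" "i \<le> l" by auto
      then obtain j where l: "l = i + 2 * j"
        by (metis dvd_def le_add_diff_inverse)
      have "(- (z\<^sup>2 / 4)) ^ j = (- 1 / 4) ^ j * z ^ (2 * j)"
        by (simp add: power_mult flip: power_mult_distrib)
      thus ?case
        by (simp add: l f_def g_def poly_monom power_mult_distrib power_add)
    qed simp
    finally show ?thesis
      by (simp add: hermite_H_def poly_sum sum_distrib_right sum_divide_distrib)
  qed
  moreover have "exp (u * z) * exp (- (z\<^sup>2 / 4)) = exp (u * z - z\<^sup>2 / 4)"
    by (simp add: mult_exp_exp)
  ultimately show ?thesis
    by (simp only:)
qed


section \<open>The mixed Hermite system\<close>

text \<open>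
  Rows \<open>h\<close> run over \<open>1..r\<close>, columns \<open>i\<close> over \<open>1..p\<close>, components \<open>j\<close> over \<open>1..r + 1\<close>;
  \<open>lam h\<close> is \<open>n\<^sub>h\<close> for \<open>1 \<le> h \<le> r\<close>, and \<open>lam (r + 1)\<close> is \<open>\<eta>\<close>.
\<close>

locale mixed_hermite =
  fixes r p :: nat
    and \<rho> d :: "nat \<Rightarrow> real"
    and a :: real
    and \<xi> :: "nat \<Rightarrow> real"
    and lam m :: "nat \<Rightarrow> nat"
begin

definition F :: "real \<Rightarrow> real" where
  "F = foldr (\<lambda>h. gamma_avg (\<rho> h) (d h)) [1..<r + 1] (gauss a)"

definition U :: "nat \<Rightarrow> real \<Rightarrow> real" where
  "U j = (if j \<le> r then gamma_avg (\<rho> j) 1 F else F)"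

definition rodrigues :: "real \<Rightarrow> real" where
  "rodrigues =
     foldr (\<lambda>i. (\<lambda>f t. \<xi> i * f t + deriv f t) ^^ m i) [1..<p + 1]
       (foldr (\<lambda>h f t. gamma_avg (\<rho> h) (real (lam h)) f t / \<rho> h ^ lam h) [1..<r + 1] F)"

definition N :: nat where
  "N = (\<Sum>j=1..r + 1. lam j)"

subsection \<open>The B-problem\<close>

definition degree_bounded :: "(nat \<Rightarrow> real poly) \<Rightarrow> bool" where
  "degree_bounded B \<longleftrightarrow>
     (\<forall>j\<in>{1..r + 1}. B j = 0 \<or> degree (B j) < lam j) \<and> (\<forall>j. j \<notin> {1..r + 1} \<longrightarrow> B j = 0)"

definition B_solutions :: "(nat \<Rightarrow> real poly) set" where
  "B_solutions =
     {B. degree_bounded B \<and>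
         (\<forall>i\<in>{1..p}. \<forall>k<m i.
            (LBINT t. t ^ k * exp (\<xi> i * t) * (\<Sum>j=1..r + 1. poly (B j) t * U j t)) = 0)}"

definition weakly_normal :: bool where
  "weakly_normal \<longleftrightarrow> vector_space.dim (\<lambda>(c::real) B j. smult c (B j)) B_solutions = 1"

text \<open>The constraint \<open>B j \<noteq> 0\<close> is needed since the zero polynomial has \<open>degree\<close> 0.\<close>

definition strongly_normal :: bool where
  "strongly_normal \<longleftrightarrow>
     weakly_normal \<and>
     (\<forall>B\<in>B_solutions. B \<noteq> 0 \<longrightarrow>
        (\<forall>j\<in>{1..r + 1}. 0 < lam j \<longrightarrow> B j \<noteq> 0 \<and> degree (B j) = lam j - 1))"

subsection \<open>The connection matrix\<close>

definition L :: "real \<Rightarrow> real" where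
  "L z = exp (a * z + z\<^sup>2 / 4) * (\<Prod>h=1..r. (\<rho> h / (\<rho> h + z)) powr d h)"

definition Lambda :: "nat \<Rightarrow> real \<Rightarrow> real" where
  "Lambda j z = (if j \<le> r then \<rho> j / (\<rho> j + z) * L z else L z)"

definition Phi :: "nat \<Rightarrow> nat \<Rightarrow> real \<Rightarrow> real" where
  "Phi j k z =
     (\<Prod>h=1..r. (\<rho> h + z) ^ lam h) / L z *
     (\<Sum>i\<le>degree (hermite_H k). coeff (hermite_H k) i * (deriv ^^ i) (Lambda j) z)"

text \<open>
  Near \<open>0\<close> the function \<open>Phi j k\<close> agrees with a polynomial; its coefficients are extracted as Taylor
  coefficients at \<open>0\<close>.
\<close>

definition conn_entry :: "nat \<Rightarrow> nat \<times> nat \<Rightarrow> real" where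
  "conn_entry \<nu> = (\<lambda>(j, k). (deriv ^^ \<nu>) (Phi j k) 0 / fact \<nu>)"

definition column_labels :: "(nat \<times> nat) list" where
  "column_labels = [(j, k). j \<leftarrow> [1..<r + 2], k \<leftarrow> [0..<lam j]]"

lemma length_column_labels: "length column_labels = N"
proof -
  have "length column_labels = (\<Sum>j\<leftarrow>[1..<r + 2]. lam j)"
    by (simp add: column_labels_def length_concat o_def)
  also have "\<dots> = (\<Sum>j\<in>set [1..<r + 2]. lam j)"
    by (simp only: sum_list_distinct_conv_sum_set distinct_upt)
  also have "set [1..<r + 2] = {1..r + 1}"
    by auto
  finally show ?thesis
    by (simp only: N_def)
qed

definition C :: "real mat" where
  "C = Matrix.mat N N (\<lambda>(\<nu>, c). conn_entry \<nu> (column_labels ! c))"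

definition pvec :: "nat \<Rightarrow> real" where
  "pvec \<nu> = coeff (\<Prod>i=1..p. [:\<xi> i, - 1:] ^ m i) \<nu>"

definition C_replaced :: "nat \<times> nat \<Rightarrow> real mat" where
  "C_replaced jk =
     Matrix.mat N N (\<lambda>(\<nu>, c). if column_labels ! c = jk then pvec \<nu>
       else conn_entry \<nu> (column_labels ! c))"

definition Delta :: real where
  "Delta = Determinant.det C"

subsection \<open>Constants\<close>

abbreviation (input) n :: "nat \<Rightarrow> nat" where "n h \<equiv> lam h"

definition R :: nat where "R = lam (r + 1)"

definition M :: nat where "M = (\<Sum>i=1..p. m i)"

definition active :: "nat set" where "active = {h\<in>{1..r}. n h > 0}"

definition d_star :: real where "d_star = (\<Sum>h=1..r. d h)"

definition c_poly :: "real poly" where "c_poly = [:a, - 1:]"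

definition cJ_poly :: "nat \<Rightarrow> real poly" where "cJ_poly J = [:a - \<rho> J / 2, - 1:]"

definition x_pole :: "nat \<Rightarrow> nat \<Rightarrow> real" where "x_pole J h = - 1 / (\<rho> h - \<rho> J)"

definition kappa :: "nat \<Rightarrow> real" where
  "kappa J = (\<Prod>i=1..p. (\<xi> i + \<rho> J) ^ m i) / (\<Prod>h\<in>active - {J}. (\<rho> h - \<rho> J) ^ n h)"

abbreviation cols :: "nat list" where "cols \<equiv> [1..<p + 1]"

abbreviation rows :: "nat list" where "rows \<equiv> [1..<r + 1]"

definition other_rows :: "nat \<Rightarrow> nat list" where "other_rows J = filter (\<lambda>h. h \<noteq> J) rows"

definition zeta :: "nat \<Rightarrow> sd_comb" where
  "zeta J =
     (if n J = 0 then 0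
      else Poly_Mapping.single
        (Homogeneous (n J - 1)
          (map (\<lambda>i. - real (m i)) cols @ [real (n h). h \<leftarrow> other_rows J, h \<in> active])
          (map (\<lambda>i. 1 / (\<xi> i + \<rho> J)) cols @ [x_pole J h. h \<leftarrow> other_rows J, h \<in> active]))
        [:kappa J:])"

subsection \<open>Finite-pole functions\<close>

text \<open>
  In the argument lists, \<open>(y, w)\<close> stands for \<open>y / c\<^sub>J(t)\<^sup>w\<close> and, for the polynomial part, for
  \<open>y / c(t)\<^sup>w\<close>.
\<close>

definition Z_weights :: "nat list" where
  "Z_weights = replicate (p + 2 * r) 1 @ [2, 2]"

definition Z_shift :: "nat list" where
  "Z_shift = replicate (p + r - 1) 0 @ replicate (r - 1) 1 @ [1, 1, 0, 2]"

definition Z_pars :: "nat \<Rightarrow> real list" where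
  "Z_pars J =
     map (\<lambda>i. - real (m i)) cols @ map (\<lambda>h. real (n h) + d h) (other_rows J) @
     map (\<lambda>h. - d h) (other_rows J) @ [1]"

definition Z_args :: "nat \<Rightarrow> real \<Rightarrow> (real \<times> nat) list" where
  "Z_args J \<upsilon> =
     map (\<lambda>i. (- 1 / (\<xi> i + \<rho> J), 1)) cols @ map (\<lambda>h. (- x_pole J h, 1)) (other_rows J) @
     map (\<lambda>h. (- x_pole J h, 1)) (other_rows J) @ [(- \<upsilon>, 1), (1, 0), (1 / 4, 2), (- 1 / 4, 2)]"

definition Z :: "nat \<Rightarrow> int \<Rightarrow> real \<Rightarrow> real \<Rightarrow> sd_comb" where
  "Z J N' b \<upsilon> =
     (if N' < 0 then 0
      else Poly_Mapping.single
        (SD (cJ_poly J) (nat N') Z_weights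
          [(- of_int N', Z_weights, 1, replicate (p + 2 * r + 2) 0), (b, Z_shift, b + 1, Z_shift)]
          (Z_pars J) (Z_args J \<upsilon>))
        [:1 / fact (nat N'):])"

definition T :: "nat \<Rightarrow> sd_comb" where
  "T J = sd_scale [:kappa J / (d J + 1):] (Z J (int (n J) - 2) (d J + 1) 0)"

definition W :: "nat \<Rightarrow> sd_comb" where
  "W J = sd_scale [:kappa J / (d J + 2):] (Z J (int (n J) - 3) (d J + 2) 0)"

text \<open>\<open>UU h J\<close> is \<open>\<U>\<^bsub>h,J\<^esub>\<close>; the weight functions of the B-problem are called \<open>U\<close> above.\<close>

definition UU :: "nat \<Rightarrow> nat \<Rightarrow> sd_comb" where
  "UU h J =
     sd_scale [:- kappa J * d h * x_pole J h / (d J + 1):] (Z J (int (n J) - 2) (d J + 1) (x_pole J h))"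

subsection \<open>Polynomial-part functions\<close>

definition Y_weights :: "nat list" where
  "Y_weights = replicate (p + 2 * r + 1) 1 @ [2, 2]"

definition Y_f :: "nat list" where
  "Y_f = replicate (p + 2 * r + 1) 1 @ [1, 0]"

definition Y_u :: "nat list" where
  "Y_u = replicate (p + r) 1 @ replicate r 0 @ [0, 1, 0]"

definition Y_v :: "nat list" where
  "Y_v = replicate (p + r) 1 @ replicate r 0 @ [0, 0, 0]"

definition Y_pars :: "real list" where
  "Y_pars =
     map (\<lambda>i. - real (m i)) cols @ map (\<lambda>h. real (n h) + d h) rows @ map (\<lambda>h. - d h) rows @ [1]"

definition Y_args :: "real \<Rightarrow> (real \<times> nat) list" where
  "Y_args \<upsilon> =
     map (\<lambda>i. (- \<xi> i / 2, 1)) cols @ map (\<lambda>h. (\<rho> h / 2, 1)) rows @ map (\<lambda>h. (\<rho> h / 2, 1)) rows @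
     [(- \<upsilon> / 2, 1), (- 1 / 2, 2), (1 / 4, 2)]"

definition Y :: "int \<Rightarrow> real \<Rightarrow> real \<Rightarrow> sd_comb" where
  "Y N' b \<upsilon> =
     (if N' < 0 then 0
      else Poly_Mapping.single
        (SD c_poly (nat N') Y_weights
          [(- of_int N', Y_weights, - of_int N', Y_f), (b, Y_u, b, Y_v)] Y_pars (Y_args \<upsilon>))
        [:(- 2) ^ nat N':])"

definition P :: "nat \<Rightarrow> sd_comb" where
  "P h = sd_scale [:2 * (- 1) ^ M * d h / \<rho> h:] (Y (int R - 2) (d_star - real R + 1) (- \<rho> h))"

definition Q1 :: sd_comb where
  "Q1 = sd_scale [:(- 1) ^ M:] (Y (int R - 1) (d_star - real R + 1) 0)"

subsection \<open>The components\<close>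

definition B_comb :: "nat \<Rightarrow> sd_comb" where
  "B_comb h =
     P h + sd_scale [:1 / \<rho> h:]
       (zeta h + sd_scale (cJ_poly h) (T h) + sd_scale [:1 / 2:] (W h) +
        (\<Sum>J\<in>{1..r} - {h}. UU h J - UU J h))"

definition D_comb :: sd_comb where
  "D_comb = Q1 + sd_scale [:1 / 2:] (\<Sum>J\<in>active. T J)"

definition components :: "nat \<Rightarrow> real poly" where
  "components j =
     (if j \<in> {1..r} then sd_value (B_comb j) else if j = r + 1 then sd_value D_comb else 0)"

definition rodrigues_decomposition :: "(nat \<Rightarrow> real poly) \<Rightarrow> bool" where
  "rodrigues_decomposition B \<longleftrightarrow>
     (\<forall>t. rodrigues t =
        (\<Sum>h=1..r. poly (B h) t * gamma_avg (\<rho> h) 1 F t) + poly (B (r + 1)) t * F t)"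

end

lemma vector_space_poly_tuples: "vector_space (\<lambda>(c::real) (B :: nat \<Rightarrow> real poly) j. smult c (B j))"
  by unfold_locales (auto simp: fun_eq_iff smult_add_right smult_add_left)

end

theory Submission
  imports Defs "HOL-Analysis.Interval_Integral" "HOL-Real_Asymp.Real_Asymp"
    "HOL-Computational_Algebra.Polynomial_FPS"
begin

text \<open>
  Everything is expressed through one function \<open>E\<close>, namely \<open>\<phi>\<^sub>a\<close> averaged by \<open>K\<close> with all exponents
  \<open>\<lambda>\<^sub>h + d\<^sub>h\<close>, and operators \<open>Q(- d/dt) E\<close> with polynomial symbol \<open>Q\<close>; the symbol is determined by the
  function because all exponential moments of \<open>E\<close> are nonzero. Since \<open>\<rho> - d/dt\<close> lowers the exponent of a
  \<open>K\<close>-average, every \<open>U\<^sub>j\<close> and the Rodrigues function have polynomial symbols, and multiplication by \<open>t\<close>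
  acts on symbols as a first-order differential operator. Hence \<open>\<Sum>\<^sub>j B\<^sub>j U\<^sub>j\<close> has a symbol of degree \<open>< N\<close>
  depending linearly on the coefficients of \<open>B\<close>, with matrix \<open>C\<close> in the Hermite basis, and the
  orthogonality conditions say that \<open>\<Prod>\<^sub>i (\<xi>\<^sub>i - z)\<^bsup>m\<^sub>i\<^esup>\<close>, of degree \<open>N - 1\<close>, divides it. So for
  invertible \<open>C\<close> the solutions are the multiples of the Rodrigues decomposition, and Cramer's rule gives
  its top coefficients.

  For the explicit components, the symbol of the Rodrigues function is expanded into partial fractions
  over \<open>\<Prod>\<^sub>h (\<rho>\<^sub>h + z)\<^bsup>\<lambda>\<^sub>h\<^esup>\<close>. The functions belonging to the poles and to the polynomial part satisfy
  three-term recurrences, coming from the first-order equation of the transform of \<open>F\<close>; their solutions are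
  coefficients of products of power series \<open>(1 - x X)\<^bsup>-\<alpha>\<^esup>\<close> and \<open>exp (q X\<^sup>2)\<close>, which the multi-index
  sums of the terminating functions compute.
\<close>

section \<open>Exponentially decaying functions\<close>

text \<open>The obstacle is that multiplication by t costs a division: the logarithmic derivative of
  the transform of \<open>E\<close> is \<open>a + z / 2\<close> minus the sum of the
  \<open>(lam h + d h) / (\<rho> h + z)\<close>, so a symbol stays polynomial only while it keeps a
  factor \<open>\<rho> h + z\<close> for every row. This is where the entries of \<open>lam\<close>
  differing by at most one enter: the symbol of \<open>U j\<close> contains each of these factors at
  least \<open>lam j - 1\<close> times, exactly enough for the powers of t below
  \<open>lam j\<close>. The same balance makes all rows active once some entry reaches 2, which is
  when the recurrences are needed. Both recurrences express t acting on the symbols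
  \<open>Dpoly / (\<rho> J + z) ^ s\<close> and \<open>z ^ s * Dpoly\<close>. The first is solved
  only from s = 1 on, since its leading factor is \<open>s + d J\<close> and \<open>d J\<close> may
  vanish; hence \<open>F\<close> and the \<open>gamma_avg (\<rho> h) 1 F\<close> remain as basis. No
  transform is computed: laws of the averages are checked after applying \<rho> - d/dt, which is
  injective on decaying functions, and the link with \<open>L\<close> uses only that both sides obey
  the same first-order equation.\<close>

definition decays :: "real \<Rightarrow> (real \<Rightarrow> real) \<Rightarrow> bool" where
  "decays \<delta> f \<longleftrightarrow> (\<forall>c>-\<delta>. \<exists>C. \<forall>t. \<bar>f t\<bar> \<le> C * exp (- c * t))"

lemma decays_add:
  assumes "decays \<delta> f" "decays \<delta> g"
  shows "decays \<delta> (\<lambda>t. f t + g t)"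
  unfolding decays_def
proof (intro allI impI)
  fix c assume c: "c > - \<delta>"
  obtain A B where A: "\<And>t. \<bar>f t\<bar> \<le> A * exp (- c * t)" and B: "\<And>t. \<bar>g t\<bar> \<le> B * exp (- c * t)"
    using assms c unfolding decays_def by meson
  have "\<bar>f t + g t\<bar> \<le> (A + B) * exp (- c * t)" for t
    using A[of t] B[of t] by (simp add: distrib_right)
  thus "\<exists>C. \<forall>t. \<bar>f t + g t\<bar> \<le> C * exp (- c * t)" by blast
qed

lemma decays_cmult:
  assumes "decays \<delta> f"
  shows "decays \<delta> (\<lambda>t. k * f t)"
  unfolding decays_def
proof (intro allI impI)
  fix c assume c: "c > - \<delta>"
  obtain A where A: "\<And>t. \<bar>f t\<bar> \<le> A * exp (- c * t)"
    using assms c unfolding decays_def by meson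
  have "\<bar>k * f t\<bar> \<le> (\<bar>k\<bar> * A) * exp (- c * t)" for t
    using mult_left_mono[OF A[of t], of "\<bar>k\<bar>"] by (simp add: abs_mult mult.assoc)
  thus "\<exists>C. \<forall>t. \<bar>k * f t\<bar> \<le> C * exp (- c * t)" by blast
qed

text \<open>The rates in \<open>decays\<close> form an open half-line so that they can be taken on
  both sides of \<xi>: the rate \<xi> - \<epsilon> controls t near -\<infinity>, the rate \<xi> +
  \<epsilon> controls t near \<infinity>. Integrability and boundary values of exponential moments
  come from this bound.\<close>

lemma decays_two_sided:
  assumes "decays \<delta> f" "\<xi> > - \<delta>"
  obtains C \<epsilon> where "\<epsilon> > 0" "C \<ge> 0" "\<xi> - \<epsilon> > - \<delta>" "\<And>t. \<bar>exp (\<xi> * t) * f t\<bar> \<le> C * exp (- \<epsilon> * \<bar>t\<bar>)"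
proof -
  define \<epsilon> where "\<epsilon> = (\<xi> + \<delta>) / 2"
  have \<epsilon>: "\<epsilon> > 0" "\<xi> - \<epsilon> > - \<delta>" "\<xi> + \<epsilon> > - \<delta>" using assms by (auto simp: \<epsilon>_def field_simps)
  obtain A B where A: "\<And>t. \<bar>f t\<bar> \<le> A * exp (- (\<xi> - \<epsilon>) * t)"
    and B: "\<And>t. \<bar>f t\<bar> \<le> B * exp (- (\<xi> + \<epsilon>) * t)"
    using assms \<epsilon> unfolding decays_def by meson
  have A0: "A \<ge> 0" "B \<ge> 0" using A[of 0] B[of 0] by auto
  have "\<bar>exp (\<xi> * t) * f t\<bar> \<le> (A + B) * exp (- \<epsilon> * \<bar>t\<bar>)" for t
  proof (cases "t \<ge> 0")
    case True
    have "\<bar>exp (\<xi> * t) * f t\<bar> \<le> exp (\<xi> * t) * (B * exp (- (\<xi> + \<epsilon>) * t))"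
      using B[of t] by (simp add: abs_mult)
    also have "\<dots> = B * exp (- \<epsilon> * \<bar>t\<bar>)"
      using True by (simp add: mult_exp_exp algebra_simps)
    also have "\<dots> \<le> (A + B) * exp (- \<epsilon> * \<bar>t\<bar>)" using A0 by (simp add: algebra_simps)
    finally show ?thesis .
  next
    case False
    have "\<bar>exp (\<xi> * t) * f t\<bar> \<le> exp (\<xi> * t) * (A * exp (- (\<xi> - \<epsilon>) * t))"
      using A[of t] by (simp add: abs_mult)
    also have "\<dots> = A * exp (- \<epsilon> * \<bar>t\<bar>)"
      using False by (simp add: mult_exp_exp algebra_simps)
    also have "\<dots> \<le> (A + B) * exp (- \<epsilon> * \<bar>t\<bar>)" using A0 by (simp add: algebra_simps)
    finally show ?thesis .
  qed
  thus ?thesis using that[of \<epsilon> "A + B"] \<epsilon> A0 by auto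
qed

lemma abs_mult_exp_le:
  fixes \<epsilon> t :: real
  assumes "\<epsilon> > 0"
  shows "\<bar>t\<bar> * exp (- \<epsilon> * \<bar>t\<bar>) \<le> 1 / \<epsilon>"
proof -
  have "\<epsilon> * \<bar>t\<bar> \<le> exp (\<epsilon> * \<bar>t\<bar>)" using exp_ge_add_one_self[of "\<epsilon> * \<bar>t\<bar>"] by linarith
  thus ?thesis using assms by (simp add: exp_minus field_simps)
qed

lemma decays_times_id:
  assumes "decays \<delta> f"
  shows "decays \<delta> (\<lambda>t. t * f t)"
  unfolding decays_def
proof (intro allI impI)
  fix c assume c: "c > - \<delta>"
  obtain C \<epsilon> where e: "\<epsilon> > 0" "C \<ge> 0" and b: "\<And>t. \<bar>exp (c * t) * f t\<bar> \<le> C * exp (- \<epsilon> * \<bar>t\<bar>)"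
    using decays_two_sided[OF assms c] by metis
  have "\<bar>t * f t\<bar> \<le> C / \<epsilon> * exp (- c * t)" for t
  proof -
    have "\<bar>t * f t\<bar> = \<bar>t\<bar> * \<bar>exp (c * t) * f t\<bar> * exp (- c * t)"
      by (simp add: abs_mult mult_ac exp_minus)
    also have "\<dots> \<le> \<bar>t\<bar> * (C * exp (- \<epsilon> * \<bar>t\<bar>)) * exp (- c * t)"
      using b[of t] by (intro mult_right_mono mult_left_mono) auto
    also have "\<dots> = C * (\<bar>t\<bar> * exp (- \<epsilon> * \<bar>t\<bar>)) * exp (- c * t)" by (simp add: mult_ac)
    also have "\<dots> \<le> C * (1 / \<epsilon>) * exp (- c * t)"
      using abs_mult_exp_le[OF e(1), of t] e by (intro mult_right_mono mult_left_mono) auto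
    finally show ?thesis by simp
  qed
  thus "\<exists>C. \<forall>t. \<bar>t * f t\<bar> \<le> C * exp (- c * t)" by blast
qed

lemma integrable_exp_minus_abs:
  fixes \<epsilon> :: real
  assumes "\<epsilon> > 0"
  shows "integrable lborel (\<lambda>t. exp (- \<epsilon> * \<bar>t\<bar>))"
proof -
  have p: "set_integrable lborel {0..} (\<lambda>t. exp (- \<epsilon> * t))"
  proof -
    have "(\<lambda>t. exp (- \<epsilon> * t)) absolutely_integrable_on {0..}"
      using integrable_on_exp_minus_to_infinity[OF assms, of 0]
      by (intro nonnegative_absolutely_integrable_1) auto
    thus ?thesis unfolding set_integrable_def
      by (subst (asm) integrable_completion) auto
  qed
  hence "integrable lborel (\<lambda>t. indicator {0..} (-t) *\<^sub>R exp (- \<epsilon> * (-t)))"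
    unfolding set_integrable_def
    using lborel_integrable_real_affine_iff[of "-1" "\<lambda>t. indicator {0..} t *\<^sub>R exp (- \<epsilon> * t)" 0]
    by simp
  from Bochner_Integration.integrable_add[OF this p[unfolded set_integrable_def]]
  show ?thesis
    by (rule Bochner_Integration.integrable_bound) (auto simp: indicator_def)
qed

lemma decays_integrable:
  assumes "decays \<delta> f" "\<xi> > - \<delta>" "continuous_on UNIV f"
  shows "integrable lborel (\<lambda>t. exp (\<xi> * t) * f t)"
proof -
  obtain C \<epsilon> where e: "\<epsilon> > 0" "C \<ge> 0" and b: "\<And>t. \<bar>exp (\<xi> * t) * f t\<bar> \<le> C * exp (- \<epsilon> * \<bar>t\<bar>)"
    using decays_two_sided[OF assms(1,2)] by metis
  have m: "(\<lambda>t. exp (\<xi> * t) * f t) \<in> borel_measurable lborel"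
    using assms(3) by (auto intro!: borel_measurable_continuous_onI continuous_intros)
  have "integrable lborel (\<lambda>t. C * exp (- \<epsilon> * \<bar>t\<bar>))"
    using integrable_exp_minus_abs[OF e(1)] by simp
  thus ?thesis
    using m by (rule Bochner_Integration.integrable_bound) (use b e in auto)
qed

lemma decays_tendsto:
  assumes "decays \<delta> f" "\<xi> > - \<delta>"
  shows "((\<lambda>t. exp (\<xi> * t) * f t) \<longlongrightarrow> 0) at_top" "((\<lambda>t. exp (\<xi> * t) * f t) \<longlongrightarrow> 0) at_bot"
proof -
  obtain C \<epsilon> where e: "\<epsilon> > 0" "C \<ge> 0" and b: "\<And>t. \<bar>exp (\<xi> * t) * f t\<bar> \<le> C * exp (- \<epsilon> * \<bar>t\<bar>)"
    using decays_two_sided[OF assms(1,2)] by metis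
  have 1: "((\<lambda>t. C * exp (- \<epsilon> * \<bar>t\<bar>)) \<longlongrightarrow> 0) F" if "filterlim (\<lambda>t::real. \<bar>t\<bar>) at_top F" for F
  proof -
    have "((\<lambda>t. C * exp (- (\<epsilon> * \<bar>t\<bar>))) \<longlongrightarrow> C * 0) F"
      by (intro tendsto_mult tendsto_const filterlim_compose[OF exp_at_bot]
          filterlim_compose[OF filterlim_uminus_at_bot_at_top]
          filterlim_tendsto_pos_mult_at_top[OF tendsto_const e(1) that])
    thus ?thesis by simp
  qed
  have t: "filterlim (\<lambda>t::real. \<bar>t\<bar>) at_top at_top" "filterlim (\<lambda>t::real. \<bar>t\<bar>) at_top at_bot"
    using filterlim_at_infinity_imp_norm_at_top[of "\<lambda>t::real. t"] at_top_le_at_infinity at_bot_le_at_infinity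
    by (auto simp: filterlim_def)
  show "((\<lambda>t. exp (\<xi> * t) * f t) \<longlongrightarrow> 0) at_top"
    by (rule Lim_null_comparison[OF _ 1[OF t(1)]]) (use b in auto)
  show "((\<lambda>t. exp (\<xi> * t) * f t) \<longlongrightarrow> 0) at_bot"
    by (rule Lim_null_comparison[OF _ 1[OF t(2)]]) (use b in auto)
qed

lemma integral_derivative_eq_0:
  fixes g g' :: "real \<Rightarrow> real"
  assumes "\<And>t. (g has_real_derivative g' t) (at t)" "continuous_on UNIV g'"
    "integrable lborel g'" "(g \<longlongrightarrow> 0) at_top" "(g \<longlongrightarrow> 0) at_bot"
  shows "(LBINT t. g' t) = 0"
proof -
  have "(LBINT t=(-\<infinity>)..\<infinity>. g' t) = 0 - 0"
  proof (rule interval_integral_FTC_integrable)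
    show "(g has_vector_derivative g' x) (at x)" for x
      using assms(1) has_real_derivative_iff_has_vector_derivative by blast
    show "isCont g' x" for x using assms(2) by (simp add: continuous_on_eq_continuous_at)
    show "set_integrable lborel (einterval (-\<infinity>) \<infinity>) g'"
      using assms(3) by (simp add: set_integrable_def)
    show "((g \<circ> real_of_ereal) \<longlongrightarrow> 0) (at_right (-\<infinity>))" "((g \<circ> real_of_ereal) \<longlongrightarrow> 0) (at_left \<infinity>)"
      using assms(4,5) by (simp_all add: ereal_tendsto_simps)
  qed auto
  thus ?thesis by (simp add: interval_lebesgue_integral_def set_lebesgue_integral_def)
qed

text \<open>The greatest fixed point expresses that the function is smooth and that it and all its
  derivatives decay, without quantifying over iterated derivatives; closure properties then need a
  single differentiation step.\<close>

coinductive adm :: "real \<Rightarrow> (real \<Rightarrow> real) \<Rightarrow> bool" for \<delta> where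
  admI: "(\<And>t. (f has_real_derivative f' t) (at t)) \<Longrightarrow> decays \<delta> f \<Longrightarrow> adm \<delta> f' \<Longrightarrow> adm \<delta> f"

lemma admD:
  assumes "adm \<delta> f"
  shows adm_deriv: "adm \<delta> (deriv f)"
    and adm_has_deriv: "(f has_real_derivative deriv f t) (at t)"
    and adm_decays: "decays \<delta> f"
proof -
  obtain f' where f': "\<And>t. (f has_real_derivative f' t) (at t)" "decays \<delta> f" "adm \<delta> f'"
    using assms
  proof (rule adm.cases)
    fix fa f' assume "f = fa" "\<And>t. (fa has_real_derivative f' t) (at t)" "decays \<delta> fa" "adm \<delta> f'"
    thus ?thesis using that[of f'] by simp
  qed
  have e: "deriv f = f'" using DERIV_imp_deriv[OF f'(1)] by (rule ext)
  show "adm \<delta> (deriv f)" "(f has_real_derivative deriv f t) (at t)" "decays \<delta> f"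
    unfolding e by (fact f')+
qed

lemma adm_continuous: "adm \<delta> f \<Longrightarrow> continuous_on UNIV f"
  by (intro continuous_at_imp_continuous_on ballI DERIV_isCont[OF adm_has_deriv])

text \<open>Reduces each closure proof below to naming a family of decaying functions that contains
  its own derivatives.\<close>

lemma adm_coinduct_set:
  assumes "h \<in> S"
    and step: "\<And>h. h \<in> S \<Longrightarrow> decays \<delta> h \<and> (\<exists>h'\<in>S. \<forall>t. (h has_real_derivative h' t) (at t))"
  shows "adm \<delta> h"
proof -
  have "\<exists>f f'. x = f \<and> (\<forall>t. (f has_real_derivative f' t) (at t)) \<and> decays \<delta> f \<and> (f' \<in> S \<or> adm \<delta> f')"
    if x: "x \<in> S" for x
  proof -
    obtain h' where "h' \<in> S" "\<forall>t. (x has_real_derivative h' t) (at t)" using step[OF x] by (elim conjE bexE) (rule that)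
    thus ?thesis using step[OF x] by (intro exI[of _ x] exI[of _ h'] conjI disjI1 refl) simp_all
  qed
  from adm.coinduct[of "\<lambda>h. h \<in> S", OF assms(1) this] show ?thesis .
qed

lemma adm_add:
  assumes "adm \<delta> f" "adm \<delta> g"
  shows "adm \<delta> (\<lambda>t. f t + g t)"
proof (rule adm_coinduct_set)
  define S where "S = (\<lambda>(f, g) t. f t + g t) ` ({f. adm \<delta> f} \<times> {f. adm \<delta> f})"
  show "(\<lambda>t. f t + g t) \<in> S" using assms by (auto simp: S_def)
  show "decays \<delta> h \<and> (\<exists>h'\<in>S. \<forall>t. (h has_real_derivative h' t) (at t))" if h: "h \<in> S" for h
  proof -
    obtain f g where fg: "adm \<delta> f" "adm \<delta> g" "h = (\<lambda>t. f t + g t)" using h by (auto simp: S_def)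
    have "(\<lambda>t. deriv f t + deriv g t) \<in> S"
      unfolding S_def by (rule image_eqI[of _ _ "(deriv f, deriv g)"]) (simp_all add: fg adm_deriv)
    moreover have "(h has_real_derivative deriv f t + deriv g t) (at t)" for t
      unfolding fg(3) by (intro DERIV_add adm_has_deriv[OF fg(1)] adm_has_deriv[OF fg(2)])
    ultimately show ?thesis
      using decays_add[OF adm_decays[OF fg(1)] adm_decays[OF fg(2)]] by (intro conjI bexI[of _ "\<lambda>t. deriv f t + deriv g t"]) (simp_all add: fg(3))
  qed
qed

lemma adm_cmult:
  assumes "adm \<delta> f"
  shows "adm \<delta> (\<lambda>t. k * f t)"
proof (rule adm_coinduct_set)
  define S where "S = (\<lambda>f t. k * f t) ` {f. adm \<delta> f}"
  show "(\<lambda>t. k * f t) \<in> S" using assms by (auto simp: S_def)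
  show "decays \<delta> h \<and> (\<exists>h'\<in>S. \<forall>t. (h has_real_derivative h' t) (at t))" if h: "h \<in> S" for h
  proof -
    obtain f where fg: "adm \<delta> f" "h = (\<lambda>t. k * f t)" using h by (auto simp: S_def)
    have "(\<lambda>t. k * deriv f t) \<in> S"
      unfolding S_def by (rule image_eqI[of _ _ "deriv f"]) (simp_all add: fg adm_deriv)
    moreover have "(h has_real_derivative k * deriv f t) (at t)" for t
      unfolding fg(2) by (intro DERIV_cmult adm_has_deriv[OF fg(1)])
    ultimately show ?thesis
      using decays_cmult[OF adm_decays[OF fg(1)], of k] by (intro conjI bexI[of _ "\<lambda>t. k * deriv f t"]) (simp_all add: fg(2))
  qed
qed

lemma adm_0: "adm \<delta> (\<lambda>t. 0)"
  by (rule adm_coinduct_set[of _ "{\<lambda>t. 0}"]) (auto simp: decays_def intro: exI[of _ 0])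

lemma adm_minus: "adm \<delta> f \<Longrightarrow> adm \<delta> (\<lambda>t. - f t)"
  using adm_cmult[of \<delta> f "-1"] by simp

lemma adm_diff: "adm \<delta> f \<Longrightarrow> adm \<delta> g \<Longrightarrow> adm \<delta> (\<lambda>t. f t - g t)"
  using adm_add[OF _ adm_minus] by simp

lemma adm_sum: "(\<And>i. i \<in> A \<Longrightarrow> adm \<delta> (f i)) \<Longrightarrow> adm \<delta> (\<lambda>t. \<Sum>i\<in>A. f i t)"
  by (induction A rule: infinite_finite_induct) (auto intro: adm_0 adm_add)

lemma adm_times_id:
  assumes "adm \<delta> f"
  shows "adm \<delta> (\<lambda>t. t * f t)"
proof (rule adm_coinduct_set)
  \<comment> \<open>The products \<open>t * f t\<close> alone are not closed under differentiation;
    the summand \<open>g\<close> absorbs the extra term \<open>f\<close>.\<close>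
  define S where "S = (\<lambda>(f, g) t. t * f t + g t) ` ({f. adm \<delta> f} \<times> {f. adm \<delta> f})"
  show "(\<lambda>t. t * f t) \<in> S"
    unfolding S_def by (rule image_eqI[of _ _ "(f, \<lambda>t. 0)"]) (simp_all add: assms adm_0)
  show "decays \<delta> h \<and> (\<exists>h'\<in>S. \<forall>t. (h has_real_derivative h' t) (at t))" if h: "h \<in> S" for h
  proof -
    obtain f g where fg: "adm \<delta> f" "adm \<delta> g" "h = (\<lambda>t. t * f t + g t)" using h by (auto simp: S_def)
    have "(\<lambda>t. t * deriv f t + (f t + deriv g t)) \<in> S"
      unfolding S_def by (rule image_eqI[of _ _ "(deriv f, \<lambda>t. f t + deriv g t)"])
        (simp_all add: fg adm_deriv adm_add)
    moreover have "(h has_real_derivative t * deriv f t + (f t + deriv g t)) (at t)" for t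
      unfolding fg(3) using adm_has_deriv[OF fg(1), of t] adm_has_deriv[OF fg(2), of t]
      by (auto intro!: derivative_eq_intros)
    ultimately show ?thesis
      using decays_add[OF decays_times_id[OF adm_decays[OF fg(1)]] adm_decays[OF fg(2)]]
      by (intro conjI bexI[of _ "\<lambda>t. t * deriv f t + (f t + deriv g t)"]) (simp_all add: fg(3))
  qed
qed

lemma adm_times_power: "adm \<delta> f \<Longrightarrow> adm \<delta> (\<lambda>t. t ^ k * f t)"
proof (induction k)
  case (Suc k)
  from adm_times_id[OF Suc.IH[OF Suc.prems]] show ?case by (simp add: mult.assoc)
qed simp

lemma adm_integrable:
  assumes "adm \<delta> f" "\<xi> > - \<delta>"
  shows "integrable lborel (\<lambda>t. t ^ k * exp (\<xi> * t) * f t)"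
  using decays_integrable[OF adm_decays[OF adm_times_power[OF assms(1)]] assms(2)
      adm_continuous[OF adm_times_power[OF assms(1)]], of k]
  by (simp add: mult_ac)

text \<open>The equation forces a multiple of exp (\<rho> t), which is unbounded at \<infinity>
  unless it vanishes. Hence \<rho> - d/dt is injective on admissible functions.\<close>

lemma adm_eq_0:
  assumes g: "adm \<delta> g" and "\<delta> > 0" "\<rho> > 0" "\<And>t. deriv g t = \<rho> * g t"
  shows "g t = 0"
proof -
  define h where "h t = exp (- \<rho> * t) * g t" for t
  have "(h has_real_derivative 0) (at t)" for t
    unfolding h_def using adm_has_deriv[OF g, of t] assms(4)[of t]
    by (auto intro!: derivative_eq_intros)
  hence c: "h t = h 0" for t
    using DERIV_isconst_all by blast
  obtain C where "\<And>t. \<bar>g t\<bar> \<le> C * exp (- 0 * t)"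
    using adm_decays[OF g] \<open>\<delta> > 0\<close> unfolding decays_def by (metis neg_less_0_iff_less)
  hence C: "\<And>t. \<bar>g t\<bar> \<le> C" by simp
  have "(h \<longlongrightarrow> 0) at_top"
  proof (rule Lim_null_comparison)
    show "eventually (\<lambda>t. norm (h t) \<le> C * exp (- \<rho> * t)) at_top"
      using C by (auto simp: h_def abs_mult mult.commute)
    have "((\<lambda>t. C * exp (- (\<rho> * t))) \<longlongrightarrow> C * 0) at_top"
      by (intro tendsto_mult tendsto_const filterlim_compose[OF exp_at_bot]
          filterlim_compose[OF filterlim_uminus_at_bot_at_top]
          filterlim_tendsto_pos_mult_at_top[OF tendsto_const assms(3) filterlim_ident])
    thus "((\<lambda>t. C * exp (- \<rho> * t)) \<longlongrightarrow> 0) at_top" by simp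
  qed
  moreover have "h = (\<lambda>_. h 0)" using c by blast
  ultimately have "h 0 = 0"
    by (metis tendsto_const_iff trivial_limit_at_top_linorder)
  thus ?thesis using c[of t] by (simp add: h_def)
qed

subsection \<open>Gamma averages\<close>

definition gamma_weight :: "real \<Rightarrow> real \<Rightarrow> real \<Rightarrow> real" where
  "gamma_weight \<rho> d u = \<rho> powr d / Gamma d * u powr (d - 1) * exp (- \<rho> * u)"

lemma gamma_avg_eq:
  "gamma_avg \<rho> d f t = (if d = 0 then f t
     else (LBINT u. indicator {0<..} u * (gamma_weight \<rho> d u * f (t + u))))"
  by (simp add: gamma_avg_def gamma_weight_def set_lebesgue_integral_def)

lemma set_integrable_gamma:
  assumes "\<rho> > 0" "d > 0"
  shows "integrable lborel (\<lambda>u::real. indicator {0<..} u * (u powr (d - 1) * exp (- \<rho> * u)))"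
proof -
  let ?f = "\<lambda>t. complex_of_real t powr (of_real d - 1) / of_real (exp (\<rho> * t))"
  have "integrable lebesgue (\<lambda>t. indicator {0<..} t *\<^sub>R ?f t)"
    using absolutely_integrable_Gamma_integral[of "of_real d" \<rho>] assms by (simp add: set_integrable_def)
  hence "integrable lebesgue (\<lambda>t. norm (indicator {0<..} t *\<^sub>R ?f t))"
    by (rule integrable_norm)
  also have "(\<lambda>t. norm (indicator {0<..} t *\<^sub>R ?f t)) = (\<lambda>u. indicator {0<..} u * (u powr (d - 1) * exp (- \<rho> * u)))"
    by (auto simp: fun_eq_iff indicator_def norm_divide norm_powr_real_powr exp_minus field_simps)
  finally show ?thesis by (subst (asm) integrable_completion) auto
qed

lemma integrable_gamma_weight:
  assumes "\<rho> > 0" "d > 0"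
  shows "integrable lborel (\<lambda>u. indicator {0<..} u * gamma_weight \<rho> d u)"
  using Bochner_Integration.integrable_mult_right[OF set_integrable_gamma[OF assms], of "\<rho> powr d / Gamma d"]
  unfolding gamma_weight_def by (simp add: mult_ac)

lemma gamma_weight_measurable [measurable]: "gamma_weight \<rho> d \<in> borel_measurable borel"
  unfolding gamma_weight_def by measurable

lemma gamma_weight_nonneg: "\<rho> > 0 \<Longrightarrow> d > 0 \<Longrightarrow> gamma_weight \<rho> d u \<ge> 0"
  unfolding gamma_weight_def by (intro mult_nonneg_nonneg divide_nonneg_nonneg) (auto simp: Gamma_real_pos less_imp_le)

lemma integrable_gamma_avg:
  assumes "\<rho> > 0" "d > 0" "continuous_on UNIV f" "\<And>t. \<bar>f t\<bar> \<le> C"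
  shows "integrable lborel (\<lambda>u. indicator {0<..} u * (gamma_weight \<rho> d u * f (t + u)))"
proof -
  have m: "(\<lambda>u. f (t + u)) \<in> borel_measurable borel"
    by (intro borel_measurable_continuous_onI continuous_on_compose2[OF assms(3)] continuous_intros) auto
  have "integrable lborel (\<lambda>u. indicator {0<..} u * gamma_weight \<rho> d u * C)"
    using integrable_gamma_weight[OF assms(1,2)] by simp
  thus ?thesis
  proof (rule Bochner_Integration.integrable_bound)
    show "(\<lambda>u. indicator {0<..} u * (gamma_weight \<rho> d u * f (t + u))) \<in> borel_measurable lborel"
      using m by measurable
    show "AE u in lborel. norm (indicator {0<..} u * (gamma_weight \<rho> d u * f (t + u)))
        \<le> norm (indicator {0<..} u * gamma_weight \<rho> d u * C)"
    proof (rule AE_I2)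
      fix u
      have "\<bar>f (t + u)\<bar> \<le> \<bar>C\<bar>" using assms(4)[of "t + u"] by linarith
      thus "norm (indicator {0<..} u * (gamma_weight \<rho> d u * f (t + u)))
          \<le> norm (indicator {0<..} u * gamma_weight \<rho> d u * C)"
        by (simp add: abs_mult mult_left_mono mult.assoc)
    qed
  qed
qed

lemma adm_bounded: assumes "adm \<delta> f" "\<delta> > 0" obtains C where "C \<ge> 0" "\<And>t. \<bar>f t\<bar> \<le> C"
proof -
  obtain C where "\<And>t. \<bar>f t\<bar> \<le> C * exp (- 0 * t)"
    using adm_decays[OF assms(1)] assms(2) unfolding decays_def by (metis neg_less_0_iff_less)
  hence C: "\<And>t. \<bar>f t\<bar> \<le> C" by simp
  have "C \<ge> 0" using C[of 0] by linarith
  thus ?thesis using that C by blast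
qed

lemma gamma_avg_integrable_adm:
  assumes "adm \<delta> f" "\<delta> > 0" "\<rho> > 0" "d > 0"
  shows "integrable lborel (\<lambda>u. indicator {0<..} u * (gamma_weight \<rho> d u * f (t + u)))"
  using adm_bounded[OF assms(1,2)] integrable_gamma_avg[OF assms(3,4) adm_continuous[OF assms(1)]] by metis

lemma gamma_avg_add:
  assumes "adm \<delta> f" "adm \<delta> g" "\<delta> > 0" "\<rho> > 0" "d \<ge> 0"
  shows "gamma_avg \<rho> d (\<lambda>t. f t + g t) t = gamma_avg \<rho> d f t + gamma_avg \<rho> d g t"
proof (cases "d = 0")
  case False
  hence d: "d > 0" using assms by simp
  show ?thesis using False gamma_avg_integrable_adm[OF assms(1,3,4) d, of t]
      gamma_avg_integrable_adm[OF assms(2,3,4) d, of t]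
    by (simp add: gamma_avg_eq distrib_left)
qed (simp add: gamma_avg_eq)

lemma gamma_avg_cmult: "gamma_avg \<rho> d (\<lambda>t. k * f t) t = k * gamma_avg \<rho> d f t"
proof -
  have "(LBINT u. indicator {0<..} u * (gamma_weight \<rho> d u * (k * f (t + u)))) =
        (LBINT u. k * (indicator {0<..} u * (gamma_weight \<rho> d u * f (t + u))))"
    by (simp add: mult_ac)
  thus ?thesis by (simp add: gamma_avg_eq)
qed

text \<open>Inserting the bound for \<open>f (t + u)\<close> turns the kernel into a Gamma weight of
  rate \<rho> + c, integrable because c > -\<delta> and \<delta> \<le> \<rho>. This is why \<delta>
  has to be a lower bound of all rates.\<close>

lemma gamma_avg_decays:
  assumes f: "adm \<delta> f" and d: "\<delta> > 0" "\<delta> \<le> \<rho>" "d \<ge> 0"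
  shows "decays \<delta> (gamma_avg \<rho> d f)"
proof (cases "d = 0")
  case True
  hence "gamma_avg \<rho> d f = f" by (simp add: fun_eq_iff gamma_avg_eq)
  thus ?thesis using adm_decays[OF f] by simp
next
  case False
  hence d0: "d > 0" and r: "\<rho> > 0" using d by auto
  show ?thesis unfolding decays_def
  proof (intro allI impI)
    fix c assume c: "c > - \<delta>"
    obtain C where C: "\<And>t. \<bar>f t\<bar> \<le> C * exp (- c * t)"
      using adm_decays[OF f] c unfolding decays_def by meson
    have "C \<ge> 0" using C[of 0] by auto
    let ?k = "\<rho> powr d / Gamma d"
    let ?g = "\<lambda>u::real. indicator {0<..} u * (u powr (d - 1) * exp (- (\<rho> + c) * u)) :: real"
    have g: "integrable lborel ?g" using c d d0 by (intro set_integrable_gamma) auto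
    have k: "?k \<ge> 0" using d0 by (simp add: Gamma_real_pos less_imp_le)
    have "\<bar>gamma_avg \<rho> d f t\<bar> \<le> (?k * C * (LBINT u. ?g u)) * exp (- c * t)" for t
    proof -
      have "\<bar>gamma_avg \<rho> d f t\<bar> \<le> (LBINT u. norm (indicator {0<..} u * (gamma_weight \<rho> d u * f (t + u))))"
        using False integral_norm_bound[of lborel "\<lambda>u. indicator {0<..} u * (gamma_weight \<rho> d u * f (t + u))"]
        by (simp add: gamma_avg_eq)
      also have "\<dots> \<le> (LBINT u. ?g u * (?k * C * exp (- c * t)))"
      proof (rule integral_mono)
        show "integrable lborel (\<lambda>u. norm (indicator {0<..} u * (gamma_weight \<rho> d u * f (t + u))))"
          by (intro integrable_norm gamma_avg_integrable_adm[OF f d(1) r d0])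
        show "integrable lborel (\<lambda>u. ?g u * (?k * C * exp (- c * t)))" using g by simp
        show "norm (indicator {0<..} u * (gamma_weight \<rho> d u * f (t + u))) \<le> ?g u * (?k * C * exp (- c * t))" for u
        proof (cases "u > 0")
          case True
          have "norm (indicator {0<..} u * (gamma_weight \<rho> d u * f (t + u))) = gamma_weight \<rho> d u * \<bar>f (t + u)\<bar>"
            using True gamma_weight_nonneg[OF r d0, of u] by (simp add: abs_mult)
          also have "\<dots> \<le> gamma_weight \<rho> d u * (C * exp (- c * (t + u)))"
            by (intro mult_left_mono C gamma_weight_nonneg r d0)
          also have "\<dots> = ?k * u powr (d - 1) * C * (exp (- \<rho> * u) * exp (- c * (t + u)))"
            by (simp add: gamma_weight_def mult_ac)
          also have "exp (- \<rho> * u) * exp (- c * (t + u)) = exp (- (\<rho> + c) * u) * exp (- c * t)"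
            by (simp add: mult_exp_exp algebra_simps)
          finally show ?thesis using True by (simp add: mult_ac)
        qed simp
      qed
      also have "\<dots> = (?k * C * (LBINT u. ?g u)) * exp (- c * t)"
        by (subst integral_mult_left_zero) (simp only: mult_ac)
      finally show ?thesis .
    qed
    thus "\<exists>C. \<forall>t. \<bar>gamma_avg \<rho> d f t\<bar> \<le> C * exp (- c * t)" by blast
  qed
qed

text \<open>Differentiation under the integral by dominated convergence along sequences; difference
  quotients are bounded by a bound of the derivative, so a multiple of the Gamma weight is the
  majorant.\<close>

lemma gamma_avg_has_deriv:
  assumes f: "adm \<delta> f" and d: "\<delta> > 0" "\<rho> > 0" "d \<ge> 0"
  shows "(gamma_avg \<rho> d f has_real_derivative gamma_avg \<rho> d (deriv f) t) (at t)"
proof (cases "d = 0")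
  case True
  hence "gamma_avg \<rho> d g = g" for g by (simp add: fun_eq_iff gamma_avg_eq)
  thus ?thesis using adm_has_deriv[OF f] by simp
next
  case False
  hence d0: "d > 0" using d by auto
  obtain C where C: "C \<ge> 0" "\<And>t. \<bar>deriv f t\<bar> \<le> C" using adm_bounded[OF adm_deriv[OF f] d(1)] by blast
  let ?G = "gamma_avg \<rho> d f"
  let ?w = "\<lambda>u. indicator {0<..} u * gamma_weight \<rho> d u"
  have G: "gamma_avg \<rho> d g s = (LBINT u. ?w u * g (s + u))" for g s
    using False by (simp add: gamma_avg_eq mult.assoc)
  have I: "integrable lborel (\<lambda>u. ?w u * f (s + u))" for s
    using gamma_avg_integrable_adm[OF f d(1,2) d0, of s] by (simp add: mult.assoc)
  have "((\<lambda>h. (?G (t + h) - ?G t) / h) \<longlongrightarrow> gamma_avg \<rho> d (deriv f) t) (at 0)"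
    unfolding tendsto_at_iff_sequentially
  proof (intro allI impI)
    fix X :: "nat \<Rightarrow> real" assume X: "\<forall>i. X i \<in> UNIV - {0}" "X \<longlonglongrightarrow> 0"
    have X0: "X i \<noteq> 0" for i using X(1) by auto
    have e: "((\<lambda>h. (?G (t + h) - ?G t) / h) \<circ> X) n = (LBINT u. ?w u * ((f (t + X n + u) - f (t + u)) / X n))" for n
    proof -
      have "((\<lambda>h. (?G (t + h) - ?G t) / h) \<circ> X) n
          = (LBINT u. ?w u * f (t + X n + u) - ?w u * f (t + u)) / X n"
        using I by (simp add: G Bochner_Integration.integral_diff)
      also have "\<dots> = (LBINT u. (?w u * f (t + X n + u) - ?w u * f (t + u)) / X n)" by simp
      finally show ?thesis by (simp add: algebra_simps diff_divide_distrib)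
    qed
    have "(\<lambda>n. LBINT u. ?w u * ((f (t + X n + u) - f (t + u)) / X n)) \<longlonglongrightarrow> (LBINT u. ?w u * deriv f (t + u))"
    proof (rule integral_dominated_convergence[where w = "\<lambda>u. ?w u * C"])
      have mf: "(\<lambda>u. f (s + u)) \<in> borel_measurable borel" "(\<lambda>u. deriv f (s + u)) \<in> borel_measurable borel" for s
        using adm_continuous[OF f] adm_continuous[OF adm_deriv[OF f]]
        by (auto intro!: borel_measurable_continuous_onI continuous_on_compose2[of UNIV f UNIV]
            continuous_on_compose2[of UNIV "deriv f" UNIV] continuous_intros)
      show "(\<lambda>u. ?w u * deriv f (t + u)) \<in> borel_measurable lborel" using mf by measurable
      show "(\<lambda>u. ?w u * ((f (t + X n + u) - f (t + u)) / X n)) \<in> borel_measurable lborel" for n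
        using mf by measurable
      show "integrable lborel (\<lambda>u. ?w u * C)" using integrable_gamma_weight[OF d(2) d0] by simp
      show "AE u in lborel. (\<lambda>n. ?w u * ((f (t + X n + u) - f (t + u)) / X n)) \<longlonglongrightarrow> ?w u * deriv f (t + u)"
      proof (rule AE_I2)
        fix u
        have "((\<lambda>h. (f (t + u + h) - f (t + u)) / h) \<longlongrightarrow> deriv f (t + u)) (at 0)"
          using adm_has_deriv[OF f, of "t + u"] by (simp add: DERIV_def)
        hence "((\<lambda>h. (f (t + u + h) - f (t + u)) / h) \<circ> X) \<longlonglongrightarrow> deriv f (t + u)"
          using X unfolding tendsto_at_iff_sequentially by blast
        hence "(\<lambda>n. (f (t + X n + u) - f (t + u)) / X n) \<longlonglongrightarrow> deriv f (t + u)"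
          by (simp add: o_def add_ac)
        thus "(\<lambda>n. ?w u * ((f (t + X n + u) - f (t + u)) / X n)) \<longlonglongrightarrow> ?w u * deriv f (t + u)"
          by (intro tendsto_mult tendsto_const)
      qed
      show "AE u in lborel. norm (?w u * ((f (t + X n + u) - f (t + u)) / X n)) \<le> ?w u * C" for n
      proof (rule AE_I2)
        fix u
        have "norm (f (t + X n + u) - f (t + u)) \<le> C * norm ((t + X n + u) - (t + u))"
          by (rule field_differentiable_bound[of UNIV f "deriv f"])
             (use C in \<open>auto intro: has_field_derivative_at_within adm_has_deriv[OF f]\<close>)
        hence "\<bar>(f (t + X n + u) - f (t + u)) / X n\<bar> \<le> C"
          using X0[of n] by (simp add: field_simps)
        moreover have w: "?w u \<ge> 0" using gamma_weight_nonneg[OF d(2) d0, of u] by simp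
        ultimately have "?w u * \<bar>(f (t + X n + u) - f (t + u)) / X n\<bar> \<le> ?w u * C"
          by (rule mult_left_mono)
        thus "norm (?w u * ((f (t + X n + u) - f (t + u)) / X n)) \<le> ?w u * C"
          unfolding real_norm_def abs_mult[of "?w u"] abs_of_nonneg[OF w] .
      qed
    qed
    thus "((\<lambda>h. (?G (t + h) - ?G t) / h) \<circ> X) \<longlonglongrightarrow> gamma_avg \<rho> d (deriv f) t"
      unfolding ext[OF e] G[of "deriv f"] .
  qed
  thus ?thesis by (simp add: DERIV_def)
qed

lemma deriv_gamma_avg:
  assumes "adm \<delta> f" "\<delta> > 0" "\<rho> > 0" "d \<ge> 0"
  shows "deriv (gamma_avg \<rho> d f) = gamma_avg \<rho> d (deriv f)"
  using gamma_avg_has_deriv[OF assms] by (auto intro!: DERIV_imp_deriv)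

lemma adm_gamma_avg:
  assumes f: "adm \<delta> f" and d: "\<delta> > 0" "\<delta> \<le> \<rho>" "d \<ge> 0"
  shows "adm \<delta> (gamma_avg \<rho> d f)"
proof (rule adm_coinduct_set)
  define S where "S = gamma_avg \<rho> d ` {f. adm \<delta> f}"
  show "gamma_avg \<rho> d f \<in> S" using f by (auto simp: S_def)
  have r: "\<rho> > 0" using d by simp
  show "decays \<delta> h \<and> (\<exists>h'\<in>S. \<forall>t. (h has_real_derivative h' t) (at t))" if h: "h \<in> S" for h
  proof -
    obtain f where fg: "adm \<delta> f" "h = gamma_avg \<rho> d f" using h by (auto simp: S_def)
    show ?thesis unfolding fg(2)
      using gamma_avg_decays[OF fg(1) d] gamma_avg_has_deriv[OF fg(1) d(1) r d(3)]
      by (intro conjI bexI[of _ "gamma_avg \<rho> d (deriv f)"]) (auto simp: S_def adm_deriv[OF fg(1)])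
  qed
qed

lemma gamma_weight_times_id:
  assumes "\<rho> > 0" "d > 0" "u > 0"
  shows "gamma_weight \<rho> d u * u = d / \<rho> * gamma_weight \<rho> (d + 1) u"
proof -
  have "d \<notin> \<int>\<^sub>\<le>\<^sub>0" using assms by (auto dest: nonpos_Ints_nonpos)
  hence "Gamma (d + 1) = d * Gamma d" by (rule Gamma_plus1)
  moreover have "Gamma d > 0" using assms by (simp add: Gamma_real_pos)
  moreover have "u powr d = u powr (d - 1) * u" using assms by (simp add: powr_diff)
  ultimately show ?thesis using assms by (simp add: gamma_weight_def powr_add field_simps)
qed

text \<open>Commuting t past an average leaves a term of exponent d + 1, because u times the weight
  of exponent d is d / \<rho> times the weight of exponent d + 1. This term is the origin of the
  poles in the logarithmic derivative of the transform.\<close>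

lemma gamma_avg_times_id:
  assumes f: "adm \<delta> f" and d: "\<delta> > 0" "\<rho> > 0" "d \<ge> 0"
  shows "gamma_avg \<rho> d (\<lambda>s. s * f s) t = t * gamma_avg \<rho> d f t + d / \<rho> * gamma_avg \<rho> (d + 1) f t"
proof (cases "d = 0")
  case False
  hence d0: "d > 0" using d by simp
  have "(LBINT u. indicator {0<..} u * (gamma_weight \<rho> d u * ((t + u) * f (t + u)))) =
        (LBINT u. t * (indicator {0<..} u * (gamma_weight \<rho> d u * f (t + u))) +
          d / \<rho> * (indicator {0<..} u * (gamma_weight \<rho> (d + 1) u * f (t + u))))"
  proof (rule Bochner_Integration.integral_cong)
    fix u :: real
    show "indicator {0<..} u * (gamma_weight \<rho> d u * ((t + u) * f (t + u))) =
        t * (indicator {0<..} u * (gamma_weight \<rho> d u * f (t + u))) +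
          d / \<rho> * (indicator {0<..} u * (gamma_weight \<rho> (d + 1) u * f (t + u)))"
    proof (cases "u > 0")
      case True
      have "gamma_weight \<rho> d u * ((t + u) * f (t + u)) =
        t * (gamma_weight \<rho> d u * f (t + u)) + (gamma_weight \<rho> d u * u) * f (t + u)"
        by (simp add: algebra_simps)
      thus ?thesis using True by (simp add: gamma_weight_times_id[OF d(2) d0 True])
    qed simp
  qed simp
  also have "\<dots> = t * (LBINT u. indicator {0<..} u * (gamma_weight \<rho> d u * f (t + u))) +
          d / \<rho> * (LBINT u. indicator {0<..} u * (gamma_weight \<rho> (d + 1) u * f (t + u)))"
    using gamma_avg_integrable_adm[OF f d(1,2) d0, of t]
      gamma_avg_integrable_adm[OF f d(1,2), of "d + 1" t] d0
    by (subst Bochner_Integration.integral_add) auto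
  finally show ?thesis using d0 by (simp add: gamma_avg_eq)
qed (simp add: gamma_avg_eq)

text \<open>Integration by parts: the weight of exponent d + 1 has as derivative \<rho> times the
  difference of the weights of exponents d and d + 1. So \<rho> - d/dt lowers the exponent of an
  average by one.\<close>

lemma gamma_avg_Suc:
  assumes f: "adm \<delta> f" and d: "\<delta> > 0" "\<rho> > 0" "d \<ge> 0"
  shows "\<rho> * gamma_avg \<rho> (d + 1) f t - gamma_avg \<rho> (d + 1) (deriv f) t = \<rho> * gamma_avg \<rho> d f t"
proof -
  define W where "W = gamma_weight \<rho> (d + 1)"
  define H' where "H' u = (\<rho> * gamma_weight \<rho> d u - \<rho> * W u) * f (t + u) + W u * deriv f (t + u)" for u
  \<comment> \<open>The boundary term at u = 0. It survives only for d = 0, where the weight of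
    exponent 0 is identically zero, since \<open>Gamma 0 = 0\<close> and division by zero gives 0;
    it then takes the place of the missing integral.\<close>
  define A where "A = (if d = 0 then \<rho> * f t else 0)"
  let ?k = "\<rho> powr (d + 1) / Gamma (d + 1)"
  have k: "?k * d = \<rho> * (\<rho> powr d / Gamma d)"
  proof (cases "d = 0")
    case False
    hence "d \<notin> \<int>\<^sub>\<le>\<^sub>0" using d by (auto dest: nonpos_Ints_nonpos)
    hence "Gamma (d + 1) = d * Gamma d" by (rule Gamma_plus1)
    thus ?thesis using False d by (simp add: powr_add field_simps)
  qed simp
  have W: "W u = ?k * u powr d * exp (- \<rho> * u)" for u by (simp add: W_def gamma_weight_def)
  have W': "(W has_real_derivative (\<rho> * gamma_weight \<rho> d u - \<rho> * W u)) (at u)" if "u > 0" for u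
  proof -
    have "((\<lambda>u. k * u powr d * exp (- \<rho> * u)) has_real_derivative
        ((k * d) * u powr (d - 1) * exp (- \<rho> * u) - \<rho> * (k * u powr d * exp (- \<rho> * u)))) (at u)" for k
      using that by (auto intro!: derivative_eq_intros simp: algebra_simps)
    from this[of ?k] have "((\<lambda>u. ?k * u powr d * exp (- \<rho> * u)) has_real_derivative
        ((?k * d) * u powr (d - 1) * exp (- \<rho> * u) - \<rho> * (?k * u powr d * exp (- \<rho> * u)))) (at u)" .
    also have "(?k * d) * u powr (d - 1) * exp (- \<rho> * u) - \<rho> * (?k * u powr d * exp (- \<rho> * u)) =
        \<rho> * gamma_weight \<rho> d u - \<rho> * W u"
      unfolding k W by (simp add: gamma_weight_def algebra_simps)
    also have "(\<lambda>u. ?k * u powr d * exp (- \<rho> * u)) = W" using W by (simp add: fun_eq_iff)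
    finally show ?thesis .
  qed
  have cf: "isCont (\<lambda>u. f (t + u)) u" "isCont (\<lambda>u. deriv f (t + u)) u" for u
    using DERIV_isCont[OF adm_has_deriv[OF f, of "t + u"]]
      DERIV_isCont[OF adm_has_deriv[OF adm_deriv[OF f], of "t + u"]]
    by (auto intro!: isCont_o2[of u "\<lambda>u. t + u"] continuous_intros)
  have I0: "integrable lborel (\<lambda>u. indicator {0<..} u * (gamma_weight \<rho> d u * f (t + u)))"
  proof (cases "d = 0")
    case True thus ?thesis by (simp add: gamma_weight_def)
  next
    case False thus ?thesis using gamma_avg_integrable_adm[OF f d(1,2), of d t] d(3) by simp
  qed
  have I1: "integrable lborel (\<lambda>u. indicator {0<..} u * (W u * f (t + u)))"
    and I2: "integrable lborel (\<lambda>u. indicator {0<..} u * (W u * deriv f (t + u)))"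
    unfolding W_def using d(3) gamma_avg_integrable_adm[OF f d(1,2), of "d + 1" t]
      gamma_avg_integrable_adm[OF adm_deriv[OF f] d(1,2), of "d + 1" t] by simp_all
  have H'_eq: "indicator {0<..} u * H' u = \<rho> * (indicator {0<..} u * (gamma_weight \<rho> d u * f (t + u))) -
      \<rho> * (indicator {0<..} u * (W u * f (t + u))) + indicator {0<..} u * (W u * deriv f (t + u))" for u
    by (simp add: H'_def algebra_simps)
  have "(LBINT u=0..\<infinity>. H' u) = 0 - A"
  proof (rule interval_integral_FTC_integrable[where F = "\<lambda>u. W u * f (t + u)"])
    fix u assume "0 < ereal u"
    hence u: "u > 0" by simp
    have "((\<lambda>u. f (t + u)) has_real_derivative deriv f (t + u)) (at u)"
      using DERIV_shift[THEN iffD1, OF adm_has_deriv[OF f, of "u + t"]] by (simp add: add.commute)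
    from DERIV_mult[OF W'[OF u] this]
    show "((\<lambda>u. W u * f (t + u)) has_vector_derivative H' u) (at u)"
      by (simp add: H'_def mult_ac has_real_derivative_iff_has_vector_derivative[symmetric])
    have "isCont (\<lambda>u. c * u powr (d - 1) * exp (- \<rho> * u)) u" for c
      using u by (auto intro!: continuous_intros)
    hence "isCont (gamma_weight \<rho> d) u"
      unfolding gamma_weight_def[abs_def] by blast
    thus "isCont H' u" unfolding H'_def[abs_def]
      using DERIV_isCont[OF W'[OF u]] by (intro continuous_intros cf)
  next
    have "integrable lborel (\<lambda>u. indicator {0<..} u * H' u)"
      unfolding H'_eq using I0 I1 I2 by simp
    thus "set_integrable lborel (einterval 0 \<infinity>) H'"
      using einterval_eq_Ici[of 0] by (simp add: set_integrable_def zero_ereal_def)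
  next
    have "((\<lambda>u::real. u powr d) \<longlongrightarrow> (if d = 0 then 1 else 0)) (at_right 0)"
    proof (cases "d = 0")
      case True
      have "eventually (\<lambda>u::real. u powr d = 1) (at_right 0)"
        using True by (auto simp: eventually_at_filter)
      thus ?thesis using True by (auto intro: tendsto_eventually)
    next
      case False
      moreover have "eventually (\<lambda>u::real. 0 \<le> u) (at_right 0)" by (auto simp: eventually_at_filter)
      ultimately show ?thesis using d by (auto intro!: tendsto_zero_powrI[where b = d] tendsto_intros)
    qed
    moreover have "((\<lambda>u. f (t + u)) \<longlongrightarrow> f (t + 0)) (at_right 0)"
      using cf(1)[of 0] unfolding isCont_def by (rule filterlim_mono) (auto simp: at_within_le_at)
    ultimately have "((\<lambda>u. ?k * u powr d * exp (- \<rho> * u) * f (t + u))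
        \<longlongrightarrow> ?k * (if d = 0 then 1 else 0) * exp (- \<rho> * 0) * f (t + 0)) (at_right 0)"
      by (intro tendsto_intros)
    also have "?k * (if d = 0 then 1 else 0) * exp (- \<rho> * 0) * f (t + 0) = A"
      using d by (simp add: A_def)
    finally have "((\<lambda>u. W u * f (t + u)) \<longlongrightarrow> A) (at_right 0)" by (simp add: W)
    thus "(((\<lambda>u. W u * f (t + u)) \<circ> real_of_ereal) \<longlongrightarrow> A) (at_right 0)"
      unfolding zero_ereal_def by (simp add: ereal_tendsto_simps)
  next
    obtain C where C: "C \<ge> 0" "\<And>t. \<bar>f t\<bar> \<le> C" using adm_bounded[OF f d(1)] by blast
    have "((\<lambda>u::real. u powr d * exp (- \<rho> * u)) \<longlongrightarrow> 0) at_top" using d by real_asymp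
    from tendsto_mult_left[OF this, of "\<bar>?k\<bar> * C"]
    have l: "((\<lambda>u. \<bar>?k\<bar> * C * (u powr d * exp (- \<rho> * u))) \<longlongrightarrow> 0) at_top" by simp
    have "norm (W u * f (t + u)) \<le> \<bar>?k\<bar> * C * (u powr d * exp (- \<rho> * u))" for u
    proof -
      have "norm (W u * f (t + u)) = \<bar>?k\<bar> * \<bar>f (t + u)\<bar> * (u powr d * exp (- \<rho> * u))"
        by (simp add: W abs_mult)
      also have "\<dots> \<le> \<bar>?k\<bar> * C * (u powr d * exp (- \<rho> * u))"
        by (intro mult_right_mono mult_left_mono C) auto
      finally show ?thesis .
    qed
    hence "((\<lambda>u. W u * f (t + u)) \<longlongrightarrow> 0) at_top"
      by (intro Lim_null_comparison[OF _ l]) auto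
    thus "(((\<lambda>u. W u * f (t + u)) \<circ> real_of_ereal) \<longlongrightarrow> 0) (at_left \<infinity>)"
      by (simp add: ereal_tendsto_simps)
  qed auto
  hence "(LBINT u. indicator {0<..} u * H' u) = - A"
    by (simp add: interval_lebesgue_integral_0_infty set_lebesgue_integral_def)
  also have "(LBINT u. indicator {0<..} u * H' u) =
      \<rho> * (LBINT u. indicator {0<..} u * (gamma_weight \<rho> d u * f (t + u))) -
      \<rho> * gamma_avg \<rho> (d + 1) f t + gamma_avg \<rho> (d + 1) (deriv f) t"
    unfolding H'_eq using I0 I1 I2 d(3) by (simp add: gamma_avg_eq W_def)
  finally show ?thesis
    using d by (cases "d = 0") (auto simp: A_def gamma_avg_eq gamma_weight_def)
qed

lemma gamma_avg_0 [simp]: "gamma_avg \<rho> 0 f = f"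
  by (simp add: fun_eq_iff gamma_avg_eq)

lemma gamma_avg_1:
  assumes "adm \<delta> f" "\<delta> > 0" "\<rho> > 0"
  shows "deriv (gamma_avg \<rho> 1 f) t = \<rho> * gamma_avg \<rho> 1 f t - \<rho> * f t"
  using gamma_avg_Suc[OF assms, of 0 t] deriv_gamma_avg[OF assms, of 1] by simp

text \<open>Applying \<rho> - d/dt to both sides replaces Fubini and Beta integrals in the semigroup
  and commutation laws below.\<close>

lemma adm_eqI:
  assumes "adm \<delta> f" "adm \<delta> g" "\<delta> > 0" "\<rho> > 0"
    and "\<And>t. \<rho> * f t - deriv f t = \<rho> * g t - deriv g t"
  shows "f = g"
proof
  fix t
  have "deriv (\<lambda>t. f t - g t) t = deriv f t - deriv g t" for t
    by (intro DERIV_imp_deriv DERIV_diff adm_has_deriv[OF assms(1)] adm_has_deriv[OF assms(2)])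
  hence "f t - g t = 0"
  proof (intro adm_eq_0[OF adm_diff[OF assms(1,2)] assms(3,4)])
    fix s
    show "deriv (\<lambda>t. f t - g t) s = \<rho> * (f s - g s)"
      unfolding \<open>\<And>t. deriv (\<lambda>t. f t - g t) t = deriv f t - deriv g t\<close>
      using assms(5)[of s] by (simp add: algebra_simps)
  qed
  thus "f t = g t" by simp
qed

lemma gamma_avg_add_1:
  assumes f: "adm \<delta> f" and d: "\<delta> > 0" "\<delta> \<le> \<rho>" "d \<ge> 0"
  shows "gamma_avg \<rho> (d + 1) f = gamma_avg \<rho> 1 (gamma_avg \<rho> d f)"
proof (rule adm_eqI)
  have r: "\<rho> > 0" using d by simp
  show "adm \<delta> (gamma_avg \<rho> (d + 1) f)" "adm \<delta> (gamma_avg \<rho> 1 (gamma_avg \<rho> d f))"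
    using d by (auto intro!: adm_gamma_avg f)
  show "\<delta> > 0" "\<rho> > 0" using d by auto
  show "\<rho> * gamma_avg \<rho> (d + 1) f t - deriv (gamma_avg \<rho> (d + 1) f) t =
      \<rho> * gamma_avg \<rho> 1 (gamma_avg \<rho> d f) t - deriv (gamma_avg \<rho> 1 (gamma_avg \<rho> d f)) t" for t
    using gamma_avg_Suc[OF f d(1) r d(3), of t] gamma_avg_1[OF adm_gamma_avg[OF f d] d(1) r, of t]
      deriv_gamma_avg[OF f d(1) r, of "d + 1"] d(3) by simp
qed

text \<open>Exponent 1 on one side is enough, since only resolvents have to pass through the
  averages.\<close>

lemma gamma_avg_1_commute:
  assumes f: "adm \<delta> f" and d: "\<delta> > 0" "\<delta> \<le> \<rho>" "\<delta> \<le> \<sigma>" "d \<ge> 0"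
  shows "gamma_avg \<sigma> 1 (gamma_avg \<rho> d f) = gamma_avg \<rho> d (gamma_avg \<sigma> 1 f)"
proof (rule adm_eqI)
  have r: "\<rho> > 0" "\<sigma> > 0" using d by simp_all
  have a1: "adm \<delta> (gamma_avg \<sigma> 1 f)" using f d by (intro adm_gamma_avg) auto
  show "adm \<delta> (gamma_avg \<rho> d (gamma_avg \<sigma> 1 f))" "adm \<delta> (gamma_avg \<sigma> 1 (gamma_avg \<rho> d f))"
    using d a1 f by (auto intro!: adm_gamma_avg)
  show "\<delta> > 0" "\<sigma> > 0" by fact+
  show "\<sigma> * gamma_avg \<sigma> 1 (gamma_avg \<rho> d f) t - deriv (gamma_avg \<sigma> 1 (gamma_avg \<rho> d f)) t =
      \<sigma> * gamma_avg \<rho> d (gamma_avg \<sigma> 1 f) t - deriv (gamma_avg \<rho> d (gamma_avg \<sigma> 1 f)) t" for t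
  proof -
    have "deriv (gamma_avg \<rho> d (gamma_avg \<sigma> 1 f)) t = gamma_avg \<rho> d (deriv (gamma_avg \<sigma> 1 f)) t"
      by (simp add: deriv_gamma_avg[OF a1 d(1) r(1) d(4)])
    also have "deriv (gamma_avg \<sigma> 1 f) = (\<lambda>t. \<sigma> * gamma_avg \<sigma> 1 f t + (- \<sigma>) * f t)"
      using gamma_avg_1[OF f d(1) r(2)] by (simp add: fun_eq_iff)
    also have "gamma_avg \<rho> d \<dots> t = \<sigma> * gamma_avg \<rho> d (gamma_avg \<sigma> 1 f) t - \<sigma> * gamma_avg \<rho> d f t"
      by (subst gamma_avg_add[OF adm_cmult[OF a1] adm_cmult[OF f] d(1) r(1) d(4)])
        (use gamma_avg_cmult[of \<rho> d "- \<sigma>" f t] in \<open>simp add: gamma_avg_cmult\<close>)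
    finally show ?thesis
      using gamma_avg_1[OF adm_gamma_avg[OF f d(1,2,4)] d(1) r(2), of t] by simp
  qed
qed

lemma lborel_not_AE_notin: "\<not> (AE u in lborel. \<not> (0 < u \<and> u < (1::real)))"
proof
  assume "AE u in lborel. \<not> (0 < u \<and> u < (1::real))"
  hence "AE u in lborel. u \<notin> {0<..<1::real}" by (auto elim!: eventually_mono)
  hence "emeasure lborel {0<..<1::real} = 0"
    by (subst (asm) AE_iff_measurable[of "{0<..<1}"]) auto
  thus False by simp
qed

lemma integral_pos:
  fixes f :: "real \<Rightarrow> real"
  assumes "integrable lborel f" "\<And>u. f u \<ge> 0" "\<And>u. 0 < u \<Longrightarrow> f u > (0::real)"
  shows "(LBINT u. f u) > 0"
proof -
  have "(LBINT u. f u) \<noteq> 0"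
  proof
    assume "(LBINT u. f u) = 0"
    hence "AE u in lborel. f u = 0"
      using integral_nonneg_eq_0_iff_AE[OF assms(1)] assms(2) by auto
    hence "AE u in lborel. \<not> (0 < u \<and> u < (1::real))"
      by (rule eventually_mono) (use assms(3) in \<open>force\<close>)
    thus False using lborel_not_AE_notin by blast
  qed
  moreover have "(LBINT u. f u) \<ge> 0" using assms(2) by simp
  ultimately show ?thesis by simp
qed

lemma gamma_avg_pos:
  assumes f: "adm \<delta> f" and d: "\<delta> > 0" "\<rho> > 0" "d \<ge> 0" and pos: "\<And>t. f t > 0"
  shows "gamma_avg \<rho> d f t > 0"
proof (cases "d = 0")
  case False
  hence d0: "d > 0" using d by simp
  have "gamma_weight \<rho> d u > 0" if "u > 0" for u
    using that d d0 by (auto simp: gamma_weight_def Gamma_real_pos)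
  hence "(LBINT u. indicator {0<..} u * (gamma_weight \<rho> d u * f (t + u))) > 0"
    using gamma_weight_nonneg[OF d(2) d0] pos
    by (intro integral_pos gamma_avg_integrable_adm[OF f d(1,2) d0]) (auto simp: less_imp_le)
  thus ?thesis using False by (simp add: gamma_avg_eq)
qed (simp add: pos)

lemma gauss_pos: "gauss a t > 0" by (simp add: gauss_def)

lemma gauss_deriv: "(gauss a has_real_derivative - 2 * (t - a) * gauss a t) (at t)"
proof -
  have "((\<lambda>t. exp (- (t - a)\<^sup>2)) has_real_derivative - 2 * (t - a) * exp (- (t - a)\<^sup>2)) (at t)"
    by (auto intro!: derivative_eq_intros simp: algebra_simps)
  from DERIV_cdivide[OF this, of "sqrt pi"] show ?thesis
    unfolding gauss_def[abs_def] by (simp add: gauss_def)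
qed

lemma decays_gauss: "decays \<delta> (gauss a)"
  unfolding decays_def
proof (intro allI impI)
  fix c :: real
  have "\<bar>gauss a t\<bar> \<le> exp (c * a + c\<^sup>2 / 4) / sqrt pi * exp (- c * t)" for t
  proof -
    \<comment> \<open>Completing the square: c t - (t - a)^2 is largest at t = a + c / 2, with value
      c a + c^2 / 4.\<close>
    have "0 \<le> (t - a - c / 2)\<^sup>2" by simp
    hence "- (t - a)\<^sup>2 \<le> (c * a + c\<^sup>2 / 4) - c * t" by (simp add: power2_eq_square field_simps)
    hence "exp (- (t - a)\<^sup>2) \<le> exp (c * a + c\<^sup>2 / 4) * exp (- c * t)"
      by (simp add: mult_exp_exp)
    thus ?thesis by (simp add: gauss_def divide_right_mono)
  qed
  thus "\<exists>C. \<forall>t. \<bar>gauss a t\<bar> \<le> C * exp (- c * t)" by blast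
qed

lemma adm_gauss: "adm \<delta> (gauss a)"
proof (rule adm_coinduct_set)
  \<comment> \<open>The derivatives of the Gaussian are polynomial multiples of it, so these
    multiples form a family closed under differentiation.\<close>
  define S where "S = (\<lambda>p t. poly p t * gauss a t) ` UNIV"
  show "gauss a \<in> S" unfolding S_def by (rule image_eqI[of _ _ 1]) (auto simp: fun_eq_iff)
  have dec: "decays \<delta> (\<lambda>t. poly p t * gauss a t)" for p
  proof (induction p)
    case (pCons c p)
    from decays_add[OF decays_cmult[OF decays_gauss, of \<delta> c] decays_times_id[OF pCons.IH]]
    show ?case by (simp add: distrib_right mult.assoc)
  qed (auto simp: decays_def intro: exI[of _ 0])
  show "decays \<delta> h \<and> (\<exists>h'\<in>S. \<forall>t. (h has_real_derivative h' t) (at t))" if h: "h \<in> S" for h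
  proof -
    obtain p where p: "h = (\<lambda>t. poly p t * gauss a t)" using h by (auto simp: S_def)
    let ?q = "pderiv p + p * [:2 * a, - 2:]"
    have "((\<lambda>t. poly p t * gauss a t) has_real_derivative poly ?q t * gauss a t) (at t)" for t
      by (rule DERIV_cong[OF DERIV_mult[OF poly_DERIV gauss_deriv]]) (simp add: algebra_simps)
    moreover have "(\<lambda>t. poly ?q t * gauss a t) \<in> S" unfolding S_def by (rule image_eqI[of _ _ ?q]) auto
    ultimately show ?thesis using dec p by (intro conjI bexI[of _ "\<lambda>t. poly ?q t * gauss a t"]) auto
  qed
qed

subsection \<open>Constant coefficient differential operators\<close>

text \<open>\<open>pdop Q\<close> is \<open>Q(- d/dt)\<close>, the operator with symbol \<open>Q(z)\<close> under \<open>f \<mapsto> \<integral> e\<^bsup>zt\<^esup> f(t) dt\<close>.\<close>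

definition pdop :: "real poly \<Rightarrow> (real \<Rightarrow> real) \<Rightarrow> real \<Rightarrow> real" where
  "pdop Q f t = (\<Sum>i\<le>degree Q. coeff Q i * (- 1) ^ i * (deriv ^^ i) f t)"

lemma pdop_bound:
  assumes "degree Q \<le> n"
  shows "pdop Q f t = (\<Sum>i\<le>n. coeff Q i * (- 1) ^ i * (deriv ^^ i) f t)"
  unfolding pdop_def using assms
  by (intro sum.mono_neutral_left) (auto simp: coeff_eq_0)

lemma pdop_0 [simp]: "pdop 0 f t = 0"
  by (simp add: pdop_def)

lemma pdop_pCons: "pdop (pCons c Q) f t = c * f t - pdop Q (deriv f) t"
proof -
  have "pdop (pCons c Q) f t = (\<Sum>i\<le>Suc (degree Q). coeff (pCons c Q) i * (- 1) ^ i * (deriv ^^ i) f t)"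
    by (rule pdop_bound) (simp add: degree_pCons_le)
  also have "\<dots> = c * f t + (\<Sum>i\<le>degree Q. coeff Q i * (- 1) ^ Suc i * (deriv ^^ Suc i) f t)"
    by (subst sum.atMost_Suc_shift) simp
  also have "\<dots> = c * f t - pdop Q (deriv f) t"
    by (simp add: pdop_def funpow_swap1 sum_negf)
  finally show ?thesis .
qed

lemma pdop_1 [simp]: "pdop 1 f t = f t"
  by (simp add: one_pCons pdop_pCons)

lemma pdop_add: "pdop (P + Q) f t = pdop P f t + pdop Q f t"
proof -
  let ?n = "max (degree P) (degree Q)"
  have "degree (P + Q) \<le> ?n" by (simp add: degree_add_le_max)
  thus ?thesis
    by (simp add: pdop_bound[of _ ?n] distrib_right sum.distrib)
qed

lemma pdop_smult: "pdop (smult c Q) f t = c * pdop Q f t"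
  by (simp add: pdop_bound[OF degree_smult_le] pdop_def sum_distrib_left mult_ac)

lemma pdop_diff: "pdop (P - Q) f t = pdop P f t - pdop Q f t"
proof -
  have "P - Q = P + smult (-1) Q" by simp
  thus ?thesis by (simp only: pdop_add pdop_smult)
qed

lemma pdop_sum: "pdop (\<Sum>i\<in>A. P i) f t = (\<Sum>i\<in>A. pdop (P i) f t)"
  by (induction A rule: infinite_finite_induct) (auto simp: pdop_add)

lemma deriv_adm_add:
  assumes "adm \<delta> f" "adm \<delta> g"
  shows "deriv (\<lambda>t. f t + g t) = (\<lambda>t. deriv f t + deriv g t)"
  by (rule ext, intro DERIV_imp_deriv DERIV_add adm_has_deriv[OF assms(1)] adm_has_deriv[OF assms(2)])

lemma deriv_adm_cmult:
  assumes "adm \<delta> f"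
  shows "deriv (\<lambda>t. k * f t) = (\<lambda>t. k * deriv f t)"
  by (rule ext, intro DERIV_imp_deriv DERIV_cmult adm_has_deriv[OF assms(1)])

lemma deriv_adm_times_id:
  assumes "adm \<delta> f"
  shows "deriv (\<lambda>t. t * f t) = (\<lambda>t. f t + t * deriv f t)"
  using DERIV_imp_deriv[OF DERIV_mult[OF DERIV_ident adm_has_deriv[OF assms]]]
  by (simp add: fun_eq_iff mult.commute)

lemma adm_pdop: "adm \<delta> f \<Longrightarrow> adm \<delta> (pdop Q f)"
proof (induction Q arbitrary: f)
  case 0
  have "pdop 0 f = (\<lambda>t. 0)" by (simp add: fun_eq_iff)
  thus ?case by (simp add: adm_0)
next
  case (pCons c Q)
  from adm_diff[OF adm_cmult[OF pCons.prems] pCons.IH[OF adm_deriv[OF pCons.prems]], of c]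
  show ?case by (simp add: pdop_pCons[abs_def])
qed

lemma pdop_fun_add:
  assumes "adm \<delta> f" "adm \<delta> g"
  shows "pdop Q (\<lambda>t. f t + g t) t = pdop Q f t + pdop Q g t"
  using assms
proof (induction Q arbitrary: f g)
  case (pCons c Q)
  show ?case
    by (simp add: pdop_pCons deriv_adm_add[OF pCons.prems]
        pCons.IH[OF adm_deriv[OF pCons.prems(1)] adm_deriv[OF pCons.prems(2)]] distrib_left)
qed simp

lemma pdop_fun_cmult:
  assumes "adm \<delta> f"
  shows "pdop Q (\<lambda>t. k * f t) t = k * pdop Q f t"
  using assms
proof (induction Q arbitrary: f)
  case (pCons c Q)
  show ?case
    by (simp add: pdop_pCons deriv_adm_cmult[OF pCons.prems]
        pCons.IH[OF adm_deriv[OF pCons.prems(1)]] algebra_simps)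
qed simp

lemma pdop_fun_zero: "pdop Q (\<lambda>t. 0) t = 0"
  using pdop_fun_cmult[OF adm_0, of Q 0] by simp

lemma pdop_fun_sum:
  assumes "\<And>i. i \<in> A \<Longrightarrow> adm \<delta> (f i)"
  shows "pdop Q (\<lambda>t. \<Sum>i\<in>A. f i t) t = (\<Sum>i\<in>A. pdop Q (f i) t)"
  using assms
proof (induction A rule: infinite_finite_induct)
  case (insert x A)
  hence "adm \<delta> (f x)" "adm \<delta> (\<lambda>t. \<Sum>i\<in>A. f i t)" by (auto intro: adm_sum)
  from pdop_fun_add[OF this] show ?case using insert by simp
qed (simp_all add: pdop_fun_zero)

lemma deriv_pdop: "adm \<delta> f \<Longrightarrow> deriv (pdop Q f) = pdop Q (deriv f)"
proof (induction Q arbitrary: f)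
  case 0
  have "pdop 0 f = (\<lambda>t. 0)" for f by (simp add: fun_eq_iff)
  thus ?case by (simp add: fun_eq_iff)
next
  case (pCons c Q)
  note f = pCons.prems
  have *: "deriv (pdop (pCons c Q) f) t = c * deriv f t - deriv (pdop Q (deriv f)) t" for t
    unfolding pdop_pCons[abs_def]
    by (intro DERIV_imp_deriv DERIV_diff DERIV_cmult adm_has_deriv[OF f]
        adm_has_deriv[OF adm_pdop[OF adm_deriv[OF f]]])
  show ?case
    by (rule ext, rule trans[OF *]) (simp only: pCons.IH[OF adm_deriv[OF f]] pdop_pCons)
qed

lemma pdop_mult:
  assumes "adm \<delta> f"
  shows "pdop (P * Q) f t = pdop P (pdop Q f) t"
  using assms
proof (induction P arbitrary: f t)
  case (pCons c P)
  show ?case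
    by (simp add: pdop_add pdop_smult pdop_pCons pCons.IH[OF adm_deriv[OF pCons.prems]]
        deriv_pdop[OF pCons.prems])
qed simp

text \<open>The commutator of t with -d/dt is the identity, so commuting t with a polynomial in
  -d/dt differentiates the polynomial.\<close>

lemma times_id_pdop:
  assumes "adm \<delta> f"
  shows "t * pdop Q f t = pdop Q (\<lambda>t. t * f t) t + pdop (pderiv Q) f t"
  using assms
proof (induction Q arbitrary: f)
  case (pCons c Q)
  note f = pCons.prems
  have "t * pdop (pCons c Q) f t = c * (t * f t) - t * pdop Q (deriv f) t"
    by (simp add: pdop_pCons algebra_simps)
  also have "t * pdop Q (deriv f) t = pdop Q (\<lambda>t. t * deriv f t) t + pdop (pderiv Q) (deriv f) t"
    by (rule pCons.IH[OF adm_deriv[OF f]])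
  also have "c * (t * f t) - \<dots> = pdop (pCons c Q) (\<lambda>t. t * f t) t + pdop (pderiv (pCons c Q)) f t"
    by (simp add: pdop_pCons pderiv_pCons pdop_add deriv_adm_times_id[OF f]
        pdop_fun_add[OF f adm_times_id[OF adm_deriv[OF f]]])
  finally show ?case .
qed simp

subsection \<open>Exponential moments\<close>

text \<open>Integration by parts: the factor z - \<xi> of the symbol acts on t^k exp (\<xi> t) by
  differentiating only the power of t. For k = 0 the truncated exponent is harmless because of the
  factor \<open>real k\<close>.\<close>

lemma exp_moment_linear_factor:
  assumes g: "adm \<delta> g" and \<xi>: "\<xi> > - \<delta>"
  shows "(LBINT t. t ^ k * exp (\<xi> * t) * pdop [:- \<xi>, 1:] g t) =
    real k * (LBINT t. t ^ (k - 1) * exp (\<xi> * t) * g t)"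
proof -
  let ?H' = "\<lambda>t. real k * (t ^ (k - 1) * exp (\<xi> * t) * g t) - t ^ k * exp (\<xi> * t) * pdop [:- \<xi>, 1:] g t"
  have p: "pdop [:- \<xi>, 1:] g t = - \<xi> * g t - deriv g t" for t
    by (simp add: pdop_pCons)
  have I: "integrable lborel (\<lambda>t. t ^ (k - 1) * exp (\<xi> * t) * g t)"
     "integrable lborel (\<lambda>t. t ^ k * exp (\<xi> * t) * pdop [:- \<xi>, 1:] g t)"
    by (intro adm_integrable[OF _ \<xi>] adm_pdop g)+
  have "(LBINT t. ?H' t) = 0"
  proof (rule integral_derivative_eq_0)
    show "((\<lambda>t. t ^ k * exp (\<xi> * t) * g t) has_real_derivative ?H' t) (at t)" for t
      using adm_has_deriv[OF g, of t]
      by (auto intro!: derivative_eq_intros simp: p algebra_simps)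
    show "continuous_on UNIV ?H'"
      using adm_continuous[OF g] adm_continuous[OF adm_pdop[OF g], of "[:- \<xi>, 1:]"]
      by (intro continuous_intros)
    show "integrable lborel ?H'" using I by simp
    show "((\<lambda>t. t ^ k * exp (\<xi> * t) * g t) \<longlongrightarrow> 0) at_top" "((\<lambda>t. t ^ k * exp (\<xi> * t) * g t) \<longlongrightarrow> 0) at_bot"
      using decays_tendsto[OF adm_decays[OF adm_times_power[OF g]] \<xi>, of k] by (simp_all add: mult_ac)
  qed
  thus ?thesis using I by simp
qed

lemma exp_moment_power_factor:
  assumes g: "adm \<delta> g" and \<xi>: "\<xi> > - \<delta>"
  shows "k < m \<Longrightarrow> (LBINT t. t ^ k * exp (\<xi> * t) * pdop ([:- \<xi>, 1:] ^ m) g t) = 0"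
    and "(LBINT t. t ^ m * exp (\<xi> * t) * pdop ([:- \<xi>, 1:] ^ m) g t) = fact m * (LBINT t. exp (\<xi> * t) * g t)"
proof -
  have s: "(LBINT t. t ^ k * exp (\<xi> * t) * pdop ([:- \<xi>, 1:] ^ Suc m) g t) =
      real k * (LBINT t. t ^ (k - 1) * exp (\<xi> * t) * pdop ([:- \<xi>, 1:] ^ m) g t)" for k m
    unfolding power_Suc by (subst pdop_mult[OF g]) (rule exp_moment_linear_factor[OF adm_pdop[OF g] \<xi>])
  show "k < m \<Longrightarrow> (LBINT t. t ^ k * exp (\<xi> * t) * pdop ([:- \<xi>, 1:] ^ m) g t) = 0"
  proof (induction m arbitrary: k)
    case (Suc m)
    show ?case unfolding s using Suc by (cases k) auto
  qed simp
  show "(LBINT t. t ^ m * exp (\<xi> * t) * pdop ([:- \<xi>, 1:] ^ m) g t) = fact m * (LBINT t. exp (\<xi> * t) * g t)"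
    by (induction m) (simp_all add: s del: power_Suc)
qed

lemma exp_moment_pdop:
  assumes g: "adm \<delta> g" and \<xi>: "\<xi> > - \<delta>"
  shows "(LBINT t. exp (\<xi> * t) * pdop Q g t) = poly Q \<xi> * (LBINT t. exp (\<xi> * t) * g t)"
proof -
  have "[:- \<xi>, 1:] dvd Q - [:poly Q \<xi>:]" by (simp flip: poly_eq_0_iff_dvd)
  then obtain R where "Q - [:poly Q \<xi>:] = [:- \<xi>, 1:] * R" by blast
  hence Q: "Q = [:- \<xi>, 1:] * R + [:poly Q \<xi>:]" by (simp add: algebra_simps)
  have "exp (\<xi> * t) * pdop Q g t = t ^ 0 * exp (\<xi> * t) * pdop [:- \<xi>, 1:] (pdop R g) t
     + poly Q \<xi> * (t ^ 0 * exp (\<xi> * t) * g t)" for t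
    by (subst Q) (simp only: pdop_add pdop_mult[OF g], simp add: pdop_pCons algebra_simps)
  hence "(LBINT t. exp (\<xi> * t) * pdop Q g t) =
     (LBINT t. t ^ 0 * exp (\<xi> * t) * pdop [:- \<xi>, 1:] (pdop R g) t + poly Q \<xi> * (t ^ 0 * exp (\<xi> * t) * g t))"
    by simp
  also have "\<dots> = (LBINT t. t ^ 0 * exp (\<xi> * t) * pdop [:- \<xi>, 1:] (pdop R g) t) +
      (LBINT t. poly Q \<xi> * (t ^ 0 * exp (\<xi> * t) * g t))"
    by (intro Bochner_Integration.integral_add Bochner_Integration.integrable_mult_right
        adm_integrable[OF _ \<xi>] adm_pdop g)
  finally show ?thesis by (simp only: exp_moment_linear_factor[OF adm_pdop[OF g] \<xi>]) simp
qed

text \<open>If Q = (z - \<xi>)^m R, the moments below m vanish by repeated lowering, and the next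
  one is m! R(\<xi>) times the moment of g, which is positive; so one more vanishing moment gives
  one more factor. This turns the orthogonality conditions into divisibility.\<close>

lemma exp_moments_eq_0_iff:
  assumes g: "adm \<delta> g" and \<xi>: "\<xi> > - \<delta>" and pos: "\<And>t. g t > 0"
  shows "(\<forall>k<m. (LBINT t. t ^ k * exp (\<xi> * t) * pdop Q g t) = 0) \<longleftrightarrow> [:- \<xi>, 1:] ^ m dvd Q"
proof
  assume "[:- \<xi>, 1:] ^ m dvd Q"
  then obtain R where R: "Q = [:- \<xi>, 1:] ^ m * R" by blast
  show "\<forall>k<m. (LBINT t. t ^ k * exp (\<xi> * t) * pdop Q g t) = 0"
    unfolding R pdop_mult[OF g] using exp_moment_power_factor(1)[OF adm_pdop[OF g] \<xi>] by blast
next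
  have "(LBINT t. t ^ 0 * exp (\<xi> * t) * g t) > 0"
    using pos by (intro integral_pos adm_integrable[OF g \<xi>]) (auto simp: less_imp_le)
  hence p: "(LBINT t. exp (\<xi> * t) * g t) \<noteq> 0" by simp
  assume "\<forall>k<m. (LBINT t. t ^ k * exp (\<xi> * t) * pdop Q g t) = 0"
  thus "[:- \<xi>, 1:] ^ m dvd Q"
  proof (induction m)
    case (Suc m)
    then obtain R where R: "Q = [:- \<xi>, 1:] ^ m * R" by (auto elim!: dvdE)
    have "(LBINT t. t ^ m * exp (\<xi> * t) * pdop Q g t) = 0" using Suc.prems by simp
    hence "fact m * (LBINT t. exp (\<xi> * t) * pdop R g t) = 0"
      unfolding R pdop_mult[OF g] by (simp add: exp_moment_power_factor(2)[OF adm_pdop[OF g] \<xi>])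
    hence "poly R \<xi> = 0" using p by (simp add: exp_moment_pdop[OF g \<xi>])
    hence "[:- \<xi>, 1:] dvd R" by (simp add: poly_eq_0_iff_dvd)
    thus ?case unfolding R by (subst power_Suc2) (rule mult_dvd_mono[OF dvd_refl])
  qed simp
qed

text \<open>The moment of Q(-d/dt) g at \<xi> is Q(\<xi>) times a positive number, so if the
  function vanishes, Q vanishes on a half-line. This justifies speaking of the symbol of a
  function.\<close>

lemma pdop_eq_0:
  assumes g: "adm \<delta> g" and d: "\<delta> > 0" and pos: "\<And>t. g t > 0" and z: "\<And>t. pdop Q g t = 0"
  shows "Q = 0"
proof -
  have "poly Q \<xi> = 0" if \<xi>: "\<xi> \<ge> 0" for \<xi>
  proof -
    have \<xi>': "\<xi> > - \<delta>" using \<xi> d by simp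
    have "(LBINT t. t ^ 0 * exp (\<xi> * t) * g t) > 0"
      using pos by (intro integral_pos adm_integrable[OF g \<xi>']) (auto simp: less_imp_le)
    thus ?thesis using exp_moment_pdop[OF g \<xi>', of Q] z by simp
  qed
  hence "{0..} \<subseteq> {x. poly Q x = 0}" by auto
  moreover have "infinite {0::real..}" by (rule infinite_Ici)
  ultimately show ?thesis using poly_roots_finite finite_subset by blast
qed

lemma gamma_avg_sum:
  assumes "\<And>i. i \<in> A \<Longrightarrow> adm \<delta> (f i)" "\<delta> > 0" "\<rho> > 0" "d \<ge> 0"
  shows "gamma_avg \<rho> d (\<lambda>t. \<Sum>i\<in>A. f i t) t = (\<Sum>i\<in>A. gamma_avg \<rho> d (f i) t)"
  using assms(1)
proof (induction A rule: infinite_finite_induct)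
  case (insert x A)
  hence "adm \<delta> (f x)" "adm \<delta> (\<lambda>t. \<Sum>i\<in>A. f i t)" by (auto intro: adm_sum)
  from gamma_avg_add[OF this assms(2-4), of t] show ?case using insert by simp
qed (use gamma_avg_cmult[of \<rho> d 0 "\<lambda>t. 0" t] in simp_all)

lemma pdop_gamma_avg_power:
  assumes f: "adm \<delta> f" and d: "\<delta> > 0" "\<delta> \<le> \<rho>"
  shows "pdop ([:\<rho>, 1:] ^ n) (\<lambda>t. gamma_avg \<rho> (real n) f t / \<rho> ^ n) = f"
proof (induction n)
  case 0
  show ?case by (simp add: fun_eq_iff)
next
  case (Suc n)
  have r: "\<rho> > 0" using d by simp
  let ?g = "\<lambda>t. inverse (\<rho> ^ Suc n) * gamma_avg \<rho> (real n + 1) f t"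
  have g0: "adm \<delta> (gamma_avg \<rho> (real n + 1) f)" using d by (intro adm_gamma_avg f) auto
  hence g: "adm \<delta> ?g" by (rule adm_cmult)
  have "pdop [:\<rho>, 1:] ?g t = gamma_avg \<rho> (real n) f t / \<rho> ^ n" for t
  proof -
    have "pdop [:\<rho>, 1:] ?g t = inverse (\<rho> ^ Suc n) *
        (\<rho> * gamma_avg \<rho> (real n + 1) f t - gamma_avg \<rho> (real n + 1) (deriv f) t)"
      using deriv_gamma_avg[OF f d(1) r, of "real n + 1"]
      by (simp only: pdop_fun_cmult[OF g0]) (simp add: pdop_pCons)
    also have "\<dots> = gamma_avg \<rho> (real n) f t / \<rho> ^ n"
      using r by (subst gamma_avg_Suc[OF f d(1) r]) (auto simp: field_simps)
    finally show ?thesis .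
  qed
  hence *: "pdop [:\<rho>, 1:] ?g = (\<lambda>t. gamma_avg \<rho> (real n) f t / \<rho> ^ n)" by (rule ext)
  have "pdop ([:\<rho>, 1:] ^ Suc n) ?g = f"
    unfolding power_Suc2[of "[:\<rho>, 1:]"] by (rule ext) (simp only: pdop_mult[OF g] * Suc)
  moreover have "?g = (\<lambda>t. gamma_avg \<rho> (real (Suc n)) f t / \<rho> ^ Suc n)"
    by (simp add: field_simps add_ac)
  ultimately show ?case by simp
qed

section \<open>The base function \<open>E\<close> and symbols relative to it\<close>

locale mixed_hermite_decay = mixed_hermite r p \<rho> d a \<xi> lam m
  for r p :: nat and \<rho> d :: "nat \<Rightarrow> real" and a :: real and \<xi> :: "nat \<Rightarrow> real" and lam m :: "nat \<Rightarrow> nat" +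
  fixes \<delta> :: real
  assumes \<delta>_pos: "\<delta> > 0"
    and \<delta>_le: "h \<in> {1..r} \<Longrightarrow> \<delta> \<le> \<rho> h"
    and d_nonneg: "h \<in> {1..r} \<Longrightarrow> d h \<ge> 0"
    and \<xi>_gt: "i \<in> {1..p} \<Longrightarrow> \<xi> i > - \<delta>"
begin

lemma \<rho>_pos: "h \<in> {1..r} \<Longrightarrow> \<rho> h > 0"
  using \<delta>_le[of h] \<delta>_pos by simp

text \<open>The inverse of \<open>\<rho> h - d/dt\<close> on admissible functions, with symbol
  \<open>1 / (\<rho> h + z)\<close>.\<close>

definition resolvent :: "nat \<Rightarrow> (real \<Rightarrow> real) \<Rightarrow> real \<Rightarrow> real" where
  "resolvent h G t = inverse (\<rho> h) * gamma_avg (\<rho> h) 1 G t"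

lemma adm_resolvent: "h \<in> {1..r} \<Longrightarrow> adm \<delta> G \<Longrightarrow> adm \<delta> (resolvent h G)"
  unfolding resolvent_def[abs_def] using \<delta>_pos \<delta>_le by (intro adm_cmult adm_gamma_avg) auto

lemma pdop_resolvent:
  assumes h: "h \<in> {1..r}" and G: "adm \<delta> G"
  shows "pdop [:\<rho> h, 1:] (resolvent h G) = G"
  using pdop_gamma_avg_power[OF G \<delta>_pos \<delta>_le[OF h], of 1]
  by (simp add: resolvent_def[abs_def] field_simps)

text \<open>Multiplication by t is differentiation of the transform. The identity therefore says
  that the logarithmic derivative of the transform of \<open>G\<close> is \<open>a + z / 2\<close>
  minus the sum of the \<open>e h / (\<rho> h + z)\<close>, without mentioning a transform.\<close>

definition logderiv_identity :: "(nat \<Rightarrow> real) \<Rightarrow> (real \<Rightarrow> real) \<Rightarrow> bool" where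
  "logderiv_identity e G \<longleftrightarrow>
     (\<forall>t. t * G t = a * G t - deriv G t / 2 - (\<Sum>h=1..r. e h * resolvent h G t))"

text \<open>On transforms the average is multiplication by the power c of
  \<open>\<rho> h / (\<rho> h + z)\<close>, so only the coefficient of row h changes, by c. In the
  proof this is the extra term of \<open>gamma_avg_times_id\<close>.\<close>

lemma logderiv_identity_gamma_avg:
  assumes G: "adm \<delta> G" and e: "logderiv_identity e G" and h: "h \<in> {1..r}" and c: "c \<ge> 0"
  shows "logderiv_identity (e(h := e h + c)) (gamma_avg (\<rho> h) c G)"
  unfolding logderiv_identity_def
proof
  fix t
  let ?K = "gamma_avg (\<rho> h) c"
  note \<rho> = \<rho>_pos[OF h]
  note d = \<delta>_pos \<delta>_le[OF h] c
  note d' = \<delta>_pos \<rho> c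
  have com: "?K (resolvent j G) s = resolvent j (?K G) s" if "j \<in> {1..r}" for j s
    unfolding resolvent_def[abs_def] gamma_avg_cmult
    by (simp only: gamma_avg_1_commute[OF G \<delta>_pos \<delta>_le[OF h] \<delta>_le[OF that] c])
  have "(\<lambda>s. s * G s) = (\<lambda>s. a * G s + ((- 1 / 2) * deriv G s + (\<Sum>j=1..r. (- e j) * resolvent j G s)))"
    using e unfolding logderiv_identity_def by (simp add: fun_eq_iff sum_negf)
  hence "?K (\<lambda>s. s * G s) t = ?K (\<lambda>s. a * G s + ((- 1 / 2) * deriv G s + (\<Sum>j=1..r. (- e j) * resolvent j G s))) t"
    by simp
  also have "\<dots> = ?K (\<lambda>s. a * G s) t + (?K (\<lambda>s. (- 1 / 2) * deriv G s) t +
      (\<Sum>j=1..r. ?K (\<lambda>s. (- e j) * resolvent j G s) t))"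
  proof -
    have s: "adm \<delta> (\<lambda>s. (- e j) * resolvent j G s)" if "j \<in> {1..r}" for j
      by (intro adm_cmult adm_resolvent that G)
    have s': "adm \<delta> (\<lambda>s. \<Sum>j=1..r. (- e j) * resolvent j G s)" by (intro adm_sum s)
    have s'': "adm \<delta> (\<lambda>s. (- 1 / 2) * deriv G s)" by (intro adm_cmult adm_deriv G)
    show ?thesis
      by (simp only: gamma_avg_add[OF adm_cmult[OF G] adm_add[OF s'' s'] d']
          gamma_avg_add[OF s'' s' d'] gamma_avg_sum[OF s d'])
  qed
  also have "\<dots> = a * ?K G t - deriv (?K G) t / 2 - (\<Sum>j=1..r. e j * resolvent j (?K G) t)"
    unfolding gamma_avg_cmult by (simp add: com deriv_gamma_avg[OF G d'] sum_negf)
  finally have 1: "?K (\<lambda>s. s * G s) t = \<dots>" .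
  have r: "c / \<rho> h * gamma_avg (\<rho> h) (c + 1) G t = c * resolvent h (?K G) t"
    unfolding gamma_avg_add_1[OF G d] resolvent_def by (simp add: divide_inverse mult.commute)
  have 2: "t * ?K G t = ?K (\<lambda>s. s * G s) t - c * resolvent h (?K G) t"
    unfolding gamma_avg_times_id[OF G d'] r by simp
  have 3: "(\<Sum>j=1..r. (e(h := e h + c)) j * resolvent j (?K G) t) =
     (\<Sum>j=1..r. e j * resolvent j (?K G) t + (if j = h then c * resolvent h (?K G) t else 0))"
    by (intro sum.cong) (auto simp: distrib_right)
  show "t * ?K G t = a * ?K G t - deriv (?K G) t / 2 - (\<Sum>j=1..r. (e(h := e h + c)) j * resolvent j (?K G) t)"
    unfolding 2 1 3 using h by (simp add: sum.distrib sum.delta)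
qed

lemma logderiv_identity_cmult:
  assumes G: "adm \<delta> G" and e: "logderiv_identity e G"
  shows "logderiv_identity e (\<lambda>t. c * G t)"
proof -
  have "c * (t * G t) = c * (a * G t - deriv G t / 2 - (\<Sum>h=1..r. e h * resolvent h G t))" for t
    using e unfolding logderiv_identity_def by simp
  thus ?thesis unfolding logderiv_identity_def
    by (simp add: resolvent_def gamma_avg_cmult deriv_adm_cmult[OF G] algebra_simps sum_distrib_left)
qed

lemma logderiv_identity_gauss: "logderiv_identity (\<lambda>_. 0) (gauss a)"
  unfolding logderiv_identity_def DERIV_imp_deriv[OF gauss_deriv] by (simp add: field_simps)

lemma foldr_gamma_avg:
  assumes "set hs \<subseteq> {1..r}" "distinct hs"
  defines "G \<equiv> foldr (\<lambda>h. gamma_avg (\<rho> h) (d h)) hs (gauss a)"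
  shows "adm \<delta> G \<and> (\<forall>t. G t > 0) \<and> logderiv_identity (\<lambda>h. if h \<in> set hs then d h else 0) G"
  unfolding G_def using assms(1,2)
proof (induction hs)
  case Nil
  show ?case using adm_gauss gauss_pos logderiv_identity_gauss by simp
next
  case (Cons h hs)
  let ?G = "foldr (\<lambda>h. gamma_avg (\<rho> h) (d h)) hs (gauss a)"
  have G: "adm \<delta> ?G" "\<forall>t. ?G t > 0" "logderiv_identity (\<lambda>h. if h \<in> set hs then d h else 0) ?G"
    and h: "h \<in> {1..r}" "h \<notin> set hs"
    using Cons by auto
  have e: "(\<lambda>j. if j \<in> set hs then d j else 0)(h := (if h \<in> set hs then d h else 0) + d h) =
    (\<lambda>j. if j \<in> set (h # hs) then d j else 0)" using h by (auto simp: fun_eq_iff)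
  show ?case
    using adm_gamma_avg[OF G(1) \<delta>_pos \<delta>_le[OF h(1)] d_nonneg[OF h(1)]]
      gamma_avg_pos[OF G(1) \<delta>_pos \<rho>_pos[OF h(1)] d_nonneg[OF h(1)]] G(2)
      logderiv_identity_gamma_avg[OF G(1,3) h(1) d_nonneg[OF h(1)], unfolded e]
    by simp
qed

text \<open>The divisors \<open>\<rho> h ^ lam h\<close> cancel the powers of the rates produced by
  \<rho> - d/dt, so the product of the \<open>(\<rho> h + z) ^ lam h\<close> undoes the averages
  without leaving a constant.\<close>

lemma foldr_gamma_avg_scaled:
  assumes "set hs \<subseteq> {1..r}" "distinct hs"
    and f: "adm \<delta> f" "\<And>t. f t > 0" "logderiv_identity e f"
  defines "G \<equiv> foldr (\<lambda>h f t. gamma_avg (\<rho> h) (real (lam h)) f t / \<rho> h ^ lam h) hs f"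
  shows "adm \<delta> G \<and> (\<forall>t. G t > 0) \<and> logderiv_identity (\<lambda>h. if h \<in> set hs then e h + real (lam h) else e h) G
    \<and> pdop (prod_list (map (\<lambda>h. [:\<rho> h, 1:] ^ lam h) hs)) G = f"
  unfolding G_def using assms(1,2)
proof (induction hs)
  case Nil
  show ?case using f by (simp add: fun_eq_iff)
next
  case (Cons h hs)
  let ?G = "foldr (\<lambda>h f t. gamma_avg (\<rho> h) (real (lam h)) f t / \<rho> h ^ lam h) hs f"
  let ?H = "\<lambda>t. inverse (\<rho> h ^ lam h) * gamma_avg (\<rho> h) (real (lam h)) ?G t"
  let ?P = "prod_list (map (\<lambda>h. [:\<rho> h, 1:] ^ lam h) hs)"
  have G: "adm \<delta> ?G" "\<forall>t. ?G t > 0" "logderiv_identity (\<lambda>h. if h \<in> set hs then e h + real (lam h) else e h) ?G"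
      "pdop ?P ?G = f"
    and h: "h \<in> {1..r}" "h \<notin> set hs"
    using Cons by auto
  have e: "(\<lambda>j. if j \<in> set hs then e j + real (lam j) else e j)
      (h := (if h \<in> set hs then e h + real (lam h) else e h) + real (lam h)) =
    (\<lambda>j. if j \<in> set (h # hs) then e j + real (lam j) else e j)" using h by (auto simp: fun_eq_iff)
  have K: "adm \<delta> (gamma_avg (\<rho> h) (real (lam h)) ?G)"
    by (intro adm_gamma_avg G(1) \<delta>_pos \<delta>_le h) auto
  have H: "adm \<delta> ?H" by (rule adm_cmult[OF K])
  have "pdop (?P * [:\<rho> h, 1:] ^ lam h) ?H t = f t" for t
    using pdop_gamma_avg_power[OF G(1) \<delta>_pos \<delta>_le[OF h(1)], of "lam h"]
    by (simp only: pdop_mult[OF H]) (simp add: field_simps G(4))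
  hence "pdop (prod_list (map (\<lambda>h. [:\<rho> h, 1:] ^ lam h) (h # hs))) ?H = f"
    by (simp add: fun_eq_iff mult.commute)
  moreover have "?H t > 0" for t
    using gamma_avg_pos[OF G(1) \<delta>_pos \<rho>_pos[OF h(1)], of "real (lam h)"] G(2) \<rho>_pos[OF h(1)] by simp
  moreover have "logderiv_identity (\<lambda>j. if j \<in> set (h # hs) then e j + real (lam j) else e j) ?H"
    by (subst e[symmetric]) (rule logderiv_identity_cmult[OF K logderiv_identity_gamma_avg[OF G(1,3) h(1)]], simp)
  moreover have "foldr (\<lambda>h f t. gamma_avg (\<rho> h) (real (lam h)) f t / \<rho> h ^ lam h) (h # hs) f = ?H"
    by (simp add: field_simps)
  ultimately show ?case using H by simp
qed

definition E :: "real \<Rightarrow> real" where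
  "E = foldr (\<lambda>h f t. gamma_avg (\<rho> h) (real (lam h)) f t / \<rho> h ^ lam h) [1..<r + 1] F"

definition Dpoly :: "real poly" where "Dpoly = (\<Prod>h=1..r. [:\<rho> h, 1:] ^ lam h)"

definition Ppoly :: "real poly" where "Ppoly = (\<Prod>i=1..p. [:\<xi> i, - 1:] ^ m i)"

lemma set_rows: "set [1..<r + 1] = {1..r}" by auto

lemma adm_F: "adm \<delta> F" and F_pos: "F t > 0"
  and logderiv_identity_F: "logderiv_identity (\<lambda>h. if h \<in> {1..r} then d h else 0) F"
  using foldr_gamma_avg[of "[1..<r + 1]"] unfolding set_rows F_def by auto

lemma adm_E: "adm \<delta> E" and E_pos: "E t > 0"
  and logderiv_identity_E: "logderiv_identity (\<lambda>h. if h \<in> {1..r} then d h + real (lam h) else 0) E"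
  and F_eq: "F = pdop Dpoly E"
proof -
  have p: "prod_list (map (\<lambda>h. [:\<rho> h, 1:] ^ lam h) [1..<r + 1]) = Dpoly"
    unfolding Dpoly_def set_rows[symmetric] by (rule prod.distinct_set_conv_list[symmetric]) simp
  have e: "(\<lambda>h. if h \<in> {1..r} then (if h \<in> {1..r} then d h else 0) + real (lam h) else (if h \<in> {1..r} then d h else 0)) =
    (\<lambda>h. if h \<in> {1..r} then d h + real (lam h) else 0)" by auto
  from foldr_gamma_avg_scaled[of "[1..<r + 1]", OF _ _ adm_F F_pos logderiv_identity_F, folded E_def,
      unfolded p set_rows e]
  show "adm \<delta> E" "E t > 0" "logderiv_identity (\<lambda>h. if h \<in> {1..r} then d h + real (lam h) else 0) E"
    "F = pdop Dpoly E" by auto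
qed

lemma U_eq:
  assumes h: "h \<in> {1..r}" and Q: "[:\<rho> h, 1:] * Q = Dpoly"
  shows "gamma_avg (\<rho> h) 1 F t = \<rho> h * pdop Q E t"
proof -
  have "gamma_avg (\<rho> h) 1 F = (\<lambda>t. \<rho> h * pdop Q E t)"
  proof (rule adm_eqI)
    show "adm \<delta> (gamma_avg (\<rho> h) 1 F)" by (intro adm_gamma_avg adm_F \<delta>_pos \<delta>_le h) auto
    show "adm \<delta> (\<lambda>t. \<rho> h * pdop Q E t)" by (intro adm_cmult adm_pdop adm_E)
    show "\<delta> > 0" "\<rho> h > 0" using \<delta>_pos \<rho>_pos h by auto
    fix t
    have 1: "\<rho> h * gamma_avg (\<rho> h) 1 F t - deriv (gamma_avg (\<rho> h) 1 F) t = \<rho> h * F t"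
      by (simp add: gamma_avg_1[OF adm_F \<delta>_pos \<rho>_pos[OF h]])
    have "F t = pdop [:\<rho> h, 1:] (pdop Q E) t"
      unfolding F_eq Q[symmetric] by (rule pdop_mult[OF adm_E])
    also have "\<dots> = \<rho> h * pdop Q E t - deriv (pdop Q E) t" by (simp add: pdop_pCons)
    finally have FE: "F t = \<rho> h * pdop Q E t - deriv (pdop Q E) t" .
    show "\<rho> h * gamma_avg (\<rho> h) 1 F t - deriv (gamma_avg (\<rho> h) 1 F) t =
        \<rho> h * (\<rho> h * pdop Q E t) - deriv (\<lambda>t. \<rho> h * pdop Q E t) t"
      unfolding 1 deriv_adm_cmult[OF adm_pdop[OF adm_E]] FE by (simp add: right_diff_distrib)
  qed
  thus ?thesis by simp
qed

lemma funpow_shift_deriv: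
  assumes "adm \<delta> g"
  shows "((\<lambda>f t. c * f t + deriv f t) ^^ k) g = pdop ([:c, - 1:] ^ k) g"
proof (induction k)
  case 0
  show ?case by (simp add: fun_eq_iff)
next
  case (Suc k)
  have 1: "((\<lambda>f t. c * f t + deriv f t) ^^ Suc k) g =
    (\<lambda>t. c * pdop ([:c, - 1:] ^ k) g t + deriv (pdop ([:c, - 1:] ^ k) g) t)"
    by (simp only: funpow.simps o_apply Suc)
  have 2: "c * pdop ([:c, - 1:] ^ k) g t + deriv (pdop ([:c, - 1:] ^ k) g) t = pdop ([:c, - 1:] ^ Suc k) g t" for t
  proof -
    have "pdop (- 1) f t = - f t" for f :: "real \<Rightarrow> real" and t
    proof -
      have "(- 1 :: real poly) = smult (- 1) 1" by (simp add: one_pCons)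
      thus ?thesis by (simp only: pdop_smult pdop_1)
    qed
    thus ?thesis unfolding power_Suc pdop_mult[OF assms] pdop_pCons by simp
  qed
  show ?case unfolding 1 2 ..
qed

lemma rodrigues_eq: "rodrigues = pdop Ppoly E"
proof -
  have "foldr (\<lambda>i. (\<lambda>f t. \<xi> i * f t + deriv f t) ^^ m i) is E =
    pdop (prod_list (map (\<lambda>i. [:\<xi> i, - 1:] ^ m i) is)) E" for "is"
  proof (induction "is")
    case (Cons i "is")
    show ?case
      by (rule ext) (simp only: foldr.simps o_apply Cons.IH funpow_shift_deriv[OF adm_pdop[OF adm_E]]
          pdop_mult[OF adm_E] list.map prod_list.Cons)
  qed (simp add: fun_eq_iff)
  moreover have "prod_list (map (\<lambda>i. [:\<xi> i, - 1:] ^ m i) [1..<p + 1]) = Ppoly"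
  proof -
    have "set [1..<p + 1] = {1..p}" by auto
    thus ?thesis unfolding Ppoly_def
      using prod.distinct_set_conv_list[OF distinct_upt, of "\<lambda>i. [:\<xi> i, - 1:] ^ m i" 1 "p + 1"] by simp
  qed
  ultimately show ?thesis unfolding rodrigues_def E_def[symmetric] by simp
qed

text \<open>Multiplication by \<open>t\<close> acts on symbols relative to \<open>E\<close> as a first-order operator; this is the
  logarithmic derivative of the transform of \<open>E\<close>.\<close>

lemma times_id_pdop_E:
  assumes S: "\<And>h. h \<in> {1..r} \<Longrightarrow> Q = [:\<rho> h, 1:] * S h"
  shows "t * pdop Q E t =
    pdop (pderiv Q + [:a, 1 / 2:] * Q - (\<Sum>h=1..r. smult (real (lam h) + d h) (S h))) E t"
proof -
  let ?e = "\<lambda>h. real (lam h) + d h"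
  have sum: "adm \<delta> (\<lambda>s. \<Sum>h=1..r. (- ?e h) * resolvent h E s)"
    by (intro adm_sum adm_cmult adm_resolvent adm_E)
  have E': "(\<lambda>s. s * E s) = (\<lambda>s. pdop [:a, 1 / 2:] E s + (\<Sum>h=1..r. (- ?e h) * resolvent h E s))"
  proof
    fix s
    have "(\<Sum>h=1..r. (if h \<in> {1..r} then d h + real (lam h) else 0) * resolvent h E s) =
      (\<Sum>h=1..r. ?e h * resolvent h E s)" by (intro sum.cong) (auto simp: add.commute)
    moreover have "s * E s = a * E s - deriv E s / 2 -
      (\<Sum>h=1..r. (if h \<in> {1..r} then d h + real (lam h) else 0) * resolvent h E s)"
      using logderiv_identity_E unfolding logderiv_identity_def by blast
    moreover have "(\<Sum>h=1..r. (- ?e h) * resolvent h E s) = - (\<Sum>h=1..r. ?e h * resolvent h E s)"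
      by (subst sum_negf[symmetric]) (simp only: mult_minus_left)
    moreover have "pdop [:a, 1 / 2:] E s = a * E s - deriv E s / 2"
      by (simp add: pdop_pCons)
    ultimately show "s * E s = pdop [:a, 1 / 2:] E s + (\<Sum>h=1..r. (- ?e h) * resolvent h E s)"
      by linarith
  qed
  have "pdop Q (\<lambda>s. s * E s) t = pdop Q (pdop [:a, 1 / 2:] E) t +
      (\<Sum>h=1..r. pdop Q (\<lambda>s. (- ?e h) * resolvent h E s) t)"
    unfolding E' by (subst pdop_fun_add[OF adm_pdop[OF adm_E] sum])
      (simp only: pdop_fun_sum[OF adm_cmult[OF adm_resolvent[OF _ adm_E]]])
  \<comment> \<open>The linear factor of Q belonging to row h cancels the resolvent of row h; this
    is what keeps the symbol polynomial.\<close>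
  also have "(\<Sum>h=1..r. pdop Q (\<lambda>s. (- ?e h) * resolvent h E s) t) = (\<Sum>h=1..r. - (?e h) * pdop (S h) E t)"
  proof (intro sum.cong refl)
    fix h assume h: "h \<in> {1..r}"
    have "pdop Q (resolvent h E) t = pdop (S h) (pdop [:\<rho> h, 1:] (resolvent h E)) t"
      by (subst S[OF h], subst mult.commute) (rule pdop_mult[OF adm_resolvent[OF h adm_E]])
    also have "pdop [:\<rho> h, 1:] (resolvent h E) = E" by (rule pdop_resolvent[OF h adm_E])
    finally show "pdop Q (\<lambda>s. (- ?e h) * resolvent h E s) t = - (?e h) * pdop (S h) E t"
      by (simp only: pdop_fun_cmult[OF adm_resolvent[OF h adm_E]])
  qed
  also have "pdop Q (pdop [:a, 1 / 2:] E) t = pdop ([:a, 1 / 2:] * Q) E t"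
    by (subst mult.commute) (rule pdop_mult[OF adm_E, symmetric])
  finally have 1: "pdop Q (\<lambda>s. s * E s) t =
     pdop ([:a, 1 / 2:] * Q) E t + (\<Sum>h=1..r. - (?e h) * pdop (S h) E t)" .
  show ?thesis
    unfolding times_id_pdop[OF adm_E] 1
    by (simp only: pdop_diff pdop_add pdop_sum pdop_smult mult_minus_left sum_negf)
qed

end

section \<open>Formal power series\<close>

text \<open>\<open>bin_fps \<alpha> x\<close> is \<open>(1 - x X)\<^bsup>-\<alpha>\<^esup>\<close> and \<open>exp_sq_fps q\<close> is \<open>exp (q X\<^sup>2)\<close>.\<close>

definition bin_fps :: "real \<Rightarrow> real \<Rightarrow> real fps" where
  "bin_fps \<alpha> x = Abs_fps (\<lambda>k. pochhammer \<alpha> k / fact k * x ^ k)"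

definition exp_sq_fps :: "real \<Rightarrow> real fps" where
  "exp_sq_fps q = Abs_fps (\<lambda>n. if even n then q ^ (n div 2) / fact (n div 2) else 0)"

lemma bin_fps_nth [simp]: "fps_nth (bin_fps \<alpha> x) k = pochhammer \<alpha> k / fact k * x ^ k"
  by (simp add: bin_fps_def)

lemma bin_fps_eq_compose: "bin_fps \<alpha> x = fps_compose (fps_binomial (- \<alpha>)) (fps_const (- x) * fps_X)"
proof (rule fps_ext)
  fix k
  have "(- x) ^ k * (- 1) ^ k = x ^ k" by (simp only: power_mult_distrib[symmetric]) simp
  thus "fps_nth (bin_fps \<alpha> x) k = fps_nth (fps_compose (fps_binomial (- \<alpha>)) (fps_const (- x) * fps_X)) k"
    unfolding fps_compose_linear by (simp add: gbinomial_pochhammer)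
qed

lemma bin_fps_mult: "bin_fps \<alpha> x * bin_fps \<beta> x = bin_fps (\<alpha> + \<beta>) x"
proof -
  have "- (\<alpha> + \<beta>) = - \<alpha> + - \<beta>" by simp
  thus ?thesis
    unfolding bin_fps_eq_compose
    by (simp only: fps_binomial_add_mult) (rule fps_compose_mult_distrib[symmetric], simp)
qed

lemma bin_fps_0 [simp]: "bin_fps 0 x = 1"
  by (rule fps_ext) (simp add: pochhammer_0_left)

lemma bin_fps_1_nth: "fps_nth (bin_fps 1 x) k = x ^ k"
proof -
  have "pochhammer 1 k = (fact k :: real)" by (rule pochhammer_fact[symmetric])
  thus ?thesis by simp
qed

lemma bin_fps_inverse: "bin_fps \<alpha> x * bin_fps (- \<alpha>) x = 1"
  by (simp add: bin_fps_mult)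

lemma bin_fps_minus_1: "bin_fps (- 1) x = 1 - fps_const x * fps_X"
proof (rule fps_ext)
  fix n
  consider "n = 0" | "n = 1" | k where "n = Suc (Suc k)" by (metis One_nat_def not0_implies_Suc)
  thus "fps_nth (bin_fps (- 1) x) n = fps_nth (1 - fps_const x * fps_X) n"
  proof cases
    case 3
    thus ?thesis by (simp add: pochhammer_rec)
  qed simp_all
qed

lemma bin_fps_minus_of_nat: "bin_fps (- real n) x = (1 - fps_const x * fps_X) ^ n"
proof (induction n)
  case (Suc n)
  have "bin_fps (- real (Suc n)) x = bin_fps (- 1) x * bin_fps (- real n) x"
    by (simp add: bin_fps_mult)
  thus ?case by (simp add: Suc bin_fps_minus_1)
qed simp

lemma bin_fps_deriv: "fps_deriv (bin_fps \<alpha> x) = fps_const (\<alpha> * x) * bin_fps 1 x * bin_fps \<alpha> x"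
proof -
  have "fps_deriv (bin_fps \<alpha> x) = fps_const (\<alpha> * x) * bin_fps (1 + \<alpha>) x"
  proof (rule fps_ext)
    fix n
    have p: "pochhammer \<alpha> (Suc n) = \<alpha> * pochhammer (1 + \<alpha>) n"
      unfolding pochhammer_rec by (simp only: add.commute)
    have f: "fact (Suc n) = real (Suc n) * fact n" by (simp only: fact_Suc of_nat_mult of_nat_fact)
    have "real (Suc n) * (pochhammer \<alpha> (Suc n) / fact (Suc n) * x ^ Suc n) =
        \<alpha> * x * (pochhammer (1 + \<alpha>) n / fact n * x ^ n)"
      unfolding p f by (simp del: of_nat_Suc)
    thus "fps_nth (fps_deriv (bin_fps \<alpha> x)) n = fps_nth (fps_const (\<alpha> * x) * bin_fps (1 + \<alpha>) x) n"
      by (simp only: fps_deriv_nth bin_fps_nth fps_mult_left_const_nth Suc_eq_plus1)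
  qed
  thus ?thesis by (simp add: bin_fps_mult mult.assoc)
qed

lemma bin_fps_1_times: "bin_fps 1 x * (1 - fps_const x * fps_X) = 1"
  using bin_fps_inverse[of 1 x] by (simp add: bin_fps_minus_1)

lemma exp_sq_fps_nth [simp]:
  "fps_nth (exp_sq_fps q) n = (if even n then q ^ (n div 2) / fact (n div 2) else 0)"
  by (simp add: exp_sq_fps_def)

lemma exp_sq_fps_deriv: "fps_deriv (exp_sq_fps q) = fps_const (2 * q) * fps_X * exp_sq_fps q"
proof (rule fps_ext)
  fix n
  show "fps_nth (fps_deriv (exp_sq_fps q)) n = fps_nth (fps_const (2 * q) * fps_X * exp_sq_fps q) n"
  proof (cases "odd n")
    case True
    then obtain j where n: "n = 2 * j + 1" by (auto elim: oddE)
    have "fact (Suc j) = real (Suc j) * fact j" by (simp only: fact_Suc of_nat_mult of_nat_fact)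
    hence "real (Suc n) * (q ^ Suc j / fact (Suc j)) = 2 * q * (q ^ j / fact j)"
      unfolding n by (simp add: divide_simps del: fact_Suc)
    thus ?thesis by (simp add: n mult.assoc del: fact_Suc)
  next
    case False
    thus ?thesis by (cases n) (simp_all add: mult.assoc)
  qed
qed

lemma exp_sq_fps_inverse: "exp_sq_fps q * exp_sq_fps (- q) = 1"
proof -
  let ?p = "exp_sq_fps q * exp_sq_fps (- q)"
  have "fps_deriv ?p = 0"
  proof -
    have "fps_deriv ?p = (fps_const (2 * q) + fps_const (2 * (- q))) * fps_X * ?p"
      by (simp only: fps_deriv_mult exp_sq_fps_deriv) (simp only: ring_distribs mult_ac add_ac)
    thus ?thesis by simp
  qed
  hence "?p = fps_const (fps_nth ?p 0)" by (simp only: fps_deriv_eq_0_iff)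
  thus ?thesis by simp
qed

subsection \<open>Multi-index sums\<close>

text \<open>Generating function of one summation index of weight e: its value j is placed in degree
  e * j.\<close>

definition weighted_fps :: "nat \<Rightarrow> (nat \<Rightarrow> real) \<Rightarrow> real fps" where
  "weighted_fps e g = Abs_fps (\<lambda>n. if e dvd n then g (n div e) else 0)"

lemma weighted_fps_mult_nth:
  assumes "e \<ge> 1"
  shows "fps_nth (weighted_fps e g * A) n = (\<Sum>j | e * j \<le> n. g j * fps_nth A (n - e * j))"
proof -
  have "fps_nth (weighted_fps e g * A) n =
     (\<Sum>i\<in>{i\<in>{0..n}. e dvd i}. g (i div e) * fps_nth A (n - i))"
    by (subst sum.inter_filter) (auto simp: fps_mult_nth weighted_fps_def intro!: sum.cong)
  also have "\<dots> = (\<Sum>j | e * j \<le> n. g j * fps_nth A (n - e * j))"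
    by (rule sum.reindex_bij_witness[of _ "\<lambda>j. e * j" "\<lambda>i. i div e"]) (use assms in auto)
  finally show ?thesis .
qed

lemma dotn_Cons: "dotn (u # us) (k # ks) = u * k + dotn us ks"
  by (simp add: dotn_def sum.lessThan_Suc_shift del: sum.lessThan_Suc)

lemma finite_dotn_le:
  assumes "\<And>i. i < length es \<Longrightarrow> es ! i \<ge> 1"
  shows "finite {k. length k = length es \<and> dotn es k \<le> N}"
proof (rule finite_subset)
  show "{k. length k = length es \<and> dotn es k \<le> N} \<subseteq> {k. set k \<subseteq> {..N} \<and> length k = length es}"
  proof clarify
    fix k x assume k: "length k = length es" "dotn es k \<le> N" "x \<in> set k"
    then obtain i where i: "i < length k" "x = k ! i" by (auto simp: in_set_conv_nth)
    have "x \<le> es ! i * k ! i" using assms[of i] i k by (cases "es ! i") auto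
    also have "\<dots> \<le> dotn es k" unfolding dotn_def by (rule member_le_sum) (use i in auto)
    finally show "x \<le> N" using k by simp
  qed
qed (rule finite_lists_length_eq, simp)

text \<open>The indices fall into those with v = 0 and those with v = e. The second group alone
  produces \<open>dotn vs k = w\<close> and uses up the same part of the degree n, leaving n - w to
  the first. So the sum is one coefficient from each of two independent products; the factors 1 only
  keep both indexed by all of \<open>es\<close>.\<close>

lemma multi_index_sum:
  assumes "length vs = length es"
    and "\<And>i. i < length es \<Longrightarrow> es ! i \<ge> 1 \<and> (vs ! i = 0 \<or> vs ! i = es ! i)"
  shows "(\<Sum>k | length k = length es \<and> dotn es k = n \<and> dotn vs k = w. \<Prod>i<length es. g i (k ! i)) =
    (if w \<le> n then
       fps_nth (\<Prod>i<length es. if vs ! i = 0 then weighted_fps (es ! i) (g i) else 1) (n - w) *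
       fps_nth (\<Prod>i<length es. if vs ! i = 0 then 1 else weighted_fps (es ! i) (g i)) w
     else 0)"
  using assms
proof (induction es arbitrary: vs g n w)
  case Nil
  have "{k. length k = length ([] :: nat list) \<and> dotn [] k = n \<and> dotn vs k = w} =
    (if n = 0 \<and> w = 0 then {[]} else {})"
    by (auto simp: dotn_def)
  thus ?case by auto
next
  case (Cons e es)
  then obtain v vs' where vs: "vs = v # vs'" by (cases vs) auto
  have len: "length vs' = length es" using Cons.prems vs by simp
  have ev: "es ! i \<ge> 1 \<and> (vs' ! i = 0 \<or> vs' ! i = es ! i)" if "i < length es" for i
    using Cons.prems(2)[of "Suc i"] that vs by simp
  have e: "e \<ge> 1" "v = 0 \<or> v = e" using Cons.prems(2)[of 0] vs by auto
  note IH = Cons.IH[OF len ev, of "\<lambda>i. g (Suc i)"]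
  let ?L = "\<lambda>n w. {k. length k = length es \<and> dotn es k = n \<and> dotn vs' k = w}"
  let ?T = "\<lambda>n w. \<Sum>k\<in>?L n w. \<Prod>i<length es. g (Suc i) (k ! i)"
  let ?A = "\<Prod>i<length es. if vs' ! i = 0 then weighted_fps (es ! i) (g (Suc i)) else 1"
  let ?B = "\<Prod>i<length es. if vs' ! i = 0 then 1 else weighted_fps (es ! i) (g (Suc i))"
  let ?J = "{j. e * j \<le> n \<and> v * j \<le> w}"
  have finJ: "finite ?J"
  proof (rule finite_subset[of _ "{..n}"])
    show "?J \<subseteq> {..n}"
    proof
      fix x assume x: "x \<in> ?J"
      have "x \<le> e * x" using e(1) by (cases e) auto
      also have "e * x \<le> n" using x by simp
      finally show "x \<in> {..n}" by simp
    qed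
  qed simp
  have finL: "finite (?L n w)" for n w
    by (rule finite_subset[OF _ finite_dotn_le[of es n]]) (use ev in auto)
  have set: "{k. length k = length (e # es) \<and> dotn (e # es) k = n \<and> dotn (v # vs') k = w} =
      (\<lambda>(j, ks). j # ks) ` (SIGMA j:?J. ?L (n - e * j) (w - v * j))" (is "?X = ?Y")
  proof (intro equalityI subsetI)
    fix k assume k: "k \<in> ?X"
    then obtain j ks where "k = j # ks" by (cases k) auto
    thus "k \<in> ?Y" using k by (auto simp: dotn_Cons image_iff)
  qed (auto simp: dotn_Cons)
  have inj: "inj_on (\<lambda>(j, ks). j # ks) X" for X :: "(nat \<times> nat list) set"
    by (auto simp: inj_on_def)
  have "(\<Sum>k | length k = length (e # es) \<and> dotn (e # es) k = n \<and> dotn vs k = w. \<Prod>i<length (e # es). g i (k ! i)) =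
     (\<Sum>(j, ks)\<in>(SIGMA j:?J. ?L (n - e * j) (w - v * j)). g 0 j * (\<Prod>i<length es. g (Suc i) (ks ! i)))"
    unfolding vs set
    by (subst sum.reindex[OF inj])
      (auto simp: prod.lessThan_Suc_shift o_def case_prod_beta simp del: prod.lessThan_Suc intro!: sum.cong)
  also have "\<dots> = (\<Sum>j\<in>?J. g 0 j * ?T (n - e * j) (w - v * j))"
    by (subst sum.Sigma[symmetric]) (use finJ finL in \<open>auto simp: sum_distrib_left\<close>)
  also have "\<dots> = (\<Sum>j\<in>?J. g 0 j * (if w - v * j \<le> n - e * j then
       fps_nth ?A (n - e * j - (w - v * j)) * fps_nth ?B (w - v * j) else 0))"
    by (simp only: IH)
  also have "\<dots> = (if w \<le> n then
       fps_nth (\<Prod>i<length (e # es). if vs ! i = 0 then weighted_fps ((e # es) ! i) (g i) else 1) (n - w) *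
       fps_nth (\<Prod>i<length (e # es). if vs ! i = 0 then 1 else weighted_fps ((e # es) ! i) (g i)) w
     else 0)"
  proof (cases "v = 0")
    case True
    have "(\<Sum>j\<in>?J. g 0 j * (if w - v * j \<le> n - e * j then
       fps_nth ?A (n - e * j - (w - v * j)) * fps_nth ?B (w - v * j) else 0)) =
       (\<Sum>j\<in>{j\<in>?J. w \<le> n - e * j}. g 0 j * fps_nth ?A (n - e * j - w)) * fps_nth ?B w"
      by (subst sum.inter_filter[OF finJ]) (auto simp: True sum_distrib_right mult.assoc intro!: sum.cong)
    also have "\<dots> = (if w \<le> n then fps_nth (weighted_fps e (g 0) * ?A) (n - w) * fps_nth ?B w else 0)"
    proof (cases "w \<le> n")
      case w: True
      have "{j\<in>?J. w \<le> n - e * j} = {j. e * j \<le> n - w}"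
        using w True by (auto simp: le_diff_conv2 add.commute)
      thus ?thesis using w weighted_fps_mult_nth[OF e(1), of "g 0" ?A "n - w"]
        by (simp add: add.commute diff_commute)
    next
      case False
      hence "{j\<in>?J. w \<le> n - e * j} = {}" by auto
      thus ?thesis using False by (simp only: sum.empty if_False mult_zero_left)
    qed
    finally show ?thesis using True e
      by (simp add: vs prod.lessThan_Suc_shift del: prod.lessThan_Suc cong: if_cong)
  next
    case False
    hence v: "v = e" using e by auto
    have J: "?J = (if w \<le> n then {j. e * j \<le> w} else ?J)" using v by auto
    have "(\<Sum>j\<in>?J. g 0 j * (if w - v * j \<le> n - e * j then
       fps_nth ?A (n - e * j - (w - v * j)) * fps_nth ?B (w - v * j) else 0)) =
       (if w \<le> n then fps_nth ?A (n - w) * (\<Sum>j | e * j \<le> w. g 0 j * fps_nth ?B (w - e * j)) else 0)"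
    proof (cases "w \<le> n")
      case True
      show ?thesis using True unfolding v
        by (auto simp: sum_distrib_left intro!: sum.cong)
    next
      case False
      have "\<not> (w - e * j \<le> n - e * j)" if "e * j \<le> n" for j using False that by auto
      thus ?thesis using False v by (auto intro!: sum.neutral)
    qed
    also have "\<dots> = (if w \<le> n then fps_nth ?A (n - w) * fps_nth (weighted_fps e (g 0) * ?B) w else 0)"
      by (simp only: weighted_fps_mult_nth[OF e(1)])
    finally show ?thesis using v e
      by (simp add: vs prod.lessThan_Suc_shift del: prod.lessThan_Suc cong: if_cong)
  qed
  finally show ?case .
qed

text \<open>In the applications \<open>H\<close> holds the factors that see the multi-index only
  through its two dot products: Pochhammer quotients and a power of the linear polynomial for
  \<open>Z\<close>, a value of \<open>theta\<close> for \<open>Y\<close>.\<close>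

lemma multi_index_sum_le:
  assumes "length vs = length es"
    and "\<And>i. i < length es \<Longrightarrow> es ! i \<ge> 1 \<and> (vs ! i = 0 \<or> vs ! i = es ! i)"
  shows "(\<Sum>k | length k = length es \<and> dotn es k \<le> N. H (dotn es k) (dotn vs k) * (\<Prod>i<length es. g i (k ! i))) =
    (\<Sum>n\<le>N. \<Sum>w\<le>n. H n w *
       (fps_nth (\<Prod>i<length es. if vs ! i = 0 then weighted_fps (es ! i) (g i) else 1) (n - w) *
       fps_nth (\<Prod>i<length es. if vs ! i = 0 then 1 else weighted_fps (es ! i) (g i)) w))"
proof -
  let ?K = "{k. length k = length es \<and> dotn es k \<le> N}"
  let ?P = "SIGMA n:{..N}. {..n}"
  have vle: "dotn vs k \<le> dotn es k" if "length k = length es" for k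
    unfolding dotn_def by (rule sum_mono) (use assms(2) that in \<open>force\<close>)
  have "(\<Sum>k\<in>?K. H (dotn es k) (dotn vs k) * (\<Prod>i<length es. g i (k ! i))) =
    (\<Sum>nw\<in>?P. \<Sum>k\<in>{k\<in>?K. (dotn es k, dotn vs k) = nw}. H (dotn es k) (dotn vs k) * (\<Prod>i<length es. g i (k ! i)))"
    by (rule sum.group[symmetric]) (use finite_dotn_le[of es N] assms(2) vle in auto)
  also have "\<dots> = (\<Sum>(n, w)\<in>?P. H n w * (\<Sum>k | length k = length es \<and> dotn es k = n \<and> dotn vs k = w. \<Prod>i<length es. g i (k ! i)))"
  proof (intro sum.cong refl)
    fix nw assume nw: "nw \<in> ?P"
    obtain n w where nw': "nw = (n, w)" by (cases nw)
    have "{k\<in>?K. (dotn es k, dotn vs k) = nw} = {k. length k = length es \<and> dotn es k = n \<and> dotn vs k = w}"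
      using nw nw' by auto
    thus "(\<Sum>k\<in>{k\<in>?K. (dotn es k, dotn vs k) = nw}. H (dotn es k) (dotn vs k) * (\<Prod>i<length es. g i (k ! i))) =
      (case nw of (n, w) \<Rightarrow> H n w * (\<Sum>k | length k = length es \<and> dotn es k = n \<and> dotn vs k = w. \<Prod>i<length es. g i (k ! i)))"
      by (simp add: nw' sum_distrib_left)
  qed
  also have "\<dots> = (\<Sum>n\<le>N. \<Sum>w\<le>n. H n w * (\<Sum>k | length k = length es \<and> dotn es k = n \<and> dotn vs k = w. \<Prod>i<length es. g i (k ! i)))"
    by (subst sum.Sigma) auto
  finally show ?thesis by (simp add: multi_index_sum[OF assms])
qed

subsection \<open>A first-order equation with a regular singular point\<close>

text \<open>Formally x^(-b) times the integral of x^(b - 1) A(x) from 0: the solution operator of X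
  Y' + b Y = A.\<close>

definition euler_integral :: "real \<Rightarrow> real fps \<Rightarrow> real fps" where
  "euler_integral b A = Abs_fps (\<lambda>n. fps_nth A n / (real n + b))"

lemma euler_integral_add: "euler_integral b (A + B) = euler_integral b A + euler_integral b B"
  by (rule fps_ext) (simp add: euler_integral_def add_divide_distrib)

lemma euler_integral_cmult: "euler_integral b (fps_const c * A) = fps_const c * euler_integral b A"
  by (rule fps_ext) (simp add: euler_integral_def)

lemma euler_integral_X: "euler_integral b (fps_X * A) = fps_X * euler_integral (b + 1) A"
  by (rule fps_ext) (auto simp: euler_integral_def of_nat_diff)

lemma fps_X_deriv_nth: "fps_nth (fps_X * fps_deriv A) n = real n * fps_nth (A :: real fps) n"
  by (cases n) simp_all

lemma euler_integral_ode:
  assumes "b > 0"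
  shows "fps_X * fps_deriv (euler_integral b A) + fps_const b * euler_integral b A = A"
proof (rule fps_ext)
  fix n
  have "real n + b \<noteq> 0" using assms by (smt (verit) of_nat_0_le_iff)
  thus "fps_nth (fps_X * fps_deriv (euler_integral b A) + fps_const b * euler_integral b A) n = fps_nth A n"
    unfolding fps_add_nth fps_X_deriv_nth fps_mult_left_const_nth distrib_right[symmetric]
    by (simp add: euler_integral_def)
qed

text \<open>Variation of constants: with \<open>\<E>\<close> as integrating factor, the quotient I
  of Y by \<open>\<E>\<close> satisfies X I' + b I = \<open>\<E>' * V\<close>, which the Euler
  integral solves.\<close>

lemma first_order_solution:
  fixes V :: "real fps"
  assumes b: "b > 0" and inv: "\<E> * \<E>' = 1" and E: "fps_deriv \<E> = S * \<E>"
  defines "Y \<equiv> \<E> * euler_integral b (\<E>' * V)"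
  shows "fps_X * fps_deriv Y + fps_const b * Y = fps_X * S * Y + V"
proof -
  let ?I = "euler_integral b (\<E>' * V)"
  have "fps_X * fps_deriv Y + fps_const b * Y =
      \<E> * (fps_X * fps_deriv ?I + fps_const b * ?I) + fps_X * S * Y"
    unfolding Y_def fps_deriv_mult E by (simp add: algebra_simps)
  also have "\<E> * (fps_X * fps_deriv ?I + fps_const b * ?I) = V"
    unfolding euler_integral_ode[OF b] using inv by (simp add: mult.assoc[symmetric])
  finally show ?thesis by (simp add: add.commute)
qed

lemma first_order_nth:
  assumes "fps_X * fps_deriv Y + fps_const b * Y = fps_X * S * Y + V"
  shows "(real n + b) * fps_nth Y n =
    (if n = 0 then 0 else \<Sum>i<n. fps_nth S i * fps_nth Y (n - 1 - i)) + fps_nth V n"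
proof -
  have "fps_nth (fps_X * fps_deriv Y + fps_const b * Y) n = fps_nth (fps_X * (S * Y) + V) n"
    using assms by (simp add: mult.assoc)
  hence "(real n + b) * fps_nth Y n = fps_nth (fps_X * (S * Y)) n + fps_nth V n"
    unfolding fps_add_nth fps_X_deriv_nth fps_mult_left_const_nth distrib_right .
  also have "fps_nth (fps_X * (S * Y)) n =
    (if n = 0 then 0 else \<Sum>i<n. fps_nth S i * fps_nth Y (n - 1 - i))"
  proof (cases n)
    case (Suc m)
    hence "fps_nth (fps_X * (S * Y)) n = fps_nth (S * Y) m" by simp
    thus ?thesis by (simp add: Suc fps_mult_nth atLeast0AtMost lessThan_Suc_atMost)
  qed simp
  finally show ?thesis .
qed

subsection \<open>A three-term recurrence\<close>

text \<open>Closed form of a weighted count of the ways to descend X levels by steps of 1 and 2: a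
  step of 1 weighs C and raises B by 1, a step of 2 weighs 2 (B + 1) and raises B by 2. It is also
  the sum over the last two indices of \<open>Y\<close>.\<close>

definition theta :: "real \<Rightarrow> nat \<Rightarrow> real \<Rightarrow> real" where
  "theta C X B = (\<Sum>K\<le>X div 2. C ^ (X - 2 * K) / fact (X - 2 * K) *
     (\<Sum>k\<le>K. 2 ^ k * fact (X - k) * pochhammer B k / (fact k * fact (K - k))))"

lemma theta_0 [simp]: "theta C 0 B = 1"
  by (simp add: theta_def)

text \<open>Compares the coefficients of C ^ (X - 2 K), up to a factorial, in the recurrence of
  \<open>theta\<close>. It rests on the contiguous relation (B)_k = (B + 1)_k - k (B + 1)_(k - 1)
  and, once the index of the second part is shifted, on (X - k) - 2 (K - k) = (X - 2 K) + k.\<close>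

lemma theta_coeff_rec:
  fixes B :: real
  assumes "2 * K \<le> X" "X \<ge> 1"
  shows "(\<Sum>k\<le>K. 2 ^ k * fact (X - k) * pochhammer B k / (fact k * fact (K - k))) =
    real (X - 2 * K) * (\<Sum>k\<le>K. 2 ^ k * fact (X - 1 - k) * pochhammer (B + 1) k / (fact k * fact (K - k))) +
    (if K = 0 then 0 else 2 * (B + 1) *
      (\<Sum>k\<le>K - 1. 2 ^ k * fact (X - 2 - k) * pochhammer (B + 2) k / (fact k * fact (K - 1 - k))))"
proof -
  define q :: "nat \<Rightarrow> real" where "q k = 2 ^ k * fact (X - 1 - k) * pochhammer (B + 1) k / (fact k * fact (K - k))" for k
  have fX: "(fact (X - k) :: real) = real (X - k) * fact (X - 1 - k)" if "k \<le> K" for k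
  proof -
    have "X - k = Suc (X - 1 - k)" using that assms by linarith
    thus ?thesis by (metis fact_Suc of_nat_mult of_nat_fact)
  qed
  have pb: "pochhammer B k = pochhammer (B + 1) k - real k * pochhammer (B + 1) (k - 1)" for k
  proof (cases k)
    case (Suc j)
    have "pochhammer B (Suc j) = B * pochhammer (B + 1) j" by (rule pochhammer_rec)
    moreover have "pochhammer (B + 1) (Suc j) = pochhammer (B + 1) j * (B + 1 + real j)" by (rule pochhammer_Suc)
    ultimately show ?thesis by (simp add: Suc algebra_simps)
  qed simp
  have "(\<Sum>k\<le>K. 2 ^ k * fact (X - k) * pochhammer B k / (fact k * fact (K - k))) =
    (\<Sum>k\<le>K. real (X - k) * q k) -
    (\<Sum>k\<le>K. 2 ^ k * fact (X - k) * (real k * pochhammer (B + 1) (k - 1)) / (fact k * fact (K - k)))"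
    unfolding sum_subtractf[symmetric]
  proof (intro sum.cong refl)
    fix k assume "k \<in> {..K}"
    hence "k \<le> K" by simp
    thus "2 ^ k * fact (X - k) * pochhammer B k / (fact k * fact (K - k)) = real (X - k) * q k -
      2 ^ k * fact (X - k) * (real k * pochhammer (B + 1) (k - 1)) / (fact k * fact (K - k))"
      by (simp add: pb[of k] q_def fX algebra_simps diff_divide_distrib)
  qed
  also have "(\<Sum>k\<le>K. 2 ^ k * fact (X - k) * (real k * pochhammer (B + 1) (k - 1)) / (fact k * fact (K - k))) =
     (\<Sum>k\<le>K. 2 * real (K - k) * q k)"
  proof -
    have "(\<Sum>k\<le>K. 2 ^ k * fact (X - k) * (real k * pochhammer (B + 1) (k - 1)) / (fact k * fact (K - k))) =
      (\<Sum>k\<in>{1..K}. 2 ^ k * fact (X - k) * (real k * pochhammer (B + 1) (k - 1)) / (fact k * fact (K - k)))"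
      by (rule sum.mono_neutral_right) (auto simp: not_le)
    also have "\<dots> = (\<Sum>k\<in>{..<K}. 2 * real (K - k) * q k)"
    proof (rule sum.reindex_bij_witness[of _ Suc "\<lambda>k. k - 1"])
      fix k assume k: "k \<in> {1..K}"
      then obtain j where j: "k = Suc j" by (cases k) auto
      have "fact (K - j) = real (K - j) * fact (K - Suc j)"
        using k j by (metis Suc_diff_Suc Suc_le_lessD atLeastAtMost_iff fact_Suc of_nat_fact of_nat_mult)
      thus "2 * real (K - (k - 1)) * q (k - 1) =
        2 ^ k * fact (X - k) * (real k * pochhammer (B + 1) (k - 1)) / (fact k * fact (K - k))"
        using k j by (simp add: q_def divide_simps del: of_nat_diff)
    qed auto
    also have "\<dots> = (\<Sum>k\<le>K. 2 * real (K - k) * q k)"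
      by (rule sum.mono_neutral_left) (auto simp: not_less)
    finally show ?thesis .
  qed
  also have "(\<Sum>k\<le>K. real (X - k) * q k) - (\<Sum>k\<le>K. 2 * real (K - k) * q k) =
     (\<Sum>k\<le>K. real (X - 2 * K) * q k + real k * q k)"
    unfolding sum_subtractf[symmetric]
    by (intro sum.cong refl) (use assms in \<open>auto simp: algebra_simps of_nat_diff\<close>)
  also have "\<dots> = real (X - 2 * K) * (\<Sum>k\<le>K. q k) + (\<Sum>k\<le>K. real k * q k)"
    by (simp add: sum.distrib sum_distrib_left)
  also have "(\<Sum>k\<le>K. real k * q k) = (if K = 0 then 0 else 2 * (B + 1) *
      (\<Sum>k\<le>K - 1. 2 ^ k * fact (X - 2 - k) * pochhammer (B + 2) k / (fact k * fact (K - 1 - k))))"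
  proof (cases K)
    case (Suc J)
    have "(\<Sum>k\<le>K. real k * q k) = (\<Sum>k\<le>J. real (Suc k) * q (Suc k))"
      unfolding Suc by (subst sum.atMost_Suc_shift) simp
    also have "\<dots> = (\<Sum>k\<le>J. 2 * (B + 1) * (2 ^ k * fact (X - 2 - k) * pochhammer (B + 2) k / (fact k * fact (J - k))))"
    proof (intro sum.cong refl)
      fix k
      have "pochhammer (B + 1) (Suc k) = (B + 1) * pochhammer (B + 2) k"
        by (simp add: pochhammer_rec add.assoc)
      moreover have "X - 1 - Suc k = X - 2 - k" by simp
      ultimately show "real (Suc k) * q (Suc k) =
        2 * (B + 1) * (2 ^ k * fact (X - 2 - k) * pochhammer (B + 2) k / (fact k * fact (J - k)))"
        unfolding q_def Suc by (simp add: divide_simps del: of_nat_Suc)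
    qed
    finally show ?thesis by (simp add: Suc sum_distrib_left)
  qed simp
  finally show ?thesis by (simp only: q_def)
qed

lemma theta_rec:
  assumes X: "X \<ge> 1"
  shows "theta C X B = C * theta C (X - 1) (B + 1) +
    (if X \<ge> 2 then 2 * (B + 1) * theta C (X - 2) (B + 2) else 0)"
proof -
  define s where "s X B K = (\<Sum>k\<le>K. 2 ^ k * fact (X - k) * pochhammer B k / (fact k * fact (K - k)) :: real)" for X B K
  have th: "theta C X B = (\<Sum>K | 2 * K \<le> X. C ^ (X - 2 * K) / fact (X - 2 * K) * s X B K)" for X B
  proof -
    have "{..X div 2} = {K. 2 * K \<le> X}" by auto
    thus ?thesis by (simp add: theta_def s_def)
  qed
  have fin: "finite {K. 2 * K \<le> n}" for n :: nat by (rule finite_subset[of _ "{..n}"]) auto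
  have "theta C X B = (\<Sum>K | 2 * K \<le> X. C ^ (X - 2 * K) / fact (X - 2 * K) * (real (X - 2 * K) * s (X - 1) (B + 1) K) +
     C ^ (X - 2 * K) / fact (X - 2 * K) * (if K = 0 then 0 else 2 * (B + 1) * s (X - 2) (B + 2) (K - 1)))"
    unfolding th
    by (intro sum.cong refl) (use theta_coeff_rec[OF _ X, folded s_def] in \<open>auto simp: distrib_left\<close>)
  also have "\<dots> = (\<Sum>K | 2 * K \<le> X. C ^ (X - 2 * K) / fact (X - 2 * K) * (real (X - 2 * K) * s (X - 1) (B + 1) K)) +
     (\<Sum>K | 2 * K \<le> X. C ^ (X - 2 * K) / fact (X - 2 * K) * (if K = 0 then 0 else 2 * (B + 1) * s (X - 2) (B + 2) (K - 1)))"
    by (rule sum.distrib)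
  also have "(\<Sum>K | 2 * K \<le> X. C ^ (X - 2 * K) / fact (X - 2 * K) * (real (X - 2 * K) * s (X - 1) (B + 1) K)) =
     (\<Sum>K | 2 * K \<le> X - 1. C ^ (X - 2 * K) / fact (X - 2 * K) * (real (X - 2 * K) * s (X - 1) (B + 1) K))"
  proof (rule sum.mono_neutral_right[OF fin])
    show "\<forall>i\<in>{K. 2 * K \<le> X} - {K. 2 * K \<le> X - 1}.
      C ^ (X - 2 * i) / fact (X - 2 * i) * (real (X - 2 * i) * s (X - 1) (B + 1) i) = 0"
    proof
      fix i assume "i \<in> {K. 2 * K \<le> X} - {K. 2 * K \<le> X - 1}"
      hence "X - 2 * i = 0" by auto
      thus "C ^ (X - 2 * i) / fact (X - 2 * i) * (real (X - 2 * i) * s (X - 1) (B + 1) i) = 0"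
        by (simp only: of_nat_0 mult_zero_left mult_zero_right)
    qed
  qed auto
  also have "\<dots> = C * theta C (X - 1) (B + 1)"
    unfolding th sum_distrib_left
  proof (intro sum.cong refl)
    fix K assume "K \<in> {K. 2 * K \<le> X - 1}"
    then obtain g where g: "X - 2 * K = Suc g" "X - 1 - 2 * K = g"
      using X by (metis Suc_diff_le Suc_pred' diff_Suc_1 diff_commute mem_Collect_eq less_eq_Suc_le One_nat_def)
    show "C ^ (X - 2 * K) / fact (X - 2 * K) * (real (X - 2 * K) * s (X - 1) (B + 1) K) =
       C * (C ^ (X - 1 - 2 * K) / fact (X - 1 - 2 * K) * s (X - 1) (B + 1) K)"
      unfolding g by (simp add: divide_simps del: of_nat_Suc)
  qed
  also have "(\<Sum>K | 2 * K \<le> X. C ^ (X - 2 * K) / fact (X - 2 * K) * (if K = 0 then 0 else 2 * (B + 1) * s (X - 2) (B + 2) (K - 1))) =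
    (if X \<ge> 2 then 2 * (B + 1) * theta C (X - 2) (B + 2) else 0)"
  proof -
    have "(\<Sum>K | 2 * K \<le> X. C ^ (X - 2 * K) / fact (X - 2 * K) * (if K = 0 then 0 else 2 * (B + 1) * s (X - 2) (B + 2) (K - 1))) =
      (\<Sum>K\<in>{K. 2 * K \<le> X \<and> K \<noteq> 0}. C ^ (X - 2 * K) / fact (X - 2 * K) * (2 * (B + 1) * s (X - 2) (B + 2) (K - 1)))"
      by (rule sum.mono_neutral_cong_right[OF fin]) auto
    also have "\<dots> = (if X \<ge> 2 then 2 * (B + 1) * theta C (X - 2) (B + 2) else 0)"
    proof (cases "X \<ge> 2")
      case True
      have "(\<Sum>K\<in>{K. 2 * K \<le> X \<and> K \<noteq> 0}. C ^ (X - 2 * K) / fact (X - 2 * K) * (2 * (B + 1) * s (X - 2) (B + 2) (K - 1))) =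
        (\<Sum>K\<in>{K. 2 * K \<le> X - 2}. 2 * (B + 1) * (C ^ (X - 2 - 2 * K) / fact (X - 2 - 2 * K) * s (X - 2) (B + 2) K))"
      proof (rule sum.reindex_bij_witness[of _ Suc "\<lambda>K. K - 1"])
        fix K assume "K \<in> {K. 2 * K \<le> X \<and> K \<noteq> 0}"
        then obtain J where J: "K = Suc J" by (cases K) auto
        have "X - 2 - 2 * J = X - 2 * Suc J" by simp
        thus "2 * (B + 1) * (C ^ (X - 2 - 2 * (K - 1)) / fact (X - 2 - 2 * (K - 1)) * s (X - 2) (B + 2) (K - 1)) =
            C ^ (X - 2 * K) / fact (X - 2 * K) * (2 * (B + 1) * s (X - 2) (B + 2) (K - 1))"
          by (simp only: J diff_Suc_1) (simp only: mult_ac times_divide_eq_left times_divide_eq_right)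
      qed (use True in auto)
      thus ?thesis using True by (simp add: th sum_distrib_left)
    next
      case False
      hence "{K. 2 * K \<le> X \<and> K \<noteq> 0} = {}" by auto
      thus ?thesis using False by (simp only: sum.empty if_False)
    qed
    finally show ?thesis .
  qed
  finally show ?thesis .
qed

text \<open>Superposition of the sources \<open>\<beta> j\<close>, each carried from level j to
  level s by \<open>theta\<close>. Its parameter starts at d - s and grows by one per level
  descended, so it is always d minus the current level.\<close>

lemma three_term_recurrence:
  fixes \<beta> :: "nat \<Rightarrow> real" and C d :: real
  defines "y \<equiv> \<lambda>s. \<Sum>j\<le>s. \<beta> j * theta C (s - j) (d - real s)"
  shows "y s = \<beta> s + (if s \<ge> 1 then C * y (s - 1) else 0) +
     (if s \<ge> 2 then 2 * (d - real s + 1) * y (s - 2) else 0)"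
proof -
  have "y s = \<beta> s + (\<Sum>j<s. \<beta> j * theta C (s - j) (d - real s))"
    unfolding y_def by (simp add: lessThan_Suc_atMost[symmetric])
  also have "(\<Sum>j<s. \<beta> j * theta C (s - j) (d - real s)) =
    (\<Sum>j<s. C * (\<beta> j * theta C (s - 1 - j) (d - real s + 1)) +
      (if s - j \<ge> 2 then 2 * (d - real s + 1) * (\<beta> j * theta C (s - 2 - j) (d - real s + 2)) else 0))"
  proof (intro sum.cong refl)
    fix j assume "j \<in> {..<s}"
    hence "s - j \<ge> 1" by auto
    moreover have "s - j - 1 = s - 1 - j" "s - j - 2 = s - 2 - j" by auto
    ultimately show "\<beta> j * theta C (s - j) (d - real s) = C * (\<beta> j * theta C (s - 1 - j) (d - real s + 1)) +
      (if s - j \<ge> 2 then 2 * (d - real s + 1) * (\<beta> j * theta C (s - 2 - j) (d - real s + 2)) else 0)"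
      using theta_rec[of "s - j" C "d - real s"] by (simp add: algebra_simps)
  qed
  also have "\<dots> = C * (\<Sum>j<s. \<beta> j * theta C (s - 1 - j) (d - real s + 1)) +
     (\<Sum>j<s. if s - j \<ge> 2 then 2 * (d - real s + 1) * (\<beta> j * theta C (s - 2 - j) (d - real s + 2)) else 0)"
    by (simp add: sum.distrib sum_distrib_left)
  also have "(\<Sum>j<s. \<beta> j * theta C (s - 1 - j) (d - real s + 1)) = (if s \<ge> 1 then y (s - 1) else 0)"
  proof (cases s)
    case (Suc s')
    thus ?thesis by (simp add: y_def lessThan_Suc_atMost algebra_simps)
  qed simp
  also have "(\<Sum>j<s. if s - j \<ge> 2 then 2 * (d - real s + 1) * (\<beta> j * theta C (s - 2 - j) (d - real s + 2)) else 0) =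
    (if s \<ge> 2 then 2 * (d - real s + 1) * y (s - 2) else 0)"
  proof (cases "s \<ge> 2")
    case True
    have "(\<Sum>j<s. if s - j \<ge> 2 then 2 * (d - real s + 1) * (\<beta> j * theta C (s - 2 - j) (d - real s + 2)) else 0) =
       (\<Sum>j\<le>s - 2. 2 * (d - real s + 1) * (\<beta> j * theta C (s - 2 - j) (d - real s + 2)))"
      by (rule sum.mono_neutral_cong_right) (use True in auto)
    moreover have "d - real s + 2 = d - real (s - 2)" using True by (simp add: of_nat_diff)
    ultimately show ?thesis using True by (simp add: y_def sum_distrib_left)
  qed (auto intro!: sum.neutral)
  finally show ?thesis by simp
qed

subsection \<open>Solutions of the two recurrences\<close>

lemma fps_deriv_prod_log:
  fixes f :: "'a \<Rightarrow> real fps"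
  assumes "\<And>i. i \<in> A \<Longrightarrow> fps_deriv (f i) = s i * f i"
  shows "fps_deriv (\<Prod>i\<in>A. f i) = (\<Sum>i\<in>A. s i) * (\<Prod>i\<in>A. f i)"
  using assms
  by (induction A rule: infinite_finite_induct) (auto simp: algebra_simps)

text \<open>For the series Y of the values f (k + 2), the sums over i are products with geometric
  series, and the recurrence becomes X Y' + (\<open>d\<^sub>0\<close> + 1) Y = X S Y + V with S the
  logarithmic derivative of \<open>\<E>\<close>. The values f 0, f 1 and g h stay free: they are the
  functions in which a pole part is to be expressed.\<close>

lemma pole_recurrence_solution:
  fixes f dd xx g :: "nat \<Rightarrow> real" and c d\<^sub>0 :: real and H :: "nat set"
  assumes d0: "d\<^sub>0 \<ge> 0"
    and rec: "\<And>s. 1 \<le> s \<Longrightarrow> s < n \<Longrightarrow> (real s + d\<^sub>0) * f (s + 1) = c * f s + f (s - 1) / 2 +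
      (\<Sum>h\<in>H. dd h * ((\<Sum>i<s. xx h ^ (i + 1) * f (s - i)) - xx h ^ s * g h))"
  defines "\<E> \<equiv> fps_exp c * exp_sq_fps (1 / 4) * (\<Prod>h\<in>H. bin_fps (dd h) (xx h))"
    and "\<E>' \<equiv> fps_exp (- c) * exp_sq_fps (- 1 / 4) * (\<Prod>h\<in>H. bin_fps (- dd h) (xx h))"
  defines "sol \<equiv> \<lambda>V. \<E> * euler_integral (d\<^sub>0 + 1) (\<E>' * V)"
  assumes k: "k + 2 \<le> n"
  shows "f (k + 2) = fps_nth
    (fps_const (f 1) * (fps_const c * sol 1 + fps_const (1 / 2) * sol fps_X +
       (\<Sum>h\<in>H. fps_const (dd h * xx h) * sol (bin_fps 1 (xx h)))) +
     fps_const (f 0 / 2) * sol 1 - (\<Sum>h\<in>H. fps_const (dd h * xx h * g h) * sol (bin_fps 1 (xx h)))) k"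
proof -
  define S where "S = fps_const c + fps_const (1 / 2) * fps_X + (\<Sum>h\<in>H. fps_const (dd h * xx h) * bin_fps 1 (xx h))"
  \<comment> \<open>Collects the terms with initial values: wherever the product with S would reach
    f 1 it contributes to f 1 S, and f 0 occurs only in the instance s = 1.\<close>
  define V where "V = fps_const (f 1) * S + fps_const (f 0 / 2) - (\<Sum>h\<in>H. fps_const (dd h * xx h * g h) * bin_fps 1 (xx h))"
  have sol_add: "sol (A + B) = sol A + sol B" for A B
    unfolding sol_def by (simp only: distrib_left euler_integral_add)
  have sol_const: "sol (fps_const q * A) = fps_const q * sol A" for A q
    unfolding sol_def mult.left_commute[of "\<E>'" "fps_const q"] euler_integral_cmult
    by (rule mult.left_commute)
  have sol_diff: "sol (A - B) = sol A - sol B" for A B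
    using sol_add[of "A - B" B] by simp
  have sol_sum: "sol (\<Sum>h\<in>X. A h) = (\<Sum>h\<in>X. sol (A h))" for X :: "nat set" and A
    by (induction X rule: infinite_finite_induct)
      (use sol_const[of 0 0] in \<open>auto simp: sol_add\<close>)
  have sol_c: "sol (fps_const q) = fps_const q * sol 1" for q
    using sol_const[of q 1] by simp
  have solV: "sol V = fps_const (f 1) * (fps_const c * sol 1 + fps_const (1 / 2) * sol fps_X +
       (\<Sum>h\<in>H. fps_const (dd h * xx h) * sol (bin_fps 1 (xx h)))) +
     fps_const (f 0 / 2) * sol 1 - (\<Sum>h\<in>H. fps_const (dd h * xx h * g h) * sol (bin_fps 1 (xx h)))"
    unfolding V_def S_def by (simp only: sol_add sol_diff sol_sum sol_const sol_c[of c] sol_c[of "f 0 / 2"])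
  have inv: "\<E> * \<E>' = 1"
  proof -
    have "\<E> * \<E>' = (fps_exp c * fps_exp (- c)) * (exp_sq_fps (1 / 4) * exp_sq_fps (- (1 / 4))) *
        (\<Prod>h\<in>H. bin_fps (dd h) (xx h) * bin_fps (- dd h) (xx h))"
      by (simp add: \<E>_def \<E>'_def prod.distrib mult_ac)
    also have "\<dots> = 1"
      by (simp only: exp_sq_fps_inverse bin_fps_inverse fps_exp_add_mult[symmetric]) simp
    finally show ?thesis .
  qed
  have dE: "fps_deriv \<E> = S * \<E>"
  proof -
    have "fps_deriv (\<Prod>h\<in>H. bin_fps (dd h) (xx h)) =
      (\<Sum>h\<in>H. fps_const (dd h * xx h) * bin_fps 1 (xx h)) * (\<Prod>h\<in>H. bin_fps (dd h) (xx h))"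
      by (rule fps_deriv_prod_log) (rule bin_fps_deriv)
    thus ?thesis unfolding \<E>_def S_def fps_deriv_mult
      by (simp add: exp_sq_fps_deriv algebra_simps)
  qed
  have "fps_X * fps_deriv (sol V) + fps_const (d\<^sub>0 + 1) * sol V = fps_X * S * sol V + V"
    unfolding sol_def by (rule first_order_solution[OF _ inv dE]) (use d0 in simp)
  note Y = first_order_nth[OF this]
  have S_nth: "fps_nth S i = (if i = 0 then c else 0) + (if i = 1 then 1 / 2 else 0) + (\<Sum>h\<in>H. dd h * xx h ^ (i + 1))" for i
    by (simp add: S_def fps_sum_nth bin_fps_1_nth mult_ac del: bin_fps_nth)
  have V_nth: "fps_nth V i = f 1 * fps_nth S i + (if i = 0 then f 0 / 2 else 0) - (\<Sum>h\<in>H. dd h * xx h ^ (i + 1) * g h)" for i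
    by (simp add: V_def fps_sum_nth bin_fps_1_nth mult_ac del: bin_fps_nth)
  have "f (k + 2) = fps_nth (sol V) k" using k
  proof (induction k rule: less_induct)
    case (less k)
    have IH: "fps_nth (sol V) (k - 1 - i) = f (k + 1 - i)" if "i < k" for i
    proof -
      have "f ((k - 1 - i) + 2) = fps_nth (sol V) (k - 1 - i)" using that less by (intro less.IH) auto
      moreover have "(k - 1 - i) + 2 = k + 1 - i" using that by simp
      ultimately show ?thesis by simp
    qed
    have "(real k + (d\<^sub>0 + 1)) * fps_nth (sol V) k =
      (\<Sum>i<k. fps_nth S i * f (k + 1 - i)) + fps_nth V k"
    proof -
      have "(\<Sum>i<k. fps_nth S i * fps_nth (sol V) (k - 1 - i)) = (\<Sum>i<k. fps_nth S i * f (k + 1 - i))"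
        by (rule sum.cong[OF refl]) (simp only: IH lessThan_iff)
      thus ?thesis unfolding Y by auto
    qed
    also have "\<dots> = (\<Sum>i\<le>k. fps_nth S i * f (k + 1 - i)) + (if k = 0 then f 0 / 2 else 0) -
       (\<Sum>h\<in>H. dd h * xx h ^ (k + 1) * g h)"
      by (simp add: V_nth lessThan_Suc_atMost[symmetric])
    also have "(\<Sum>i\<le>k. fps_nth S i * f (k + 1 - i)) =
      (\<Sum>i\<le>k. if i = 0 then c * f (k + 1) else 0) + (\<Sum>i\<le>k. if i = 1 then f k / 2 else 0) +
      (\<Sum>i\<le>k. \<Sum>h\<in>H. dd h * (xx h ^ (i + 1) * f (k + 1 - i)))"
      unfolding sum.distrib[symmetric]
      by (intro sum.cong refl) (auto simp: S_nth algebra_simps sum_distrib_left)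
    also have "(\<Sum>i\<le>k. \<Sum>h\<in>H. dd h * (xx h ^ (i + 1) * f (k + 1 - i))) =
      (\<Sum>h\<in>H. dd h * (\<Sum>i<k + 1. xx h ^ (i + 1) * f (k + 1 - i)))"
      by (subst sum.swap) (simp add: sum_distrib_left lessThan_Suc_atMost)
    also have "(\<Sum>i\<le>k. if i = 0 then c * f (k + 1) else 0) = c * f (k + 1)" by simp
    also have "(\<Sum>i\<le>k. if i = 1 then f k / 2 else 0) = (if k = 0 then 0 else f k / 2)" by auto
    finally have "(real k + (d\<^sub>0 + 1)) * fps_nth (sol V) k = c * f (k + 1) + (if k = 0 then 0 else f k / 2) +
      (\<Sum>h\<in>H. dd h * (\<Sum>i<k + 1. xx h ^ (i + 1) * f (k + 1 - i))) +
      (if k = 0 then f 0 / 2 else 0) - (\<Sum>h\<in>H. dd h * xx h ^ (k + 1) * g h)" .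
    moreover have "(if k = 0 then 0 else f k / 2) + (if k = 0 then f 0 / 2 else 0) = f k / 2" by auto
    ultimately have "(real k + (d\<^sub>0 + 1)) * fps_nth (sol V) k = c * f (k + 1) + f k / 2 +
      (\<Sum>h\<in>H. dd h * (\<Sum>i<k + 1. xx h ^ (i + 1) * f (k + 1 - i))) - (\<Sum>h\<in>H. dd h * xx h ^ (k + 1) * g h)"
      by linarith
    also have "\<dots> = (real k + (d\<^sub>0 + 1)) * f (k + 2)"
      using rec[of "k + 1"] less.prems
      by (simp add: sum_subtractf[symmetric] right_diff_distrib add_ac mult_ac)
    finally show ?case using d0 by auto
  qed
  thus ?thesis by (simp only: solV)
qed

text \<open>The shape of the values of \<open>Y\<close>: a part of degree w taken from A moves the
  parameter of \<open>theta\<close> from b to b + w, a part taken from B does not.\<close>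

definition two_grade_sum :: "real fps \<Rightarrow> real fps \<Rightarrow> nat \<Rightarrow> real \<Rightarrow> real \<Rightarrow> real" where
  "two_grade_sum A B n b C =
     (\<Sum>s\<le>n. \<Sum>w\<le>s. fps_nth A w * fps_nth B (s - w) * theta C (n - s) (b + real w))"

lemma two_grade_sum_X: "two_grade_sum A (fps_X * B) n b C = (if n = 0 then 0 else two_grade_sum A B (n - 1) b C)"
proof (cases n)
  case (Suc k)
  have "two_grade_sum A (fps_X * B) n b C =
      (\<Sum>s\<le>k. \<Sum>w\<le>Suc s. fps_nth A w * fps_nth (fps_X * B) (Suc s - w) * theta C (k - s) (b + real w))"
    unfolding two_grade_sum_def Suc by (subst sum.atMost_Suc_shift) simp
  also have "\<dots> = (\<Sum>s\<le>k. \<Sum>w\<le>s. fps_nth A w * fps_nth B (s - w) * theta C (k - s) (b + real w))"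
  proof (rule sum.cong[OF refl])
    fix s
    have "(\<Sum>w\<le>s. fps_nth A w * fps_nth (fps_X * B) (Suc s - w) * theta C (k - s) (b + real w)) =
      (\<Sum>w\<le>s. fps_nth A w * fps_nth B (s - w) * theta C (k - s) (b + real w))"
      by (intro sum.cong refl) (simp add: Suc_diff_le)
    thus "(\<Sum>w\<le>Suc s. fps_nth A w * fps_nth (fps_X * B) (Suc s - w) * theta C (k - s) (b + real w)) =
      (\<Sum>w\<le>s. fps_nth A w * fps_nth B (s - w) * theta C (k - s) (b + real w))" by simp
  qed
  finally show ?thesis by (simp add: Suc two_grade_sum_def)
qed (simp add: two_grade_sum_def)

lemma two_grade_sum_add: "two_grade_sum A (B + B') n b C = two_grade_sum A B n b C + two_grade_sum A B' n b C"
  by (simp add: two_grade_sum_def sum.distrib[symmetric] algebra_simps)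

lemma two_grade_sum_cmult: "two_grade_sum A (fps_const c * B) n b C = c * two_grade_sum A B n b C"
  by (simp add: two_grade_sum_def sum_distrib_left mult_ac)

lemma two_grade_sum_sum: "two_grade_sum A (\<Sum>i\<in>I. B i) n b C = (\<Sum>i\<in>I. two_grade_sum A (B i) n b C)"
  by (induction I rule: infinite_finite_induct)
    (auto simp: two_grade_sum_add, auto simp: two_grade_sum_def)

text \<open>Multiplying the series of f by G, the product of the (1 + rr X)^dd, removes the
  convolutions with geometric series and leaves a three-term recurrence with coefficient 2 (ds - s +
  1), where ds is the sum of the dd. The required sum is then the coefficient n of A G' Y; a part of
  degree w from A G' leaves \<open>theta\<close> at the parameter ds - (n - w), which is b +
  w.\<close>

lemma polynomial_recurrence_solution:
  fixes f dd rr g :: "nat \<Rightarrow> real" and C :: real and H :: "nat set" and A :: "real fps"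
  assumes rec: "\<And>s. s < n \<Longrightarrow> f (s + 1) = C * f s - 2 * real s * f (s - 1) +
      2 * (\<Sum>h\<in>H. dd h * ((\<Sum>i<s. (- rr h) ^ i * f (s - 1 - i)) + (- rr h) ^ s * g h))"
  defines "G \<equiv> \<Prod>h\<in>H. bin_fps (- dd h) (- rr h)"
    and "G' \<equiv> \<Prod>h\<in>H. bin_fps (dd h) (- rr h)"
    and "b \<equiv> (\<Sum>h\<in>H. dd h) - real n"
  shows "(\<Sum>s\<le>n. fps_nth A (n - s) * f s) = f 0 * two_grade_sum (A * G') G n b C +
    (\<Sum>h\<in>H. 2 * dd h * g h * (if n = 0 then 0 else two_grade_sum (A * G') (bin_fps 1 (- rr h) * G) (n - 1) b C))"
proof -
  define ds where "ds = (\<Sum>h\<in>H. dd h)"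
  define \<beta> where "\<beta> = fps_const (f 0) * G + (\<Sum>h\<in>H. fps_const (2 * dd h * g h) * (fps_X * (bin_fps 1 (- rr h) * G)))"
  define Y where "Y = Abs_fps (\<lambda>s. \<Sum>j\<le>s. fps_nth \<beta> j * theta C (s - j) (ds - real s))"
  define W where "W = G' * Y"
  define L where "L = (\<Sum>h\<in>H. fps_const (dd h) * bin_fps 1 (- rr h))"
  define L' where "L' = (\<Sum>h\<in>H. fps_const (dd h * (- rr h)) * bin_fps 1 (- rr h))"
  have Y_nth: "fps_nth Y s = fps_nth \<beta> s + (if s \<ge> 1 then C * fps_nth Y (s - 1) else 0) +
     (if s \<ge> 2 then 2 * (ds - real s + 1) * fps_nth Y (s - 2) else 0)" for s
    unfolding Y_def fps_nth_Abs_fps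
    by (rule three_term_recurrence[where \<beta> = "fps_nth \<beta>" and C = C and d = ds and s = s])
  have Y_eq: "Y = \<beta> + fps_const C * fps_X * Y + fps_const (2 * ds) * (fps_X * (fps_X * Y)) -
      fps_const 2 * (fps_X * (fps_X * fps_deriv (fps_X * Y)))"
  proof (rule fps_ext)
    fix s
    consider "s = 0" | "s = 1" | k where "s = Suc (Suc k)" by (metis One_nat_def not0_implies_Suc)
    thus "fps_nth Y s = fps_nth (\<beta> + fps_const C * fps_X * Y + fps_const (2 * ds) * (fps_X * (fps_X * Y)) -
      fps_const 2 * (fps_X * (fps_X * fps_deriv (fps_X * Y)))) s"
    proof cases
      case 3
      thus ?thesis by (subst Y_nth) (simp add: mult.assoc, simp add: algebra_simps)
    qed (subst Y_nth, simp add: mult.assoc)+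
  qed
  have GG: "G' * G = 1" unfolding G'_def G_def by (simp add: prod.distrib[symmetric] bin_fps_inverse)
  have dG: "fps_deriv G' = L' * G'"
    unfolding G'_def L'_def by (rule fps_deriv_prod_log) (rule bin_fps_deriv)
  \<comment> \<open>Splits the geometric series into constant terms and a remainder: the constants
    are the term 2 * ds of the three-term recurrence, and the remainder is what differentiating G'
    produces.\<close>
  have LL: "L = fps_const ds + fps_X * L'"
  proof -
    have "bin_fps 1 (- rr h) = 1 + fps_const (- rr h) * fps_X * bin_fps 1 (- rr h)" for h
      using bin_fps_1_times[of "- rr h"] by (simp add: algebra_simps)
    hence "fps_const (dd h) * bin_fps 1 (- rr h) =
        fps_const (dd h) * (1 + fps_const (- rr h) * fps_X * bin_fps 1 (- rr h))" for h
      by (rule arg_cong)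
    hence "fps_const (dd h) * bin_fps 1 (- rr h) =
        fps_const (dd h) + fps_X * (fps_const (dd h * (- rr h)) * bin_fps 1 (- rr h))" for h
      by (simp only: fps_const_mult[symmetric] distrib_left mult_1_right mult_1_left mult_ac)
    hence "L = (\<Sum>h\<in>H. fps_const (dd h) + fps_X * (fps_const (dd h * (- rr h)) * bin_fps 1 (- rr h)))"
      unfolding L_def by simp
    also have "\<dots> = fps_const ds + fps_X * L'"
    proof -
      have "(\<Sum>h\<in>H. fps_const (dd h)) = fps_const ds"
        by (rule fps_ext) (simp add: fps_sum_nth ds_def)
      thus ?thesis by (simp only: sum.distrib L'_def sum_distrib_left)
    qed
    finally show ?thesis .
  qed
  have G\<beta>: "G' * \<beta> = fps_const (f 0) + fps_X * (\<Sum>h\<in>H. fps_const (2 * dd h * g h) * bin_fps 1 (- rr h))"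
  proof -
    have "G' * \<beta> = (G' * G) * (fps_const (f 0) + fps_X * (\<Sum>h\<in>H. fps_const (2 * dd h * g h) * bin_fps 1 (- rr h)))"
      unfolding \<beta>_def by (simp add: distrib_left sum_distrib_left mult_ac)
    thus ?thesis by (simp add: GG)
  qed
  have "W = G' * \<beta> + fps_const C * fps_X * W + fps_const (2 * ds) * (fps_X * (fps_X * W)) -
      fps_const 2 * (fps_X * (fps_X * (G' * fps_deriv (fps_X * Y))))"
    unfolding W_def by (subst Y_eq) (simp add: algebra_simps)
  also have "G' * fps_deriv (fps_X * Y) = fps_deriv (fps_X * W) - fps_X * L' * W"
    unfolding W_def by (simp add: dG algebra_simps)
  finally have W_eq: "W = fps_const (f 0) + fps_X * (\<Sum>h\<in>H. fps_const (2 * dd h * g h) * bin_fps 1 (- rr h)) +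
      fps_const C * (fps_X * W) + fps_const 2 * (fps_X * (fps_X * (L * W))) - fps_const 2 * (fps_X * (fps_X * fps_deriv (fps_X * W)))"
    unfolding G\<beta> LL by (simp add: algebra_simps flip: fps_const_mult)
  have W0: "fps_nth W 0 = f 0" by (subst W_eq) simp
  have LW: "fps_nth (L * W) s = (\<Sum>h\<in>H. dd h * (\<Sum>i\<le>s. (- rr h) ^ i * fps_nth W (s - i)))" for s
    unfolding L_def sum_distrib_right
    by (simp add: fps_sum_nth mult.assoc) (simp add: fps_mult_nth bin_fps_1_nth atLeast0AtMost del: bin_fps_nth)
  have WS: "fps_nth W (s + 1) = C * fps_nth W s - 2 * real s * fps_nth W (s - 1) +
      2 * (\<Sum>h\<in>H. dd h * ((\<Sum>i<s. (- rr h) ^ i * fps_nth W (s - 1 - i)) + (- rr h) ^ s * g h))" for s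
  proof -
    have "fps_nth W (s + 1) = (\<Sum>h\<in>H. 2 * dd h * g h * (- rr h) ^ s) + C * fps_nth W s +
      2 * (if s = 0 then 0 else fps_nth (L * W) (s - 1)) - 2 * real s * fps_nth W (s - 1)"
      by (subst W_eq, cases s)
        (simp_all add: fps_sum_nth bin_fps_1_nth mult.assoc del: bin_fps_nth, simp_all add: algebra_simps)
    also have "(if s = 0 then 0 else fps_nth (L * W) (s - 1)) =
      (\<Sum>h\<in>H. dd h * (\<Sum>i<s. (- rr h) ^ i * fps_nth W (s - 1 - i)))"
      by (cases s) (simp_all add: LW lessThan_Suc_atMost)
    finally show ?thesis by (simp add: distrib_left sum.distrib sum_distrib_left mult_ac)
  qed
  have fW: "f s = fps_nth W s" if "s \<le> n" for s using that
  proof (induction s rule: less_induct)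
    case (less s)
    show ?case
    proof (cases s)
      case (Suc k)
      have "f (k + 1) = fps_nth W (k + 1)"
        unfolding WS using rec[of k] less.IH less.prems Suc by (simp add: less_imp_diff_less)
      thus ?thesis using Suc by simp
    qed (simp add: W0)
  qed
  have "(\<Sum>s\<le>n. fps_nth A (n - s) * f s) = fps_nth (W * A) n"
    unfolding fps_mult_nth atLeast0AtMost by (intro sum.cong refl) (simp add: fW mult.commute)
  also have "W * A = (A * G') * Y" by (simp add: W_def mult_ac)
  also have "fps_nth \<dots> n = (\<Sum>i\<le>n. \<Sum>j\<le>n - i. fps_nth (A * G') i * (fps_nth \<beta> j * theta C (n - i - j) (b + real i)))"
    unfolding fps_mult_nth[of _ Y] atLeast0AtMost
    by (intro sum.cong refl) (simp add: Y_def sum_distrib_left b_def ds_def of_nat_diff algebra_simps)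
  also have "\<dots> = (\<Sum>(i, j)\<in>(SIGMA i:{..n}. {..n - i}). fps_nth (A * G') i * (fps_nth \<beta> j * theta C (n - i - j) (b + real i)))"
    by (rule sum.Sigma) auto
  also have "\<dots> = (\<Sum>(s, w)\<in>(SIGMA s:{..n}. {..s}). fps_nth (A * G') w * fps_nth \<beta> (s - w) * theta C (n - s) (b + real w))"
    by (rule sum.reindex_bij_witness[of _ "\<lambda>(s, w). (w, s - w)" "\<lambda>(i, j). (i + j, i)"]) auto
  also have "\<dots> = two_grade_sum (A * G') \<beta> n b C"
    unfolding two_grade_sum_def by (rule sum.Sigma[symmetric]) auto
  also have "\<dots> = f 0 * two_grade_sum (A * G') G n b C +
    (\<Sum>h\<in>H. 2 * dd h * g h * (if n = 0 then 0 else two_grade_sum (A * G') (bin_fps 1 (- rr h) * G) (n - 1) b C))"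
    unfolding \<beta>_def by (simp only: two_grade_sum_add two_grade_sum_sum two_grade_sum_cmult two_grade_sum_X)
  finally show ?thesis .
qed

section \<open>Values of the terminating functions\<close>

lemma sd_value_superset:
  assumes "finite S" "Poly_Mapping.keys X \<subseteq> S"
  shows "sd_value X = (\<Sum>f\<in>S. Poly_Mapping.lookup X f * sd_poly f)"
  unfolding sd_value_def using assms
  by (intro sum.mono_neutral_left) (auto simp: in_keys_iff)

lemma sd_value_0 [simp]: "sd_value 0 = 0"
  by (simp add: sd_value_def)

lemma sd_value_add: "sd_value (X + Y) = sd_value X + sd_value Y"
proof -
  let ?S = "Poly_Mapping.keys X \<union> Poly_Mapping.keys Y"
  have "sd_value (X + Y) = (\<Sum>f\<in>?S. Poly_Mapping.lookup (X + Y) f * sd_poly f)"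
    by (rule sd_value_superset) (use keys_add[of X Y] in auto)
  also have "\<dots> = sd_value X + sd_value Y"
    by (simp add: sd_value_superset[of ?S X] sd_value_superset[of ?S Y] lookup_add distrib_right sum.distrib)
  finally show ?thesis .
qed

lemma sd_value_diff: "sd_value (X - Y) = sd_value X - sd_value Y"
  using sd_value_add[of "X - Y" Y] by simp

lemma sd_value_sum: "sd_value (\<Sum>i\<in>A. X i) = (\<Sum>i\<in>A. sd_value (X i))"
  by (induction A rule: infinite_finite_induct) (auto simp: sd_value_add)

lemma lookup_sd_scale: "Poly_Mapping.lookup (sd_scale q X) f = q * Poly_Mapping.lookup X f"
  by (auto simp: sd_scale_def Poly_Mapping.map.rep_eq when_def)

lemma sd_value_scale: "sd_value (sd_scale q X) = q * sd_value X"
proof -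
  have "Poly_Mapping.keys (sd_scale q X) \<subseteq> Poly_Mapping.keys X"
    by (auto simp: in_keys_iff lookup_sd_scale)
  from sd_value_superset[OF _ this] show ?thesis
    by (simp add: lookup_sd_scale sd_value_def sum_distrib_left mult.assoc)
qed

lemma sd_value_single: "sd_value (Poly_Mapping.single f q) = q * sd_poly f"
  using sd_value_superset[of "{f}" "Poly_Mapping.single f q"] by simp

text \<open>Shares out the powers of q: each argument is completed by
  \<open>poly q t ^ (es ! i - snd (args ! i))\<close>, so that the power left outside depends on k
  only through \<open>dotn es k\<close>. This is the form to which \<open>multi_index_sum_le\<close>
  applies.\<close>

lemma poly_sd_poly_SD:
  assumes len: "length args = length es" "length pars \<le> length es"
    and le: "\<And>i. i < length es \<Longrightarrow> snd (args ! i) \<le> es ! i"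
  shows "poly (sd_poly (SD q N es quots pars args)) t =
    (\<Sum>k | length k = length es \<and> dotn es k \<le> N.
       (\<Prod>(b, u, c, v)\<leftarrow>quots. poch_quot b (dotn u k) c (dotn v k)) * poly q t ^ (N - dotn es k) *
       (\<Prod>i<length es. (if i < length pars then pochhammer (pars ! i) (k ! i) else 1) / fact (k ! i) *
          (fst (args ! i) * poly q t ^ (es ! i - snd (args ! i))) ^ (k ! i)))"
  unfolding sd_poly.simps poly_sum poly_smult poly_power sd_indices_def
proof (intro sum.cong refl)
  fix k assume "k \<in> {k. length k = length es \<and> dotn es k \<le> N}"
  hence k: "length k = length es" "dotn es k \<le> N" by auto
  let ?w = "map snd args"
  have "dotn es k = dotn ?w k + (\<Sum>i<length es. (es ! i - snd (args ! i)) * k ! i)"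
    unfolding dotn_def k(1) sum.distrib[symmetric]
    by (intro sum.cong refl) (use le len in \<open>auto simp flip: distrib_right\<close>)
  hence "N - dotn ?w k = (N - dotn es k) + (\<Sum>i<length es. (es ! i - snd (args ! i)) * k ! i)"
    using k(2) by simp
  hence p: "poly q t ^ (N - dotn ?w k) =
      poly q t ^ (N - dotn es k) * (\<Prod>i<length es. (poly q t ^ (es ! i - snd (args ! i))) ^ (k ! i))"
    by (simp add: power_add power_sum power_mult)
  have pars: "(\<Prod>i<length pars. pochhammer (pars ! i) (k ! i)) =
      (\<Prod>i<length es. if i < length pars then pochhammer (pars ! i) (k ! i) else 1)"
    by (rule prod.mono_neutral_cong_left) (use len in auto)
  show "sd_coeff quots pars k * (\<Prod>i<length es. fst (args ! i) ^ (k ! i)) * poly q t ^ (N - dotn ?w k) =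
     (\<Prod>(b, u, c, v)\<leftarrow>quots. poch_quot b (dotn u k) c (dotn v k)) * poly q t ^ (N - dotn es k) *
       (\<Prod>i<length es. (if i < length pars then pochhammer (pars ! i) (k ! i) else 1) / fact (k ! i) *
          (fst (args ! i) * poly q t ^ (es ! i - snd (args ! i))) ^ (k ! i))"
    unfolding sd_coeff_def p pars k(1) prod.distrib prod_dividef power_mult_distrib by simp
qed

lemma pochhammer_neg_of_nat:
  assumes "k \<le> n"
  shows "pochhammer (- real n) k = (- 1) ^ k * fact n / fact (n - k)"
  using assms
proof (induction k)
  case (Suc k)
  have "n - k = Suc (n - Suc k)" using Suc.prems by simp
  hence f: "fact (n - k) = real (n - k) * fact (n - Suc k)" by (metis fact_Suc of_nat_fact of_nat_mult)
  have "pochhammer (- real n) (Suc k) = (- 1) ^ k * fact n / fact (n - k) * (- real n + real k)"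
    using Suc by (simp add: pochhammer_Suc)
  also have "- real n + real k = - real (n - k)" using Suc.prems by (simp add: of_nat_diff)
  also have "(- 1) ^ k * fact n / fact (n - k) * (- real (n - k)) = (- 1) ^ Suc k * fact n / fact (n - Suc k)"
    unfolding f using Suc.prems by (simp add: divide_simps del: of_nat_diff)
  finally show ?case .
qed simp

lemma prod_list_nth: "prod_list L = (\<Prod>i<length L. L ! i)"
  by (induction L) (simp_all add: prod.lessThan_Suc_shift del: prod.lessThan_Suc)

lemma prod_list_eq_prod_nth:
  assumes "length L = n" "\<And>i. i < n \<Longrightarrow> f i = L ! i"
  shows "(\<Prod>i<n. f i) = prod_list L"
  using assms by (simp add: prod_list_nth)

lemma prod_list_map_distinct: "distinct xs \<Longrightarrow> prod_list (map f xs) = (\<Prod>x\<in>set xs. f x)"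
  by (rule prod.distinct_set_conv_list[symmetric])

lemma weighted_fps_bin: "weighted_fps (Suc 0) (\<lambda>n. pochhammer \<alpha> n * y ^ n / fact n) = bin_fps \<alpha> y"
  by (rule fps_ext) (simp add: weighted_fps_def)

lemma weighted_fps_exp: "weighted_fps (Suc 0) (\<lambda>n. y ^ n / fact n) = fps_exp y"
  by (rule fps_ext) (simp add: weighted_fps_def)

lemma weighted_fps_exp_sq: "weighted_fps 2 (\<lambda>n. y ^ n / fact n) = exp_sq_fps y"
  by (rule fps_ext) (simp add: weighted_fps_def)

lemma dotn_append:
  "length us = length ks \<Longrightarrow> dotn (us @ us') (ks @ ks') = dotn us ks + dotn us' ks'"
proof (induction us ks rule: list_induct2)
  case Nil
  show ?case by (simp add: dotn_def)
next
  case (Cons u us k ks)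
  thus ?case by (simp add: dotn_Cons)
qed

lemma dotn_zero: "dotn (replicate n 0) k = 0" if "length k = n"
  using that by (simp add: dotn_def)

section \<open>The functions \<open>Z\<close> and \<open>Y\<close> as coefficients of power
  series\<close>

context mixed_hermite
begin

text \<open>Up to the factor \<open>kappa J\<close>, the expansion in X =
  \<open>\<rho> J + z\<close> of the Rodrigues numerator divided by the factors
  \<open>(\<rho> h + z) ^ lam h\<close> of the other rows.\<close>

definition pole_weight_fps :: "nat \<Rightarrow> real fps" where
  "pole_weight_fps J = (\<Prod>i=1..p. bin_fps (- real (m i)) (1 / (\<xi> i + \<rho> J))) *
     (\<Prod>h\<in>{1..r} - {J}. bin_fps (real (lam h)) (x_pole J h))"

definition pole_fps :: "nat \<Rightarrow> real \<Rightarrow> real fps" where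
  "pole_fps J c = fps_exp c * exp_sq_fps (1 / 4) * (\<Prod>h\<in>{1..r} - {J}. bin_fps (d h) (x_pole J h))"

definition pole_fps_inv :: "nat \<Rightarrow> real \<Rightarrow> real fps" where
  "pole_fps_inv J c = fps_exp (- c) * exp_sq_fps (- 1 / 4) * (\<Prod>h\<in>{1..r} - {J}. bin_fps (- d h) (x_pole J h))"

lemma length_other_rows: "J \<in> {1..r} \<Longrightarrow> length (other_rows J) = r - 1"
proof -
  assume J: "J \<in> {1..r}"
  have "length (other_rows J) = card ({1..r} - {J})"
    unfolding other_rows_def by (subst distinct_card[symmetric]) (auto intro!: arg_cong[of _ _ card])
  thus ?thesis using J by simp
qed

lemma set_other_rows: "set (other_rows J) = {1..r} - {J}"
  and distinct_other_rows: "distinct (other_rows J)"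
  by (auto simp: other_rows_def)

lemma set_cols: "set cols = {1..p}" by auto

text \<open>Each ingredient of the sum is a series. The Pochhammer symbol of -N' together with the
  power of c gives exp (c X), its signs being moved into the arguments by \<open>g\<close>; the
  quotient (b)_w / (b + 1)_w = b / (b + w) gives the Euler integral; and \<open>Z_shift\<close>
  decides which indices stand outside (\<open>A0\<close>) and which inside (\<open>A1\<close>) that
  integral. The argument (1, 0) becomes exp (-c X).\<close>

lemma poly_Z:
  fixes t :: real
  assumes J: "J \<in> {1..r}" and b: "b > 0"
  defines "c \<equiv> a - \<rho> J / 2 - t"
  shows "poly (sd_value (Z J (int N') b \<upsilon>)) t =
    b * fps_nth (pole_weight_fps J * (pole_fps J c * euler_integral b (pole_fps_inv J c * bin_fps 1 \<upsilon>))) N'"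
proof -
  define r' where "r' = r - 1"
  have r': "r = r' + 1" using J by (simp add: r'_def)
  define ors where "ors = other_rows J"
  have lo: "length ors = r'" using length_other_rows[OF J] by (simp add: ors_def r'_def)
  define es where "es = Z_weights"
  define vs where "vs = Z_shift"
  \<comment> \<open>Only r' rows differ from J, so two of the unit weights remain: they belong to
    the argument with \<open>\<upsilon>\<close> and to the one that becomes exp (-c X).\<close>
  have "p + 2 * r = (p + 2 * r') + 2" by (simp add: r')
  hence es_eq: "es = replicate (p + 2 * r') 1 @ [1, 1, 2, 2]"
    unfolding es_def Z_weights_def by (simp only: replicate_add) (simp add: numeral_2_eq_2)
  have vs_eq: "vs = replicate (p + r') 0 @ replicate r' 1 @ [1, 1, 0, 2]"
    unfolding vs_def Z_shift_def by (subst (1 2) r') simp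
  have les: "length es = p + 2 * r' + 4" by (simp add: es_eq)
  have lvs: "length vs = length es" by (simp add: les vs_eq)
  have lpars: "length (Z_pars J) = p + 2 * r' + 1" using lo by (simp add: Z_pars_def ors_def[symmetric])
  have largs: "length (Z_args J \<upsilon>) = length es" using lo by (simp add: les Z_args_def ors_def[symmetric])
  have idx: "i < p \<or> (\<exists>j<r'. i = p + j) \<or> (\<exists>j<r'. i = p + r' + j) \<or> i = p + 2 * r' \<or> i = p + 2 * r' + 1 \<or>
      i = p + 2 * r' + 2 \<or> i = p + 2 * r' + 3" if "i < length es" for i
  proof -
    have "\<exists>j<r'. i = p + j" if "p \<le> i" "i < p + r'" using that by (intro exI[of _ "i - p"]) auto
    moreover have "\<exists>j<r'. i = p + r' + j" if "p + r' \<le> i" "i < p + 2 * r'"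
      using that by (intro exI[of _ "i - (p + r')"]) auto
    moreover have "i < p \<or> (p \<le> i \<and> i < p + r') \<or> (p + r' \<le> i \<and> i < p + 2 * r') \<or> i = p + 2 * r' \<or>
      i = p + 2 * r' + 1 \<or> i = p + 2 * r' + 2 \<or> i = p + 2 * r' + 3"
      using that les by arith
    ultimately show ?thesis by blast
  qed
  have ev: "es ! i \<ge> 1 \<and> (vs ! i = 0 \<or> vs ! i = es ! i)" if "i < length es" for i
    using idx[OF that] by (auto simp: es_eq vs_eq nth_append)
  have le: "snd (Z_args J \<upsilon> ! i) \<le> es ! i" if "i < length es" for i
    using idx[OF that]
    by (auto simp: es_eq Z_args_def nth_append lo ors_def[symmetric] simp del: upt_Suc)
  define g where "g i n = (if i < length (Z_pars J) then pochhammer (Z_pars J ! i) n else 1) / fact n *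
      ((- 1) ^ (es ! i) * (fst (Z_args J \<upsilon> ! i) * c ^ (es ! i - snd (Z_args J \<upsilon> ! i)))) ^ n" for i n
  define A0 where "A0 = map (\<lambda>i. bin_fps (- real (m i)) (1 / (\<xi> i + \<rho> J))) cols @
     map (\<lambda>h. bin_fps (real (lam h) + d h) (x_pole J h)) ors @ map (\<lambda>_. 1) ors @ [1, 1, exp_sq_fps (1 / 4), 1]"
  define A1 where "A1 = map (\<lambda>_. 1) cols @ map (\<lambda>_. 1) ors @
     map (\<lambda>h. bin_fps (- d h) (x_pole J h)) ors @ [bin_fps 1 \<upsilon>, fps_exp (- c), 1, exp_sq_fps (- 1 / 4)]"
  have A0: "(\<Prod>i<length es. if vs ! i = 0 then weighted_fps (es ! i) (g i) else 1) = prod_list A0"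
  proof (rule prod_list_eq_prod_nth)
    show "length A0 = length es" by (simp add: A0_def lo les)
    fix i assume "i < length es"
    from idx[OF this] show "(if vs ! i = 0 then weighted_fps (es ! i) (g i) else 1) = A0 ! i"
      by (elim disjE exE conjE)
        (simp_all add: A0_def g_def[abs_def] es_eq vs_eq Z_args_def Z_pars_def nth_append lo
          ors_def[symmetric] weighted_fps_bin weighted_fps_exp_sq del: upt_Suc)
  qed
  have A1: "(\<Prod>i<length es. if vs ! i = 0 then 1 else weighted_fps (es ! i) (g i)) = prod_list A1"
  proof (rule prod_list_eq_prod_nth)
    show "length A1 = length es" by (simp add: A1_def lo les)
    fix i assume "i < length es"
    from idx[OF this] show "(if vs ! i = 0 then 1 else weighted_fps (es ! i) (g i)) = A1 ! i"
      by (elim disjE exE conjE)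
        (simp_all add: A1_def g_def[abs_def] es_eq vs_eq Z_args_def Z_pars_def nth_append lo
          ors_def[symmetric] weighted_fps_bin weighted_fps_exp weighted_fps_exp_sq del: upt_Suc)
  qed
  have pl: "prod_list (map f ors) = (\<Prod>h\<in>{1..r} - {J}. f h)" for f :: "nat \<Rightarrow> real fps"
    unfolding ors_def set_other_rows[symmetric] by (rule prod_list_map_distinct[OF distinct_other_rows])
  have pc: "prod_list (map f cols) = (\<Prod>i=1..p. f i)" for f :: "nat \<Rightarrow> real fps"
    unfolding set_cols[symmetric] by (rule prod_list_map_distinct) simp
  have A0': "fps_exp c * prod_list A0 = pole_weight_fps J * pole_fps J c"
    unfolding A0_def prod_list.append pl pc pole_weight_fps_def pole_fps_def
    by (simp add: prod.distrib bin_fps_mult[symmetric] mult_ac)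
  have A1': "prod_list A1 = pole_fps_inv J c * bin_fps 1 \<upsilon>"
    unfolding A1_def prod_list.append pl pc pole_fps_inv_def by (simp add: mult_ac)
  have cJ: "poly (cJ_poly J) t = c" by (simp add: cJ_poly_def c_def)
  have "poly (sd_value (Z J (int N') b \<upsilon>)) t = 1 / fact N' *
    (\<Sum>k | length k = length es \<and> dotn es k \<le> N'.
       (\<Prod>(b, u, c, v)\<leftarrow>[(- real N', es, 1, replicate (p + 2 * r + 2) 0), (b, vs, b + 1, vs)]. poch_quot b (dotn u k) c (dotn v k)) *
       c ^ (N' - dotn es k) *
       (\<Prod>i<length es. (if i < length (Z_pars J) then pochhammer (Z_pars J ! i) (k ! i) else 1) / fact (k ! i) *
          (fst (Z_args J \<upsilon> ! i) * c ^ (es ! i - snd (Z_args J \<upsilon> ! i))) ^ (k ! i)))"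
    unfolding cJ[symmetric]
    by (subst poly_sd_poly_SD[symmetric])
      (use largs lpars le les in \<open>auto simp: Z_def sd_value_single es_def[symmetric] vs_def[symmetric]\<close>)
  also have "\<dots> = 1 / fact N' * (\<Sum>k | length k = length es \<and> dotn es k \<le> N'.
      (\<lambda>n w. fact N' / fact (N' - n) * (b / (b + real w)) * c ^ (N' - n)) (dotn es k) (dotn vs k) *
      (\<Prod>i<length es. g i (k ! i)))"
  proof (intro arg_cong[of _ _ "\<lambda>x. 1 / fact N' * x"] sum.cong refl)
    fix k assume "k \<in> {k. length k = length es \<and> dotn es k \<le> N'}"
    hence k: "length k = length es" "dotn es k \<le> N'" by auto
    have "pochhammer b n / pochhammer (b + 1) n = b / (b + real n)" for n
    proof -
      have "b * pochhammer (b + 1) n = pochhammer b n * (b + real n)"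
        using pochhammer_rec[of b n] pochhammer_Suc[of b n] by simp
      moreover have "pochhammer (b + 1) n > 0" using b by (intro pochhammer_pos) auto
      moreover have "b + real n > 0" using b by simp
      ultimately show ?thesis by (simp add: divide_simps)
    qed
    hence q2: "poch_quot b (dotn vs k) (b + 1) (dotn vs k) = b / (b + real (dotn vs k))"
      by (simp add: poch_quot_def)
    have q1: "poch_quot (- real N') (dotn es k) 1 (dotn (replicate (p + 2 * r + 2) 0) k) =
       (- 1) ^ dotn es k * fact N' / fact (N' - dotn es k)"
      using k les r' dotn_zero[of k "p + 2 * r + 2"] by (simp add: poch_quot_def pochhammer_neg_of_nat)
    have s: "(- 1) ^ dotn es k = (\<Prod>i<length es. ((- 1) ^ (es ! i)) ^ (k ! i) :: real)"
      by (simp add: dotn_def k(1) power_sum power_mult)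
    show "(\<Prod>(b, u, c, v)\<leftarrow>[(- real N', es, 1, replicate (p + 2 * r + 2) 0), (b, vs, b + 1, vs)]. poch_quot b (dotn u k) c (dotn v k)) *
       c ^ (N' - dotn es k) *
       (\<Prod>i<length es. (if i < length (Z_pars J) then pochhammer (Z_pars J ! i) (k ! i) else 1) / fact (k ! i) *
          (fst (Z_args J \<upsilon> ! i) * c ^ (es ! i - snd (Z_args J \<upsilon> ! i))) ^ (k ! i)) =
      (\<lambda>n w. fact N' / fact (N' - n) * (b / (b + real w)) * c ^ (N' - n)) (dotn es k) (dotn vs k) *
      (\<Prod>i<length es. g i (k ! i))"
      unfolding g_def power_mult_distrib prod.distrib s[symmetric]
      by (simp only: list.map prod_list.Cons prod_list.Nil prod.case q1 q2 mult_1_right) (simp add: mult_ac)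
  qed
  also have "(\<Sum>k | length k = length es \<and> dotn es k \<le> N'.
      (\<lambda>n w. fact N' / fact (N' - n) * (b / (b + real w)) * c ^ (N' - n)) (dotn es k) (dotn vs k) *
      (\<Prod>i<length es. g i (k ! i))) =
    (\<Sum>n\<le>N'. \<Sum>w\<le>n. (fact N' / fact (N' - n) * (b / (b + real w)) * c ^ (N' - n)) *
       (fps_nth (prod_list A0) (n - w) * fps_nth (prod_list A1) w))"
    using multi_index_sum_le[OF lvs ev, where N = N' and g = g and
        H = "\<lambda>n w. fact N' / fact (N' - n) * (b / (b + real w)) * c ^ (N' - n)"]
    unfolding A0 A1 .
  also have "1 / fact N' * \<dots> = b * (\<Sum>n\<le>N'. c ^ (N' - n) / fact (N' - n) *
      (\<Sum>w\<le>n. fps_nth (prod_list A0) (n - w) * (fps_nth (prod_list A1) w / (real w + b))))"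
    by (simp add: sum_distrib_left mult_ac add.commute)
  also have "\<dots> = b * fps_nth (fps_exp c * (prod_list A0 * euler_integral b (prod_list A1))) N'"
  proof -
    have "fps_nth (prod_list A0 * euler_integral b (prod_list A1)) n =
      (\<Sum>w\<le>n. fps_nth (prod_list A0) (n - w) * (fps_nth (prod_list A1) w / (real w + b)))" for n
      unfolding mult.commute[of "prod_list A0" "euler_integral b (prod_list A1)"] fps_mult_nth atLeast0AtMost
      by (intro sum.cong refl) (simp add: euler_integral_def)
    moreover have "fps_nth (fps_exp c * Q) N' = (\<Sum>n\<le>N'. c ^ (N' - n) / fact (N' - n) * fps_nth Q n)" for Q
      unfolding mult.commute[of "fps_exp c" Q] fps_mult_nth atLeast0AtMost
      by (intro sum.cong refl) simp
    ultimately show ?thesis by simp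
  qed
  also have "fps_exp c * (prod_list A0 * euler_integral b (prod_list A1)) =
     pole_weight_fps J * (pole_fps J c * euler_integral b (pole_fps_inv J c * bin_fps 1 \<upsilon>))"
    unfolding A1'[symmetric] using A0' by (simp add: mult.assoc[symmetric])
  finally show ?thesis .
qed

text \<open>The expansion at infinity, in X = 1 / z, of the Rodrigues numerator over the product of
  the \<open>(\<rho> h + z) ^ lam h\<close>, divided by its leading term.\<close>

definition infinity_weight_fps :: "real fps" where
  "infinity_weight_fps = (\<Prod>i=1..p. bin_fps (- real (m i)) (\<xi> i)) * (\<Prod>h=1..r. bin_fps (real (lam h)) (- \<rho> h))"

text \<open>Both indices have weight 2, and collecting them by K = k + v gives the outer sum of
  \<open>theta\<close>. The powers of 4 contained in (-2)^X, with the sign of the Pochhammer symbol,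
  turn the powers of -1/2 and 1/4 into 2^k and 1.\<close>

lemma theta_double_sum:
  "(\<Sum>(k, v) | 2 * k + 2 * v \<le> X. (- 2) ^ X * (pochhammer (- real (X - k)) (k + 2 * v) * pochhammer B k *
      (1 / fact k * (- 1 / 2) ^ k) * (1 / fact v * (1 / 4) ^ v) * c ^ (X - (2 * k + 2 * v)))) = theta (- 2 * c) X B"
proof -
  have "(\<Sum>(k, v) | 2 * k + 2 * v \<le> X. (- 2) ^ X * (pochhammer (- real (X - k)) (k + 2 * v) * pochhammer B k *
      (1 / fact k * (- 1 / 2) ^ k) * (1 / fact v * (1 / 4) ^ v) * c ^ (X - (2 * k + 2 * v)))) =
     (\<Sum>(K, k)\<in>(SIGMA K:{..X div 2}. {..K}). (- 2 * c) ^ (X - 2 * K) / fact (X - 2 * K) *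
       (2 ^ k * fact (X - k) * pochhammer B k / (fact k * fact (K - k))))"
  proof (rule sum.reindex_bij_witness[of _ "\<lambda>(K, k). (k, K - k)" "\<lambda>(k, v). (k + v, k)"])
    fix kv :: "nat \<times> nat" assume kv: "kv \<in> {(k, v). 2 * k + 2 * v \<le> X}"
    obtain k v where kv': "kv = (k, v)" by (cases kv)
    have le: "2 * (k + v) \<le> X" "k + 2 * v \<le> X - k" using kv kv' by auto
    have X: "X - k - (k + 2 * v) = X - 2 * (k + v)" by simp
    have p: "pochhammer (- real (X - k)) (k + 2 * v) = (- 1) ^ k * fact (X - k) / fact (X - 2 * (k + v))"
      unfolding pochhammer_neg_of_nat[OF le(2)] X by (simp add: power_add power_mult)
    have "(- 2 :: real) ^ X = (- 2) ^ (X - 2 * (k + v)) * (- 2) ^ (2 * (k + v))"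
      unfolding power_add[symmetric] by (rule arg_cong[of _ _ "\<lambda>n. (- 2) ^ n"]) (use le(1) in simp)
    also have "(- 2 :: real) ^ (2 * (k + v)) = 4 ^ k * 4 ^ v" by (simp add: power_mult power_add)
    finally have e: "(- 2 :: real) ^ X = (- 2) ^ (X - 2 * (k + v)) * (4 ^ k * 4 ^ v)" .
    have q: "4 ^ k * (- 1) ^ k * (- 1 / 2) ^ k = (2 :: real) ^ k" "4 ^ v * (1 / 4) ^ v = (1 :: real)"
      by (simp_all flip: power_mult_distrib)
    have "(- 2) ^ X * (pochhammer (- real (X - k)) (k + 2 * v) * pochhammer B k *
      (1 / fact k * (- 1 / 2) ^ k) * (1 / fact v * (1 / 4) ^ v) * c ^ (X - (2 * k + 2 * v))) =
      (4 ^ k * (- 1) ^ k * (- 1 / 2) ^ k) * (4 ^ v * (1 / 4) ^ v) * ((- 2) ^ (X - 2 * (k + v)) * c ^ (X - 2 * (k + v))) / fact (X - 2 * (k + v)) *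
       (fact (X - k) * pochhammer B k / (fact k * fact v))"
      unfolding e p by (simp add: add_mult_distrib2 mult_ac)
    also have "\<dots> = (- 2 * c) ^ (X - 2 * (k + v)) / fact (X - 2 * (k + v)) *
       (2 ^ k * fact (X - k) * pochhammer B k / (fact k * fact v))"
      unfolding q power_mult_distrib[symmetric] by simp
    finally show "(case case kv of (k, v) \<Rightarrow> (k + v, k) of (K, k) \<Rightarrow> (- 2 * c) ^ (X - 2 * K) / fact (X - 2 * K) *
       (2 ^ k * fact (X - k) * pochhammer B k / (fact k * fact (K - k)))) =
      (case kv of (k, v) \<Rightarrow> (- 2) ^ X * (pochhammer (- real (X - k)) (k + 2 * v) * pochhammer B k *
      (1 / fact k * (- 1 / 2) ^ k) * (1 / fact v * (1 / 4) ^ v) * c ^ (X - (2 * k + 2 * v))))"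
      unfolding kv' by simp
  qed auto
  also have "\<dots> = theta (- 2 * c) X B"
    unfolding theta_def sum_distrib_left by (rule sum.Sigma[symmetric]) auto
  finally show ?thesis .
qed

text \<open>The last two indices enter the Pochhammer quotients differently from their weights, so
  they are split off and summed to \<open>theta\<close>. The remaining p + 2 r + 1 indices have
  weight 1, and \<open>multi_index_sum_le\<close> applies with those counted by \<open>Y_v\<close>
  as second grade.\<close>

lemma poly_Y:
  fixes t :: real
  defines "c \<equiv> a - t"
  shows "poly (sd_value (Y (int N') b \<upsilon>)) t =
    two_grade_sum (infinity_weight_fps * (\<Prod>h=1..r. bin_fps (d h) (- \<rho> h)))
      (bin_fps 1 \<upsilon> * (\<Prod>h=1..r. bin_fps (- d h) (- \<rho> h))) N' b (- 2 * c)"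
proof -
  define es where "es = replicate (p + 2 * r) (1::nat) @ [1]"
  define vs where "vs = replicate (p + r) (1::nat) @ replicate r 0 @ [0]"
  have Yw: "Y_weights = es @ [2, 2]" "Y_f = es @ [1, 0]" "Y_u = vs @ [1, 0]" "Y_v = vs @ [0, 0]"
    by (simp_all add: es_def vs_def Y_weights_def Y_f_def Y_u_def Y_v_def replicate_app_Cons_same)
  have les: "length es = p + 2 * r + 1" by (simp add: es_def)
  have lvs: "length vs = length es" by (simp add: es_def vs_def)
  have lpars: "length Y_pars = p + 2 * r + 1" by (simp add: Y_pars_def)
  have largs: "length (Y_args \<upsilon>) = p + 2 * r + 3" by (simp add: Y_args_def)
  have idx: "i < p \<or> (\<exists>j<r. i = p + j) \<or> (\<exists>j<r. i = p + r + j) \<or> i = p + 2 * r" if "i < length es" for i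
  proof -
    have "\<exists>j<r. i = p + j" if "p \<le> i" "i < p + r" using that by (intro exI[of _ "i - p"]) auto
    moreover have "\<exists>j<r. i = p + r + j" if "p + r \<le> i" "i < p + 2 * r"
      using that by (intro exI[of _ "i - (p + r)"]) auto
    moreover have "i < p \<or> (p \<le> i \<and> i < p + r) \<or> (p + r \<le> i \<and> i < p + 2 * r) \<or> i = p + 2 * r"
      using that les by arith
    ultimately show ?thesis by blast
  qed
  have ev: "es ! i \<ge> 1 \<and> (vs ! i = 0 \<or> vs ! i = es ! i)" if "i < length es" for i
    using idx[OF that] by (auto simp: es_def vs_def nth_append)
  have args_snd: "map snd (Y_args \<upsilon>) = Y_weights"
  proof -
    have "p + 2 * r = p + (r + r)" by simp
    hence "es = replicate p 1 @ replicate r 1 @ replicate r 1 @ [1]"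
      unfolding es_def by (simp only: replicate_add append_assoc)
    thus ?thesis unfolding Yw Y_args_def by (simp add: o_def map_replicate_const del: upt_Suc)
  qed
  have le: "snd (Y_args \<upsilon> ! i) = Y_weights ! i" if "i < p + 2 * r + 3" for i
    using that by (simp add: args_snd[symmetric] largs)
  define g where "g i n = pochhammer (Y_pars ! i) n / fact n * (- 2 * fst (Y_args \<upsilon> ! i)) ^ n" for i n
  define G where "G i n = (if i < length Y_pars then pochhammer (Y_pars ! i) n else 1) / fact n *
      fst (Y_args \<upsilon> ! i) ^ n" for i n
  define A0 where "A0 = map (\<lambda>_. 1) cols @ map (\<lambda>_. 1) rows @ map (\<lambda>h. bin_fps (- d h) (- \<rho> h)) rows @ [bin_fps 1 \<upsilon>]"
  define A1 where "A1 = map (\<lambda>i. bin_fps (- real (m i)) (\<xi> i)) cols @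
     map (\<lambda>h. bin_fps (real (lam h) + d h) (- \<rho> h)) rows @ map (\<lambda>_. 1) rows @ [1]"
  have A0: "(\<Prod>i<length es. if vs ! i = 0 then weighted_fps (es ! i) (g i) else 1) = prod_list A0"
  proof (rule prod_list_eq_prod_nth)
    show "length A0 = length es" by (simp add: A0_def les)
    fix i assume "i < length es"
    from idx[OF this] show "(if vs ! i = 0 then weighted_fps (es ! i) (g i) else 1) = A0 ! i"
      by (elim disjE exE conjE)
        (simp_all add: A0_def g_def[abs_def] es_def vs_def Y_args_def Y_pars_def nth_append
          weighted_fps_bin del: upt_Suc)
  qed
  have A1: "(\<Prod>i<length es. if vs ! i = 0 then 1 else weighted_fps (es ! i) (g i)) = prod_list A1"
  proof (rule prod_list_eq_prod_nth)
    show "length A1 = length es" by (simp add: A1_def les)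
    fix i assume "i < length es"
    from idx[OF this] show "(if vs ! i = 0 then 1 else weighted_fps (es ! i) (g i)) = A1 ! i"
      by (elim disjE exE conjE)
        (simp_all add: A1_def g_def[abs_def] es_def vs_def Y_args_def Y_pars_def nth_append
          weighted_fps_bin del: upt_Suc)
  qed
  have sr: "set rows = {1..r}" by auto
  have pl: "prod_list (map f rows) = (\<Prod>h=1..r. f h)" for f :: "nat \<Rightarrow> real fps"
    unfolding sr[symmetric] by (rule prod_list_map_distinct) simp
  have pc: "prod_list (map f cols) = (\<Prod>i=1..p. f i)" for f :: "nat \<Rightarrow> real fps"
    unfolding set_cols[symmetric] by (rule prod_list_map_distinct) simp
  have A1': "prod_list A1 = infinity_weight_fps * (\<Prod>h=1..r. bin_fps (d h) (- \<rho> h))"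
    unfolding A1_def prod_list.append pl pc infinity_weight_fps_def
    by (simp add: prod.distrib bin_fps_mult[symmetric] mult_ac)
  have A0': "prod_list A0 = bin_fps 1 \<upsilon> * (\<Prod>h=1..r. bin_fps (- d h) (- \<rho> h))"
    unfolding A0_def prod_list.append pl pc by (simp add: mult_ac)
  let ?K = "{k. length k = length Y_weights \<and> dotn Y_weights k \<le> N'}"
  let ?KS = "{ks. length ks = length es \<and> dotn es ks \<le> N'}"
  let ?KV = "\<lambda>X. {(k, v). 2 * k + 2 * v \<le> (X::nat)}"
  have lY: "length Y_weights = p + 2 * r + 3" by (simp add: Y_weights_def)
  have finKV: "finite (?KV X)" for X
    by (rule finite_subset[of _ "{..X} \<times> {..X}"]) auto
  have finKS: "finite ?KS" by (rule finite_dotn_le) (use ev in auto)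
  have K_eq: "?K = (\<lambda>(ks, k, v). ks @ [k, v]) ` (SIGMA ks:?KS. ?KV (N' - dotn es ks))" (is "_ = ?I")
  proof (intro equalityI subsetI)
    fix k assume k: "k \<in> ?K"
    define ks where "ks = take (p + 2 * r + 1) k"
    have kk: "k = ks @ [k ! (p + 2 * r + 1), k ! (p + 2 * r + 2)]"
    proof (rule nth_equalityI)
      have lk: "length k = p + 2 * r + 3" using k lY by simp
      thus "length k = length (ks @ [k ! (p + 2 * r + 1), k ! (p + 2 * r + 2)])" by (simp add: ks_def)
      fix i assume "i < length k"
      hence "i < p + 2 * r + 1 \<or> i = p + 2 * r + 1 \<or> i = p + 2 * r + 2" using lk by arith
      thus "k ! i = (ks @ [k ! (p + 2 * r + 1), k ! (p + 2 * r + 2)]) ! i"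
        by (elim disjE) (simp_all add: ks_def lk nth_append)
    qed
    have lks: "length ks = length es" using k lY by (simp add: ks_def les)
    have "dotn Y_weights k = dotn es ks + (2 * k ! (p + 2 * r + 1) + 2 * k ! (p + 2 * r + 2))"
      by (subst kk, unfold Yw, subst dotn_append) (simp_all add: lks dotn_Cons, simp add: dotn_def)
    thus "k \<in> ?I" using k lks kk
      by (intro image_eqI[of _ _ "(ks, k ! (p + 2 * r + 1), k ! (p + 2 * r + 2))"]) auto
  next
    fix k assume "k \<in> ?I"
    then obtain ks x y where k: "k = ks @ [x, y]" "length ks = length es" "dotn es ks \<le> N'" "2 * x + 2 * y \<le> N' - dotn es ks"
      by auto
    have "dotn Y_weights k = dotn es ks + (2 * x + 2 * y)"
      unfolding k(1) Yw by (subst dotn_append) (simp_all add: k(2) dotn_Cons, simp add: dotn_def)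
    thus "k \<in> ?K" using k by (simp add: Yw)
  qed
  have inj: "inj_on (\<lambda>(ks, k, v). ks @ [k, v]) S" for S :: "(nat list \<times> nat \<times> nat) set"
    by (auto simp: inj_on_def)
  let ?q = "\<lambda>k. \<Prod>(b, u, c, v)\<leftarrow>[(- real N', Y_weights, - real N', Y_f), (b, Y_u, b, Y_v)]. poch_quot b (dotn u k) c (dotn v k)"
  have cp: "poly c_poly t = c" by (simp add: c_poly_def c_def)
  have "poly (sd_value (Y (int N') b \<upsilon>)) t = (- 2) ^ N' * (\<Sum>k\<in>?K. ?q k * c ^ (N' - dotn Y_weights k) *
      (\<Prod>i<length Y_weights. (if i < length Y_pars then pochhammer (Y_pars ! i) (k ! i) else 1) / fact (k ! i) *
          (fst (Y_args \<upsilon> ! i) * c ^ (Y_weights ! i - snd (Y_args \<upsilon> ! i))) ^ (k ! i)))"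
    unfolding cp[symmetric]
    by (subst poly_sd_poly_SD[symmetric])
      (use largs lpars le lY in \<open>auto simp: Y_def sd_value_single\<close>)
  also have "(\<Sum>k\<in>?K. ?q k * c ^ (N' - dotn Y_weights k) *
      (\<Prod>i<length Y_weights. (if i < length Y_pars then pochhammer (Y_pars ! i) (k ! i) else 1) / fact (k ! i) *
          (fst (Y_args \<upsilon> ! i) * c ^ (Y_weights ! i - snd (Y_args \<upsilon> ! i))) ^ (k ! i))) =
     (\<Sum>k\<in>?K. ?q k * c ^ (N' - dotn Y_weights k) * (\<Prod>i<length Y_weights. G i (k ! i)))"
    by (intro sum.cong refl arg_cong2[of _ _ _ _ "(*)"] prod.cong) (simp add: G_def le lY)
  also have "\<dots> = (\<Sum>(ks, k, v)\<in>(SIGMA ks:?KS. ?KV (N' - dotn es ks)).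
      ?q (ks @ [k, v]) * c ^ (N' - dotn Y_weights (ks @ [k, v])) * (\<Prod>i<length Y_weights. G i ((ks @ [k, v]) ! i)))"
    unfolding K_eq by (subst sum.reindex[OF inj]) (simp add: o_def case_prod_beta)
  also have "\<dots> = (\<Sum>ks\<in>?KS. \<Sum>(k, v)\<in>?KV (N' - dotn es ks).
      ?q (ks @ [k, v]) * c ^ (N' - dotn Y_weights (ks @ [k, v])) * (\<Prod>i<length Y_weights. G i ((ks @ [k, v]) ! i)))"
    by (subst sum.Sigma[symmetric]) (use finKS finKV in auto)
  also have "(- 2) ^ N' * \<dots> = (\<Sum>ks\<in>?KS. theta (- 2 * c) (N' - dotn es ks) (b + real (dotn vs ks)) * (\<Prod>i<length es. g i (ks ! i)))"
    unfolding sum_distrib_left[of "(- 2) ^ N'" _ ?KS]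
  proof (rule sum.cong[OF refl])
    fix ks assume "ks \<in> ?KS"
    hence ks: "length ks = length es" "dotn es ks \<le> N'" by auto
    define X where "X = N' - dotn es ks"
    have N': "N' = X + dotn es ks" using ks by (simp add: X_def)
    \<comment> \<open>The power (-2)^N' is shared out: the part with exponent
      \<open>dotn es ks\<close> removes the halves in the arguments, the part with exponent X goes
      to \<open>theta\<close>.\<close>
    have gG: "(\<Prod>i<length es. g i (ks ! i)) = (- 2) ^ dotn es ks * (\<Prod>i<length es. G i (ks ! i))"
    proof -
      have "g i n = ((- 2) ^ (es ! i)) ^ n * G i n" if "i < length es" for i n
      proof -
        have "es ! i = 1" using that by (auto simp: es_def nth_append less_Suc_eq)
        thus ?thesis using that les lpars by (simp only: g_def G_def power_one_right power_mult_distrib) simp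
      qed
      thus ?thesis by (simp add: prod.distrib dotn_def ks(1) power_sum power_mult)
    qed
    have "(- 2) ^ N' * (?q (ks @ [k, v]) * c ^ (N' - dotn Y_weights (ks @ [k, v])) * (\<Prod>i<length Y_weights. G i ((ks @ [k, v]) ! i))) =
       (- 2) ^ X * (pochhammer (- real (X - k)) (k + 2 * v) * pochhammer (b + real (dotn vs ks)) k *
      (1 / fact k * (- 1 / 2) ^ k) * (1 / fact v * (1 / 4) ^ v) * c ^ (X - (2 * k + 2 * v))) * (\<Prod>i<length es. g i (ks ! i))"
      if kv: "2 * k + 2 * v \<le> X" for k v
    proof -
      have dots: "dotn Y_weights (ks @ [k, v]) = dotn es ks + (2 * k + 2 * v)"
         "dotn Y_f (ks @ [k, v]) = dotn es ks + k" "dotn Y_u (ks @ [k, v]) = dotn vs ks + k"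
         "dotn Y_v (ks @ [k, v]) = dotn vs ks"
        unfolding Yw by (simp_all add: dotn_append ks lvs dotn_Cons dotn_def[of _ "[]"])
      \<comment> \<open>Both parameters agree, so \<open>poch_quot\<close> takes its cancelled
        reading and nothing is divided by a vanishing Pochhammer symbol.\<close>
      have q1: "poch_quot (- real N') (dotn Y_weights (ks @ [k, v])) (- real N') (dotn Y_f (ks @ [k, v])) =
          pochhammer (- real (X - k)) (k + 2 * v)"
      proof -
        have "- real N' + real (dotn es ks + k) = - real (X - k)" using kv by (simp add: N' of_nat_diff)
        moreover have "dotn es ks + (2 * k + 2 * v) - (dotn es ks + k) = k + 2 * v" by simp
        ultimately show ?thesis unfolding poch_quot_def dots by (simp only: if_True simp_thms) simp
      qed
      have q2: "poch_quot b (dotn Y_u (ks @ [k, v])) b (dotn Y_v (ks @ [k, v])) = pochhammer (b + real (dotn vs ks)) k"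
        by (simp add: poch_quot_def dots)
      have pG: "(\<Prod>i<length Y_weights. G i ((ks @ [k, v]) ! i)) =
          (\<Prod>i<length es. G i (ks ! i)) * (1 / fact k * (- 1 / 2) ^ k) * (1 / fact v * (1 / 4) ^ v)"
      proof -
        have "length Y_weights = Suc (Suc (length es))" by (simp add: lY les)
        moreover have "(\<Prod>i<length es. G i ((ks @ [k, v]) ! i)) = (\<Prod>i<length es. G i (ks ! i))"
          by (intro prod.cong refl) (simp add: nth_append ks)
        moreover have "G (length es) n = 1 / fact n * (- 1 / 2) ^ n" "G (Suc (length es)) n = 1 / fact n * (1 / 4) ^ n" for n
          by (simp_all add: G_def lpars les Y_args_def nth_append del: upt_Suc)
        ultimately show ?thesis using ks(1) by (simp add: nth_append)
      qed
      have c': "N' - dotn Y_weights (ks @ [k, v]) = X - (2 * k + 2 * v)" unfolding dots by (simp add: N')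
      have e: "(- 2 :: real) ^ N' = (- 2) ^ X * (- 2) ^ dotn es ks" by (simp add: N' power_add)
      show ?thesis unfolding gG e
        by (simp only: list.map prod_list.Cons prod_list.Nil prod.case q1 q2 pG c' mult_1_right) (simp only: mult_ac)
    qed
    hence "(- 2) ^ N' * (\<Sum>(k, v)\<in>?KV (N' - dotn es ks).
      ?q (ks @ [k, v]) * c ^ (N' - dotn Y_weights (ks @ [k, v])) * (\<Prod>i<length Y_weights. G i ((ks @ [k, v]) ! i))) =
      (\<Sum>(k, v)\<in>?KV X. (- 2) ^ X * (pochhammer (- real (X - k)) (k + 2 * v) * pochhammer (b + real (dotn vs ks)) k *
      (1 / fact k * (- 1 / 2) ^ k) * (1 / fact v * (1 / 4) ^ v) * c ^ (X - (2 * k + 2 * v)))) * (\<Prod>i<length es. g i (ks ! i))"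
      unfolding sum_distrib_left sum_distrib_right X_def[symmetric] by (intro sum.cong refl) auto
    thus "(- 2) ^ N' * (\<Sum>(k, v)\<in>?KV (N' - dotn es ks).
      ?q (ks @ [k, v]) * c ^ (N' - dotn Y_weights (ks @ [k, v])) * (\<Prod>i<length Y_weights. G i ((ks @ [k, v]) ! i))) =
       theta (- 2 * c) (N' - dotn es ks) (b + real (dotn vs ks)) * (\<Prod>i<length es. g i (ks ! i))"
      unfolding theta_double_sum X_def .
  qed
  also have "\<dots> = (\<Sum>n\<le>N'. \<Sum>w\<le>n. theta (- 2 * c) (N' - n) (b + real w) *
       (fps_nth (prod_list A0) (n - w) * fps_nth (prod_list A1) w))"
    using multi_index_sum_le[OF lvs ev, where N = N' and g = g and H = "\<lambda>n w. theta (- 2 * c) (N' - n) (b + real w)"] unfolding A0 A1 .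
  finally show ?thesis unfolding two_grade_sum_def A1'[symmetric] A0'[symmetric]
    by (simp only: mult_ac)
qed

end

section \<open>Partial fractions\<close>

text \<open>The roots are distinct, so splitting off the factors treated so far does not change the
  order at the next root.\<close>

lemma prod_linear_power_dvd:
  fixes x :: "nat \<Rightarrow> real" and Q :: "real poly"
  assumes "finite A" "inj_on x A" "\<And>i. i \<in> A \<Longrightarrow> [:- x i, 1:] ^ e i dvd Q"
  shows "(\<Prod>i\<in>A. [:- x i, 1:] ^ e i) dvd Q"
proof (cases "Q = 0")
  case False
  from assms show ?thesis
  proof (induction A rule: finite_induct)
    case (insert y A)
    hence "(\<Prod>i\<in>A. [:- x i, 1:] ^ e i) dvd Q" by auto
    then obtain S where S: "Q = (\<Prod>i\<in>A. [:- x i, 1:] ^ e i) * S" by (elim dvdE)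
    have nz: "poly (\<Prod>i\<in>A. [:- x i, 1:] ^ e i) (x y) \<noteq> 0"
      unfolding poly_prod using insert by (auto simp: inj_on_def)
    have "(\<Prod>i\<in>A. [:- x i, 1:] ^ e i) * S \<noteq> 0" using False S by simp
    hence "order (x y) Q = order (x y) S"
      unfolding S using nz by (simp add: order_mult order_0I)
    moreover have "e y \<le> order (x y) Q"
      using insert.prems(2)[of y] False by (simp add: order_divides)
    ultimately have "[:- x y, 1:] ^ e y dvd S" by (simp add: order_divides)
    hence "(\<Prod>i\<in>A. [:- x i, 1:] ^ e i) * [:- x y, 1:] ^ e y dvd Q"
      unfolding S by (rule mult_dvd_mono[OF dvd_refl])
    thus ?case using insert by (simp add: mult.commute)
  qed simp
qed simp

lemma pcompose_power: "pcompose (p ^ n) q = pcompose p (q :: real poly) ^ n"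
  by (induction n) (simp_all add: pcompose_mult pcompose_1)

lemma pcompose_prod_real: "pcompose (\<Prod>i\<in>A. f i) q = (\<Prod>i\<in>A. pcompose (f i) (q :: real poly))"
  by (induction A rule: infinite_finite_induct) (simp_all add: pcompose_mult pcompose_1)

lemma linear_power_dvdI:
  fixes X :: "real poly"
  assumes "\<And>k. k < n \<Longrightarrow> coeff (pcompose X [:- x, 1:]) k = 0"
  shows "[:x, 1:] ^ n dvd X"
proof -
  have "monom 1 n dvd pcompose X [:- x, 1:]"
    using assms by (simp add: monom_1_dvd_iff')
  then obtain S where "pcompose X [:- x, 1:] = monom 1 n * S" by (elim dvdE)
  hence "pcompose (pcompose X [:- x, 1:]) [:x, 1:] = pcompose ([:0, 1:] ^ n * S) [:x, 1:]"
    by (simp add: monom_altdef)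
  also have "pcompose (pcompose X [:- x, 1:]) [:x, 1:] = pcompose X (pcompose [:- x, 1:] [:x, 1:])"
    by (rule pcompose_assoc[symmetric])
  also have "pcompose [:- x, 1:] [:x, 1:] = [:0, 1:]" by (simp add: pcompose_pCons)
  also have "pcompose X [:0, 1:] = X" by simp
  finally have "X = [:x, 1:] ^ n * pcompose S [:x, 1:]"
    by (simp add: pcompose_mult pcompose_power pcompose_pCons)
  thus ?thesis by (metis dvd_triv_left)
qed

lemma fps_mult_nth_cong:
  assumes "\<And>j. j \<le> i \<Longrightarrow> fps_nth A j = fps_nth A' j"
  shows "fps_nth (A * B) i = fps_nth (A' * B) i"
  unfolding fps_mult_nth by (intro sum.cong refl) (use assms in auto)

lemma fps_of_poly_linear: "fps_of_poly [:c, e:] = fps_const (c :: real) + fps_const e * fps_X"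
  by (rule fps_ext) (auto simp: coeff_pCons split: nat.split)

lemma smult_sum_right: "smult c (\<Sum>i\<in>A. f i) = (\<Sum>i\<in>A. smult c (f i :: real poly))"
  by (induction A rule: infinite_finite_induct) (simp_all add: smult_add_right)

lemma fps_const_prod: "fps_const (\<Prod>i\<in>A. f i) = (\<Prod>i\<in>A. fps_const (f i :: real))"
  by (induction A rule: infinite_finite_induct) (simp_all flip: fps_const_mult)

lemma fps_prod_nth_zero: "fps_nth (\<Prod>i\<in>A. f i) 0 = (\<Prod>i\<in>A. fps_nth (f i :: real fps) 0)"
  by (induction A rule: infinite_finite_induct) simp_all

text \<open>The case of \<open>multi_index_sum\<close> with a single grade: all weights are 1 and
  the second weight is zero.\<close>

lemma homogeneous_sum_eq:
  assumes "length b = length x"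
  shows "homogeneous_sum k b x = fps_nth (prod_list (map2 bin_fps b x)) k"
proof -
  let ?n = "length x"
  let ?es = "replicate ?n (1::nat)" and ?vs = "replicate ?n (0::nat)"
  let ?g = "\<lambda>i n. pochhammer (b ! i) n * x ! i ^ n / fact n"
  have "dotn ?es \<alpha> = sum_list \<alpha>" "dotn ?vs \<alpha> = 0" if "length \<alpha> = ?n" for \<alpha>
    using that by (auto simp: dotn_def sum_list_sum_nth atLeast0LessThan)
  hence set: "{\<alpha>. length \<alpha> = ?n \<and> sum_list \<alpha> = k} =
      {\<alpha>. length \<alpha> = length ?es \<and> dotn ?es \<alpha> = k \<and> dotn ?vs \<alpha> = 0}"
    by auto
  have "homogeneous_sum k b x = fps_nth (\<Prod>i<length ?es. if ?vs ! i = 0 then weighted_fps (?es ! i) (?g i) else 1) (k - 0) *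
       fps_nth (\<Prod>i<length ?es. if ?vs ! i = 0 then 1 else weighted_fps (?es ! i) (?g i)) 0"
    unfolding homogeneous_sum_def set
    using multi_index_sum[of ?vs ?es ?g k 0] by (simp add: mult_ac)
  also have "(\<Prod>i<length ?es. if ?vs ! i = 0 then 1 else weighted_fps (?es ! i) (?g i)) = 1"
    by (rule prod.neutral) simp
  also have "(\<Prod>i<length ?es. if ?vs ! i = 0 then weighted_fps (?es ! i) (?g i) else 1) = prod_list (map2 bin_fps b x)"
    by (rule prod_list_eq_prod_nth) (use assms in \<open>simp_all add: weighted_fps_bin\<close>)
  finally show ?thesis by simp
qed

lemma concat_map_if: "concat (map (\<lambda>h. if P h then [f h] else []) xs) = map f (filter P xs)"
  by (induction xs) auto

section \<open>Recurrences of the pole and monomial functions, and partial fractions\<close>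

locale mixed_hermite_balanced = mixed_hermite_decay +
  assumes balanced: "j \<in> {1..r + 1} \<Longrightarrow> j' \<in> {1..r + 1} \<Longrightarrow> lam j \<le> lam j' + 1"
    and N_pos: "(\<Sum>j=1..r + 1. lam j) \<ge> 1"
    and m_sum: "(\<Sum>i=1..p. m i) = (\<Sum>j=1..r + 1. lam j) - 1"
    and \<xi>_gt_\<rho>: "i \<in> {1..p} \<Longrightarrow> h \<in> {1..r} \<Longrightarrow> \<xi> i + \<rho> h > 0"
    and inj_active: "inj_on \<rho> active"
begin

definition row_prod :: "(nat \<Rightarrow> nat) \<Rightarrow> real poly" where
  "row_prod \<epsilon> = (\<Prod>h=1..r. [:\<rho> h, 1:] ^ \<epsilon> h)"

abbreviation lower :: "(nat \<Rightarrow> nat) \<Rightarrow> nat \<Rightarrow> nat \<Rightarrow> nat" where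
  "lower \<epsilon> h \<equiv> \<epsilon>(h := \<epsilon> h - 1)"

lemma Dpoly_eq_row_prod: "Dpoly = row_prod lam" by (simp add: Dpoly_def row_prod_def)

lemma row_prod_upd:
  assumes "j \<in> {1..r}"
  shows "row_prod (\<epsilon>(j := e)) = [:\<rho> j, 1:] ^ e * (\<Prod>h\<in>{1..r} - {j}. [:\<rho> h, 1:] ^ \<epsilon> h)"
proof -
  have "row_prod (\<epsilon>(j := e)) = [:\<rho> j, 1:] ^ e * (\<Prod>h\<in>{1..r} - {j}. [:\<rho> h, 1:] ^ (\<epsilon>(j := e)) h)"
    unfolding row_prod_def using assms by (subst prod.remove[of _ j]) auto
  also have "(\<Prod>h\<in>{1..r} - {j}. [:\<rho> h, 1:] ^ (\<epsilon>(j := e)) h) = (\<Prod>h\<in>{1..r} - {j}. [:\<rho> h, 1:] ^ \<epsilon> h)"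
    by (intro prod.cong) auto
  finally show ?thesis .
qed

lemma row_prod_lower:
  assumes "j \<in> {1..r}" "\<epsilon> j \<ge> 1"
  shows "row_prod \<epsilon> = [:\<rho> j, 1:] * row_prod (lower \<epsilon> j)"
proof -
  obtain e where e: "\<epsilon> j = Suc e" using assms(2) by (cases "\<epsilon> j") auto
  have "row_prod \<epsilon> = row_prod (\<epsilon>(j := Suc e))" using e by (metis fun_upd_triv)
  moreover have "lower \<epsilon> j = \<epsilon>(j := e)" by (simp add: e)
  ultimately show ?thesis by (simp only: row_prod_upd[OF assms(1)] power_Suc mult.assoc)
qed

lemma pderiv_row_prod: "pderiv (row_prod \<epsilon>) = (\<Sum>h=1..r. smult (real (\<epsilon> h)) (row_prod (lower \<epsilon> h)))"
proof -
  have "pderiv (row_prod \<epsilon>) = (\<Sum>h=1..r. (\<Prod>h\<in>{1..r} - {h}. [:\<rho> h, 1:] ^ \<epsilon> h) * pderiv ([:\<rho> h, 1:] ^ \<epsilon> h))"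
    unfolding row_prod_def by (rule pderiv_prod)
  also have "\<dots> = (\<Sum>h=1..r. smult (real (\<epsilon> h)) (row_prod (lower \<epsilon> h)))"
  proof (intro sum.cong refl)
    fix h assume h: "h \<in> {1..r}"
    have "pderiv ([:\<rho> h, 1:] ^ \<epsilon> h) = smult (real (\<epsilon> h)) ([:\<rho> h, 1:] ^ (\<epsilon> h - 1))"
    proof (cases "\<epsilon> h")
      case (Suc e)
      have "pderiv ([:\<rho> h, 1:] ^ Suc e) = smult (real (Suc e)) ([:\<rho> h, 1:] ^ e) * pderiv [:\<rho> h, 1:]"
        by (simp only: pderiv_power_Suc)
      also have "pderiv [:\<rho> h, 1:] = 1" by (simp add: pderiv_pCons)
      finally show ?thesis using Suc by simp
    qed simp
    thus "(\<Prod>h\<in>{1..r} - {h}. [:\<rho> h, 1:] ^ \<epsilon> h) * pderiv ([:\<rho> h, 1:] ^ \<epsilon> h) = smult (real (\<epsilon> h)) (row_prod (lower \<epsilon> h))"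
      by (simp add: row_prod_upd[OF h] mult.commute)
  qed
  finally show ?thesis .
qed

text \<open>Differentiating the product returns the symbol lowered at row h with coefficient
  \<epsilon> h, while \<open>E\<close> subtracts it lam h + d h times. The net coefficient is the
  pole order lam h - \<epsilon> h relative to \<open>Dpoly\<close>, plus d h.\<close>

lemma times_id_row_prod:
  assumes \<epsilon>: "\<And>h. h \<in> {1..r} \<Longrightarrow> \<epsilon> h \<ge> 1"
  shows "t * pdop (q * row_prod \<epsilon>) E t = pdop (pderiv q * row_prod \<epsilon>) E t + pdop ([:a, 1 / 2:] * (q * row_prod \<epsilon>)) E t
     - (\<Sum>h=1..r. (real (lam h) - real (\<epsilon> h) + d h) * pdop (q * row_prod (lower \<epsilon> h)) E t)"
proof -
  have "q * row_prod \<epsilon> = [:\<rho> h, 1:] * (q * row_prod (lower \<epsilon> h))" if "h \<in> {1..r}" for h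
    by (subst row_prod_lower[of h \<epsilon>, OF that \<epsilon>[OF that]]) (rule mult.left_commute)
  from times_id_pdop_E[OF this]
  have "t * pdop (q * row_prod \<epsilon>) E t = pdop (pderiv (q * row_prod \<epsilon>) + [:a, 1 / 2:] * (q * row_prod \<epsilon>)
      - (\<Sum>h=1..r. smult (real (lam h) + d h) (q * row_prod (lower \<epsilon> h)))) E t" .
  also have "\<dots> = pdop (pderiv q * row_prod \<epsilon>) E t + pdop ([:a, 1 / 2:] * (q * row_prod \<epsilon>)) E t +
      ((\<Sum>h=1..r. real (\<epsilon> h) * pdop (q * row_prod (lower \<epsilon> h)) E t) -
       (\<Sum>h=1..r. (real (lam h) + d h) * pdop (q * row_prod (lower \<epsilon> h)) E t))"
    unfolding pderiv_mult pderiv_row_prod sum_distrib_left mult_smult_right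
    by (simp only: pdop_add pdop_diff pdop_sum pdop_smult mult.commute[of "row_prod \<epsilon>"])
  also have "(\<Sum>h=1..r. real (\<epsilon> h) * pdop (q * row_prod (lower \<epsilon> h)) E t) -
       (\<Sum>h=1..r. (real (lam h) + d h) * pdop (q * row_prod (lower \<epsilon> h)) E t) =
     - (\<Sum>h=1..r. (real (lam h) - real (\<epsilon> h) + d h) * pdop (q * row_prod (lower \<epsilon> h)) E t)"
    by (simp add: sum_subtractf[symmetric] sum_negf[symmetric] algebra_simps)
  finally show ?thesis by simp
qed

text \<open>Allows the recurrences, which occur only when some entry is at least 2, to lower the
  exponent of every row.\<close>

lemma all_active:
  assumes "j \<in> {1..r + 1}" "lam j \<ge> 2" "h \<in> {1..r}"
  shows "lam h \<ge> 1"
  using balanced[of j h] assms by auto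

lemma active_iff: "h \<in> active \<longleftrightarrow> h \<in> {1..r} \<and> lam h \<ge> 1"
  by (auto simp: active_def)

definition pole_poly :: "nat \<Rightarrow> nat \<Rightarrow> real poly" where
  "pole_poly J s = row_prod (lam(J := lam J - s))"

lemma pole_poly_0: "pole_poly J 0 = Dpoly" by (simp add: pole_poly_def Dpoly_eq_row_prod)

text \<open>After division by \<open>Dpoly\<close> this is the partial fraction expansion of 1 /
  ((\<rho> h + z) (\<rho> J + z)^s). It brings the mixed terms back to functions of pole J and the
  simple pole at h.\<close>

lemma other_pole_expansion:
  assumes J: "J \<in> {1..r}" and h: "h \<in> {1..r}" "h \<noteq> J" "lam h \<ge> 1" and ne: "\<rho> h \<noteq> \<rho> J" and s: "s \<le> lam J"
  shows "row_prod (lower (lam(J := lam J - s)) h) = smult (x_pole J h ^ s) (pole_poly h 1) -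
    (\<Sum>i<s. smult (x_pole J h ^ (i + 1)) (pole_poly J (s - i)))"
  using s
proof (induction s)
  case 0
  have 0: "lower (lam(J := lam J - 0)) h = lower lam h" using h by (auto simp: fun_eq_iff)
  show ?case by (simp only: 0 pole_poly_def power_0 smult_1_left lessThan_0 sum.empty diff_zero fun_upd_triv)
next
  case (Suc s)
  let ?x = "x_pole J h"
  let ?V = "\<lambda>s. row_prod (lower (lam(J := lam J - s)) h)"
  have x: "?x * (\<rho> h - \<rho> J) = - 1" using ne by (simp add: x_pole_def field_simps)
  have up1: "pole_poly J (Suc s) = [:\<rho> h, 1:] * ?V (Suc s)"
    unfolding pole_poly_def by (rule row_prod_lower) (use h in auto)
  have up2: "?V s = [:\<rho> J, 1:] * ?V (Suc s)"
  proof -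
    have e: "lower (lower (lam(J := lam J - s)) h) J = lower (lam(J := lam J - Suc s)) h"
      using h(2) by (auto simp: fun_eq_iff)
    show ?thesis
      unfolding e[symmetric] by (rule row_prod_lower[OF J]) (use Suc.prems h(2) in auto)
  qed
  have "pole_poly J (Suc s) = ?V s + smult (\<rho> h - \<rho> J) (?V (Suc s))"
    unfolding up1 up2 by (simp add: algebra_simps smult_diff_left)
  hence "smult ?x (pole_poly J (Suc s)) = smult ?x (?V s) + smult (?x * (\<rho> h - \<rho> J)) (?V (Suc s))"
    by (simp add: smult_add_right)
  hence "?V (Suc s) = smult ?x (?V s) - smult ?x (pole_poly J (Suc s))"
    unfolding x by (simp add: algebra_simps)
  also have "?V s = smult (?x ^ s) (pole_poly h 1) - (\<Sum>i<s. smult (?x ^ (i + 1)) (pole_poly J (s - i)))"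
    by (rule Suc.IH) (use Suc.prems in simp)
  also have "smult ?x \<dots> = smult (?x ^ Suc s) (pole_poly h 1) - (\<Sum>i<s. smult (?x ^ (Suc i + 1)) (pole_poly J (Suc s - Suc i)))"
    by (simp add: smult_diff_right smult_sum_right)
  finally have fin: "?V (Suc s) = smult (?x ^ Suc s) (pole_poly h 1) -
      (\<Sum>i<s. smult (?x ^ (Suc i + 1)) (pole_poly J (Suc s - Suc i))) - smult ?x (pole_poly J (Suc s))" .
  show ?case unfolding fin by (subst sum.lessThan_Suc_shift) simp
qed

definition pole_value :: "nat \<Rightarrow> nat \<Rightarrow> real \<Rightarrow> real" where
  "pole_value J s t = pdop (pole_poly J s) E t"

lemma pole_value_0: "pole_value J 0 t = F t"
  by (simp add: pole_value_def pole_poly_0 F_eq)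

lemma pole_value_1: "h \<in> active \<Longrightarrow> gamma_avg (\<rho> h) 1 F t = \<rho> h * pole_value h 1 t"
  unfolding pole_value_def pole_poly_def active_iff Dpoly_eq_row_prod
  by (rule U_eq) (simp_all only: Dpoly_eq_row_prod row_prod_lower[of h lam, symmetric])

text \<open>Obtained by letting t act on \<open>pole_poly J s\<close>. Writing a + z / 2 = (a -
  \<rho> J / 2) + (\<rho> J + z) / 2 explains the shifted centre and the term of order s - 1; row J
  itself contributes s + d J times the function of order s + 1.\<close>

lemma pole_value_rec:
  assumes J: "J \<in> {1..r}" and s: "1 \<le> s" "s < lam J"
  shows "(real s + d J) * pole_value J (s + 1) t = (a - \<rho> J / 2 - t) * pole_value J s t + pole_value J (s - 1) t / 2 +
      (\<Sum>h\<in>{1..r} - {J}. d h * ((\<Sum>i<s. x_pole J h ^ (i + 1) * pole_value J (s - i) t) - x_pole J h ^ s * pole_value h 1 t))"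
proof -
  let ?\<epsilon> = "lam(J := lam J - s)"
  have act: "lam h \<ge> 1" if "h \<in> {1..r}" for h
    by (rule all_active[of J]) (use J s that in auto)
  have \<epsilon>: "?\<epsilon> h \<ge> 1" if "h \<in> {1..r}" for h using act[OF that] s by auto
  have ne: "\<rho> h \<noteq> \<rho> J" if "h \<in> {1..r} - {J}" for h
    using inj_onD[OF inj_active, of h J] act J that by (auto simp: active_iff)
  have e1: "lower ?\<epsilon> J = lam(J := lam J - (s + 1))" by auto
  have up: "pole_poly J (s - 1) = [:\<rho> J, 1:] * pole_poly J s"
  proof -
    have "lower (lam(J := lam J - (s - 1))) J = ?\<epsilon>" using s by (auto simp: fun_eq_iff)
    thus ?thesis unfolding pole_poly_def by (subst row_prod_lower[OF J]) (use s in auto)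
  qed
  have a: "pdop ([:a, 1 / 2:] * row_prod ?\<epsilon>) E t = (a - \<rho> J / 2) * pole_value J s t + pole_value J (s - 1) t / 2"
  proof -
    have "[:a, 1 / 2:] * row_prod ?\<epsilon> = smult (a - \<rho> J / 2) (pole_poly J s) + smult (1 / 2) (pole_poly J (s - 1))"
      unfolding up unfolding pole_poly_def by (simp add: algebra_simps smult_diff_left smult_add_right)
    thus ?thesis by (simp add: pdop_add pdop_smult pole_value_def)
  qed
  have V: "pdop (row_prod (lower ?\<epsilon> h)) E t = x_pole J h ^ s * pole_value h 1 t - (\<Sum>i<s. x_pole J h ^ (i + 1) * pole_value J (s - i) t)"
    if "h \<in> {1..r} - {J}" for h
    using that by (subst other_pole_expansion[OF J _ _ act ne])
      (use s in \<open>auto simp: pdop_diff pdop_sum pdop_smult pole_value_def\<close>)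
  have "t * pole_value J s t = (a - \<rho> J / 2) * pole_value J s t + pole_value J (s - 1) t / 2
     - (\<Sum>h=1..r. (real (lam h) - real (?\<epsilon> h) + d h) * pdop (row_prod (lower ?\<epsilon> h)) E t)"
    using times_id_row_prod[of ?\<epsilon> t 1, OF \<epsilon>] unfolding mult_1_left a by (simp add: pole_value_def pole_poly_def)
  also have "(\<Sum>h=1..r. (real (lam h) - real (?\<epsilon> h) + d h) * pdop (row_prod (lower ?\<epsilon> h)) E t) =
     (real s + d J) * pole_value J (s + 1) t + (\<Sum>h\<in>{1..r} - {J}. d h * pdop (row_prod (lower ?\<epsilon> h)) E t)"
  proof -
    have "real (lam J) - real (?\<epsilon> J) = real s" using s by (simp add: of_nat_diff)
    thus ?thesis using J
      by (subst sum.remove[of _ J]) (simp_all add: e1 pole_value_def pole_poly_def)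
  qed
  also have "(\<Sum>h\<in>{1..r} - {J}. d h * pdop (row_prod (lower ?\<epsilon> h)) E t) =
    - (\<Sum>h\<in>{1..r} - {J}. d h * ((\<Sum>i<s. x_pole J h ^ (i + 1) * pole_value J (s - i) t) - x_pole J h ^ s * pole_value h 1 t))"
    unfolding sum_negf[symmetric] by (intro sum.cong refl) (subst V, assumption, simp add: algebra_simps)
  finally show ?thesis by (simp add: algebra_simps)
qed

text \<open>Division of z^s by z + \<rho> h with remainder (-\<rho> h)^s, multiplied by
  \<open>pole_poly h 1\<close>.\<close>

lemma monom_pole_expansion:
  assumes h: "h \<in> {1..r}" "lam h \<ge> 1"
  shows "monom 1 s * pole_poly h 1 = (\<Sum>i<s. smult ((- \<rho> h) ^ i) (monom 1 (s - 1 - i) * Dpoly)) + smult ((- \<rho> h) ^ s) (pole_poly h 1)"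
proof (induction s)
  case 0
  show ?case by simp
next
  case (Suc s)
  have D: "Dpoly = [:\<rho> h, 1:] * pole_poly h 1"
    unfolding Dpoly_eq_row_prod pole_poly_def by (rule row_prod_lower[of h lam, OF h])
  have "monom 1 (Suc s) * pole_poly h 1 = monom 1 s * Dpoly + smult (- \<rho> h) (monom 1 s * pole_poly h 1)"
    unfolding D by (simp add: monom_Suc algebra_simps)
  also have "monom 1 s * pole_poly h 1 = (\<Sum>i<s. smult ((- \<rho> h) ^ i) (monom 1 (s - 1 - i) * Dpoly)) + smult ((- \<rho> h) ^ s) (pole_poly h 1)"
    by (rule Suc.IH)
  also have "smult (- \<rho> h) \<dots> = (\<Sum>i<s. smult ((- \<rho> h) ^ Suc i) (monom 1 (Suc s - 1 - Suc i) * Dpoly)) + smult ((- \<rho> h) ^ Suc s) (pole_poly h 1)"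
    by (simp add: smult_add_right smult_sum_right)
  finally show ?case by (subst sum.lessThan_Suc_shift) (simp add: add.assoc)
qed

definition monom_value :: "nat \<Rightarrow> real \<Rightarrow> real" where
  "monom_value s t = pdop (monom 1 s * Dpoly) E t"

text \<open>Obtained by letting t act on z^s \<open>Dpoly\<close>. The highest monomial arises from
  z / 2, so solving for it doubles all other terms.\<close>

lemma monom_value_rec:
  assumes s: "s + 1 < lam (r + 1)"
  shows "monom_value (s + 1) t = (- 2 * (a - t)) * monom_value s t - 2 * real s * monom_value (s - 1) t +
      2 * (\<Sum>h=1..r. d h * ((\<Sum>i<s. (- \<rho> h) ^ i * monom_value (s - 1 - i) t) + (- \<rho> h) ^ s * pole_value h 1 t))"
proof -
  have act: "lam h \<ge> 1" if "h \<in> {1..r}" for h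
    by (rule all_active[of "r + 1"]) (use s that in auto)
  have "pderiv (monom 1 s) = smult (real s) (monom 1 (s - 1) :: real poly)"
    by (simp add: pderiv_monom smult_monom)
  hence p: "pdop (pderiv (monom 1 s) * row_prod lam) E t = real s * monom_value (s - 1) t"
    by (simp add: monom_value_def Dpoly_eq_row_prod pdop_smult)
  have "[:a, 1 / 2:] * (monom 1 s * row_prod lam) = smult a (monom 1 s * Dpoly) + smult (1 / 2) (monom 1 (s + 1) * Dpoly)"
    by (simp add: Dpoly_eq_row_prod monom_Suc algebra_simps)
  hence a: "pdop ([:a, 1 / 2:] * (monom 1 s * row_prod lam)) E t = a * monom_value s t + monom_value (s + 1) t / 2"
    by (simp add: pdop_add pdop_smult monom_value_def)
  have V: "pdop (monom 1 s * row_prod (lower lam h)) E t = (\<Sum>i<s. (- \<rho> h) ^ i * monom_value (s - 1 - i) t) + (- \<rho> h) ^ s * pole_value h 1 t"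
    if h: "h \<in> {1..r}" for h
    using monom_pole_expansion[OF h act[OF h], of s] unfolding pole_poly_def
    by (simp add: pdop_add pdop_sum pdop_smult monom_value_def pole_value_def pole_poly_def)
  have "t * monom_value s t = real s * monom_value (s - 1) t + (a * monom_value s t + monom_value (s + 1) t / 2) -
     (\<Sum>h=1..r. d h * pdop (monom 1 s * row_prod (lower lam h)) E t)"
    using times_id_row_prod[of lam t "monom 1 s", OF act] unfolding a p by (simp add: monom_value_def Dpoly_eq_row_prod)
  also have "(\<Sum>h=1..r. d h * pdop (monom 1 s * row_prod (lower lam h)) E t) =
    (\<Sum>h=1..r. d h * ((\<Sum>i<s. (- \<rho> h) ^ i * monom_value (s - 1 - i) t) + (- \<rho> h) ^ s * pole_value h 1 t))"
    by (intro sum.cong refl) (simp only: V)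
  finally show ?thesis by (simp add: algebra_simps)
qed

subsection \<open>Expansion of the symbol\<close>

definition pole_coeff :: "nat \<Rightarrow> nat \<Rightarrow> real" where
  "pole_coeff J k = kappa J * fps_nth (pole_weight_fps J) k"

definition infinity_coeff :: "nat \<Rightarrow> real" where
  "infinity_coeff k = (- 1) ^ M * fps_nth infinity_weight_fps k"

text \<open>In the variable \<open>\<rho> J + z\<close> each factor is its value at the pole times a
  power of some 1 - x X, and \<open>kappa J\<close> collects the values. Rows with exponent 0
  contribute 1 even if their rate equals that of J.\<close>

lemma kappa_times_denominator:
  assumes J: "J \<in> active"
  shows "fps_const (kappa J) * pole_weight_fps J * fps_of_poly (\<Prod>h\<in>{1..r} - {J}. [:\<rho> h - \<rho> J, 1:] ^ lam h) =
    fps_of_poly (\<Prod>i=1..p. [:\<xi> i + \<rho> J, - 1:] ^ m i)"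
proof -
  have Jr: "J \<in> {1..r}" using J by (simp add: active_iff)
  have num: "fps_of_poly (\<Prod>i=1..p. [:\<xi> i + \<rho> J, - 1:] ^ m i) =
     fps_const (\<Prod>i=1..p. (\<xi> i + \<rho> J) ^ m i) * (\<Prod>i=1..p. bin_fps (- real (m i)) (1 / (\<xi> i + \<rho> J)))"
  proof -
    have "fps_of_poly ([:\<xi> i + \<rho> J, - 1:] ^ m i) = fps_const ((\<xi> i + \<rho> J) ^ m i) * bin_fps (- real (m i)) (1 / (\<xi> i + \<rho> J))"
      if i: "i \<in> {1..p}" for i
    proof -
      let ?x = "\<xi> i + \<rho> J"
      have "?x \<noteq> 0" using \<xi>_gt_\<rho>[OF i Jr] by simp
      hence "fps_of_poly [:?x, - 1:] = fps_const ?x * (1 - fps_const (1 / ?x) * fps_X)"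
        unfolding fps_of_poly_linear by (intro fps_ext) (simp add: distrib_left right_diff_distrib mult.assoc[symmetric])
      thus ?thesis
        by (simp only: fps_of_poly_power bin_fps_minus_of_nat power_mult_distrib fps_const_power)
    qed
    thus ?thesis by (simp add: fps_of_poly_prod prod.distrib fps_const_prod del: fps_of_poly_power)
  qed
  have den: "fps_of_poly (\<Prod>h\<in>{1..r} - {J}. [:\<rho> h - \<rho> J, 1:] ^ lam h) =
     fps_const (\<Prod>h\<in>{1..r} - {J}. (\<rho> h - \<rho> J) ^ lam h) * (\<Prod>h\<in>{1..r} - {J}. bin_fps (- real (lam h)) (x_pole J h))"
  proof -
    have "fps_of_poly ([:\<rho> h - \<rho> J, 1:] ^ lam h) = fps_const ((\<rho> h - \<rho> J) ^ lam h) * bin_fps (- real (lam h)) (x_pole J h)"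
      if h: "h \<in> {1..r} - {J}" for h
    proof (cases "lam h = 0")
      case False
      let ?x = "\<rho> h - \<rho> J"
      have "?x \<noteq> 0" using inj_onD[OF inj_active, of h J] J h False by (auto simp: active_iff)
      hence "fps_of_poly [:?x, 1:] = fps_const ?x * (1 - fps_const (x_pole J h) * fps_X)"
        unfolding fps_of_poly_linear x_pole_def
        by (intro fps_ext) (simp add: distrib_left right_diff_distrib mult.assoc[symmetric])
      thus ?thesis
        by (simp only: fps_of_poly_power bin_fps_minus_of_nat power_mult_distrib fps_const_power)
    qed simp
    thus ?thesis by (simp add: fps_of_poly_prod prod.distrib fps_const_prod del: fps_of_poly_power)
  qed
  have nz: "(\<Prod>h\<in>{1..r} - {J}. (\<rho> h - \<rho> J) ^ lam h) \<noteq> 0"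
  proof -
    have "(\<rho> h - \<rho> J) ^ lam h \<noteq> 0" if h: "h \<in> {1..r} - {J}" for h
    proof (cases "lam h = 0")
      case False
      thus ?thesis using inj_onD[OF inj_active, of h J] J h by (auto simp: active_iff)
    qed simp
    thus ?thesis by simp
  qed
  have k: "kappa J * (\<Prod>h\<in>{1..r} - {J}. (\<rho> h - \<rho> J) ^ lam h) = (\<Prod>i=1..p. (\<xi> i + \<rho> J) ^ m i)"
  proof -
    have "(\<Prod>h\<in>active - {J}. (\<rho> h - \<rho> J) ^ lam h) = (\<Prod>h\<in>{1..r} - {J}. (\<rho> h - \<rho> J) ^ lam h)"
    proof (rule prod.mono_neutral_left)
      show "\<forall>h\<in>({1..r} - {J}) - (active - {J}). (\<rho> h - \<rho> J) ^ lam h = 1"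
      proof
        fix h assume "h \<in> ({1..r} - {J}) - (active - {J})"
        hence "lam h = 0" by (auto simp: active_iff)
        thus "(\<rho> h - \<rho> J) ^ lam h = 1" by simp
      qed
    qed (auto simp: active_iff)
    thus ?thesis using nz by (simp add: kappa_def)
  qed
  have inv: "(\<Prod>h\<in>{1..r} - {J}. bin_fps (real (lam h)) (x_pole J h)) *
      (\<Prod>h\<in>{1..r} - {J}. bin_fps (- real (lam h)) (x_pole J h)) = 1"
    by (simp add: prod.distrib[symmetric] bin_fps_inverse)
  let ?A = "\<Prod>i=1..p. bin_fps (- real (m i)) (1 / (\<xi> i + \<rho> J))"
  let ?B = "\<Prod>h\<in>{1..r} - {J}. bin_fps (real (lam h)) (x_pole J h)"
  let ?B' = "\<Prod>h\<in>{1..r} - {J}. bin_fps (- real (lam h)) (x_pole J h)"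
  let ?c = "\<Prod>h\<in>{1..r} - {J}. (\<rho> h - \<rho> J) ^ lam h"
  have "fps_const (kappa J) * pole_weight_fps J * (fps_const ?c * ?B') = (fps_const (kappa J) * fps_const ?c) * ?A * (?B * ?B')"
    unfolding pole_weight_fps_def by (simp only: mult_ac)
  thus ?thesis unfolding num den inv fps_const_mult k by simp
qed

lemma degree_row_prod: "degree (row_prod \<epsilon>) = (\<Sum>h=1..r. \<epsilon> h)" and row_prod_nonzero: "row_prod \<epsilon> \<noteq> 0"
proof -
  have "\<forall>h\<in>{1..r}. [:\<rho> h, 1:] ^ \<epsilon> h \<noteq> 0" by simp
  thus "degree (row_prod \<epsilon>) = (\<Sum>h=1..r. \<epsilon> h)"
    unfolding row_prod_def by (subst degree_prod_eq_sum_degree) (auto simp: degree_power_eq)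
  show "row_prod \<epsilon> \<noteq> 0" unfolding row_prod_def by simp
qed

lemma degree_Ppoly: "degree Ppoly = M" and Ppoly_nonzero: "Ppoly \<noteq> 0"
proof -
  have "\<forall>i\<in>{1..p}. [:\<xi> i, - 1:] ^ m i \<noteq> 0" by simp
  thus "degree Ppoly = M"
    unfolding Ppoly_def M_def by (subst degree_prod_eq_sum_degree) (auto simp: degree_power_eq)
  show "Ppoly \<noteq> 0" unfolding Ppoly_def by simp
qed

lemma M_eq: "M + 1 = (\<Sum>h=1..r. lam h) + R"
proof -
  have "(\<Sum>j=1..r + 1. lam j) = (\<Sum>h=1..r. lam h) + R" by (simp add: R_def)
  thus ?thesis using m_sum N_pos by (simp add: M_def)
qed

definition infinity_part :: "real poly" where
  "infinity_part = (\<Sum>s<R. monom (infinity_coeff (R - 1 - s)) s)"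

lemma coeff_infinity_part: "coeff infinity_part k = (if k < R then infinity_coeff (R - 1 - k) else 0)"
proof -
  have "coeff infinity_part k = (\<Sum>s<R. if s = k then infinity_coeff (R - 1 - s) else 0)"
    by (simp add: infinity_part_def coeff_sum)
  thus ?thesis by simp
qed

text \<open>After \<open>reflect_poly\<close> the top coefficients become low ones, and the claim is
  a congruence modulo X^R: \<open>infinity_part\<close> is the truncation of the expansion of
  \<open>Ppoly / Dpoly\<close> at infinity. Above degree M neither polynomial has
  coefficients.\<close>

lemma coeff_infinity_diff:
  assumes "k \<ge> (\<Sum>h=1..r. lam h)"
  shows "coeff (Ppoly - Dpoly * infinity_part) k = 0"
proof (cases "R = 0")
  case True
  hence "infinity_part = 0" by (simp add: infinity_part_def)
  thus ?thesis using assms degree_Ppoly M_eq True by (simp add: coeff_eq_0)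
next
  case False
  define L where "L = (\<Sum>h=1..r. lam h)"
  have M: "M = L + (R - 1)" using M_eq False by (simp add: L_def)
  have w0: "fps_nth infinity_weight_fps 0 = 1"
    by (simp add: infinity_weight_fps_def fps_prod_nth_zero)
  hence lead: "coeff infinity_part (R - 1) \<noteq> 0"
    using False by (simp add: coeff_infinity_part infinity_coeff_def)
  have deg: "degree infinity_part = R - 1"
    using lead by (intro antisym le_degree degree_le) (auto simp: coeff_infinity_part)
  have nz: "infinity_part \<noteq> 0" using lead by auto
  have degD: "degree (Dpoly * infinity_part) = M"
    using nz row_prod_nonzero by (simp add: Dpoly_eq_row_prod degree_mult_eq degree_row_prod deg M L_def)
  have rP: "fps_of_poly (reflect_poly Ppoly) = fps_const ((- 1) ^ M) * (\<Prod>i=1..p. bin_fps (- real (m i)) (\<xi> i))"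
  proof -
    have "fps_of_poly (reflect_poly [:\<xi> i, - 1:]) = fps_const (- 1) * (1 - fps_const (\<xi> i) * fps_X)" for i
    proof -
      have "reflect_poly [:\<xi> i, - 1:] = [:- 1, \<xi> i:]"
        by (rule poly_eqI) (auto simp: coeff_reflect_poly coeff_pCons split: nat.splits)
      thus ?thesis by (simp add: fps_of_poly_linear right_diff_distrib flip: fps_const_neg)
    qed
    hence "fps_of_poly (reflect_poly ([:\<xi> i, - 1:] ^ m i)) = fps_const ((- 1) ^ m i) * bin_fps (- real (m i)) (\<xi> i)" for i
      by (simp only: reflect_poly_power fps_of_poly_power bin_fps_minus_of_nat power_mult_distrib fps_const_power)
    thus ?thesis unfolding Ppoly_def M_def
      by (simp add: reflect_poly_prod fps_of_poly_prod prod.distrib power_sum flip: fps_const_prod)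
  qed
  have rD: "fps_of_poly (reflect_poly Dpoly) = (\<Prod>h=1..r. bin_fps (- real (lam h)) (- \<rho> h))"
  proof -
    have "fps_of_poly (reflect_poly [:\<rho> h, 1:]) = 1 - fps_const (- \<rho> h) * fps_X" for h
    proof -
      have "reflect_poly [:\<rho> h, 1:] = [:1, \<rho> h:]"
        by (rule poly_eqI) (auto simp: coeff_reflect_poly coeff_pCons split: nat.splits)
      thus ?thesis by (simp add: fps_of_poly_linear flip: fps_const_neg)
    qed
    hence "fps_of_poly (reflect_poly ([:\<rho> h, 1:] ^ lam h)) = bin_fps (- real (lam h)) (- \<rho> h)" for h
      by (simp only: reflect_poly_power fps_of_poly_power bin_fps_minus_of_nat)
    thus ?thesis unfolding Dpoly_def by (simp add: reflect_poly_prod fps_of_poly_prod)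
  qed
  have key: "fps_const ((- 1) ^ M) * infinity_weight_fps * fps_of_poly (reflect_poly Dpoly) = fps_of_poly (reflect_poly Ppoly)"
  proof -
    have "(\<Prod>h=1..r. bin_fps (real (lam h)) (- \<rho> h)) * (\<Prod>h=1..r. bin_fps (- real (lam h)) (- \<rho> h)) = 1"
      by (simp add: prod.distrib[symmetric] bin_fps_inverse)
    thus ?thesis unfolding rP rD infinity_weight_fps_def by (simp add: mult.assoc)
  qed
  have eq: "coeff (reflect_poly (Dpoly * infinity_part)) j = coeff (reflect_poly Ppoly) j" if "j < R" for j
  proof -
    have "coeff (reflect_poly (Dpoly * infinity_part)) j =
        fps_nth (fps_of_poly (reflect_poly infinity_part) * fps_of_poly (reflect_poly Dpoly)) j"
      by (simp only: reflect_poly_mult fps_of_poly_mult[symmetric] fps_of_poly_nth mult.commute)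
    also have "\<dots> = fps_nth (fps_const ((- 1) ^ M) * infinity_weight_fps * fps_of_poly (reflect_poly Dpoly)) j"
    proof (rule fps_mult_nth_cong)
      fix i assume "i \<le> j"
      thus "fps_nth (fps_of_poly (reflect_poly infinity_part)) i = fps_nth (fps_const ((- 1) ^ M) * infinity_weight_fps) i"
        using that by (auto simp: coeff_reflect_poly deg coeff_infinity_part infinity_coeff_def)
    qed
    finally show ?thesis unfolding key by simp
  qed
  show ?thesis
  proof (cases "k \<le> M")
    case True
    hence j: "M - k < R" "M - (M - k) = k" using assms False by (auto simp: M L_def)
    have "coeff (Dpoly * infinity_part) k = coeff Ppoly k"
    proof -
      have "\<not> M < M - k" by simp
      thus ?thesis
        using eq[OF j(1)] unfolding coeff_reflect_poly degD degree_Ppoly j(2) by (simp only: if_False)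
    qed
    thus ?thesis by simp
  next
    case False
    thus ?thesis using degD degree_Ppoly by (simp add: coeff_eq_0)
  qed
qed

text \<open>The difference X of the two sides is divisible by \<open>(\<rho> J + z) ^ lam J\<close>
  for every active J, hence by \<open>Dpoly\<close>, but its degree is smaller, so it vanishes. At a
  given pole all terms but \<open>Ppoly\<close> and S J are visibly divisible; the degree bound at
  infinity is \<open>coeff_infinity_diff\<close>.\<close>

lemma partial_fractions:
  "Ppoly = (\<Sum>J\<in>active. \<Sum>k<lam J. smult (pole_coeff J (lam J - 1 - k)) (pole_poly J (k + 1))) + Dpoly * infinity_part"
proof -
  define S where "S J = (\<Sum>k<lam J. smult (pole_coeff J (lam J - 1 - k)) (pole_poly J (k + 1)))" for J
  define X where "X = Ppoly - ((\<Sum>J\<in>active. S J) + Dpoly * infinity_part)"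
  have fin: "finite active" by (simp add: active_def)
  have dvd: "[:\<rho> J, 1:] ^ lam J dvd X" if J: "J \<in> active" for J
  proof -
    have Jr: "J \<in> {1..r}" using J by (simp add: active_iff)
    let ?DJ = "\<Prod>h\<in>{1..r} - {J}. [:\<rho> h, 1:] ^ lam h"
    have D: "[:\<rho> J, 1:] ^ lam J dvd Dpoly"
      unfolding Dpoly_def using Jr by (intro dvd_prodI) auto
    have oth: "[:\<rho> J, 1:] ^ lam J dvd S K" if K: "K \<in> active - {J}" for K
    proof -
      have "[:\<rho> J, 1:] ^ lam J dvd pole_poly K s" for s
      proof -
        have "[:\<rho> J, 1:] ^ (lam(K := lam K - s)) J dvd pole_poly K s"
          unfolding pole_poly_def row_prod_def
          using Jr by (intro dvd_prodI[where f = "\<lambda>h. [:\<rho> h, 1:] ^ (lam(K := lam K - s)) h"]) auto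
        thus ?thesis using K by simp
      qed
      thus ?thesis unfolding S_def by (intro dvd_sum dvd_smult) auto
    qed
    have own: "[:\<rho> J, 1:] ^ lam J dvd Ppoly - S J"
    proof (rule linear_power_dvdI)
      fix k assume k: "k < lam J"
      let ?sh = "\<lambda>Q. pcompose Q [:- \<rho> J, 1:]"
      \<comment> \<open>The truncation of \<open>kappa J * pole_weight_fps J\<close> below degree
        lam J. In the shifted variable S J is \<open>Tr\<close> times the factors of the other rows,
        so it agrees with \<open>Ppoly\<close> modulo X ^ lam J.\<close>
      define Tr where "Tr = (\<Sum>k<lam J. monom (pole_coeff J (lam J - 1 - k)) (lam J - 1 - k))"
      have SJ: "S J = (\<Sum>k<lam J. smult (pole_coeff J (lam J - 1 - k)) ([:\<rho> J, 1:] ^ (lam J - 1 - k))) * ?DJ"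
        unfolding S_def pole_poly_def row_prod_upd[OF Jr] sum_distrib_right by simp
      have sh1: "?sh ([:\<rho> J, 1:] ^ e) = monom 1 e" for e
        by (simp add: pcompose_power pcompose_pCons monom_altdef)
      have shS: "?sh (S J) = Tr * ?sh ?DJ"
        unfolding SJ pcompose_mult pcompose_sum pcompose_smult sh1 Tr_def smult_monom by simp
      have shD: "?sh ?DJ = (\<Prod>h\<in>{1..r} - {J}. [:\<rho> h - \<rho> J, 1:] ^ lam h)"
        by (simp add: pcompose_prod_real pcompose_power pcompose_pCons)
      have shP: "?sh Ppoly = (\<Prod>i=1..p. [:\<xi> i + \<rho> J, - 1:] ^ m i)"
        by (simp add: Ppoly_def pcompose_prod_real pcompose_power pcompose_pCons)
      have Tr: "coeff Tr i = pole_coeff J i" if "i < lam J" for i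
      proof -
        have "Tr = (\<Sum>k<lam J. monom (pole_coeff J k) k)"
          unfolding Tr_def by (rule sum.reindex_bij_witness[of _ "\<lambda>k. lam J - 1 - k" "\<lambda>k. lam J - 1 - k"]) auto
        hence "coeff Tr i = (\<Sum>k<lam J. if k = i then pole_coeff J k else 0)" by (simp add: coeff_sum)
        thus ?thesis using that by simp
      qed
      have "coeff (Tr * ?sh ?DJ) k = fps_nth (fps_of_poly Tr * fps_of_poly (?sh ?DJ)) k"
        by (simp add: fps_of_poly_mult[symmetric])
      also have "\<dots> = fps_nth (fps_const (kappa J) * pole_weight_fps J * fps_of_poly (?sh ?DJ)) k"
        by (rule fps_mult_nth_cong) (use k in \<open>auto simp: Tr pole_coeff_def\<close>)
      also have "\<dots> = coeff (?sh Ppoly) k"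
        unfolding shD shP kappa_times_denominator[OF J] by simp
      finally show "coeff (?sh (Ppoly - S J)) k = 0"
        by (simp add: pcompose_diff shS)
    qed
    have "X = (Ppoly - S J) - ((\<Sum>K\<in>active - {J}. S K) + Dpoly * infinity_part)"
      unfolding X_def using J fin by (subst sum.remove[of _ J]) (auto simp: algebra_simps)
    moreover have "[:\<rho> J, 1:] ^ lam J dvd \<dots>"
      by (rule dvd_diff[OF own dvd_add[OF dvd_sum[OF oth] dvd_mult2[OF D]]])
    ultimately show ?thesis by simp
  qed
  have "(\<Prod>J\<in>active. [:- (- \<rho> J), 1:] ^ lam J) dvd X"
    by (rule prod_linear_power_dvd) (use fin inj_active dvd in \<open>auto simp: inj_on_def\<close>)
  also have "(\<Prod>J\<in>active. [:- (- \<rho> J), 1:] ^ lam J) = Dpoly"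
    unfolding Dpoly_def by (rule prod.mono_neutral_cong_left) (auto simp: active_iff Suc_le_eq)
  finally have "Dpoly dvd X" .
  moreover have "X = 0 \<or> degree X < degree Dpoly"
  proof (rule ccontr)
    assume *: "\<not> (X = 0 \<or> degree X < degree Dpoly)"
    have cS: "coeff (S J) (degree X) = 0" if J: "J \<in> active" for J
    proof -
      have "degree (pole_poly J (k + 1)) < degree Dpoly" for k
        unfolding pole_poly_def Dpoly_eq_row_prod degree_row_prod
        by (rule sum_strict_mono_ex1) (use J in \<open>auto simp: active_iff\<close>)
      hence "coeff (pole_poly J (k + 1)) (degree X) = 0" for k
        using * by (intro coeff_eq_0) (meson linorder_not_less order_le_less_trans order_less_le_trans)
      thus ?thesis by (simp add: S_def coeff_sum)
    qed
    have "coeff (Ppoly - Dpoly * infinity_part) (degree X) = 0"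
      by (rule coeff_infinity_diff) (use * in \<open>simp add: Dpoly_eq_row_prod degree_row_prod\<close>)
    moreover have "coeff X k = coeff (Ppoly - Dpoly * infinity_part) k - (\<Sum>J\<in>active. coeff (S J) k)" for k
      by (simp add: X_def coeff_sum)
    ultimately have "coeff X (degree X) = 0" using cS by simp
    thus False using * by simp
  qed
  ultimately have "X = 0" using dvd_imp_degree_le by force
  thus ?thesis by (simp add: X_def S_def)
qed

end

section \<open>The explicit components\<close>

context mixed_hermite_balanced
begin

lemma zeta_value:
  assumes J: "J \<in> active"
  shows "poly (sd_value (zeta J)) t = pole_coeff J (lam J - 1)"
proof -
  let ?ors = "filter (\<lambda>h. h \<in> active) (other_rows J)"
  let ?b = "map (\<lambda>i. - real (m i)) cols @ map (\<lambda>h. real (lam h)) ?ors"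
  let ?x = "map (\<lambda>i. 1 / (\<xi> i + \<rho> J)) cols @ map (x_pole J) ?ors"
  have "zeta J = Poly_Mapping.single (Homogeneous (lam J - 1) ?b ?x) [:kappa J:]"
    using J by (simp add: zeta_def concat_map_if active_iff)
  hence "sd_value (zeta J) = [:kappa J * homogeneous_sum (lam J - 1) ?b ?x:]"
    by (simp add: sd_value_single)
  moreover have "prod_list (map2 bin_fps ?b ?x) = pole_weight_fps J"
  proof -
    have "prod_list (map2 bin_fps ?b ?x) =
      prod_list (map (\<lambda>i. bin_fps (- real (m i)) (1 / (\<xi> i + \<rho> J))) cols) *
      prod_list (map (\<lambda>h. bin_fps (real (lam h)) (x_pole J h)) ?ors)"
      by (simp add: zip_map_map o_def map_zip_map2 zip_same_conv_map case_prod_beta)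
    also have "prod_list (map (\<lambda>i. bin_fps (- real (m i)) (1 / (\<xi> i + \<rho> J))) cols) =
       (\<Prod>i=1..p. bin_fps (- real (m i)) (1 / (\<xi> i + \<rho> J)))"
      unfolding set_cols[symmetric] by (rule prod_list_map_distinct) simp
    also have "prod_list (map (\<lambda>h. bin_fps (real (lam h)) (x_pole J h)) ?ors) =
       (\<Prod>h\<in>set ?ors. bin_fps (real (lam h)) (x_pole J h))"
      by (rule prod_list_map_distinct) (simp add: distinct_other_rows)
    also have "\<dots> = (\<Prod>h\<in>{1..r} - {J}. bin_fps (real (lam h)) (x_pole J h))"
    proof (rule prod.mono_neutral_left)
      show "\<forall>h\<in>({1..r} - {J}) - set ?ors. bin_fps (real (lam h)) (x_pole J h) = 1"
      proof
        fix h assume "h \<in> ({1..r} - {J}) - set ?ors"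
        hence "lam h = 0" by (auto simp: set_other_rows active_iff)
        thus "bin_fps (real (lam h)) (x_pole J h) = 1" by simp
      qed
    qed (auto simp: set_other_rows)
    finally show ?thesis by (simp add: pole_weight_fps_def)
  qed
  ultimately show ?thesis
    by (simp add: homogeneous_sum_eq pole_coeff_def)
qed

text \<open>The solution operator \<open>sol\<close> of \<open>pole_recurrence_solution\<close> at
  pole J. The functions \<open>T\<close>, \<open>W\<close> and \<open>UU\<close> come from the
  sources 1, X and 1 / (1 - x X).\<close>

definition pole_sol :: "nat \<Rightarrow> real \<Rightarrow> real fps \<Rightarrow> real fps" where
  "pole_sol J c V = pole_fps J c * euler_integral (d J + 1) (pole_fps_inv J c * V)"

lemma bin_fps_1_0: "bin_fps 1 0 = 1"
  by (rule fps_ext) (simp add: pochhammer_fact[symmetric])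

text \<open>A factor X in the source raises the parameter of the Euler integral by one and lowers
  the order by one. Hence \<open>W\<close> has n J - 3 and d J + 2 where \<open>T\<close> has n J -
  2 and d J + 1.\<close>

lemma pole_sol_X: "pole_sol J c fps_X = fps_X * (pole_fps J c * euler_integral (d J + 2) (pole_fps_inv J c * bin_fps 1 0))"
proof -
  have "euler_integral (d J + 1) (pole_fps_inv J c * fps_X) = fps_X * euler_integral (d J + 2) (pole_fps_inv J c)"
    unfolding mult.commute[of _ fps_X] euler_integral_X by (simp add: add.assoc)
  thus ?thesis by (simp add: pole_sol_def bin_fps_1_0 mult_ac)
qed

lemma
  assumes J: "J \<in> {1..r}" and n: "lam J \<ge> 2"
  defines "c \<equiv> \<lambda>t. a - \<rho> J / 2 - t"
  shows T_value: "poly (sd_value (T J)) t = kappa J * fps_nth (pole_weight_fps J * pole_sol J (c t) 1) (lam J - 2)"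
    and W_value: "poly (sd_value (W J)) t = kappa J * fps_nth (pole_weight_fps J * pole_sol J (c t) fps_X) (lam J - 2)"
    and UU_value: "poly (sd_value (UU h J)) t =
      - (kappa J * d h * x_pole J h * fps_nth (pole_weight_fps J * pole_sol J (c t) (bin_fps 1 (x_pole J h))) (lam J - 2))"
proof -
  have b: "d J + 1 > 0" "d J + 2 > 0" using d_nonneg[OF J] by auto
  have i: "int (lam J) - 2 = int (lam J - 2)" using n by simp
  show "poly (sd_value (T J)) t = kappa J * fps_nth (pole_weight_fps J * pole_sol J (c t) 1) (lam J - 2)"
    using b unfolding T_def sd_value_scale i
    by (simp add: poly_Z[OF J b(1)] pole_sol_def c_def bin_fps_1_0)
  show "poly (sd_value (UU h J)) t =
      - (kappa J * d h * x_pole J h * fps_nth (pole_weight_fps J * pole_sol J (c t) (bin_fps 1 (x_pole J h))) (lam J - 2))"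
    using b unfolding UU_def sd_value_scale i
    by (simp add: poly_Z[OF J b(1)] pole_sol_def c_def)
  have X: "fps_nth (pole_weight_fps J * pole_sol J (c t) fps_X) (lam J - 2) =
    (if lam J = 2 then 0 else fps_nth (pole_weight_fps J * (pole_fps J (c t) * euler_integral (d J + 2) (pole_fps_inv J (c t) * bin_fps 1 0))) (lam J - 3))"
    unfolding pole_sol_X mult.left_commute[of "pole_weight_fps J" fps_X] using n by simp
  show "poly (sd_value (W J)) t = kappa J * fps_nth (pole_weight_fps J * pole_sol J (c t) fps_X) (lam J - 2)"
  proof (cases "lam J = 2")
    case True
    thus ?thesis unfolding X by (simp add: W_def sd_value_scale Z_def)
  next
    case False
    hence i: "int (lam J) - 3 = int (lam J - 3)" using n by simp
    show ?thesis using b False unfolding X W_def sd_value_scale i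
      by (simp add: poly_Z[OF J b(2)] c_def)
  qed
qed

lemma
  assumes "lam J < 2"
  shows T_value_0: "sd_value (T J) = 0" and W_value_0: "sd_value (W J) = 0" and UU_value_0: "sd_value (UU h J) = 0"
  using assms by (simp_all add: T_def W_def UU_def sd_value_scale Z_def)

text \<open>The functions of order at least 2 are replaced by the solution of their recurrence, and
  the result is collected by the order 1 functions and \<open>F\<close>. The source of row h is
  proportional to the order 1 function of J minus that of h, hence the opposite signs of the two
  sums of \<open>UU\<close>.\<close>

lemma pole_part:
  assumes J: "J \<in> active"
  shows "(\<Sum>k<lam J. pole_coeff J (lam J - 1 - k) * pole_value J (k + 1) t) =
    (poly (sd_value (zeta J)) t + (a - \<rho> J / 2 - t) * poly (sd_value (T J)) t + poly (sd_value (W J)) t / 2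
      - (\<Sum>h\<in>{1..r} - {J}. poly (sd_value (UU h J)) t)) * pole_value J 1 t +
    poly (sd_value (T J)) t / 2 * F t + (\<Sum>h\<in>{1..r} - {J}. poly (sd_value (UU h J)) t * pole_value h 1 t)"
proof (cases "lam J \<ge> 2")
  case False
  hence "lam J = 1" using J by (simp add: active_iff)
  thus ?thesis using False by (simp add: zeta_value[OF J] T_value_0 W_value_0 UU_value_0)
next
  case True
  define n where "n = lam J - 2"
  have n: "lam J = Suc (Suc n)" using True by (simp add: n_def)
  have Jr: "J \<in> {1..r}" using J by (simp add: active_iff)
  let ?c = "a - \<rho> J / 2 - t"
  let ?H = "{1..r} - {J}"
  let ?f = "\<lambda>s. pole_value J s t"
  let ?x = "x_pole J"
  let ?sol = "pole_sol J ?c"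
  define Y where "Y = fps_const (?f 1) * (fps_const ?c * ?sol 1 + fps_const (1 / 2) * ?sol fps_X +
       (\<Sum>h\<in>?H. fps_const (d h * ?x h) * ?sol (bin_fps 1 (?x h)))) +
     fps_const (?f 0 / 2) * ?sol 1 - (\<Sum>h\<in>?H. fps_const (d h * ?x h * pole_value h 1 t) * ?sol (bin_fps 1 (?x h)))"
  have f: "?f (k + 2) = fps_nth Y k" if "k + 2 \<le> lam J" for k
    unfolding Y_def pole_sol_def pole_fps_def pole_fps_inv_def
    by (rule pole_recurrence_solution[OF d_nonneg[OF Jr] pole_value_rec[OF Jr] that])
  let ?p = "\<lambda>V. kappa J * fps_nth (pole_weight_fps J * ?sol V) n"
  have Tv: "poly (sd_value (T J)) t = ?p 1" and Wv: "poly (sd_value (W J)) t = ?p fps_X"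
    and Uv: "poly (sd_value (UU h J)) t = - (d h * ?x h * ?p (bin_fps 1 (?x h)))" for h
    using T_value[OF Jr True] W_value[OF Jr True] UU_value[OF Jr True] by (simp_all add: n)
  have "(\<Sum>k<lam J. pole_coeff J (lam J - 1 - k) * ?f (k + 1)) =
      pole_coeff J (lam J - 1) * ?f 1 + (\<Sum>k\<le>n. pole_coeff J (n - k) * ?f (k + 2))"
    unfolding n by (subst sum.lessThan_Suc_shift) (simp add: lessThan_Suc_atMost)
  also have "(\<Sum>k\<le>n. pole_coeff J (n - k) * ?f (k + 2)) = (\<Sum>k\<le>n. pole_coeff J (n - k) * fps_nth Y k)"
  proof (rule sum.cong[OF refl])
    fix k assume "k \<in> {..n}"
    hence "k + 2 \<le> lam J" by (simp add: n)
    thus "pole_coeff J (n - k) * ?f (k + 2) = pole_coeff J (n - k) * fps_nth Y k" by (simp only: f)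
  qed
  also have "\<dots> = kappa J * fps_nth (Y * pole_weight_fps J) n"
    by (simp add: pole_coeff_def fps_mult_nth atLeast0AtMost sum_distrib_left mult_ac)
  also have "Y * pole_weight_fps J = fps_const (?f 1) * (fps_const ?c * (pole_weight_fps J * ?sol 1) + fps_const (1 / 2) * (pole_weight_fps J * ?sol fps_X) +
       (\<Sum>h\<in>?H. fps_const (d h * ?x h) * (pole_weight_fps J * ?sol (bin_fps 1 (?x h))))) +
     fps_const (?f 0 / 2) * (pole_weight_fps J * ?sol 1) - (\<Sum>h\<in>?H. fps_const (d h * ?x h * pole_value h 1 t) * (pole_weight_fps J * ?sol (bin_fps 1 (?x h))))"
    unfolding Y_def
    by (simp only: distrib_left distrib_right left_diff_distrib right_diff_distrib sum_distrib_left sum_distrib_right mult_ac)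
  also have "kappa J * fps_nth \<dots> n = ?f 1 * (?c * ?p 1 + 1 / 2 * ?p fps_X + (\<Sum>h\<in>?H. (d h * ?x h) * ?p (bin_fps 1 (?x h)))) +
     ?f 0 / 2 * ?p 1 - (\<Sum>h\<in>?H. (d h * ?x h * pole_value h 1 t) * ?p (bin_fps 1 (?x h)))"
    by (simp only: fps_add_nth fps_sub_nth fps_mult_left_const_nth fps_sum_nth)
      (simp only: distrib_left right_diff_distrib sum_distrib_left mult_ac)
  finally show ?thesis
    by (simp add: zeta_value[OF J] pole_value_0 Tv Wv Uv sum_negf algebra_simps sum_distrib_left)
qed

lemma polynomial_part:
  "(\<Sum>s<R. infinity_coeff (R - 1 - s) * monom_value s t) =
    poly (sd_value Q1) t * F t + (\<Sum>h=1..r. poly (sd_value (P h)) t * (\<rho> h * pole_value h 1 t))"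
proof (cases R)
  case 0
  thus ?thesis by (simp add: Q1_def P_def sd_value_scale Y_def)
next
  case (Suc n)
  let ?G' = "\<Prod>h=1..r. bin_fps (d h) (- \<rho> h)"
  let ?G = "\<Prod>h=1..r. bin_fps (- d h) (- \<rho> h)"
  let ?C = "- 2 * (a - t)"
  let ?b = "(\<Sum>h=1..r. d h) - real n"
  have b: "d_star - real R + 1 = ?b" by (simp add: d_star_def Suc)
  have rec: "monom_value (s + 1) t = ?C * monom_value s t - 2 * real s * monom_value (s - 1) t +
      2 * (\<Sum>h=1..r. d h * ((\<Sum>i<s. (- \<rho> h) ^ i * monom_value (s - 1 - i) t) + (- \<rho> h) ^ s * pole_value h 1 t))"
    if "s < n" for s
    by (rule monom_value_rec) (use that Suc in \<open>simp add: R_def\<close>)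
  have "(\<Sum>s<R. infinity_coeff (R - 1 - s) * monom_value s t) =
      (- 1) ^ M * (\<Sum>s\<le>n. fps_nth infinity_weight_fps (n - s) * monom_value s t)"
    by (simp add: Suc lessThan_Suc_atMost infinity_coeff_def sum_distrib_left mult_ac)
  also have "(\<Sum>s\<le>n. fps_nth infinity_weight_fps (n - s) * monom_value s t) =
    monom_value 0 t * two_grade_sum (infinity_weight_fps * ?G') ?G n ?b ?C +
    (\<Sum>h=1..r. 2 * d h * pole_value h 1 t *
      (if n = 0 then 0 else two_grade_sum (infinity_weight_fps * ?G') (bin_fps 1 (- \<rho> h) * ?G) (n - 1) ?b ?C))"
    by (rule polynomial_recurrence_solution[OF rec])
  also have "monom_value 0 t = F t" by (simp add: monom_value_def F_eq)
  also have "two_grade_sum (infinity_weight_fps * ?G') ?G n ?b ?C = poly (sd_value (Y (int n) ?b 0)) t"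
    by (simp add: poly_Y bin_fps_1_0)
  finally have 1: "(\<Sum>s<R. infinity_coeff (R - 1 - s) * monom_value s t) =
    (- 1) ^ M * (F t * poly (sd_value (Y (int n) ?b 0)) t + (\<Sum>h=1..r. 2 * d h * pole_value h 1 t *
      (if n = 0 then 0 else two_grade_sum (infinity_weight_fps * ?G') (bin_fps 1 (- \<rho> h) * ?G) (n - 1) ?b ?C)))" .
  have Q: "poly (sd_value Q1) t = (- 1) ^ M * poly (sd_value (Y (int n) ?b 0)) t"
    by (simp add: Q1_def sd_value_scale b, simp add: Suc)
  have P: "poly (sd_value (P h)) t * (\<rho> h * pole_value h 1 t) = (- 1) ^ M * (2 * d h * pole_value h 1 t *
      (if n = 0 then 0 else two_grade_sum (infinity_weight_fps * ?G') (bin_fps 1 (- \<rho> h) * ?G) (n - 1) ?b ?C))"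
    if h: "h \<in> {1..r}" for h
  proof (cases "n = 0")
    case True
    thus ?thesis by (simp add: P_def sd_value_scale Suc Y_def)
  next
    case False
    hence i: "int R - 2 = int (n - 1)" by (simp add: Suc)
    show ?thesis unfolding P_def sd_value_scale b i poly_mult poly_Y
      using False \<rho>_pos[OF h] by simp
  qed
  show ?thesis unfolding 1 Q by (simp only: P cong: sum.cong) (simp add: distrib_left sum_distrib_left mult_ac)
qed

lemma sum_U:
  "(\<Sum>j=1..r + 1. poly (B j) t * U j t) = (\<Sum>h=1..r. poly (B h) t * gamma_avg (\<rho> h) 1 F t) + poly (B (r + 1)) t * F t"
  by (simp add: U_def)

lemma B_comb_value:
  assumes h: "h \<in> {1..r}"
  shows "poly (sd_value (B_comb h)) t = poly (sd_value (P h)) t + 1 / \<rho> h *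
    (poly (sd_value (zeta h)) t + (a - \<rho> h / 2 - t) * poly (sd_value (T h)) t + poly (sd_value (W h)) t / 2 +
     (\<Sum>J\<in>{1..r} - {h}. poly (sd_value (UU h J)) t - poly (sd_value (UU J h)) t))"
  by (simp add: B_comb_def sd_value_add sd_value_scale sd_value_sum sd_value_diff poly_sum cJ_poly_def algebra_simps)

lemma lam_le_1_if_inactive:
  assumes "h \<in> {1..r}" "h \<notin> active" "j \<in> {1..r + 1}"
  shows "lam j \<le> 1"
  using assms balanced[of j h] by (simp add: active_iff)

text \<open>A zero entry bounds all entries by 1, which makes the order of every \<open>Y\<close>
  and \<open>Z\<close> in the component negative.\<close>

lemma B_comb_inactive:
  assumes h: "h \<in> {1..r}" "h \<notin> active"
  shows "sd_value (B_comb h) = 0"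
proof -
  have l: "lam j \<le> 1" if "j \<in> {1..r + 1}" for j
    by (rule lam_le_1_if_inactive[OF h that])
  have "zeta h = 0" using h by (simp add: zeta_def active_iff)
  moreover have "sd_value (P h) = 0"
    using l[of "r + 1"] by (simp add: P_def sd_value_scale Y_def R_def)
  moreover have "sd_value (T j) = 0" "sd_value (W j) = 0" "sd_value (UU i j) = 0" if "j \<in> {1..r}" for i j
    using l[of j] that T_value_0[of j] W_value_0[of j] UU_value_0[of j] by auto
  ultimately show ?thesis using h
    by (simp add: B_comb_def sd_value_add sd_value_scale sd_value_sum sd_value_diff)
qed

theorem rodrigues_components:
  "rodrigues t = (\<Sum>j=1..r + 1. poly (components j) t * U j t)"
proof -
  let ?g = "\<lambda>h. pole_value h 1 t"
  let ?T = "\<lambda>J. poly (sd_value (T J)) t"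
  let ?W = "\<lambda>J. poly (sd_value (W J)) t"
  let ?Z = "\<lambda>J. poly (sd_value (zeta J)) t"
  let ?U = "\<lambda>h J. poly (sd_value (UU h J)) t"
  let ?P = "\<lambda>h. poly (sd_value (P h)) t"
  have fin: "finite active" by (simp add: active_def)
  have sub: "active \<subseteq> {1..r}" by (auto simp: active_def)
  have U0: "?U h J = 0" if "h \<in> {1..r}" "J \<in> {1..r}" "h \<notin> active \<or> J \<notin> active" for h J
  proof -
    have "lam J < 2"
      using that lam_le_1_if_inactive[of h J] lam_le_1_if_inactive[of J J] by auto
    thus ?thesis by (simp add: UU_value_0)
  qed
  have "rodrigues t = pdop Ppoly E t" by (simp add: rodrigues_eq)
  also have "\<dots> = (\<Sum>J\<in>active. \<Sum>k<lam J. pole_coeff J (lam J - 1 - k) * pole_value J (k + 1) t) +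
     (\<Sum>s<R. infinity_coeff (R - 1 - s) * monom_value s t)"
  proof -
    have "Dpoly * infinity_part = (\<Sum>s<R. smult (infinity_coeff (R - 1 - s)) (monom 1 s * Dpoly))"
      by (simp add: infinity_part_def sum_distrib_left mult.commute smult_monom flip: mult_smult_left)
    thus ?thesis
      by (subst partial_fractions) (simp add: pdop_add pdop_sum pdop_smult pole_value_def monom_value_def)
  qed
  also have "(\<Sum>J\<in>active. \<Sum>k<lam J. pole_coeff J (lam J - 1 - k) * pole_value J (k + 1) t) =
     (\<Sum>J\<in>active. (?Z J + (a - \<rho> J / 2 - t) * ?T J + ?W J / 2 - (\<Sum>h\<in>{1..r} - {J}. ?U h J)) * ?g J) +
     (\<Sum>J\<in>active. ?T J / 2 * F t) + (\<Sum>J\<in>active. \<Sum>h\<in>{1..r} - {J}. ?U h J * ?g h)"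
    unfolding sum.distrib[symmetric] by (intro sum.cong refl pole_part)
  \<comment> \<open>What pole J contributes to row h is regrouped by row. Together with the terms
    kept at J this produces the differences UU h J - UU J h.\<close>
  also have "(\<Sum>J\<in>active. \<Sum>h\<in>{1..r} - {J}. ?U h J * ?g h) = (\<Sum>h\<in>active. (\<Sum>J\<in>{1..r} - {h}. ?U h J) * ?g h)"
  proof -
    have "(\<Sum>J\<in>active. \<Sum>h\<in>{1..r} - {J}. ?U h J * ?g h) = (\<Sum>J\<in>active. \<Sum>h\<in>active. if h = J then 0 else ?U h J * ?g h)"
    proof (rule sum.cong[OF refl])
      fix J assume J: "J \<in> active"
      have "(\<Sum>h\<in>{1..r} - {J}. ?U h J * ?g h) = (\<Sum>h\<in>active - {J}. ?U h J * ?g h)"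
      proof (rule sum.mono_neutral_right)
        show "\<forall>h\<in>({1..r} - {J}) - (active - {J}). ?U h J * ?g h = 0"
          using U0[of _ J] sub J by (metis DiffD1 DiffD2 DiffI mult_zero_left subsetD)
      qed (use sub in auto)
      also have "\<dots> = (\<Sum>h\<in>active. if h = J then 0 else ?U h J * ?g h)"
        using fin by (intro sum.mono_neutral_cong_left) auto
      finally show "(\<Sum>h\<in>{1..r} - {J}. ?U h J * ?g h) = (\<Sum>h\<in>active. if h = J then 0 else ?U h J * ?g h)" .
    qed
    also have "\<dots> = (\<Sum>h\<in>active. \<Sum>J\<in>active. if h = J then 0 else ?U h J * ?g h)" by (rule sum.swap)
    also have "\<dots> = (\<Sum>h\<in>active. (\<Sum>J\<in>{1..r} - {h}. ?U h J) * ?g h)"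
    proof (rule sum.cong[OF refl])
      fix h assume h: "h \<in> active"
      have "(\<Sum>J\<in>{1..r} - {h}. ?U h J * ?g h) = (\<Sum>J\<in>active - {h}. ?U h J * ?g h)"
      proof (rule sum.mono_neutral_right)
        show "\<forall>J\<in>({1..r} - {h}) - (active - {h}). ?U h J * ?g h = 0"
          using U0[of h] sub h by (metis DiffD1 DiffD2 DiffI mult_zero_left subsetD)
      qed (use sub in auto)
      also have "\<dots> = (\<Sum>J\<in>active. if h = J then 0 else ?U h J * ?g h)"
        using fin by (intro sum.mono_neutral_cong_left) auto
      finally show "(\<Sum>J\<in>active. if h = J then 0 else ?U h J * ?g h) = (\<Sum>J\<in>{1..r} - {h}. ?U h J) * ?g h"
        by (simp add: sum_distrib_right)
    qed
    finally show ?thesis .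
  qed
  also have "(\<Sum>s<R. infinity_coeff (R - 1 - s) * monom_value s t) =
    poly (sd_value Q1) t * F t + (\<Sum>h\<in>active. ?P h * (\<rho> h * ?g h))"
  proof -
    have "?P h = 0" if "h \<in> {1..r} - active" for h
      using lam_le_1_if_inactive[of h "r + 1"] that by (simp add: P_def sd_value_scale Y_def R_def)
    hence "(\<Sum>h=1..r. ?P h * (\<rho> h * ?g h)) = (\<Sum>h\<in>active. ?P h * (\<rho> h * ?g h))"
      by (intro sum.mono_neutral_right) (use sub in auto)
    thus ?thesis unfolding polynomial_part by simp
  qed
  finally have "rodrigues t = (\<Sum>J\<in>active. (?Z J + (a - \<rho> J / 2 - t) * ?T J + ?W J / 2 - (\<Sum>h\<in>{1..r} - {J}. ?U h J)) * ?g J) +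
     (\<Sum>J\<in>active. ?T J / 2 * F t) + (\<Sum>h\<in>active. (\<Sum>J\<in>{1..r} - {h}. ?U h J) * ?g h) +
     (poly (sd_value Q1) t * F t + (\<Sum>h\<in>active. ?P h * (\<rho> h * ?g h)))" .
  also have "\<dots> = (\<Sum>h\<in>active. poly (sd_value (B_comb h)) t * (\<rho> h * ?g h)) + poly (sd_value D_comb) t * F t"
  proof -
    have D: "poly (sd_value D_comb) t * F t = poly (sd_value Q1) t * F t + (\<Sum>J\<in>active. ?T J / 2 * F t)"
      by (simp add: D_comb_def sd_value_add sd_value_scale sd_value_sum poly_sum sum_distrib_left distrib_right
          sum_distrib_right flip: sum_divide_distrib)
    have "(\<Sum>h\<in>active. poly (sd_value (B_comb h)) t * (\<rho> h * ?g h)) =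
       (\<Sum>h\<in>active. (?Z h + (a - \<rho> h / 2 - t) * ?T h + ?W h / 2 - (\<Sum>J\<in>{1..r} - {h}. ?U J h)) * ?g h +
         (\<Sum>J\<in>{1..r} - {h}. ?U h J) * ?g h + ?P h * (\<rho> h * ?g h))"
    proof (rule sum.cong[OF refl])
      fix h assume "h \<in> active"
      hence h: "h \<in> {1..r}" using sub by blast
      show "poly (sd_value (B_comb h)) t * (\<rho> h * ?g h) =
        (?Z h + (a - \<rho> h / 2 - t) * ?T h + ?W h / 2 - (\<Sum>J\<in>{1..r} - {h}. ?U J h)) * ?g h +
         (\<Sum>J\<in>{1..r} - {h}. ?U h J) * ?g h + ?P h * (\<rho> h * ?g h)"
        unfolding B_comb_value[OF h] sum_subtractf using \<rho>_pos[OF h] by (simp add: field_simps)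
    qed
    thus ?thesis unfolding D by (simp add: sum.distrib)
  qed
  also have "(\<Sum>h\<in>active. poly (sd_value (B_comb h)) t * (\<rho> h * ?g h)) =
      (\<Sum>h=1..r. poly (components h) t * gamma_avg (\<rho> h) 1 F t)"
    by (rule sum.mono_neutral_cong_left)
      (use sub in \<open>auto simp: components_def B_comb_inactive pole_value_1[unfolded One_nat_def]\<close>)
  also have "poly (sd_value D_comb) t = poly (components (r + 1)) t" by (simp add: components_def)
  finally show ?thesis unfolding sum_U .
qed

end

section \<open>Degrees and numbers of terminating functions\<close>

lemma sd_poly_SD_coeff_0:
  assumes "degree c \<le> 1" "k > N"
  shows "coeff (sd_poly (SD c N es quots pars args)) k = 0"
proof -
  have "degree (c ^ n) \<le> n" for n
  proof -
    have "degree (c ^ n) \<le> degree c * n" by (rule degree_power_le)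
    also have "\<dots> \<le> 1 * n" using assms(1) by (rule mult_le_mono1)
    finally show ?thesis by simp
  qed
  hence "degree (c ^ (N - e)) < k" for e using assms(2) by (meson diff_le_self le_less_trans le_trans)
  thus ?thesis by (simp add: coeff_sum coeff_eq_0)
qed

text \<open>Symbols are counted after collecting: equal ones merge and zero coefficients disappear,
  so sums only add up upper bounds.\<close>

definition sd_bounded :: "nat \<Rightarrow> nat \<Rightarrow> sd_comb \<Rightarrow> bool" where
  "sd_bounded b n X \<longleftrightarrow> card (Poly_Mapping.keys X) \<le> n \<and> (\<forall>f\<in>Poly_Mapping.keys X. sd_arity f \<le> b)"

lemma sd_bounded_0: "sd_bounded b n 0"
  by (simp add: sd_bounded_def)

lemma sd_bounded_mono: "sd_bounded b n X \<Longrightarrow> n \<le> n' \<Longrightarrow> sd_bounded b n' X"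
  by (auto simp: sd_bounded_def)

lemma sd_bounded_single: "sd_arity f \<le> b \<Longrightarrow> sd_bounded b 1 (Poly_Mapping.single f q)"
  by (cases "q = 0") (simp_all add: sd_bounded_def)

lemma sd_bounded_union:
  assumes "sd_bounded b n X" "sd_bounded b n' X'" "Poly_Mapping.keys X'' \<subseteq> Poly_Mapping.keys X \<union> Poly_Mapping.keys X'"
  shows "sd_bounded b (n + n') X''"
proof -
  have "card (Poly_Mapping.keys X'') \<le> card (Poly_Mapping.keys X \<union> Poly_Mapping.keys X')"
    by (rule card_mono) (use assms in auto)
  also have "\<dots> \<le> card (Poly_Mapping.keys X) + card (Poly_Mapping.keys X')" by (rule card_Un_le)
  finally show ?thesis using assms by (auto simp: sd_bounded_def)
qed

lemma sd_bounded_add: "sd_bounded b n X \<Longrightarrow> sd_bounded b n' X' \<Longrightarrow> sd_bounded b (n + n') (X + X')"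
  by (rule sd_bounded_union[OF _ _ keys_add])

lemma sd_bounded_diff: "sd_bounded b n X \<Longrightarrow> sd_bounded b n' X' \<Longrightarrow> sd_bounded b (n + n') (X - X')"
  by (rule sd_bounded_union) (auto simp: in_keys_iff lookup_minus)

lemma sd_bounded_scale:
  assumes "sd_bounded b n X"
  shows "sd_bounded b n (sd_scale q X)"
proof -
  have "Poly_Mapping.keys (sd_scale q X) \<subseteq> Poly_Mapping.keys X \<union> Poly_Mapping.keys (0 :: sd_comb)"
    by (auto simp: in_keys_iff lookup_sd_scale)
  from sd_bounded_union[OF assms sd_bounded_0[of b 0] this] show ?thesis by simp
qed

lemma sd_bounded_sum:
  assumes "\<And>i. i \<in> A \<Longrightarrow> sd_bounded b n (X i)"
  shows "sd_bounded b (n * card A) (\<Sum>i\<in>A. X i)"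
  using assms
proof (induction A rule: infinite_finite_induct)
  case (insert x A)
  thus ?case using sd_bounded_add[of b n "X x" "n * card A" "\<Sum>i\<in>A. X i"] by simp
qed (simp_all add: sd_bounded_0)

lemma coeff_pCons_mult: "coeff ([:c, e:] * q) k = c * coeff q k + e * (if k = 0 then 0 else coeff q (k - 1 :: nat))"
  for c :: real
  by (cases k) simp_all

context mixed_hermite_balanced
begin

lemma Z_bounded: "J \<in> {1..r} \<Longrightarrow> sd_bounded (p + 2 * r + 3) 1 (Z J N' b \<upsilon>)"
  unfolding Z_def using length_other_rows[of J]
  by (auto simp: Z_args_def simp del: upt_Suc intro!: sd_bounded_0 sd_bounded_single[unfolded One_nat_def])

lemma Y_bounded: "sd_bounded (p + 2 * r + 3) 1 (Y N' b \<upsilon>)"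
  unfolding Y_def by (auto simp: Y_args_def simp del: upt_Suc intro!: sd_bounded_0 sd_bounded_single[unfolded One_nat_def])

lemma zeta_bounded:
  assumes "J \<in> {1..r}"
  shows "sd_bounded (p + 2 * r + 3) 1 (zeta J)"
proof (cases "lam J = 0")
  case False
  have "length (filter (\<lambda>h. h \<in> active) (other_rows J)) \<le> r"
    using length_filter_le[of "\<lambda>h. h \<in> active" "other_rows J"] length_other_rows[OF assms] by linarith
  thus ?thesis using False unfolding zeta_def
    by (auto simp: concat_map_if simp del: upt_Suc intro!: sd_bounded_single[unfolded One_nat_def])
qed (simp add: zeta_def sd_bounded_0)

lemma B_comb_bounded:
  assumes h: "h \<in> {1..r}"
  shows "sd_bounded (p + 2 * r + 3) (2 * r + 2) (B_comb h)"
proof -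
  \<comment> \<open>One symbol from \<open>P\<close>, three from \<open>zeta\<close>,
    \<open>T\<close> and \<open>W\<close>, and two for each other row.\<close>
  have "sd_bounded (p + 2 * r + 3) (1 + (1 + 1 + 1 + (1 + 1) * card ({1..r} - {h}))) (B_comb h)"
    unfolding B_comb_def P_def T_def W_def UU_def
    by (intro sd_bounded_add sd_bounded_diff sd_bounded_scale sd_bounded_sum Z_bounded Y_bounded zeta_bounded)
      (use h in auto)
  moreover have card: "card ({1..r} - {h}) = r - 1" and "r \<ge> 1" using h by simp_all
  hence "1 + (1 + 1 + 1 + (1 + 1) * card ({1..r} - {h})) = 2 * r + 2"
    unfolding card by (cases r) simp_all
  ultimately show ?thesis by simp
qed

lemma D_comb_bounded: "sd_bounded (p + 2 * r + 3) (r + 1) D_comb"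
proof -
  have "sd_bounded (p + 2 * r + 3) (1 + 1 * card active) D_comb"
    unfolding D_comb_def Q1_def T_def
    by (intro sd_bounded_add sd_bounded_scale sd_bounded_sum Z_bounded Y_bounded) (auto simp: active_def)
  moreover have "active \<subseteq> {1..r}" by (auto simp: active_def)
  hence "card active \<le> r" using card_mono[of "{1..r}" active] by simp
  ultimately show ?thesis by (auto intro: sd_bounded_mono)
qed

lemma coeff_Z: "int k > N' \<Longrightarrow> coeff (sd_value (Z J N' b \<upsilon>)) k = 0"
  unfolding Z_def by (auto simp: sd_value_single cJ_poly_def simp del: sd_poly.simps intro!: sd_poly_SD_coeff_0)

lemma coeff_Y: "int k > N' \<Longrightarrow> coeff (sd_value (Y N' b \<upsilon>)) k = 0"
  unfolding Y_def by (auto simp: sd_value_single c_poly_def simp del: sd_poly.simps intro!: sd_poly_SD_coeff_0)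

lemma
  assumes "k + 1 \<ge> lam J"
  shows coeff_T: "coeff (sd_value (T J)) k = 0" and coeff_W: "coeff (sd_value (W J)) k = 0"
    and coeff_UU: "coeff (sd_value (UU h J)) k = 0"
  using assms unfolding T_def W_def UU_def sd_value_scale by (simp_all add: coeff_Z)

lemma coeff_zeta: "k \<ge> 1 \<Longrightarrow> coeff (sd_value (zeta J)) k = 0"
  by (cases k) (auto simp: zeta_def sd_value_single)

text \<open>\<open>Z\<close> and \<open>Y\<close> of order N' have degree at most N', since they are
  built from powers of a linear polynomial. Terms governed by another entry, such as
  \<open>UU j J\<close> of degree at most lam J - 2, stay below lam j by balance.\<close>

lemma coeff_components:
  assumes j: "j \<in> {1..r + 1}" and k: "k \<ge> lam j"
  shows "coeff (components j) k = 0"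
proof (cases "j \<in> {1..r}")
  case True
  show ?thesis
  proof (cases "j \<in> active")
    case act: True
    hence k1: "k \<ge> 1" "k - 1 + 1 \<ge> lam j" using k by (auto simp: active_iff)
    have "coeff (sd_value (P j)) k = 0"
      using balanced[of "r + 1" j] j k by (simp add: P_def sd_value_scale coeff_Y R_def)
    moreover have "coeff (sd_value (UU j J)) k = 0" if "J \<in> {1..r}" for J
      by (rule coeff_UU) (use balanced[of J j] j that k in auto)
    moreover have "coeff (cJ_poly j * sd_value (T j)) k = 0"
      unfolding cJ_poly_def coeff_pCons_mult using k k1 by (simp add: coeff_T)
    ultimately show ?thesis using True k k1
      by (simp add: components_def B_comb_def sd_value_add sd_value_scale sd_value_sum sd_value_diff
          coeff_sum coeff_zeta coeff_W coeff_UU)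
  qed (use True in \<open>simp add: components_def B_comb_inactive\<close>)
next
  case False
  hence j': "j = r + 1" using j by auto
  have "coeff (sd_value Q1) k = 0"
    using k by (simp add: Q1_def sd_value_scale coeff_Y R_def j')
  moreover have "coeff (sd_value (T J)) k = 0" if "J \<in> active" for J
    by (rule coeff_T) (use balanced[of J "r + 1"] that k in \<open>auto simp: active_iff j'\<close>)
  ultimately show ?thesis
    by (simp add: j' components_def D_comb_def sd_value_add sd_value_scale sd_value_sum coeff_sum)
qed

lemma components_degree_bounded: "degree_bounded components"
proof -
  have "components j = 0 \<or> degree (components j) < lam j" if "j \<in> {1..r + 1}" for j
    using coeff_components[OF that, of "degree (components j)"] by (metis leading_coeff_0_iff not_le)
  moreover have "components j = 0" if "j \<notin> {1..r + 1}" for j using that by (auto simp: components_def)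
  ultimately show ?thesis unfolding degree_bounded_def by blast
qed

lemma components_eq_0: "j \<in> {1..r + 1} \<Longrightarrow> lam j = 0 \<Longrightarrow> components j = 0"
  using components_degree_bounded unfolding degree_bounded_def by (metis not_less_zero)

lemma components_rodrigues: "rodrigues_decomposition components"
  unfolding rodrigues_decomposition_def
  by (intro allI) (rule trans[OF rodrigues_components sum_U])

end

section \<open>The connection matrix\<close>

lemma higher_deriv_poly:
  fixes f :: "real \<Rightarrow> real"
  assumes "open S" "\<And>z. z \<in> S \<Longrightarrow> f z = poly p z"
  shows "z \<in> S \<Longrightarrow> (deriv ^^ n) f z = poly ((pderiv ^^ n) p) z"
proof (induction n arbitrary: z)
  case (Suc n)
  have "(poly ((pderiv ^^ n) p) has_real_derivative poly (pderiv ((pderiv ^^ n) p)) z) (at z)"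
    by (rule poly_DERIV)
  hence "((deriv ^^ n) f has_real_derivative poly (pderiv ((pderiv ^^ n) p)) z) (at z)"
    by (rule has_field_derivative_transform_within_open[OF _ assms(1) Suc.prems]) (simp add: Suc.IH)
  thus ?case by (simp add: DERIV_imp_deriv)
qed (simp add: assms(2))

lemma poly_higher_pderiv_0: "poly ((pderiv ^^ n) p) 0 = fact n * coeff (p :: real poly) n"
proof (induction n arbitrary: p)
  case 0
  show ?case by (simp add: poly_0_coeff_0)
next
  case (Suc n)
  have "poly ((pderiv ^^ Suc n) p) 0 = poly ((pderiv ^^ n) (pderiv p)) 0" by (simp add: funpow_swap1)
  also have "\<dots> = fact n * coeff (pderiv p) n" by (rule Suc.IH)
  finally show ?case by (simp add: coeff_pderiv mult_ac)
qed

lemma log_derivative_prod: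
  fixes f :: "'a \<Rightarrow> real \<Rightarrow> real"
  assumes "\<And>i. i \<in> A \<Longrightarrow> (f i has_real_derivative s i * f i z) (at z)"
  shows "((\<lambda>z. \<Prod>i\<in>A. f i z) has_real_derivative (\<Sum>i\<in>A. s i) * (\<Prod>i\<in>A. f i z)) (at z)"
  using assms
proof (induction A rule: infinite_finite_induct)
  case (insert x A)
  have "((\<lambda>z. f x z * (\<Prod>i\<in>A. f i z)) has_real_derivative
      s x * f x z * (\<Prod>i\<in>A. f i z) + (\<Sum>i\<in>A. s i) * (\<Prod>i\<in>A. f i z) * f x z) (at z)"
    by (rule DERIV_mult) (use insert in auto)
  thus ?case using insert by (simp add: algebra_simps)
qed auto

lemma hermite_H_coeff: "coeff (hermite_H l) k =
  (if k \<le> l \<and> even (l - k) then fact l / (fact k * fact ((l - k) div 2)) * (- 1 / 4) ^ ((l - k) div 2) else 0)"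
proof -
  have "coeff (hermite_H l) k = (\<Sum>i | i \<le> l \<and> even (l - i).
      if i = k then fact l / (fact i * fact ((l - i) div 2)) * (- 1 / 4) ^ ((l - i) div 2) else 0)"
    unfolding hermite_H_def coeff_sum coeff_monom ..
  thus ?thesis by (simp add: sum.delta del: even_diff_nat)
qed

lemma degree_hermite_H: "degree (hermite_H l) = l" and lead_hermite_H: "coeff (hermite_H l) l = 1"
proof -
  show 1: "coeff (hermite_H l) l = 1" by (simp add: hermite_H_coeff)
  show "degree (hermite_H l) = l"
    by (intro antisym degree_le le_degree) (auto simp: hermite_H_coeff)
qed

lemma monic_expansion:
  fixes H :: "nat \<Rightarrow> real poly"
  assumes H: "\<And>k. degree (H k) = k" "\<And>k. coeff (H k) k = 1"
    and q: "\<And>k. k \<ge> n \<Longrightarrow> coeff q k = 0"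
  shows "\<exists>b. q = (\<Sum>k<n. smult (b k) (H k))"
  using q
proof (induction n arbitrary: q)
  case 0
  hence "q = 0" by (simp add: poly_eq_iff)
  thus ?case by simp
next
  case (Suc n)
  define c where "c = coeff q n"
  have "coeff (q - smult c (H n)) k = 0" if "k \<ge> n" for k
    using that Suc.prems[of k] H(2)[of n] H(1)[of n]
    by (cases "k = n") (auto simp: c_def coeff_eq_0)
  then obtain b where b: "q - smult c (H n) = (\<Sum>k<n. smult (b k) (H k))" using Suc.IH by blast
  have "q = (\<Sum>k<Suc n. smult ((b(n := c)) k) (H k))"
    using b by (simp add: algebra_simps)
  thus ?case by blast
qed

context mixed_hermite
begin

lemma sum_column_labels:
  "(\<Sum>c<N. f (column_labels ! c)) = (\<Sum>j=1..r + 1. \<Sum>k<lam j. (f (j, k) :: real))"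
proof -
  have concat: "sum_list (concat xss) = (\<Sum>xs\<leftarrow>xss. sum_list xs)" for xss :: "real list list"
    by (induction xss) simp_all
  have "(\<Sum>c<N. f (column_labels ! c)) = sum_list (map f column_labels)"
    by (simp add: sum_list_sum_nth length_column_labels atLeast0LessThan)
  also have "\<dots> = (\<Sum>j\<leftarrow>[1..<r + 2]. \<Sum>k\<leftarrow>[0..<lam j]. f (j, k))"
    unfolding column_labels_def by (simp only: map_concat concat map_map o_def)
  also have "\<dots> = (\<Sum>j\<in>set [1..<r + 2]. \<Sum>k\<leftarrow>[0..<lam j]. f (j, k))"
    by (rule sum_list_distinct_conv_sum_set) (rule distinct_upt)
  also have "set [1..<r + 2] = {1..r + 1}" by auto
  also have "(\<Sum>j=1..r + 1. \<Sum>k\<leftarrow>[0..<lam j]. f (j, k)) = (\<Sum>j=1..r + 1. \<Sum>k<lam j. f (j, k))"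
    by (intro sum.cong refl)
      (simp only: sum_list_distinct_conv_sum_set[OF distinct_upt] set_upt atLeast0LessThan)
  finally show ?thesis .
qed

lemma distinct_column_labels: "distinct column_labels"
proof -
  have "distinct (concat (map (\<lambda>j. map (Pair j) [0..<lam j]) js))" if "distinct js" for js
    using that by (induction js) (auto simp: distinct_map inj_on_def)
  thus ?thesis unfolding column_labels_def by (metis distinct_upt)
qed

lemma set_column_labels: "set column_labels = {(j, k). j \<in> {1..r + 1} \<and> k < lam j}"
  unfolding column_labels_def set_concat set_map set_upt image_image by force

lemma column_index:
  assumes "j \<in> {1..r + 1}" "k < lam j"
  obtains c where "c < N" "column_labels ! c = (j, k)"
proof -
  have "(j, k) \<in> set column_labels" using assms by (simp add: set_column_labels)
  thus ?thesis using that by (auto simp: in_set_conv_nth length_column_labels)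
qed

lemma C_carrier: "C \<in> carrier_mat N N" by (simp add: C_def)

text \<open>Active rows of equal rate share the function \<open>Lambda\<close> and so give equal
  columns of \<open>C\<close>. This supplies the locale assumption \<open>inj_active\<close>, which
  separates the poles.\<close>

lemma inj_active_if_Delta:
  assumes "Delta \<noteq> 0"
  shows "inj_on \<rho> active"
proof (rule inj_onI, rule ccontr)
  fix i j assume ij: "i \<in> active" "j \<in> active" "\<rho> i = \<rho> j" "i \<noteq> j"
  obtain c where c: "c < N" "column_labels ! c = (i, 0)"
    by (rule column_index[of i 0]) (use ij in \<open>auto simp: active_def\<close>)
  obtain c' where c': "c' < N" "column_labels ! c' = (j, 0)"
    by (rule column_index[of j 0]) (use ij in \<open>auto simp: active_def\<close>)
  have "Lambda i = Lambda j" using ij by (auto simp: Lambda_def active_def fun_eq_iff)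
  hence "Phi i 0 = Phi j 0" by (intro ext) (simp only: Phi_def)
  hence "conn_entry \<nu> (i, 0) = conn_entry \<nu> (j, 0)" for \<nu>
    by (simp add: conn_entry_def)
  hence "col C c = col C c'" using c c' by (intro eq_vecI) (auto simp: C_def)
  moreover have "c \<noteq> c'" using c c' ij by auto
  ultimately have "det C = 0" using det_identical_columns[OF C_carrier _ c(1) c'(1)] by blast
  thus False using assms by (simp add: Delta_def)
qed

end

section \<open>Symbols of the components, the connection matrix and normality\<close>

context mixed_hermite_balanced
begin

text \<open>Stands for the transform of \<open>E\<close>, but is used only through its logarithmic
  derivative, which matches \<open>logderiv_identity_E\<close>. So one operator \<open>nabla\<close>
  describes both t acting on Q(-d/dt) E and d/dz acting on Q times \<open>transform\<close>, and no
  integral has to be evaluated.\<close>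

definition transform :: "real \<Rightarrow> real" where
  "transform z = L z / poly Dpoly z"

lemma factor_pos: "z > - \<delta> \<Longrightarrow> h \<in> {1..r} \<Longrightarrow> \<rho> h + z > 0"
  using \<delta>_le[of h] by simp

lemma poly_Dpoly: "poly Dpoly z = (\<Prod>h=1..r. (\<rho> h + z) ^ lam h)"
  by (simp add: Dpoly_def poly_prod poly_power add.commute)

lemma poly_Dpoly_pos: "z > - \<delta> \<Longrightarrow> poly Dpoly z > 0"
  unfolding poly_Dpoly by (intro prod_pos) (simp add: factor_pos)

lemma L_pos: "z > - \<delta> \<Longrightarrow> L z > 0"
  unfolding L_def by (intro mult_pos_pos prod_pos) (auto simp: factor_pos \<rho>_pos less_imp_neq[symmetric] intro!: divide_pos_pos)

lemma transform_deriv: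
  assumes z: "z > - \<delta>"
  shows "(transform has_real_derivative (a + z / 2 - (\<Sum>h=1..r. (real (lam h) + d h) / (\<rho> h + z))) * transform z) (at z)"
proof -
  have d1: "((\<lambda>z. exp (a * z + z\<^sup>2 / 4)) has_real_derivative (a + z / 2) * exp (a * z + z\<^sup>2 / 4)) (at z)"
    by (auto intro!: derivative_eq_intros simp: algebra_simps)
  have d2: "((\<lambda>z. \<Prod>h=1..r. (\<rho> h / (\<rho> h + z)) powr d h) has_real_derivative
      (\<Sum>h=1..r. - d h / (\<rho> h + z)) * (\<Prod>h=1..r. (\<rho> h / (\<rho> h + z)) powr d h)) (at z)"
  proof (rule log_derivative_prod)
    fix h assume h: "h \<in> {1..r}"
    have pos: "\<rho> h + z > 0" "\<rho> h > 0" using factor_pos[OF z h] \<rho>_pos[OF h] by auto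
    have "(\<rho> h / (\<rho> h + z)) powr (d h - 1) * \<rho> h = (\<rho> h / (\<rho> h + z)) powr d h * (\<rho> h + z)"
      using pos by (simp add: powr_diff)
    thus "((\<lambda>z. (\<rho> h / (\<rho> h + z)) powr d h) has_real_derivative
        - d h / (\<rho> h + z) * (\<rho> h / (\<rho> h + z)) powr d h) (at z)"
      using pos by (auto intro!: derivative_eq_intros simp: divide_simps)
  qed
  have d3: "((\<lambda>z. \<Prod>h=1..r. inverse ((\<rho> h + z) ^ lam h)) has_real_derivative
      (\<Sum>h=1..r. - real (lam h) / (\<rho> h + z)) * (\<Prod>h=1..r. inverse ((\<rho> h + z) ^ lam h))) (at z)"
  proof (rule log_derivative_prod)
    fix h assume h: "h \<in> {1..r}"
    have pos: "\<rho> h + z > 0" using factor_pos[OF z h] by auto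
    have d: "((\<lambda>z. inverse ((\<rho> h + z) ^ lam h)) has_real_derivative
        - (inverse ((\<rho> h + z) ^ lam h) * (real (lam h) * (\<rho> h + z) ^ (lam h - 1)) * inverse ((\<rho> h + z) ^ lam h))) (at z)"
      using pos by (auto intro!: derivative_eq_intros)
    have e: "- (inverse ((\<rho> h + z) ^ lam h) * (real (lam h) * (\<rho> h + z) ^ (lam h - 1)) * inverse ((\<rho> h + z) ^ lam h)) =
        - real (lam h) / (\<rho> h + z) * inverse ((\<rho> h + z) ^ lam h)"
    proof (cases "lam h")
      case (Suc n)
      have key: "- (inverse (x * y) * (k * y) * inverse (x * y)) = - k / x * inverse (x * y)"
        if "x \<noteq> 0" "y \<noteq> 0" for x y k :: real
        using that by (simp add: divide_simps)
      have "\<rho> h + z \<noteq> 0" "(\<rho> h + z) ^ n \<noteq> 0" using pos by simp_all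
      thus ?thesis unfolding Suc power_Suc diff_Suc_1 by (rule key)
    qed simp
    show "((\<lambda>z. inverse ((\<rho> h + z) ^ lam h)) has_real_derivative
        - real (lam h) / (\<rho> h + z) * inverse ((\<rho> h + z) ^ lam h)) (at z)"
      using d unfolding e .
  qed
  have tr: "transform = (\<lambda>z. exp (a * z + z\<^sup>2 / 4) * (\<Prod>h=1..r. (\<rho> h / (\<rho> h + z)) powr d h) * (\<Prod>h=1..r. inverse ((\<rho> h + z) ^ lam h)))"
    unfolding transform_def L_def poly_Dpoly divide_inverse prod_inversef[symmetric, unfolded o_def] ..
  have se: "a + z / 2 - (\<Sum>h=1..r. (real (lam h) + d h) / (\<rho> h + z)) =
     a + z / 2 + (\<Sum>h=1..r. - d h / (\<rho> h + z)) + (\<Sum>h=1..r. - real (lam h) / (\<rho> h + z))"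
    by (simp add: sum_negf add_divide_distrib sum.distrib)
  show ?thesis unfolding tr se
    by (rule DERIV_cong[OF DERIV_mult[OF DERIV_mult[OF d1 d2] d3]]) (simp only: algebra_simps)
qed

text \<open>The division is meant to be exact: the lemmas below ask that every
  \<open>\<rho> h + z\<close> divides Q.\<close>

definition nabla :: "real poly \<Rightarrow> real poly" where
  "nabla Q = pderiv Q + [:a, 1 / 2:] * Q - (\<Sum>h=1..r. smult (real (lam h) + d h) (Q div [:\<rho> h, 1:]))"

lemma
  assumes dvd: "\<And>h. h \<in> {1..r} \<Longrightarrow> [:\<rho> h, 1:] dvd Q"
  shows times_id_nabla: "t * pdop Q E t = pdop (nabla Q) E t"
    and deriv_nabla: "z > - \<delta> \<Longrightarrow>
      ((\<lambda>z. poly Q z * transform z) has_real_derivative poly (nabla Q) z * transform z) (at z)"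
    and degree_nabla: "degree (nabla Q) \<le> degree Q + 1"
proof -
  have S: "Q = [:\<rho> h, 1:] * (Q div [:\<rho> h, 1:])" if "h \<in> {1..r}" for h
    using dvd[OF that] by (simp only: dvd_mult_div_cancel)
  show "t * pdop Q E t = pdop (nabla Q) E t"
    unfolding nabla_def by (rule times_id_pdop_E[OF S])
  show "degree (nabla Q) \<le> degree Q + 1"
  proof -
    have "degree (Q div [:\<rho> h, 1:]) \<le> degree Q" if h: "h \<in> {1..r}" for h
    proof (cases "Q = 0")
      case False
      thus ?thesis by (metis S[OF h] degree_mult_right_le mult.commute mult_zero_left mult_eq_0_iff)
    qed simp
    hence "degree (\<Sum>h=1..r. smult (real (lam h) + d h) (Q div [:\<rho> h, 1:])) \<le> degree Q + 1"
      by (intro degree_sum_le) (auto intro: order_trans[OF degree_smult_le] le_SucI)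
    moreover have "degree ([:a, 1 / 2:] * Q) \<le> degree Q + 1"
      using degree_mult_le[of "[:a, 1 / 2:]" Q] by simp
    moreover have "degree (pderiv Q) \<le> degree Q + 1" by (simp add: degree_pderiv)
    ultimately show ?thesis unfolding nabla_def by (intro degree_diff_le degree_add_le)
  qed
  assume z: "z > - \<delta>"
  have "poly (Q div [:\<rho> h, 1:]) z = poly Q z / (\<rho> h + z)" if h: "h \<in> {1..r}" for h
  proof -
    have "poly Q z = (\<rho> h + z) * poly (Q div [:\<rho> h, 1:]) z"
      by (subst S[OF h]) (simp add: algebra_simps)
    thus ?thesis using factor_pos[OF z h] by simp
  qed
  hence n: "poly (nabla Q) z = poly (pderiv Q) z + (a + z / 2) * poly Q z -
      (\<Sum>h=1..r. (real (lam h) + d h) * (poly Q z / (\<rho> h + z)))"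
    by (simp add: nabla_def poly_sum algebra_simps)
  have "poly (pderiv Q) z * transform z + (a + z / 2 - (\<Sum>h=1..r. (real (lam h) + d h) / (\<rho> h + z))) * transform z * poly Q z =
     poly (nabla Q) z * transform z"
    unfolding n by (simp add: algebra_simps sum_distrib_left sum_distrib_right)
  thus "((\<lambda>z. poly Q z * transform z) has_real_derivative poly (nabla Q) z * transform z) (at z)"
    using DERIV_mult[OF poly_DERIV transform_deriv[OF z], of Q] by simp
qed

lemma row_prod_dvd:
  assumes "\<And>h. h \<in> {1..r} \<Longrightarrow> \<epsilon> h \<le> \<epsilon>' h"
  shows "row_prod \<epsilon> dvd row_prod \<epsilon>'"
  unfolding row_prod_def by (intro prod_dvd_prod) (simp add: assms le_imp_power_dvd)

text \<open>Each term of \<open>nabla Q\<close> loses at most one factor per row.\<close>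

lemma nabla_dvd:
  assumes \<epsilon>: "\<And>h. h \<in> {1..r} \<Longrightarrow> \<epsilon> h \<ge> 1" and Q: "row_prod \<epsilon> dvd Q"
  shows "row_prod (\<lambda>h. \<epsilon> h - 1) dvd nabla Q"
proof -
  let ?e = "\<lambda>h. \<epsilon> h - 1"
  obtain q where q: "Q = row_prod \<epsilon> * q" using Q by (elim dvdE)
  have 1: "row_prod ?e dvd row_prod \<epsilon>" and 2: "row_prod ?e dvd row_prod (lower \<epsilon> h)" for h
    by (auto intro!: row_prod_dvd)
  have 3: "Q div [:\<rho> h, 1:] = row_prod (lower \<epsilon> h) * q" if h: "h \<in> {1..r}" for h
  proof -
    have "Q = [:\<rho> h, 1:] * (row_prod (lower \<epsilon> h) * q)"
      unfolding q by (subst row_prod_lower[of h \<epsilon>, OF h \<epsilon>[OF h]]) (rule mult.assoc)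
    moreover have "[:\<rho> h, 1:] \<noteq> 0" by simp
    ultimately show ?thesis by (simp del: mult_pCons_left)
  qed
  have "row_prod ?e dvd pderiv Q"
    unfolding q pderiv_mult pderiv_row_prod
    by (intro dvd_add dvd_mult2[OF 1] dvd_mult dvd_sum dvd_smult 2)
  moreover have "row_prod ?e dvd [:a, 1 / 2:] * Q"
    unfolding q by (intro dvd_mult dvd_mult2[OF 1])
  moreover have "row_prod ?e dvd (\<Sum>h=1..r. smult (real (lam h) + d h) (Q div [:\<rho> h, 1:]))"
    by (intro dvd_sum dvd_smult) (subst 3, assumption, rule dvd_mult2[OF 2])
  ultimately show ?thesis unfolding nabla_def by (intro dvd_diff dvd_add)
qed

text \<open>\<open>symbol j i\<close> is the polynomial \<open>Q\<close> with \<open>t\<^sup>i U\<^sub>j = Q(- d/dt) E\<close>.\<close>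

definition symbol :: "nat \<Rightarrow> nat \<Rightarrow> real poly" where
  "symbol j i = (nabla ^^ i) (if j \<le> r then smult (\<rho> j) (pole_poly j 1) else Dpoly)"

definition symbol_exponent :: "nat \<Rightarrow> nat \<Rightarrow> nat" where
  "symbol_exponent j h = (if h = j then lam j - 1 else lam h)"

text \<open>The divisibility clause carries the induction: it provides a factor of every row, so
  that \<open>nabla\<close> is exact at the next step. The powers of t and the derivatives of
  \<open>Lambda\<close> then advance in parallel with the same polynomial.\<close>

lemma symbol_properties:
  assumes j: "j \<in> {1..r + 1}" and i: "i < lam j"
  shows "row_prod (\<lambda>h. symbol_exponent j h - i) dvd symbol j i \<and>
    (\<forall>t. t ^ i * U j t = pdop (symbol j i) E t) \<and>
    (\<forall>z>-\<delta>. (deriv ^^ i) (Lambda j) z = poly (symbol j i) z * transform z) \<and>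
    degree (symbol j i) \<le> degree (symbol j 0) + i"
  using i
proof (induction i)
  case 0
  show ?case
  proof (cases "j \<le> r")
    case True
    hence jr: "j \<in> {1..r}" and act: "j \<in> active" using j 0 by (auto simp: active_iff)
    have D: "Dpoly = [:\<rho> j, 1:] * pole_poly j 1"
      unfolding Dpoly_eq_row_prod pole_poly_def by (rule row_prod_lower[of j lam]) (use jr 0 in auto)
    have "row_prod (symbol_exponent j) dvd symbol j 0"
      using True unfolding symbol_def pole_poly_def
      by (auto intro!: dvd_smult row_prod_dvd simp: symbol_exponent_def)
    moreover have "U j t = pdop (symbol j 0) E t" for t
      using True pole_value_1[OF act, of t] by (simp add: U_def symbol_def pdop_smult pole_value_def)
    moreover have "Lambda j z = poly (symbol j 0) z * transform z" if z: "z > - \<delta>" for z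
    proof -
      have "poly Dpoly z = (\<rho> j + z) * poly (pole_poly j 1) z" unfolding D by (simp add: algebra_simps)
      moreover have "poly (pole_poly j 1) z \<noteq> 0"
        using calculation poly_Dpoly_pos[OF z] by auto
      ultimately show ?thesis using True factor_pos[OF z jr]
        by (simp add: Lambda_def symbol_def transform_def)
    qed
    ultimately show ?thesis by simp
  next
    case False
    hence j': "j = r + 1" using j by auto
    have "row_prod (symbol_exponent j) dvd symbol j 0"
      using False unfolding symbol_def Dpoly_eq_row_prod by (auto intro!: row_prod_dvd simp: symbol_exponent_def)
    moreover have "Lambda j z = poly (symbol j 0) z * transform z" if z: "z > - \<delta>" for z
      using False poly_Dpoly_pos[OF z] by (simp add: Lambda_def symbol_def transform_def)
    ultimately show ?thesis using False by (simp add: U_def symbol_def F_eq)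
  qed
next
  case (Suc i)
  note IH = Suc.IH[OF Suc_lessD[OF Suc.prems]]
  \<comment> \<open>Balance is used here: every exponent of the initial symbol is at least lam j -
    1, and Suc i < lam j leaves i \<le> lam j - 2.\<close>
  have \<epsilon>: "symbol_exponent j h - i \<ge> 1" if h: "h \<in> {1..r}" for h
    using balanced[of j h] h j Suc.prems by (auto simp: symbol_exponent_def)
  have dvd: "[:\<rho> h, 1:] dvd symbol j i" if h: "h \<in> {1..r}" for h
  proof -
    have "[:\<rho> h, 1:] dvd row_prod (\<lambda>h. symbol_exponent j h - i)"
      using row_prod_lower[of h "\<lambda>h. symbol_exponent j h - i", OF h \<epsilon>[OF h]] by (metis dvd_triv_left)
    thus ?thesis using IH dvd_trans by blast
  qed
  have s: "symbol j (Suc i) = nabla (symbol j i)" by (simp add: symbol_def)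
  have "row_prod (\<lambda>h. symbol_exponent j h - i - 1) dvd symbol j (Suc i)"
    unfolding s by (rule nabla_dvd[OF \<epsilon>]) (use IH in auto)
  moreover have "t ^ Suc i * U j t = pdop (symbol j (Suc i)) E t" for t
    using IH times_id_nabla[OF dvd, of t] by (simp add: s mult.assoc)
  moreover have "(deriv ^^ Suc i) (Lambda j) z = poly (symbol j (Suc i)) z * transform z" if z: "z > - \<delta>" for z
  proof -
    have "((deriv ^^ i) (Lambda j) has_real_derivative poly (nabla (symbol j i)) z * transform z) (at z)"
      by (rule has_field_derivative_transform_within_open[OF deriv_nabla[OF dvd z], of "{- \<delta><..}"]) (use z IH in auto)
    thus ?thesis by (simp add: s DERIV_imp_deriv)
  qed
  moreover have "degree (symbol j (Suc i)) \<le> degree (symbol j 0) + Suc i"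
    using IH degree_nabla[OF dvd] by (simp add: s)
  ultimately show ?case by simp
qed

lemma N_eq: "N = M + 1"
  using m_sum N_pos by (simp add: N_def M_def)

text \<open>With S the sum of the row entries, N = S + R. A row starts at degree S - 1 and gains at
  most lam j - 1 \<le> R; the last component starts at S and gains at most R - 1. Either way the
  degree is at most N - 1.\<close>

lemma degree_symbol:
  assumes j: "j \<in> {1..r + 1}" and i: "i < lam j"
  shows "degree (symbol j i) < N"
proof (cases "j \<le> r")
  case True
  have "lam j \<le> R + 1" using balanced[of j "r + 1"] j by (simp add: R_def)
  moreover have "degree (symbol j 0) + 1 \<le> (\<Sum>h=1..r. lam h)"
  proof -
    have "degree (pole_poly j 1) < (\<Sum>h=1..r. lam h)"
      unfolding pole_poly_def degree_row_prod
      by (rule sum_strict_mono_ex1) (use j i True in auto)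
    thus ?thesis using True \<rho>_pos[of j] j by (simp add: symbol_def)
  qed
  moreover have "N = (\<Sum>h=1..r. lam h) + R" using N_eq M_eq by simp
  ultimately show ?thesis using symbol_properties[OF j i] i by linarith
next
  case False
  have "degree (symbol j 0) = (\<Sum>h=1..r. lam h)" using False by (simp add: symbol_def Dpoly_eq_row_prod degree_row_prod)
  moreover have "lam j = R" using False j by (auto simp: R_def le_Suc_eq)
  moreover have "N = (\<Sum>h=1..r. lam h) + R" using N_eq M_eq by simp
  ultimately show ?thesis using symbol_properties[OF j i] i by linarith
qed

definition component_symbol :: "nat \<Rightarrow> real poly \<Rightarrow> real poly" where
  "component_symbol j q = (\<Sum>i<lam j. smult (coeff q i) (symbol j i))"

lemma component_symbol_diff: "component_symbol j (q - q') = component_symbol j q - component_symbol j q'"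
  by (simp add: component_symbol_def smult_diff_left sum_subtractf)

lemma component_symbol_smult: "component_symbol j (smult c q) = smult c (component_symbol j q)"
  by (simp add: component_symbol_def smult_sum_right)

lemma component_symbol_sum: "component_symbol j (\<Sum>i\<in>A. q i) = (\<Sum>i\<in>A. component_symbol j (q i))"
proof -
  have "component_symbol j (\<Sum>i\<in>A. q i) = (\<Sum>l<lam j. \<Sum>i\<in>A. smult (coeff (q i) l) (symbol j l))"
    by (simp add: component_symbol_def coeff_sum smult_sum)
  also have "\<dots> = (\<Sum>i\<in>A. component_symbol j (q i))"
    unfolding component_symbol_def by (rule sum.swap)
  finally show ?thesis .
qed

lemma degree_component_symbol:
  assumes j: "j \<in> {1..r + 1}" and k: "k \<ge> N"
  shows "coeff (component_symbol j q) k = 0"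
proof -
  have "coeff (symbol j i) k = 0" if "i < lam j" for i
    using degree_symbol[OF j that] k by (intro coeff_eq_0) linarith
  thus ?thesis by (simp add: component_symbol_def coeff_sum)
qed

lemma pdop_component_symbol:
  assumes j: "j \<in> {1..r + 1}" and q: "\<And>k. k \<ge> lam j \<Longrightarrow> coeff q k = 0"
  shows "pdop (component_symbol j q) E t = poly q t * U j t"
proof -
  have "poly q t = (\<Sum>i<lam j. coeff q i * t ^ i)"
  proof -
    have "(\<Sum>i\<le>degree q. coeff q i * t ^ i) = (\<Sum>i<lam j. coeff q i * t ^ i)"
      by (rule sum.mono_neutral_cong) (use q in \<open>auto simp: coeff_eq_0 not_less\<close>)
    thus ?thesis by (simp add: poly_altdef)
  qed
  hence "poly q t * U j t = (\<Sum>i<lam j. coeff q i * (t ^ i * U j t))"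
    by (simp add: sum_distrib_right mult.assoc)
  also have "\<dots> = (\<Sum>i<lam j. coeff q i * pdop (symbol j i) E t)"
    using symbol_properties[OF j] by (intro sum.cong refl) auto
  finally show ?thesis by (simp add: component_symbol_def pdop_sum pdop_smult)
qed

text \<open>Dividing the Hermite derivative of \<open>Lambda j\<close> by \<open>transform\<close>
  leaves its symbol, so \<open>Phi j k\<close> is this polynomial for all z > -\<delta>. That is an
  open set around 0, and the Taylor coefficients there are the coefficients of the
  polynomial.\<close>

lemma conn_entry_eq:
  assumes j: "j \<in> {1..r + 1}" and k: "k < lam j"
  shows "conn_entry \<nu> (j, k) = coeff (component_symbol j (hermite_H k)) \<nu>"
proof -
  have "Phi j k z = poly (component_symbol j (hermite_H k)) z" if z: "z \<in> {- \<delta><..}" for z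
  proof -
    have z': "z > - \<delta>" using z by simp
    have "(\<Sum>i\<le>degree (hermite_H k). coeff (hermite_H k) i * (deriv ^^ i) (Lambda j) z) =
      (\<Sum>i<lam j. coeff (hermite_H k) i * (deriv ^^ i) (Lambda j) z)"
      by (rule sum.mono_neutral_left) (use k in \<open>auto simp: degree_hermite_H hermite_H_coeff\<close>)
    also have "\<dots> = (\<Sum>i<lam j. coeff (hermite_H k) i * (poly (symbol j i) z * transform z))"
      using symbol_properties[OF j] z' by (intro sum.cong refl) auto
    also have "\<dots> = poly (component_symbol j (hermite_H k)) z * transform z"
      by (simp add: component_symbol_def poly_sum sum_distrib_right mult.assoc)
    finally show ?thesis
      unfolding Phi_def poly_Dpoly[symmetric] transform_def using L_pos[OF z'] poly_Dpoly_pos[OF z'] by simp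
  qed
  from higher_deriv_poly[OF open_greaterThan this, where z = 0 and n = \<nu>] show ?thesis
    using \<delta>_pos by (simp add: conn_entry_def poly_higher_pderiv_0)
qed

definition total_symbol :: "(nat \<Rightarrow> real poly) \<Rightarrow> real poly" where
  "total_symbol B = (\<Sum>j=1..r + 1. component_symbol j (B j))"

lemma degree_bounded_coeff: "degree_bounded B \<Longrightarrow> j \<in> {1..r + 1} \<Longrightarrow> k \<ge> lam j \<Longrightarrow> coeff (B j) k = 0"
  unfolding degree_bounded_def by (metis coeff_0 coeff_eq_0 order_less_le_trans)

lemma degree_boundedI:
  assumes "\<And>j k. j \<in> {1..r + 1} \<Longrightarrow> k \<ge> lam j \<Longrightarrow> coeff (B j) k = 0" "\<And>j. j \<notin> {1..r + 1} \<Longrightarrow> B j = 0"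
  shows "degree_bounded B"
  unfolding degree_bounded_def using assms by (metis leading_coeff_0_iff not_le)

lemma pdop_total_symbol:
  assumes "degree_bounded B"
  shows "pdop (total_symbol B) E t = (\<Sum>j=1..r + 1. poly (B j) t * U j t)"
  unfolding total_symbol_def pdop_sum
  by (intro sum.cong refl pdop_component_symbol degree_bounded_coeff[OF assms])

lemma total_symbol_eq_iff:
  assumes "degree_bounded B"
  shows "total_symbol B = Q \<longleftrightarrow> (\<forall>t. (\<Sum>j=1..r + 1. poly (B j) t * U j t) = pdop Q E t)"
proof
  assume *: "\<forall>t. (\<Sum>j=1..r + 1. poly (B j) t * U j t) = pdop Q E t"
  have "total_symbol B - Q = 0"
    by (rule pdop_eq_0[OF adm_E \<delta>_pos E_pos]) (simp only: pdop_diff pdop_total_symbol[OF assms] * diff_self)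
  thus "total_symbol B = Q" by simp
next
  assume "total_symbol B = Q"
  thus "\<forall>t. (\<Sum>j=1..r + 1. poly (B j) t * U j t) = pdop Q E t"
    unfolding pdop_total_symbol[OF assms, symmetric] by blast
qed

text \<open>In the Hermite basis, \<open>C\<close> is the matrix of the map from coefficient vectors to symbols.\<close>

lemma connection:
  assumes "degree_bounded B"
  obtains v where "v \<in> carrier_vec N"
    and "\<And>\<nu>. \<nu> < N \<Longrightarrow> vec_index (C *\<^sub>v v) \<nu> = coeff (total_symbol B) \<nu>"
    and "\<And>c j. c < N \<Longrightarrow> column_labels ! c = (j, lam j - 1) \<Longrightarrow> vec_index v c = coeff (B j) (lam j - 1)"
    and "v = 0\<^sub>v N \<Longrightarrow> B = (\<lambda>_. 0)"
proof -
  have "\<exists>b. B j = (\<Sum>k<lam j. smult (b k) (hermite_H k))" if "j \<in> {1..r + 1}" for j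
    using monic_expansion[OF degree_hermite_H lead_hermite_H degree_bounded_coeff[OF assms that]] by blast
  then obtain b where b: "\<And>j. j \<in> {1..r + 1} \<Longrightarrow> B j = (\<Sum>k<lam j. smult (b j k) (hermite_H k))" by metis
  define v where "v = Matrix.vec N (\<lambda>c. b (fst (column_labels ! c)) (snd (column_labels ! c)))"
  have v: "v \<in> carrier_vec N" by (simp add: v_def)
  have lab: "fst (column_labels ! c) \<in> {1..r + 1}" "snd (column_labels ! c) < lam (fst (column_labels ! c))"
    if "c < N" for c
    using nth_mem[of c column_labels] that by (auto simp: set_column_labels length_column_labels)
  have "vec_index (C *\<^sub>v v) \<nu> = coeff (total_symbol B) \<nu>" if \<nu>: "\<nu> < N" for \<nu>
  proof -
    have "vec_index (C *\<^sub>v v) \<nu> = (\<Sum>c<N. conn_entry \<nu> (column_labels ! c) * b (fst (column_labels ! c)) (snd (column_labels ! c)))"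
      using \<nu> by (simp add: C_def v_def scalar_prod_def atLeast0LessThan)
    also have "\<dots> = (\<Sum>j=1..r + 1. \<Sum>k<lam j. conn_entry \<nu> (j, k) * b j k)"
      using sum_column_labels[of "\<lambda>(j, k). conn_entry \<nu> (j, k) * b j k"] by (simp add: case_prod_beta)
    also have "\<dots> = (\<Sum>j=1..r + 1. coeff (component_symbol j (B j)) \<nu>)"
    proof (intro sum.cong refl)
      fix j assume j: "j \<in> {1..r + 1}"
      have "coeff (component_symbol j (B j)) \<nu> = (\<Sum>k<lam j. b j k * coeff (component_symbol j (hermite_H k)) \<nu>)"
        by (subst b[OF j]) (simp add: component_symbol_sum component_symbol_smult coeff_sum)
      thus "(\<Sum>k<lam j. conn_entry \<nu> (j, k) * b j k) = coeff (component_symbol j (B j)) \<nu>"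
        by (simp add: conn_entry_eq[OF j] mult.commute)
    qed
    finally show ?thesis by (simp add: total_symbol_def coeff_sum)
  qed
  moreover have "vec_index v c = coeff (B j) (lam j - 1)" if c: "c < N" "column_labels ! c = (j, lam j - 1)" for c j
  proof -
    have j: "j \<in> {1..r + 1}" "lam j - 1 < lam j" using lab[OF c(1)] c(2) by auto
    have "coeff (B j) (lam j - 1) = (\<Sum>k<lam j. b j k * coeff (hermite_H k) (lam j - 1))"
      by (subst b[OF j(1)]) (simp add: coeff_sum)
    \<comment> \<open>The Hermite polynomials are monic, so the top coefficient is the same in the
      Hermite basis; this lets Cramer's rule decide the exact degree.\<close>
    also have "\<dots> = (\<Sum>k<lam j. if k = lam j - 1 then b j k else 0)"
      by (intro sum.cong refl) (auto simp: hermite_H_coeff)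
    finally show ?thesis using j(2) c by (simp add: v_def)
  qed
  moreover have "B = (\<lambda>_. 0)" if v0: "v = 0\<^sub>v N"
  proof
    fix j
    show "B j = 0"
    proof (cases "j \<in> {1..r + 1}")
      case True
      have "b j k = 0" if k: "k < lam j" for k
      proof -
        obtain c where c: "c < N" "column_labels ! c = (j, k)" by (rule column_index[OF True k])
        hence "b j k = vec_index v c" by (simp add: v_def)
        thus ?thesis using v0 c by simp
      qed
      thus ?thesis by (subst b[OF True]) simp
    qed (use assms in \<open>auto simp: degree_bounded_def\<close>)
  qed
  ultimately show ?thesis using that v by blast
qed

lemma total_symbol_eq_0:
  assumes D: "Delta \<noteq> 0" and B: "degree_bounded B" and z: "total_symbol B = 0"
  shows "B = (\<lambda>_. 0)"
proof -
  obtain v where v: "v \<in> carrier_vec N" "\<And>\<nu>. \<nu> < N \<Longrightarrow> vec_index (C *\<^sub>v v) \<nu> = coeff (total_symbol B) \<nu>"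
    "v = 0\<^sub>v N \<Longrightarrow> B = (\<lambda>_. 0)"
    using connection[OF B] by metis
  have "C *\<^sub>v v = 0\<^sub>v N"
    using C_carrier v z by (intro eq_vecI) auto
  thus ?thesis using det_0_iff_vec_prod_zero_field[OF C_carrier] D v(1,3) unfolding Delta_def by blast
qed

lemma total_symbol_inj:
  assumes D: "Delta \<noteq> 0" and B: "degree_bounded B" "degree_bounded B'" and e: "total_symbol B = total_symbol B'"
  shows "B = B'"
proof -
  have "degree_bounded (\<lambda>j. B j - B' j)"
    using B by (intro degree_boundedI) (auto simp: degree_bounded_coeff degree_bounded_def)
  moreover have "total_symbol (\<lambda>j. B j - B' j) = 0"
    using e by (simp add: total_symbol_def component_symbol_diff sum_subtractf)
  ultimately have "(\<lambda>j. B j - B' j) = (\<lambda>_. 0)" by (rule total_symbol_eq_0[OF D])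
  thus ?thesis by (simp add: fun_eq_iff)
qed

lemma total_symbol_components: "total_symbol components = Ppoly"
  unfolding total_symbol_eq_iff[OF components_degree_bounded]
  by (simp only: rodrigues_components[symmetric] rodrigues_eq simp_thms)

lemma rodrigues_decomposition_unique:
  assumes D: "Delta \<noteq> 0" and B: "degree_bounded B" "rodrigues_decomposition B"
  shows "B = components"
proof (rule total_symbol_inj[OF D B(1) components_degree_bounded])
  have "total_symbol B = Ppoly"
    unfolding total_symbol_eq_iff[OF B(1)] sum_U
    using B(2) unfolding rodrigues_decomposition_def rodrigues_eq by metis
  thus "total_symbol B = total_symbol components" by (simp add: total_symbol_components)
qed

lemma Ppoly_conv: "Ppoly = smult ((- 1) ^ M) (\<Prod>i=1..p. [:- \<xi> i, 1:] ^ m i)"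
proof -
  have "[:\<xi> i, - 1:] ^ m i = smult ((- 1) ^ m i) ([:- \<xi> i, 1:] ^ m i)" for i
  proof -
    have "[:\<xi> i, - 1:] = smult (- 1) [:- \<xi> i, 1:]" by simp
    thus ?thesis by (simp only: smult_power)
  qed
  thus ?thesis by (simp add: Ppoly_def M_def prod_smult power_sum)
qed

text \<open>The total symbol of a solution is a multiple of \<open>Ppoly\<close> of degree at most N
  - 1 = M, the degree of \<open>Ppoly\<close>, so the cofactor is constant. Invertibility of
  \<open>C\<close> carries the proportionality from symbols back to components.\<close>

lemma B_solutions_iff:
  assumes D: "Delta \<noteq> 0" and inj: "inj_on \<xi> {1..p}"
  shows "B \<in> B_solutions \<longleftrightarrow> (\<exists>c. B = (\<lambda>j. smult c (components j)))"
proof -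
  have scaled: "degree_bounded (\<lambda>j. smult c (components j))"
    "total_symbol (\<lambda>j. smult c (components j)) = smult c Ppoly" for c
  proof -
    show "degree_bounded (\<lambda>j. smult c (components j))"
      using components_degree_bounded
      by (intro degree_boundedI) (auto simp: degree_bounded_coeff degree_bounded_def)
    show "total_symbol (\<lambda>j. smult c (components j)) = smult c Ppoly"
      unfolding total_symbol_components[symmetric]
      by (simp add: total_symbol_def component_symbol_smult smult_sum_right smult_add_right)
  qed
  have sol: "B \<in> B_solutions \<longleftrightarrow> degree_bounded B \<and> (\<forall>i\<in>{1..p}. [:- \<xi> i, 1:] ^ m i dvd total_symbol B)" for B
  proof (cases "degree_bounded B")
    case True
    have "(\<forall>k<m i. (LBINT t. t ^ k * exp (\<xi> i * t) * (\<Sum>j=1..r + 1. poly (B j) t * U j t)) = 0) \<longleftrightarrow>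
      [:- \<xi> i, 1:] ^ m i dvd total_symbol B" if "i \<in> {1..p}" for i
      unfolding pdop_total_symbol[OF True, symmetric]
      by (rule exp_moments_eq_0_iff[OF adm_E \<xi>_gt[OF that] E_pos])
    thus ?thesis using True by (simp add: B_solutions_def)
  qed (simp add: B_solutions_def)
  show ?thesis
  proof
    assume "B \<in> B_solutions"
    hence B: "degree_bounded B" "\<forall>i\<in>{1..p}. [:- \<xi> i, 1:] ^ m i dvd total_symbol B" by (simp_all add: sol)
    have "(\<Prod>i=1..p. [:- \<xi> i, 1:] ^ m i) dvd total_symbol B"
      by (rule prod_linear_power_dvd) (use B inj in auto)
    hence "Ppoly dvd total_symbol B" unfolding Ppoly_conv by (simp add: smult_dvd)
    then obtain S where S: "total_symbol B = Ppoly * S" by (elim dvdE)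
    have "\<exists>c. total_symbol B = smult c Ppoly"
    proof (cases "S = 0")
      case True
      thus ?thesis using S by (intro exI[of _ 0]) simp
    next
      case False
      have "degree (total_symbol B) \<le> M"
        using degree_component_symbol by (intro degree_le) (auto simp: total_symbol_def coeff_sum N_eq)
      hence "degree S = 0" using S False Ppoly_nonzero by (simp add: degree_mult_eq degree_Ppoly)
      then obtain c where "S = [:c:]" by (rule degree_eq_zeroE)
      thus ?thesis using S by (intro exI[of _ c]) simp
    qed
    then obtain c where c: "total_symbol B = smult c Ppoly" ..
    hence "B = (\<lambda>j. smult c (components j))"
      by (intro total_symbol_inj[OF D B(1) scaled(1)]) (simp add: scaled(2))
    thus "\<exists>c. B = (\<lambda>j. smult c (components j))" ..
  next
    assume "\<exists>c. B = (\<lambda>j. smult c (components j))"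
    then obtain c where c: "B = (\<lambda>j. smult c (components j))" ..
    have "[:- \<xi> i, 1:] ^ m i dvd Ppoly" if "i \<in> {1..p}" for i
      unfolding Ppoly_conv using that by (intro dvd_smult dvd_prodI[where f = "\<lambda>i. [:- \<xi> i, 1:] ^ m i"]) auto
    thus "B \<in> B_solutions" unfolding sol c using scaled by (auto intro: dvd_smult)
  qed
qed

lemma components_nonzero: "components \<noteq> (\<lambda>_. 0)"
proof
  assume "components = (\<lambda>_. 0)"
  hence "total_symbol components = 0" by (simp add: total_symbol_def component_symbol_def)
  thus False using total_symbol_components Ppoly_nonzero by simp
qed

lemma weakly_normal_holds:
  assumes D: "Delta \<noteq> 0" and inj: "inj_on \<xi> {1..p}"
  shows weakly_normal
proof -
  interpret V: vector_space "\<lambda>(c::real) (B :: nat \<Rightarrow> real poly) j. smult c (B j)"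
    by (rule vector_space_poly_tuples)
  have s: "V.span {components} = B_solutions"
    using B_solutions_iff[OF D inj] unfolding V.span_singleton by auto
  have "components \<noteq> 0" using components_nonzero by (simp add: zero_fun_def)
  hence i: "V.independent {components}" by simp
  have "V.dim B_solutions = 1"
    by (rule V.dim_unique[of "{components}"]) (use V.span_base[of components "{components}"] i s in auto)
  thus ?thesis by (simp add: weakly_normal_def)
qed

text \<open>The symbol of \<open>components\<close> is \<open>Ppoly\<close>, whose coefficient
  vector is \<open>pvec\<close>. So the Hermite coordinates v of \<open>components\<close> solve C v
  = p, and the replaced determinant measures one coordinate of v.\<close>

lemma det_C_replaced:
  assumes j: "j \<in> {1..r + 1}" "lam j > 0"
  shows "det (C_replaced (j, lam j - 1)) = coeff (components j) (lam j - 1) * Delta"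
proof -
  obtain v where v: "v \<in> carrier_vec N" "\<And>\<nu>. \<nu> < N \<Longrightarrow> vec_index (C *\<^sub>v v) \<nu> = coeff (total_symbol components) \<nu>"
    "\<And>c j. c < N \<Longrightarrow> column_labels ! c = (j, lam j - 1) \<Longrightarrow> vec_index v c = coeff (components j) (lam j - 1)"
    using connection[OF components_degree_bounded] by metis
  obtain c where c: "c < N" "column_labels ! c = (j, lam j - 1)"
    by (rule column_index[of j "lam j - 1"]) (use j in auto)
  have eq: "column_labels ! c' = (j, lam j - 1) \<longleftrightarrow> c' = c" if "c' < N" for c'
    using c that nth_eq_iff_index_eq[OF distinct_column_labels, of c' c] by (auto simp: length_column_labels)
  have "C_replaced (j, lam j - 1) = replace_col C (C *\<^sub>v v) c"
  proof (rule eq_matI)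
    fix \<nu> c' assume "\<nu> < dim_row (replace_col C (C *\<^sub>v v) c)" "c' < dim_col (replace_col C (C *\<^sub>v v) c)"
    hence n: "\<nu> < N" "c' < N" using C_carrier by (auto simp: replace_col_def)
    have "pvec \<nu> = vec_index (C *\<^sub>v v) \<nu>"
      by (simp add: v(2)[OF n(1)] total_symbol_components pvec_def Ppoly_def)
    thus "C_replaced (j, lam j - 1) $$ (\<nu>, c') = replace_col C (C *\<^sub>v v) c $$ (\<nu>, c')"
      using n eq[OF n(2)] C_carrier by (simp add: C_replaced_def replace_col_def C_def)
  qed (use C_carrier in \<open>auto simp: C_replaced_def replace_col_def\<close>)
  thus ?thesis using cramer_lemma_mat[OF C_carrier v(1) c(1)] v(3)[OF c] by (simp add: Delta_def)
qed

lemma strongly_normal_iff: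
  assumes D: "Delta \<noteq> 0" and inj: "inj_on \<xi> {1..p}"
  shows "strongly_normal \<longleftrightarrow> (\<forall>j\<in>{1..r + 1}. lam j > 0 \<longrightarrow> det (C_replaced (j, lam j - 1)) \<noteq> 0)"
proof -
  have exact: "components j \<noteq> 0 \<and> degree (components j) = lam j - 1 \<longleftrightarrow> coeff (components j) (lam j - 1) \<noteq> 0"
    if j: "j \<in> {1..r + 1}" "lam j > 0" for j
  proof
    assume *: "coeff (components j) (lam j - 1) \<noteq> 0"
    hence "components j \<noteq> 0" by auto
    moreover have "degree (components j) < lam j"
      using calculation components_degree_bounded j unfolding degree_bounded_def by blast
    moreover have "lam j - 1 \<le> degree (components j)" using * by (rule le_degree)
    ultimately show "components j \<noteq> 0 \<and> degree (components j) = lam j - 1" by simp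
  qed (metis leading_coeff_0_iff)
  have "strongly_normal \<longleftrightarrow> (\<forall>j\<in>{1..r + 1}. 0 < lam j \<longrightarrow> components j \<noteq> 0 \<and> degree (components j) = lam j - 1)"
  proof
    assume s: strongly_normal
    have "components \<in> B_solutions"
      unfolding B_solutions_iff[OF D inj] by (rule exI[of _ 1]) simp
    moreover have "components \<noteq> 0" using components_nonzero by (simp add: zero_fun_def)
    ultimately show "\<forall>j\<in>{1..r + 1}. 0 < lam j \<longrightarrow> components j \<noteq> 0 \<and> degree (components j) = lam j - 1"
      using s unfolding strongly_normal_def by blast
  next
    assume c: "\<forall>j\<in>{1..r + 1}. 0 < lam j \<longrightarrow> components j \<noteq> 0 \<and> degree (components j) = lam j - 1"
    show strongly_normal unfolding strongly_normal_def
    proof (intro conjI ballI impI weakly_normal_holds[OF D inj])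
      fix B j assume B: "B \<in> B_solutions" "B \<noteq> 0" and j: "j \<in> {1..r + 1}" "0 < lam j"
      obtain q where q: "B = (\<lambda>j. smult q (components j))" using B(1) B_solutions_iff[OF D inj] by blast
      have "q \<noteq> 0" using B(2) q by (auto simp: zero_fun_def)
      thus "B j \<noteq> 0" "degree (B j) = lam j - 1" using c j unfolding q by auto
    qed
  qed
  also have "\<dots> \<longleftrightarrow> (\<forall>j\<in>{1..r + 1}. lam j > 0 \<longrightarrow> det (C_replaced (j, lam j - 1)) \<noteq> 0)"
    using exact det_C_replaced D by (metis mult_eq_0_iff)
  finally show ?thesis .
qed

end

theorem corollary5p15:
  fixes r p :: nat
    and \<rho> d \<xi> :: "nat \<Rightarrow> real"
    and a :: real
    and lam m :: "nat \<Rightarrow> nat"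
  assumes "p \<ge> 1"
    and "\<And>h. h \<in> {1..r} \<Longrightarrow> \<rho> h > 0"
    and "\<And>h. h \<in> {1..r} \<Longrightarrow> d h \<ge> 0"
    and "inj_on \<xi> {1..p}"
    and "\<And>i h. i \<in> {1..p} \<Longrightarrow> h \<in> {1..r} \<Longrightarrow> \<xi> i + \<rho> h > 0"
    and "\<And>j j'. j \<in> {1..r + 1} \<Longrightarrow> j' \<in> {1..r + 1} \<Longrightarrow> lam j \<le> lam j' + 1"
    and "(\<Sum>j=1..r + 1. lam j) \<ge> 1"
    and "(\<Sum>i=1..p. m i) = (\<Sum>j=1..r + 1. lam j) - 1"
    and "mixed_hermite.Delta r \<rho> d a lam \<noteq> 0"
  shows
    "mixed_hermite.degree_bounded r lam (mixed_hermite.components r p \<rho> d a \<xi> lam m)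
     \<and> (\<forall>j\<in>{1..r + 1}. lam j = 0 \<longrightarrow> mixed_hermite.components r p \<rho> d a \<xi> lam m j = 0)
     \<and> mixed_hermite.rodrigues_decomposition r p \<rho> d a \<xi> lam m
         (mixed_hermite.components r p \<rho> d a \<xi> lam m)
     \<and> mixed_hermite.components r p \<rho> d a \<xi> lam m \<in> mixed_hermite.B_solutions r p \<rho> d a \<xi> lam m
     \<and> (\<forall>B. mixed_hermite.degree_bounded r lam B
            \<and> mixed_hermite.rodrigues_decomposition r p \<rho> d a \<xi> lam m B
          \<longrightarrow> B = mixed_hermite.components r p \<rho> d a \<xi> lam m)
     \<and> (r \<ge> 1 \<longrightarrow>
          (\<forall>h\<in>{1..r}.
             card (Poly_Mapping.keys (mixed_hermite.B_comb r p \<rho> d a \<xi> lam m h)) \<le> 2 * r + 2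
             \<and> (\<forall>f\<in>Poly_Mapping.keys (mixed_hermite.B_comb r p \<rho> d a \<xi> lam m h).
                  sd_arity f \<le> p + 2 * r + 3))
          \<and> card (Poly_Mapping.keys (mixed_hermite.D_comb r p \<rho> d a \<xi> lam m)) \<le> r + 1
          \<and> (\<forall>f\<in>Poly_Mapping.keys (mixed_hermite.D_comb r p \<rho> d a \<xi> lam m).
               sd_arity f \<le> p + 2 * r + 3))
     \<and> mixed_hermite.weakly_normal r p \<rho> d a \<xi> lam m
     \<and> (mixed_hermite.strongly_normal r p \<rho> d a \<xi> lam m \<longleftrightarrow>
          (\<forall>j\<in>{1..r + 1}. lam j > 0 \<longrightarrow>
             Determinant.det (mixed_hermite.C_replaced r p \<rho> d a \<xi> lam m (j, lam j - 1)) \<noteq> 0))"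
proof -
  \<comment> \<open>For r > 0 the smallest rate serves, because \<xi> i + \<rho> h > 0 at the row
    attaining it. For r = 0 no average limits the decay, and any number exceeding all absolute
    values of the \<xi> i will do.\<close>
  define \<delta> where "\<delta> = (if r = 0 then 1 + (\<Sum>i=1..p. \<bar>\<xi> i\<bar>) else Min (\<rho> ` {1..r}))"
  have \<delta>: "\<delta> > 0" "\<And>h. h \<in> {1..r} \<Longrightarrow> \<delta> \<le> \<rho> h" "\<And>i. i \<in> {1..p} \<Longrightarrow> \<xi> i > - \<delta>"
  proof -
    show "\<delta> > 0"
      using assms(2) by (auto simp: \<delta>_def add_pos_nonneg sum_nonneg)
    show "\<delta> \<le> \<rho> h" if "h \<in> {1..r}" for h using that by (auto simp: \<delta>_def)
    show "\<xi> i > - \<delta>" if i: "i \<in> {1..p}" for i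
    proof (cases "r = 0")
      case True
      have "\<bar>\<xi> i\<bar> \<le> (\<Sum>i=1..p. \<bar>\<xi> i\<bar>)" by (rule member_le_sum) (use i in auto)
      thus ?thesis using True by (simp add: \<delta>_def)
    next
      case False
      have "Min (\<rho> ` {1..r}) \<in> \<rho> ` {1..r}" using False by (intro Min_in) auto
      hence "\<delta> \<in> \<rho> ` {1..r}" using False by (simp only: \<delta>_def if_False)
      then obtain h where "h \<in> {1..r}" "\<delta> = \<rho> h" by blast
      thus ?thesis using assms(5)[OF i] by fastforce
    qed
  qed
  have inj: "inj_on \<rho> (mixed_hermite.active r lam)"
    by (rule mixed_hermite.inj_active_if_Delta[OF assms(9)])
  interpret mixed_hermite_balanced r p \<rho> d a \<xi> lam m \<delta>
    by unfold_locales (use \<delta> assms(3,5-8) inj in auto)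
  have "components \<in> B_solutions"
    unfolding B_solutions_iff[OF assms(9,4)] by (rule exI[of _ 1]) simp
  thus ?thesis
    using components_degree_bounded components_eq_0 components_rodrigues
      rodrigues_decomposition_unique[OF assms(9)] B_comb_bounded D_comb_bounded
      weakly_normal_holds[OF assms(9,4)] strongly_normal_iff[OF assms(9,4)]
    unfolding sd_bounded_def by blast
qed

end
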